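(* Let $V$ be a non-trivial unitarizable irreducible Harish-Chandra module of $G=\mathrm{SL}(2,\mathbb R)$. Then the Sobolev gap of $V$ satisfies $s(V)=1$.
   Context: $G=\mathrm{SL}(2,\mathbb R)$, $K=\mathrm{SO}(2)$, with Lie algebras $\mathfrak g,\mathfrak k$. A Harish-Chandra module is a $(\mathfrak g,K)$-module that is finitely generated over $\mathcal U(\mathfrak g)$ and has finite $K$-multiplicities. For a norm $p$ on $V$ let $V_p$ be the Banach completion; $p$ is $G$-continuous if there is a continuous representation of $G$ on $V_p$ whose $(\mathfrak g,K)$-module of $K$-finite vectors is $V$; the action is written $g\cdot v$. $V$ is unitarizable if it admits a $G$-continuous norm induced by a $G$-invariant inner product. $\mathrm{Norm}(V)$ is the set of $G$-continuous norms $p$ on $V$ for which there is $C>0$ with $p(g\cdot v)\le Cp(v)$ for all $g\in G,v\in V$. Write $p\lesssim q$ if $p\le Cq$ for some $C>0$, and $p\sim q$ if $p\lesssim q\lesssim p$. The set $\mathfrak{Norm}(V)=\mathrm{Norm}(V)/\!\sim$ is partially ordered by $\lesssim$; when non-empty it has a unique minimal element $[p_{\min}]$ and a unique maximal element $[p_{\max}]$. Sobolev norms: let $\Delta_K=-Y^2$ for a fixed unit vector $Y\in\mathfrak k$ (with respect to minus a multiple of the Killing form); it acts on each $K$-isotypical component $V[n]$ ($n\in\hat K=\mathbb Z$) by a scalar. For $s\in\mathbb R$ let $D_s=(1+\Delta_K)^{s/2}$ (acting diagonally on $K$-types) and $p_s(v):=p(D_sv)$. The Sobolev gap is $s(V):=\inf\{s\ge0\mid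 p_{\max}\lesssim (p_{\min})_s\}$. *)

theory Defs
  imports "HOL-Analysis.Analysis"
begin

section \<open>The groups and Lie algebras\<close>

type_synonym mat2 = "real^2^2"

definition SL2 :: "mat2 set" where
  "SL2 = {A. det A = 1}"

definition SO2 :: "mat2 set" where
  "SO2 = {A. rotation_matrix A}"

definition sl2 :: "mat2 set" where
  "sl2 = {X. trace X = 0}"

definition so2 :: "mat2 set" where
  "so2 = {X. transpose X = - X}"

definition bracket :: "mat2 \<Rightarrow> mat2 \<Rightarrow> mat2" where
  "bracket X Z = X ** Z - Z ** X"

definition mexp :: "mat2 \<Rightarrow> mat2" where
  "mexp X = (\<Sum>n. (1 / fact n) *\<^sub>R (((**) X ^^ n) (mat 1)))"

(* The trace of ad X o ad Z on sl2, computed in the basis H, E, F of sl2; the coordinates of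
   a trace-zero matrix with respect to this basis are its (1,1), (1,2) and (2,1) entries. *)
definition killing :: "mat2 \<Rightarrow> mat2 \<Rightarrow> real" where
  "killing X Z =
     (let T = (\<lambda>W. bracket X (bracket Z W));
          H = vector [vector [1, 0], vector [0, -1]];
          E = vector [vector [0, 1], vector [0, 0]];
          F = vector [vector [0, 0], vector [1, 0]]
      in T H $ 1 $ 1 + T E $ 1 $ 2 + T F $ 2 $ 1)"


section \<open>Harish-Chandra modules\<close>

(* The vector space is the whole type 'v. The actions are only meaningful for X in sl2 and
   k in SO2; their values elsewhere are never used. *)
record 'v gk =
  scl :: "complex \<Rightarrow> 'v \<Rightarrow> 'v"
  lie :: "mat2 \<Rightarrow> 'v \<Rightarrow> 'v"
  kact :: "mat2 \<Rightarrow> 'v \<Rightarrow> 'v"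

abbreviation endo :: "('v::ab_group_add) gk \<Rightarrow> ('v \<Rightarrow> 'v) \<Rightarrow> bool" where
  "endo V \<equiv> Vector_Spaces.linear (scl V) (scl V)"

abbreviation functional :: "('v::ab_group_add) gk \<Rightarrow> ('v \<Rightarrow> complex) \<Rightarrow> bool" where
  "functional V \<equiv> Vector_Spaces.linear (scl V) (*)"

definition lie_rep :: "('v::ab_group_add) gk \<Rightarrow> bool" where
  "lie_rep V \<longleftrightarrow>
     (\<forall>X\<in>sl2. endo V (lie V X)) \<and>
     (\<forall>X\<in>sl2. \<forall>Z\<in>sl2. \<forall>a b::real. \<forall>v.
        lie V (a *\<^sub>R X + b *\<^sub>R Z) v =
          scl V (of_real a) (lie V X v) + scl V (of_real b) (lie V Z v)) \<and>
     (\<forall>X\<in>sl2. \<forall>Z\<in>sl2. \<forall>v.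
        lie V (bracket X Z) v = lie V X (lie V Z v) - lie V Z (lie V X v))"

definition K_rep :: "('v::ab_group_add) gk \<Rightarrow> bool" where
  "K_rep V \<longleftrightarrow>
     (\<forall>k\<in>SO2. endo V (kact V k)) \<and>
     (\<forall>v. kact V (mat 1) v = v) \<and>
     (\<forall>k\<in>SO2. \<forall>l\<in>SO2. \<forall>v. kact V (k ** l) v = kact V k (kact V l v))"

(* Given local finiteness, testing against all linear functionals expresses continuity and
   differentiability of an orbit map in the unique Hausdorff vector space topology of the
   finite-dimensional span of the orbit. *)
definition gk_module :: "('v::ab_group_add) gk \<Rightarrow> bool" where
  "gk_module V \<longleftrightarrow>
     vector_space (scl V) \<and> lie_rep V \<and> K_rep V \<and>
     (\<forall>v. \<exists>B. finite B \<and> (\<forall>k\<in>SO2. kact V k v \<in> module.span (scl V) B)) \<and>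
     (\<forall>v \<phi>. functional V \<phi> \<longrightarrow> continuous_on SO2 (\<lambda>k. \<phi> (kact V k v))) \<and>
     (\<forall>X\<in>so2. \<forall>v \<phi>. functional V \<phi> \<longrightarrow>
        ((\<lambda>t. \<phi> (kact V (mexp (t *\<^sub>R X)) v)) has_vector_derivative \<phi> (lie V X v)) (at 0)) \<and>
     (\<forall>k\<in>SO2. \<forall>X\<in>sl2. \<forall>v.
        kact V k (lie V X v) = lie V (k ** X ** matrix_inv k) (kact V k v))"

(* The character of SO2 with index n sends the rotation by t to exp (i n t). *)
definition K_type :: "('v::ab_group_add) gk \<Rightarrow> int \<Rightarrow> 'v set" where
  "K_type V n = {v. \<forall>k\<in>SO2. kact V k v = scl V (Complex (k $ 1 $ 1) (k $ 2 $ 1) powi n) v}"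

(* U(g) is spanned by the products X1 ... Xm of elements of g, so this is U(g) S. *)
definition U_span :: "('v::ab_group_add) gk \<Rightarrow> 'v set \<Rightarrow> 'v set" where
  "U_span V S = module.span (scl V) {foldr (lie V) Xs v |Xs v. set Xs \<subseteq> sl2 \<and> v \<in> S}"

definition harish_chandra_module :: "('v::ab_group_add) gk \<Rightarrow> bool" where
  "harish_chandra_module V \<longleftrightarrow>
     gk_module V \<and>
     (\<exists>S. finite S \<and> U_span V S = UNIV) \<and>
     (\<forall>n. \<exists>B. finite B \<and> K_type V n \<subseteq> module.span (scl V) B)"

definition gk_submodule :: "('v::ab_group_add) gk \<Rightarrow> 'v set \<Rightarrow> bool" where
  "gk_submodule V W \<longleftrightarrow>
     module.subspace (scl V) W \<and>
     (\<forall>X\<in>sl2. \<forall>w\<in>W. lie V X w \<in> W) \<and> (\<forall>k\<in>SO2. \<forall>w\<in>W. kact V k w \<in> W)"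

definition irreducible_gk :: "('v::ab_group_add) gk \<Rightarrow> bool" where
  "irreducible_gk V \<longleftrightarrow>
     (\<exists>v::'v. v \<noteq> 0) \<and> (\<forall>W. gk_submodule V W \<longrightarrow> W = {0} \<or> W = UNIV)"

definition trivial_gk :: "('v::ab_group_add) gk \<Rightarrow> bool" where
  "trivial_gk V \<longleftrightarrow>
     (\<forall>X\<in>sl2. \<forall>v. lie V X v = 0) \<and> (\<forall>k\<in>SO2. \<forall>v. kact V k v = v)"


section \<open>Norms and Banach completions\<close>

definition is_norm :: "('v::ab_group_add) gk \<Rightarrow> ('v \<Rightarrow> real) \<Rightarrow> bool" where
  "is_norm V p \<longleftrightarrow>
     (\<forall>v. 0 \<le> p v) \<and> (\<forall>v. p v = 0 \<longleftrightarrow> v = 0) \<and>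
     (\<forall>v w. p (v + w) \<le> p v + p w) \<and> (\<forall>c v. p (scl V c v) = cmod c * p v)"

record 'e nspace =
  pts :: "'e set"
  zer :: 'e
  add :: "'e \<Rightarrow> 'e \<Rightarrow> 'e"
  smul :: "complex \<Rightarrow> 'e \<Rightarrow> 'e"
  nrm :: "'e \<Rightarrow> real"

(* The locale Metric_space requires non-negativity and symmetry also outside the carrier. *)
definition ndist :: "'e nspace \<Rightarrow> 'e \<Rightarrow> 'e \<Rightarrow> real" where
  "ndist E a b =
     (if a \<in> pts E \<and> b \<in> pts E then nrm E (add E a (smul E (-1) b)) else 0)"

definition nspan :: "'e nspace \<Rightarrow> 'e set \<Rightarrow> 'e set" where
  "nspan E B =
     \<Inter>{W. B \<subseteq> W \<and> zer E \<in> W \<and> (\<forall>a\<in>W. \<forall>b\<in>W. add E a b \<in> W) \<and> (\<forall>c. \<forall>a\<in>W. smul E c a \<in> W)}"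

definition cauchy_seqs :: "(('v::ab_group_add) \<Rightarrow> real) \<Rightarrow> (nat \<Rightarrow> 'v) set" where
  "cauchy_seqs p = {u. \<forall>e>0. \<exists>N. \<forall>m\<ge>N. \<forall>n\<ge>N. p (u m - u n) < e}"

definition cauchy_class :: "(('v::ab_group_add) \<Rightarrow> real) \<Rightarrow> (nat \<Rightarrow> 'v) \<Rightarrow> (nat \<Rightarrow> 'v) set" where
  "cauchy_class p u = {w \<in> cauchy_seqs p. (\<lambda>n. p (u n - w n)) \<longlonglongrightarrow> 0}"

definition rep_seq :: "(nat \<Rightarrow> 'v) set \<Rightarrow> nat \<Rightarrow> 'v" where
  "rep_seq A = (SOME u. u \<in> A)"

definition banach_completion ::
  "('v::ab_group_add) gk \<Rightarrow> ('v \<Rightarrow> real) \<Rightarrow> (nat \<Rightarrow> 'v) set nspace" where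
  "banach_completion V p =
     \<lparr> pts = cauchy_class p ` cauchy_seqs p,
       zer = cauchy_class p (\<lambda>n. 0),
       add = (\<lambda>A B. cauchy_class p (\<lambda>n. rep_seq A n + rep_seq B n)),
       smul = (\<lambda>c A. cauchy_class p (\<lambda>n. scl V c (rep_seq A n))),
       nrm = (\<lambda>A. lim (\<lambda>n. p (rep_seq A n))) \<rparr>"

definition embed :: "(('v::ab_group_add) \<Rightarrow> real) \<Rightarrow> 'v \<Rightarrow> (nat \<Rightarrow> 'v) set" where
  "embed p v = cauchy_class p (\<lambda>n. v)"


section \<open>Continuous representations and G-continuous norms\<close>

definition continuous_rep :: "'e nspace \<Rightarrow> (mat2 \<Rightarrow> 'e \<Rightarrow> 'e) \<Rightarrow> bool" where
  "continuous_rep E \<rho> \<longleftrightarrow>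
     (\<forall>g\<in>SL2. \<forall>a\<in>pts E. \<rho> g a \<in> pts E) \<and>
     (\<forall>g\<in>SL2. \<forall>a\<in>pts E. \<forall>b\<in>pts E. \<rho> g (add E a b) = add E (\<rho> g a) (\<rho> g b)) \<and>
     (\<forall>g\<in>SL2. \<forall>c. \<forall>a\<in>pts E. \<rho> g (smul E c a) = smul E c (\<rho> g a)) \<and>
     (\<forall>a\<in>pts E. \<rho> (mat 1) a = a) \<and>
     (\<forall>g\<in>SL2. \<forall>h\<in>SL2. \<forall>a\<in>pts E. \<rho> (g ** h) a = \<rho> g (\<rho> h a)) \<and>
     continuous_map
       (prod_topology (top_of_set SL2) (Metric_space.mtopology (pts E) (ndist E)))
       (Metric_space.mtopology (pts E) (ndist E)) (\<lambda>(g, a). \<rho> g a)"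

definition K_finite_vectors :: "'e nspace \<Rightarrow> (mat2 \<Rightarrow> 'e \<Rightarrow> 'e) \<Rightarrow> 'e set" where
  "K_finite_vectors E \<rho> =
     {a \<in> pts E. \<exists>B. finite B \<and> B \<subseteq> pts E \<and> (\<forall>k\<in>SO2. \<rho> k a \<in> nspan E B)}"

definition lie_derivative ::
  "'e nspace \<Rightarrow> (mat2 \<Rightarrow> 'e \<Rightarrow> 'e) \<Rightarrow> mat2 \<Rightarrow> 'e \<Rightarrow> 'e \<Rightarrow> bool" where
  "lie_derivative E \<rho> X a b \<longleftrightarrow>
     ((\<lambda>t. ndist E (smul E (of_real (1 / t)) (add E (\<rho> (mexp (t *\<^sub>R X)) a) (smul E (-1) a))) b)
        \<longlongrightarrow> 0) (at 0)"

(* rho is a continuous representation on V_p whose (g,K)-module of K-finite vectors is V.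
   The third conjunct makes the K-finite vectors smooth: the derivatives lie in V again. *)
definition globalization ::
  "('v::ab_group_add) gk \<Rightarrow> ('v \<Rightarrow> real) \<Rightarrow> (mat2 \<Rightarrow> (nat \<Rightarrow> 'v) set \<Rightarrow> (nat \<Rightarrow> 'v) set) \<Rightarrow> bool"
  where
  "globalization V p \<rho> \<longleftrightarrow>
     (let E = banach_completion V p in
        continuous_rep E \<rho> \<and>
        K_finite_vectors E \<rho> = range (embed p) \<and>
        (\<forall>X\<in>sl2. \<forall>v. lie_derivative E \<rho> X (embed p v) (embed p (lie V X v))) \<and>
        (\<forall>k\<in>SO2. \<forall>v. \<rho> k (embed p v) = embed p (kact V k v)))"

definition G_continuous :: "('v::ab_group_add) gk \<Rightarrow> ('v \<Rightarrow> real) \<Rightarrow> bool" where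
  "G_continuous V p \<longleftrightarrow> is_norm V p \<and> (\<exists>\<rho>. globalization V p \<rho>)"


section \<open>Unitarizability\<close>

definition inner_product :: "('v::ab_group_add) gk \<Rightarrow> ('v \<Rightarrow> 'v \<Rightarrow> complex) \<Rightarrow> bool" where
  "inner_product V ip \<longleftrightarrow>
     (\<forall>u v w. ip (u + v) w = ip u w + ip v w) \<and>
     (\<forall>c v w. ip (scl V c v) w = c * ip v w) \<and>
     (\<forall>v w. ip w v = cnj (ip v w)) \<and>
     (\<forall>v. v \<noteq> 0 \<longrightarrow> 0 < Re (ip v v))"

definition ip_norm :: "('v \<Rightarrow> 'v \<Rightarrow> complex) \<Rightarrow> 'v \<Rightarrow> real" where
  "ip_norm ip v = sqrt (Re (ip v v))"

(* The continuous extension of the inner product to the completion. *)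
definition ip_completion ::
  "('v \<Rightarrow> 'v \<Rightarrow> complex) \<Rightarrow> (nat \<Rightarrow> 'v) set \<Rightarrow> (nat \<Rightarrow> 'v) set \<Rightarrow> complex" where
  "ip_completion ip A B = lim (\<lambda>n. ip (rep_seq A n) (rep_seq B n))"

definition unitarizable :: "('v::ab_group_add) gk \<Rightarrow> bool" where
  "unitarizable V \<longleftrightarrow>
     (\<exists>ip \<rho>. inner_product V ip \<and> G_continuous V (ip_norm ip) \<and>
        globalization V (ip_norm ip) \<rho> \<and>
        (\<forall>g\<in>SL2. \<forall>A\<in>pts (banach_completion V (ip_norm ip)).
           \<forall>B\<in>pts (banach_completion V (ip_norm ip)).
             ip_completion ip (\<rho> g A) (\<rho> g B) = ip_completion ip A B))"


section \<open>The Sobolev gap\<close>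

(* The globalization of a given norm is unique, so the quantifier over rho just names the
   action of G on V_p. *)
definition Norms :: "('v::ab_group_add) gk \<Rightarrow> ('v \<Rightarrow> real) set" where
  "Norms V = {p. G_continuous V p \<and>
     (\<exists>\<rho>. globalization V p \<rho> \<and>
        (\<exists>C>0. \<forall>g\<in>SL2. \<forall>v. nrm (banach_completion V p) (\<rho> g (embed p v)) \<le> C * p v))}"

definition dominated :: "('v \<Rightarrow> real) \<Rightarrow> ('v \<Rightarrow> real) \<Rightarrow> bool" where
  "dominated p q \<longleftrightarrow> (\<exists>C>0. \<forall>v. p v \<le> C * q v)"

(* Representatives of the minimal and the maximal class of Norms V modulo mutual domination. *)
definition p_min :: "('v::ab_group_add) gk \<Rightarrow> 'v \<Rightarrow> real" where
  "p_min V = (SOME p. p \<in> Norms V \<and> (\<forall>q\<in>Norms V. dominated q p \<longrightarrow> dominated p q))"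

definition p_max :: "('v::ab_group_add) gk \<Rightarrow> 'v \<Rightarrow> real" where
  "p_max V = (SOME p. p \<in> Norms V \<and> (\<forall>q\<in>Norms V. dominated p q \<longrightarrow> dominated q p))"

definition Delta_K :: "('v::ab_group_add) gk \<Rightarrow> mat2 \<Rightarrow> 'v \<Rightarrow> 'v" where
  "Delta_K V Y v = - lie V Y (lie V Y v)"

(* Delta_K acts on each K-type by a scalar \<mu> \<ge> 0; as V is the direct sum of its K-types,
   prescribing the values on the K-types determines the linear operator. *)
definition D_op :: "('v::ab_group_add) gk \<Rightarrow> mat2 \<Rightarrow> real \<Rightarrow> 'v \<Rightarrow> 'v" where
  "D_op V Y s = (THE T. endo V T \<and>
     (\<forall>n. \<forall>v\<in>K_type V n. \<forall>\<mu>::real. Delta_K V Y v = scl V (of_real \<mu>) v \<longrightarrow>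
        T v = scl V (of_real ((1 + \<mu>) powr (s / 2))) v))"

definition sobolev_norm ::
  "('v::ab_group_add) gk \<Rightarrow> mat2 \<Rightarrow> ('v \<Rightarrow> real) \<Rightarrow> real \<Rightarrow> 'v \<Rightarrow> real" where
  "sobolev_norm V Y p s v = p (D_op V Y s v)"

(* Extended reals make the infimum of the empty set infinite. *)
definition sobolev_gap :: "('v::ab_group_add) gk \<Rightarrow> mat2 \<Rightarrow> ereal" where
  "sobolev_gap V Y =
     Inf (ereal ` {s. 0 \<le> s \<and> dominated (p_max V) (sobolev_norm V Y (p_min V) s)})"

end

theory Submission
  imports Defs "HOL-Computational_Algebra.Fundamental_Theorem_Algebra" "HOL-Real_Asymp.Real_Asymp"
begin
text \<open>Let \<open>e n\<close> be an orthonormal basis of K-types for the invariant inner product, \<open>o'\<close> a fixed K-type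
  and \<open>hyp t = diag (exp t, exp (- t))\<close>. The least class in Norm(V) is represented by
  \<open>q0 o' v = sup\<^sub>g \<bar>\<langle>g v, e o'\<rangle>\<bar>\<close>, the greatest by the supremum \<open>pmax\<close> of all invariant seminorms with
  \<open>q (e n) \<le> 1 / q0 o' (e n)\<close>, and \<open>pmax (e n) = 1 / q0 o' (e n)\<close>.
  By the Cartan decomposition \<open>q0 o' (e n)\<close> is the supremum of the radial coefficient
  \<open>rad n t = \<langle>hyp t (e n), e o'\<rangle>\<close>. The differential relations linking \<open>rad n\<close> to \<open>rad (n \<plusminus> 2)\<close> give
  \<open>\<bar>rad n t\<bar>\<^sup>2 \<le> C / (1 + \<bar>n\<bar>)\<close>, so that \<open>pmax (e n) \<ge> c (1 + \<bar>n\<bar>) q0 o' (e n)\<close> and the gap is at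
  least \<open>1\<close>. They also give \<open>\<integral> \<bar>rad n t\<bar>\<^sup>2 exp (- 2 \<epsilon> t) dt \<ge> c (1 + \<bar>n\<bar>)\<close> to the power \<open>- 1 - 2 \<epsilon>\<close>.
  Averaging over K and integrating over \<open>t\<close> turns this into Sobolev bounds: for \<open>v = \<Sum> a n (e n)\<close> the
  square of \<open>q0 o' v\<close> dominates \<open>\<Sum> \<bar>a n\<bar>\<^sup>2 (1 + \<bar>n\<bar>)\<close> to the power \<open>- 1 - 2 \<epsilon>\<close>, and dually the square of
  \<open>pmax v\<close> is dominated by the same sum with exponent \<open>1 + 2 \<epsilon>\<close>; hence the gap is at most \<open>1 + 2 \<epsilon>\<close>.
  Matrix coefficients do not depend on the norm, as they solve a differential system whose singular
  point \<open>t = 0\<close> is regular.\<close>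

section \<open>Two-by-two matrices\<close>

text \<open>Completions of different norms are different spaces and \<open>G\<close> acts only on
  completions, so norms cannot be compared along orbits directly. What they share are the
  coefficients \<open>M n g v\<close>. An orbit vector is therefore handled through the finite
  truncations \<open>S N g v\<close> of its K-type expansion, which lie in \<open>V\<close>; the
  coefficients decay like the inverse third power of \<open>1 + |n|\<close>, which beats the linear
  growth of the norms of \<open>e n\<close> and leaves a summable tail. In the same spirit averages
  over K are finite sums over roots of unity, exact once the modulus exceeds all differences of the
  K-types involved, and integrals over \<open>t\<close> are finite sums with nonnegative weights.

  The weight \<open>exp (- 2 \<epsilon> t)\<close> makes the bound \<open>|rad n t| <= 1\<close>
  enough both for convergence and for the boundary term at infinity; its price is the
  \<open>2 \<epsilon>\<close> in the exponents. The rate \<open>1 / (1 + |n|)\<close> from above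
  rests on the derivative of \<open>rad n\<close>, itself a unitary coefficient and hence square
  summable over \<open>n\<close>. Unitarity and nontriviality exclude finite-dimensional modules, so
  arbitrarily large \<open>|n|\<close> can be tested in the lower bound on the gap.\<close>

definition mk2 :: "real \<Rightarrow> real \<Rightarrow> real \<Rightarrow> real \<Rightarrow> mat2" where
  "mk2 a b c d = vector [vector [a, b], vector [c, d]]"

lemma mk2_nth [simp]:
  "mk2 a b c d $ 1 $ 1 = a" "mk2 a b c d $ 1 $ 2 = b"
  "mk2 a b c d $ 2 $ 1 = c" "mk2 a b c d $ 2 $ 2 = d"
  by (simp_all add: mk2_def)

lemma mat2_eq_iff:
  "(A::mat2) = B \<longleftrightarrow> A$1$1 = B$1$1 \<and> A$1$2 = B$1$2 \<and> A$2$1 = B$2$1 \<and> A$2$2 = B$2$2"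
  by (auto simp: vec_eq_iff forall_2)

lemma mat2_mult_nth [simp]:
  "((A::mat2) ** B) $ i $ j = A$i$1 * B$1$j + A$i$2 * B$2$j"
  by (simp add: matrix_matrix_mult_def sum_2)

lemma mat2_one [simp]:
  "(mat 1 :: mat2) $ 1 $ 1 = 1" "(mat 1 :: mat2) $ 1 $ 2 = 0"
  "(mat 1 :: mat2) $ 2 $ 1 = 0" "(mat 1 :: mat2) $ 2 $ 2 = 1"
  by (simp_all add: mat_def)

lemma trace2: "trace (A::mat2) = A$1$1 + A$2$2"
  by (simp add: trace_def sum_2)

definition "Y0 = mk2 0 (-1) 1 0"
definition "Hm = mk2 1 0 0 (-1)"
definition "Zm = mk2 0 1 1 0"
definition "rot t = mk2 (cos t) (- sin t) (sin t) (cos t)"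
definition "hyp t = mk2 (exp t) 0 0 (exp (-t))"

text \<open>The adjugate, which inverts elements of \<open>SL2\<close> and is total and polynomial
  in the entries.\<close>

definition adj2 :: "mat2 \<Rightarrow> mat2" where "adj2 g = mk2 (g$2$2) (- g$1$2) (- g$2$1) (g$1$1)"

lemma adj2_mult: "g \<in> SL2 \<Longrightarrow> adj2 g ** g = mat 1" "g \<in> SL2 \<Longrightarrow> g ** adj2 g = mat 1"
  by (auto simp: SL2_def det_2 mat2_eq_iff adj2_def algebra_simps)

lemma adj2_SL2 [simp]: "g \<in> SL2 \<Longrightarrow> adj2 g \<in> SL2"
  by (auto simp: SL2_def det_2 adj2_def algebra_simps)

lemma matrix_inv_SL2:
  assumes g: "g \<in> SL2" shows "matrix_inv g = adj2 g"
proof -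
  have "invertible g" using g by (auto simp: invertible_def intro!: exI[of _ "adj2 g"] adj2_mult)
  then have "matrix_inv g ** g = mat 1" unfolding invertible_def matrix_inv_def by (rule someI2_ex) blast
  then have "matrix_inv g ** (g ** adj2 g) = adj2 g" by (simp add: matrix_mul_assoc)
  then show ?thesis by (simp add: adj2_mult g)
qed

lemma SL2_mult [simp]: "g \<in> SL2 \<Longrightarrow> h \<in> SL2 \<Longrightarrow> g ** h \<in> SL2"
  by (simp add: SL2_def det_mul)

lemma SL2_1 [simp]: "mat 1 \<in> SL2"
  by (simp add: SL2_def)

lemma rot_SO2 [simp]: "rot t \<in> SO2"
  unfolding SO2_def rotation_matrix_def orthogonal_matrix_def mem_Collect_eq rot_def
  by (auto simp: mat2_eq_iff det_2 transpose_def sin_cos_squared_add3 simp flip: power2_eq_square)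

lemma SO2_cases: assumes "k \<in> SO2" obtains t where "k = rot t"
proof -
  have o: "transpose k ** k = mat 1" and d: "det k = 1"
    using assms by (auto simp: SO2_def rotation_matrix_def orthogonal_matrix_def)
  have 1: "k$1$1 * k$1$1 + k$2$1 * k$2$1 = 1" "k$1$1 * k$1$2 + k$2$1 * k$2$2 = 0"
    "k$1$1 * k$2$2 - k$1$2 * k$2$1 = 1"
    using o d by (auto simp: mat2_eq_iff transpose_def det_2)
  then obtain t where t: "k$1$1 = cos t" "k$2$1 = sin t"
    using sincos_total_2pi[of "k$1$1" "k$2$1"] unfolding power2_eq_square by blast
  \<comment> \<open>Cramer's rule: the factor \<open>1\<close>, written as the squared length of the
    first column, lets orthogonality of the columns and the determinant solve for the second
    column.\<close>
  have "k$2$2 = (k$1$1 * k$1$1 + k$2$1 * k$2$1) * k$2$2" using 1 by simp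
  also have "\<dots> = k$1$1 * (k$1$1 * k$2$2 - k$1$2 * k$2$1) + k$2$1 * (k$1$1 * k$1$2 + k$2$1 * k$2$2)"
    by (simp add: algebra_simps)
  finally have a: "k$2$2 = cos t" using 1 t by simp
  have "k$1$2 = (k$1$1 * k$1$1 + k$2$1 * k$2$1) * k$1$2" using 1 by simp
  also have "\<dots> = k$1$1 * (k$1$1 * k$1$2 + k$2$1 * k$2$2) - k$2$1 * (k$1$1 * k$2$2 - k$1$2 * k$2$1)"
    by (simp add: algebra_simps)
  finally have b: "k$1$2 = - sin t" using 1 t by simp
  show thesis by (rule that[of t]) (use a b t in \<open>simp add: mat2_eq_iff rot_def\<close>)
qed

lemma SO2_SL2: "k \<in> SO2 \<Longrightarrow> k \<in> SL2"
  by (simp add: SO2_def SL2_def rotation_matrix_def)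

lemma rot_SL2 [simp]: "rot t \<in> SL2" by (simp add: SO2_SL2)

lemma hyp_SL2 [simp]: "hyp t \<in> SL2"
  by (simp add: hyp_def SL2_def det_2 flip: exp_add)

lemma rot_add: "rot (s + t) = rot s ** rot t"
  by (simp add: rot_def mat2_eq_iff sin_add cos_add)

lemma rot_0 [simp]: "rot 0 = mat 1" by (simp add: rot_def mat2_eq_iff)

lemma rot_2pi: "rot (2 * pi) = mat 1" by (simp add: rot_def mat2_eq_iff)

lemma hyp_0 [simp]: "hyp 0 = mat 1" by (simp add: hyp_def mat2_eq_iff)

lemma adj2_rot: "adj2 (rot t) = rot (- t)" by (simp add: adj2_def rot_def)
lemma adj2_hyp: "adj2 (hyp t) = hyp (- t)" by (simp add: adj2_def hyp_def)

lemma basis_sl2 [simp]: "Y0 \<in> sl2" "Hm \<in> sl2" "Zm \<in> sl2"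
  by (simp_all add: sl2_def trace2 Y0_def Hm_def Zm_def)

lemma Y0_so2 [simp]: "Y0 \<in> so2"
  by (simp add: so2_def Y0_def mat2_eq_iff transpose_def)

lemma so2_cases: assumes "Y \<in> so2" obtains y where "Y = y *\<^sub>R Y0"
proof -
  have "transpose Y = - Y" using assms by (simp add: so2_def)
  then have *: "transpose Y $ i $ j = (- Y) $ i $ j" for i j by (simp only:)
  have "Y$1$1 = 0" "Y$1$2 = - Y$2$1" "Y$2$2 = 0"
    using *[of 1 1] *[of 2 2] *[of 2 1] by (simp_all add: transpose_def)
  then show thesis by (intro that[of "Y$2$1"]) (auto simp: mat2_eq_iff Y0_def)
qed

lemma sl2_expand:
  assumes "X \<in> sl2"
  shows "X = ((X$2$1 - X$1$2) / 2) *\<^sub>R Y0 + 1 *\<^sub>R ((X$1$1) *\<^sub>R Hm + ((X$2$1 + X$1$2) / 2) *\<^sub>R Zm)"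
  using assms by (auto simp: mat2_eq_iff Y0_def Hm_def Zm_def sl2_def trace2 field_simps)

lemma killing_Y0: "killing (y *\<^sub>R Y0) (y *\<^sub>R Y0) = - 8 * y\<^sup>2"
  unfolding killing_def bracket_def Let_def mk2_def[symmetric]
  by (simp add: Y0_def power2_eq_square)

subsection \<open>The matrix exponential\<close>

text \<open>When \<open>X\<close> squares to a scalar, its powers alternate between multiples of
  \<open>mat 1\<close> and of \<open>X\<close>, so the exponential series splits into two scalar
  series, one over the even and one over the odd exponents.\<close>

lemma mexp_sums_cases:
  assumes "X ** X = d *\<^sub>R mat 1"
    and A: "(\<lambda>n. if even n then (d ^ (n div 2) * t ^ n) / fact n else 0) sums A"
    and B: "(\<lambda>n. if odd n then (d ^ (n div 2) * t ^ n) / fact n else 0) sums B"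
  shows "mexp (t *\<^sub>R X) = A *\<^sub>R mat 1 + B *\<^sub>R X"
proof -
  have dbl: "(((**) (t *\<^sub>R X)) ^^ n) (mat 1) =
     (if even n then (d ^ (n div 2) * t ^ n) *\<^sub>R mat 1 else (d ^ (n div 2) * t ^ n) *\<^sub>R X)" for n
  proof (induction n)
    case (Suc n)
    show ?case
    proof (cases "even n")
      case True
      with Suc show ?thesis by (simp add: mat2_eq_iff algebra_simps)
    next
      case False
      then have n: "Suc n div 2 = Suc (n div 2)" by presburger
      have "(t *\<^sub>R X) ** (s *\<^sub>R X) = (t * s) *\<^sub>R (X ** X)" for s
        by (simp add: mat2_eq_iff algebra_simps)
      then show ?thesis using False Suc n assms(1) by (simp add: algebra_simps)
    qed
  qed simp
  have "(\<lambda>n. (if even n then (d ^ (n div 2) * t ^ n) / fact n else 0) *\<^sub>R mat 1 +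
        (if odd n then (d ^ (n div 2) * t ^ n) / fact n else 0) *\<^sub>R X)
     sums (A *\<^sub>R mat 1 + B *\<^sub>R X)"
    by (intro sums_add bounded_linear.sums[OF bounded_linear_scaleR_left] A B)
  also have "(\<lambda>n. (if even n then (d ^ (n div 2) * t ^ n) / fact n else 0) *\<^sub>R mat 1 +
        (if odd n then (d ^ (n div 2) * t ^ n) / fact n else 0) *\<^sub>R X)
     = (\<lambda>n. (1 / fact n) *\<^sub>R (((**) (t *\<^sub>R X)) ^^ n) (mat 1))"
    by (rule ext) (simp add: dbl)
  finally show ?thesis unfolding mexp_def by (rule sums_unique[symmetric])
qed

lemma mexp_elliptic:
  assumes "X ** X = (- (w\<^sup>2)) *\<^sub>R mat 1" "w \<noteq> 0"
  shows "mexp (t *\<^sub>R X) = cos (w * t) *\<^sub>R mat 1 + (sin (w * t) / w) *\<^sub>R X"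
proof (rule mexp_sums_cases[OF assms(1)])
  have e: "(- (w\<^sup>2)) ^ (n div 2) = (-1) ^ (n div 2) * w ^ n" if "even n" for n
    using that by (auto elim!: evenE simp: power_mult[symmetric] power_minus[of "w\<^sup>2"])
  have o: "(- (w\<^sup>2)) ^ (n div 2) = (-1) ^ (n div 2) * w ^ n / w" if "odd n" for n
    using that assms(2) by (auto elim!: oddE simp: power_mult[symmetric] power_minus[of "w\<^sup>2"])
  show "(\<lambda>n. if even n then ((- (w\<^sup>2)) ^ (n div 2) * t ^ n) / fact n else 0) sums cos (w * t)"
    using cos_converges[of "w * t"]
    by (rule sums_cong[THEN iffD1, rotated]) (auto simp: cos_coeff_def e power_mult_distrib)
  have "(\<lambda>n. if odd n then ((- (w\<^sup>2)) ^ (n div 2) * t ^ n) / fact n else 0)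
      = (\<lambda>n. (sin_coeff n *\<^sub>R (w * t) ^ n) / w)"
    by (rule ext) (auto simp: sin_coeff_def o power_mult_distrib elim!: oddE)
  then show "(\<lambda>n. if odd n then ((- (w\<^sup>2)) ^ (n div 2) * t ^ n) / fact n else 0) sums (sin (w * t) / w)"
    using sums_divide[OF sin_converges[of "w * t"], of w] by simp
qed

lemma mexp_hyperbolic:
  assumes "X ** X = (w\<^sup>2) *\<^sub>R mat 1" "w \<noteq> 0"
  shows "mexp (t *\<^sub>R X) = cosh (w * t) *\<^sub>R mat 1 + (sinh (w * t) / w) *\<^sub>R X"
proof (rule mexp_sums_cases[OF assms(1)])
  have e: "(w\<^sup>2) ^ (n div 2) = w ^ n" if "even n" for n
    using that by (auto elim!: evenE simp: power_mult[symmetric])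
  have o: "(w\<^sup>2) ^ (n div 2) = w ^ n / w" if "odd n" for n
    using that assms(2) by (auto elim!: oddE simp: power_mult[symmetric])
  have "(\<lambda>n. if even n then ((w\<^sup>2) ^ (n div 2) * t ^ n) / fact n else 0)
      = (\<lambda>n. if even n then (w * t) ^ n /\<^sub>R fact n else 0)"
    by (rule ext) (auto simp: e power_mult_distrib field_simps)
  then show "(\<lambda>n. if even n then ((w\<^sup>2) ^ (n div 2) * t ^ n) / fact n else 0) sums cosh (w * t)"
    using cosh_converges[of "w * t"] by simp
  have "(\<lambda>n. if odd n then ((w\<^sup>2) ^ (n div 2) * t ^ n) / fact n else 0)
      = (\<lambda>n. (if even n then 0 else (w * t) ^ n /\<^sub>R fact n) / w)"
    by (rule ext) (auto simp: o power_mult_distrib field_simps)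
  then show "(\<lambda>n. if odd n then ((w\<^sup>2) ^ (n div 2) * t ^ n) / fact n else 0) sums (sinh (w * t) / w)"
    using sums_divide[OF sinh_converges[of "w * t"], of w] by simp
qed

lemma mexp_parabolic:
  assumes "X ** X = 0"
  shows "mexp (t *\<^sub>R X) = 1 *\<^sub>R mat 1 + t *\<^sub>R X"
proof (rule mexp_sums_cases[of X 0])
  have "(\<lambda>n. if even n then (0 ^ (n div 2) * t ^ n) / fact n else 0) = (\<lambda>n. if n = 0 then 1 else (0::real))"
    by (rule ext) (auto elim!: evenE)
  then show "(\<lambda>n. if even n then (0 ^ (n div 2) * t ^ n) / fact n else 0) sums 1"
    using sums_single[of 0 "\<lambda>_. 1::real"] by simp
  have "(\<lambda>n. if odd n then (0 ^ (n div 2) * t ^ n) / fact n else 0) = (\<lambda>n. if n = 1 then t else (0::real))"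
    by (rule ext) (auto elim!: oddE)
  then show "(\<lambda>n. if odd n then (0 ^ (n div 2) * t ^ n) / fact n else 0) sums t"
    using sums_single[of 1 "\<lambda>_. t"] by simp
qed (use assms in simp)

text \<open>A trace-zero matrix has \<open>X^2 = d\<close> with \<open>d = - det X\<close> by
  Cayley-Hamilton, hence \<open>mexp (t X) = A t + B t X\<close>. All claims become identities
  between \<open>A\<close> and \<open>B\<close>: the addition formulas give the group law and
  \<open>A^2 - d B^2 = 1\<close> the determinant. The sign of \<open>d\<close> selects the pair cos
  and sin, \<open>1\<close> and \<open>t\<close>, or cosh and sinh.\<close>

lemma mexp_group:
  assumes "X \<in> sl2"
  shows "mexp ((s + t) *\<^sub>R X) = mexp (s *\<^sub>R X) ** mexp (t *\<^sub>R X)"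
    and "mexp (t *\<^sub>R X) \<in> SL2" and "mexp 0 = mat 1"
    and "continuous_on UNIV (\<lambda>t. mexp (t *\<^sub>R X))"
proof -
  define d where "d = - det X"
  have tr: "X$2$2 = - X$1$1" using assms by (simp add: sl2_def trace2)
  have XX: "X ** X = d *\<^sub>R mat 1" by (simp add: d_def mat2_eq_iff det_2 tr algebra_simps)
  obtain A B where AB: "\<And>t. mexp (t *\<^sub>R X) = A t *\<^sub>R mat 1 + B t *\<^sub>R X"
    "\<And>s t. A (s + t) = A s * A t + d * (B s * B t)" "\<And>s t. B (s + t) = A s * B t + B s * A t"
    "A 0 = 1" "B 0 = 0" "\<And>t. A t * A t - d * (B t * B t) = 1"
    "continuous_on UNIV A" "continuous_on UNIV B"
  proof (cases d "0::real" rule: linorder_cases)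
    case less
    define w where "w = sqrt (- d)"
    have w: "w \<noteq> 0" "d = - (w\<^sup>2)" using less by (auto simp: w_def)
    have ww: "w\<^sup>2 * (x / w * (y / w)) = x * y" for x y using w by (simp add: power2_eq_square)
    show ?thesis
    proof (rule that[of "\<lambda>t. cos (w * t)" "\<lambda>t. sin (w * t) / w"])
      show "mexp (t *\<^sub>R X) = cos (w * t) *\<^sub>R mat 1 + (sin (w * t) / w) *\<^sub>R X" for t
        using mexp_elliptic XX w by simp
    qed (use w ww in \<open>auto intro!: continuous_intros
           simp: distrib_left cos_add sin_add add_divide_distrib power_divide simp flip: power2_eq_square\<close>)
  next
    case equal
    show ?thesis
      by (rule that[of "\<lambda>t. 1" "\<lambda>t. t"])
        (use mexp_parabolic[of X] XX equal in \<open>auto intro!: continuous_intros\<close>)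
  next
    case greater
    define w where "w = sqrt d"
    have w: "w \<noteq> 0" "d = w\<^sup>2" using greater by (auto simp: w_def)
    have ww: "w\<^sup>2 * (x / w * (y / w)) = x * y" for x y using w by (simp add: power2_eq_square)
    show ?thesis
    proof (rule that[of "\<lambda>t. cosh (w * t)" "\<lambda>t. sinh (w * t) / w"])
      show "mexp (t *\<^sub>R X) = cosh (w * t) *\<^sub>R mat 1 + (sinh (w * t) / w) *\<^sub>R X" for t
        using mexp_hyperbolic XX w by simp
    qed (use w ww in \<open>auto intro!: continuous_intros
           simp: distrib_left cosh_add sinh_add add_divide_distrib power_divide cosh_square_eq simp flip: power2_eq_square\<close>)
  qed
  have "mexp (s *\<^sub>R X) ** mexp (t *\<^sub>R X) = (A s * A t) *\<^sub>R mat 1 + (A s * B t + B s * A t) *\<^sub>R X + (B s * B t) *\<^sub>R (X ** X)"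
    for s t unfolding AB(1) by (simp add: mat2_eq_iff algebra_simps)
  then show "mexp ((s + t) *\<^sub>R X) = mexp (s *\<^sub>R X) ** mexp (t *\<^sub>R X)"
    unfolding XX AB(1,2,3) by (simp add: mat2_eq_iff algebra_simps)
  have "det (mexp (t *\<^sub>R X)) = A t * A t - d * (B t * B t)"
    unfolding AB(1) by (simp add: det_2 tr d_def algebra_simps)
  then show "mexp (t *\<^sub>R X) \<in> SL2" using AB(6)[of t] unfolding SL2_def mem_Collect_eq by (rule trans)
  show "mexp 0 = mat 1" using AB(1)[of 0] AB(4,5) by simp
  show "continuous_on UNIV (\<lambda>t. mexp (t *\<^sub>R X))"
    unfolding AB(1) by (intro continuous_intros AB)
qed

text \<open>The element \<open>adj2 g ** Y0 ** g\<close> squares to \<open>- 1\<close> like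
  \<open>Y0\<close>, so the elliptic formula applies, and multiplying by \<open>g\<close> from the
  left turns it into \<open>Y0 ** g\<close>. A rotation on the left of \<open>g\<close> thereby
  becomes a one-parameter group on its right, where the Lie algebra acts.\<close>

lemma mexp_conj_Y0:
  assumes "g \<in> SL2"
  shows "g ** mexp (t *\<^sub>R (adj2 g ** Y0 ** g)) = rot t ** g" and "adj2 g ** Y0 ** g \<in> sl2"
proof -
  let ?X = "adj2 g ** Y0 ** g"
  have dg: "g$1$1 * g$2$2 = 1 + g$1$2 * g$2$1" using assms by (simp add: SL2_def det_2)
  have YY: "Y0 ** Y0 = (-1) *\<^sub>R mat 1" by (simp add: Y0_def mat2_eq_iff)
  have "?X ** ?X = adj2 g ** Y0 ** (g ** adj2 g) ** Y0 ** g" by (simp add: matrix_mul_assoc)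
  also have "\<dots> = adj2 g ** (Y0 ** Y0) ** g" by (simp add: adj2_mult assms matrix_mul_assoc)
  also have "\<dots> = (-1) *\<^sub>R (adj2 g ** g)" unfolding YY by (simp add: mat2_eq_iff)
  finally have XX: "?X ** ?X = (- (1\<^sup>2)) *\<^sub>R mat 1" by (simp add: adj2_mult assms)
  have m: "mexp (t *\<^sub>R ?X) = cos t *\<^sub>R mat 1 + sin t *\<^sub>R ?X"
    using mexp_elliptic[OF XX, of t] by simp
  have "g ** mexp (t *\<^sub>R ?X) = cos t *\<^sub>R g + sin t *\<^sub>R (g ** adj2 g ** Y0 ** g)"
    unfolding m by (simp add: mat2_eq_iff algebra_simps)
  also have "\<dots> = rot t ** g" by (simp add: adj2_mult assms) (simp add: mat2_eq_iff rot_def Y0_def)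
  finally show "g ** mexp (t *\<^sub>R ?X) = rot t ** g" .
  show "?X \<in> sl2" using dg by (simp add: sl2_def trace2 adj2_def Y0_def)
qed

lemma mexp_Y0: "mexp (t *\<^sub>R Y0) = rot t"
  using mexp_elliptic[of Y0 1 t] by (simp add: Y0_def mat2_eq_iff rot_def)

lemma mexp_Hm: "mexp (t *\<^sub>R Hm) = hyp t"
  using mexp_hyperbolic[of Hm 1 t]
  by (simp add: Hm_def mat2_eq_iff hyp_def cosh_plus_sinh cosh_minus_sinh)

lemma adj2_hyp_Y0:
  "adj2 (hyp t) ** Y0 ** hyp t = cosh (2 * t) *\<^sub>R Y0 + sinh (2 * t) *\<^sub>R Zm"
  by (simp add: adj2_def hyp_def Y0_def Zm_def mat2_eq_iff cosh_def sinh_def field_simps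
      flip: exp_add)

subsection \<open>The Cartan decomposition\<close>

text \<open>A two-by-two matrix is the sum of a conformal part, with coordinates
  \<open>a + d\<close> and \<open>c - b\<close>, and an anticonformal part, with coordinates
  \<open>a - d\<close> and \<open>b + c\<close>. In polar coordinates these parts have radii
  \<open>2 P\<close> and \<open>2 Q\<close>; the determinant says \<open>P^2 - Q^2 = 1\<close>, so
  \<open>P + Q\<close> and \<open>P - Q\<close> are the two reciprocal singular values.\<close>

lemma KAK:
  assumes "g \<in> SL2" obtains s t u where "0 \<le> t" "g = rot s ** hyp t ** rot u"
proof -
  define a where "a = g$1$1" define b where "b = g$1$2"
  define c where "c = g$2$1" define d where "d = g$2$2"
  have det: "a * d - b * c = 1" using assms by (simp add: SL2_def det_2 a_def b_def c_def d_def)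
  define P where "P = sqrt ((a + d)\<^sup>2 + (c - b)\<^sup>2) / 2"
  define Q where "Q = sqrt ((a - d)\<^sup>2 + (b + c)\<^sup>2) / 2"
  have PQ: "P\<^sup>2 - Q\<^sup>2 = 1" "P \<ge> 0" "Q \<ge> 0"
    using det by (auto simp: P_def Q_def power_divide) (simp add: power2_eq_square field_simps)
  have "1\<^sup>2 \<le> P\<^sup>2" using PQ(1) zero_le_power2[of Q] unfolding one_power2 by linarith
  then have P1: "P \<ge> 1" using PQ(2) power2_le_imp_le by blast
  obtain x where x: "a + d = 2 * P * cos x" "c - b = 2 * P * sin x"
  proof -
    have "((a + d) / (2*P))\<^sup>2 + ((c - b) / (2*P))\<^sup>2 = ((a + d)\<^sup>2 + (c - b)\<^sup>2) / (2*P)\<^sup>2"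
      unfolding power_divide by (rule add_divide_distrib[symmetric])
    also have "(2 * P)\<^sup>2 = (a + d)\<^sup>2 + (c - b)\<^sup>2" by (simp add: P_def)
    also have "((a + d)\<^sup>2 + (c - b)\<^sup>2) / ((a + d)\<^sup>2 + (c - b)\<^sup>2) = 1"
      unfolding \<open>(2 * P)\<^sup>2 = _\<close>[symmetric] using P1 by simp
    finally obtain x where "(a + d) / (2*P) = cos x" "(c - b) / (2*P) = sin x"
      using sincos_total_2pi by metis
    then show thesis using P1 by (intro that[of x]) (auto simp: field_simps)
  qed
  obtain y where y: "a - d = 2 * Q * cos y" "b + c = 2 * Q * sin y"
  proof (cases "Q = 0")
    case True
    then have "(a - d)\<^sup>2 + (b + c)\<^sup>2 = 0" by (simp add: Q_def)
    then have "a - d = 0" "b + c = 0" using sum_power2_eq_zero_iff by blast+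
    then show thesis using True by (intro that[of 0]) auto
  next
    case False
    have "((a - d) / (2*Q))\<^sup>2 + ((b + c) / (2*Q))\<^sup>2 = ((a - d)\<^sup>2 + (b + c)\<^sup>2) / (2*Q)\<^sup>2"
      unfolding power_divide by (rule add_divide_distrib[symmetric])
    also have "(2 * Q)\<^sup>2 = (a - d)\<^sup>2 + (b + c)\<^sup>2" by (simp add: Q_def)
    also have "((a - d)\<^sup>2 + (b + c)\<^sup>2) / ((a - d)\<^sup>2 + (b + c)\<^sup>2) = 1"
      unfolding \<open>(2 * Q)\<^sup>2 = _\<close>[symmetric] using False by simp
    finally obtain y where "(a - d) / (2*Q) = cos y" "(b + c) / (2*Q) = sin y"
      using sincos_total_2pi by metis
    then show thesis using False by (intro that[of y]) (auto simp: field_simps)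
  qed
  define t where "t = ln (P + Q)"
  have pos: "P + Q \<ge> 1" using PQ P1 by simp
  have e: "exp t = P + Q" using pos by (simp add: t_def)
  have "(P - Q) * (P + Q) = 1" using PQ by (simp add: power2_eq_square algebra_simps)
  then have e': "exp (- t) = P - Q" using e pos by (simp add: exp_minus field_simps)
  \<comment> \<open>The polar angles \<open>x\<close> and \<open>y\<close> are the sum and the
    difference of the two rotation angles.\<close>
  let ?s = "(x + y) / 2" and ?u = "(x - y) / 2"
  have xy: "?s + ?u = x" "?s - ?u = y" by (simp_all add: field_simps)
  have xs: "cos x = cos ?s * cos ?u - sin ?s * sin ?u" "sin x = sin ?s * cos ?u + cos ?s * sin ?u"
     "cos y = cos ?s * cos ?u + sin ?s * sin ?u" "sin y = sin ?s * cos ?u - cos ?s * sin ?u"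
    using cos_add[of ?s ?u] sin_add[of ?s ?u] cos_diff[of ?s ?u] sin_diff[of ?s ?u] xy by simp_all
  have "a = P * cos x + Q * cos y" "d = P * cos x - Q * cos y" "c = P * sin x + Q * sin y"
     "b = Q * sin y - P * sin x"
    using x y by simp_all
  then have "g = rot ?s ** hyp t ** rot ?u"
    unfolding xs a_def b_def c_def d_def
    by (simp add: mat2_eq_iff rot_def hyp_def e e' algebra_simps)
  moreover have "0 \<le> t" using pos by (simp add: t_def)
  ultimately show thesis using that by blast
qed

section \<open>Banach completions\<close>

lemma functionalD:
  assumes "functional V \<xi>"
  shows "\<xi> (u + v) = \<xi> u + \<xi> v" "\<xi> (scl V c v) = c * \<xi> v" "\<xi> 0 = 0" "\<xi> (u - v) = \<xi> u - \<xi> v"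
    "\<xi> (sum f S) = (\<Sum>x\<in>S. \<xi> (f x))"
proof -
  interpret l: Vector_Spaces.linear "scl V" "(*)" \<xi> by fact
  show "\<xi> (u + v) = \<xi> u + \<xi> v" "\<xi> (scl V c v) = c * \<xi> v" "\<xi> 0 = 0" "\<xi> (u - v) = \<xi> u - \<xi> v"
    "\<xi> (sum f S) = (\<Sum>x\<in>S. \<xi> (f x))"
    by (simp_all add: l.add l.scale l.zero l.diff l.sum)
qed

lemma functionalI:
  assumes "vector_space (scl V)" "\<And>u v. \<xi> (u + v) = \<xi> u + \<xi> v" "\<And>c v. \<xi> (scl V c v) = c * \<xi> v"
  shows "functional V \<xi>"
proof -
  interpret vector_space "scl V" by fact
  interpret c: vector_space "(*) :: complex \<Rightarrow> complex \<Rightarrow> complex"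
    by unfold_locales (auto simp: algebra_simps)
  show ?thesis by unfold_locales (use assms in auto)
qed

lemma endoD:
  assumes "endo V T"
  shows "T (u + v) = T u + T v" "T (scl V c v) = scl V c (T v)" "T 0 = 0" "T (u - v) = T u - T v"
    "T (sum f S) = (\<Sum>x\<in>S. T (f x))"
proof -
  interpret l: Vector_Spaces.linear "scl V" "scl V" T by fact
  show "T (u + v) = T u + T v" "T (scl V c v) = scl V c (T v)" "T 0 = 0" "T (u - v) = T u - T v"
    "T (sum f S) = (\<Sum>x\<in>S. T (f x))"
    by (simp_all add: l.add l.scale l.zero l.diff l.sum)
qed

lemma endoI:
  assumes "vector_space (scl V)" "\<And>u v. T (u + v) = T u + T v" "\<And>c v. T (scl V c v) = scl V c (T v)"
  shows "endo V T"
proof -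
  interpret vector_space "scl V" by fact
  show ?thesis by unfold_locales (use assms in auto)
qed

locale normed_gk =
  fixes V :: "('v::ab_group_add) gk" and p :: "'v \<Rightarrow> real"
  assumes vs: "vector_space (scl V)" and nm: "is_norm V p"
begin

sublocale vs: vector_space "scl V" by (rule vs)

lemma p_nonneg [simp]: "0 \<le> p v" and p_eq_0 [simp]: "p v = 0 \<longleftrightarrow> v = 0"
  and p_triangle: "p (v + w) \<le> p v + p w" and p_scl [simp]: "p (scl V c v) = cmod c * p v"
  using nm by (auto simp: is_norm_def)

lemma p_zero [simp]: "p 0 = 0" by simp

lemma p_minus [simp]: "p (- v) = p v"
  using p_scl[of "-1" v] by simp

lemma p_commute: "p (v - w) = p (w - v)"
  using p_minus[of "v - w"] by simp

lemma p_diff: "p (v - w) \<le> p v + p w"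
  using p_triangle[of v "- w"] by simp

lemma p_tri: "p (u - w) \<le> p (u - v) + p (v - w)"
  using p_triangle[of "u - v" "v - w"] by simp

lemma p_rev: "\<bar>p u - p v\<bar> \<le> p (u - v)"
  using p_triangle[of "u - v" v] p_triangle[of "v - u" u] p_commute[of u v] by simp

lemma p_sum: "p (sum f S) \<le> (\<Sum>x\<in>S. p (f x))"
  by (induction S rule: infinite_finite_induct) (auto intro: order_trans[OF p_triangle])

abbreviation "CS \<equiv> cauchy_seqs p"
abbreviation "cc \<equiv> cauchy_class p"
abbreviation "E \<equiv> banach_completion V p"

lemma CS_D: "u \<in> CS \<Longrightarrow> e > 0 \<Longrightarrow> \<exists>N. \<forall>m\<ge>N. \<forall>n\<ge>N. p (u m - u n) < e"
  by (simp add: cauchy_seqs_def)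

lemma CS_I: "(\<And>e. e > 0 \<Longrightarrow> \<exists>N. \<forall>m\<ge>N. \<forall>n\<ge>N. p (u m - u n) < e) \<Longrightarrow> u \<in> CS"
  by (simp add: cauchy_seqs_def)

lemma CS_const [simp]: "(\<lambda>n. v) \<in> CS"
  by (rule CS_I) auto

lemma CS_bound:
  assumes "\<And>m n. f (u m - u n) \<le> K * p (w m - w n)" "w \<in> CS" "\<And>v. f v = p v" shows "u \<in> CS"
proof (rule CS_I)
  fix e :: real assume e: "e > 0"
  define K' where "K' = max K 1"
  have K'0: "K' > 0" by (simp add: K'_def)
  obtain N where N: "\<forall>m\<ge>N. \<forall>n\<ge>N. p (w m - w n) < e / K'"
    using CS_D[OF assms(2), of "e / K'"] e by (auto simp: K'_def)
  show "\<exists>N. \<forall>m\<ge>N. \<forall>n\<ge>N. p (u m - u n) < e"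
  proof (intro exI allI impI)
    fix m n assume "N \<le> m" "N \<le> n"
    have "p (u m - u n) \<le> K * p (w m - w n)" using assms by metis
    also have "\<dots> \<le> K' * p (w m - w n)" by (intro mult_right_mono) (auto simp: K'_def)
    also have "\<dots> < e" using N \<open>N \<le> m\<close> \<open>N \<le> n\<close> K'0 by (simp add: pos_less_divide_eq mult.commute)
    finally show "p (u m - u n) < e" .
  qed
qed

lemma CS_add [simp]:
  assumes "u \<in> CS" "w \<in> CS" shows "(\<lambda>n. u n + w n) \<in> CS"
proof (rule CS_I)
  fix e :: real assume "e > 0"
  then obtain M N where "\<forall>m\<ge>M. \<forall>n\<ge>M. p (u m - u n) < e/2" "\<forall>m\<ge>N. \<forall>n\<ge>N. p (w m - w n) < e/2"
    using CS_D[OF assms(1), of "e/2"] CS_D[OF assms(2), of "e/2"] half_gt_zero by blast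
  note MN = this
  have "p (u m + w m - (u n + w n)) < e" if "m \<ge> max M N" "n \<ge> max M N" for m n
  proof -
    have "p (u m - u n) < e/2" "p (w m - w n) < e/2" using that MN by auto
    then show ?thesis using p_triangle[of "u m - u n" "w m - w n"] by (simp add: algebra_simps)
  qed
  then show "\<exists>N. \<forall>m\<ge>N. \<forall>n\<ge>N. p (u m + w m - (u n + w n)) < e" by blast
qed

lemma CS_scl [simp]:
  assumes "u \<in> CS" shows "(\<lambda>n. scl V c (u n)) \<in> CS"
  by (rule CS_bound[of p _ "cmod c" u]) (auto simp: assms simp flip: vs.scale_right_diff_distrib)

lemma CS_diff [simp]:
  assumes "u \<in> CS" "w \<in> CS" shows "(\<lambda>n. u n - w n) \<in> CS"
  using CS_add[OF assms(1) CS_scl[OF assms(2), of "-1"]] by simp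

lemma CS_p_convergent:
  assumes "u \<in> CS" shows "convergent (\<lambda>n. p (u n))"
proof -
  have "Cauchy (\<lambda>n. p (u n))"
  proof (rule metric_CauchyI)
    fix e :: real assume "e > 0"
    then obtain N where "\<forall>m\<ge>N. \<forall>n\<ge>N. p (u m - u n) < e" using CS_D[OF assms] by blast
    then show "\<exists>M. \<forall>m\<ge>M. \<forall>n\<ge>M. dist (p (u m)) (p (u n)) < e"
      by (metis dist_real_def order.strict_trans1 p_rev)
  qed
  then show ?thesis by (simp add: Cauchy_convergent_iff)
qed

lemma cc_eq_iff:
  assumes "u \<in> CS" "w \<in> CS"
  shows "cc u = cc w \<longleftrightarrow> (\<lambda>n. p (u n - w n)) \<longlonglongrightarrow> 0"
proof
  assume "cc u = cc w"
  moreover have "w \<in> cc w" using assms by (simp add: cauchy_class_def)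
  ultimately have "w \<in> cc u" by simp
  then show "(\<lambda>n. p (u n - w n)) \<longlonglongrightarrow> 0" by (simp add: cauchy_class_def)
next
  have tr: "(\<lambda>n. p (x n - z n)) \<longlonglongrightarrow> 0"
    if "(\<lambda>n. p (x n - y n)) \<longlonglongrightarrow> 0" "(\<lambda>n. p (y n - z n)) \<longlonglongrightarrow> 0" for x y z
    by (rule Lim_null_comparison[OF _ tendsto_add_zero[OF that]]) (use p_tri in simp)
  assume l: "(\<lambda>n. p (u n - w n)) \<longlonglongrightarrow> 0"
  have l': "(\<lambda>n. p (w n - u n)) \<longlonglongrightarrow> 0" using l by (subst p_commute)
  show "cc u = cc w" unfolding cauchy_class_def using tr[OF l] tr[OF l'] by blast
qed

lemma pts_E: "pts E = cc ` CS" by (simp add: banach_completion_def)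

lemma cc_pts [simp]: "u \<in> CS \<Longrightarrow> cc u \<in> pts E" by (simp add: pts_E)

lemma pts_cases: assumes "A \<in> pts E" obtains u where "u \<in> CS" "A = cc u"
  using assms by (auto simp: pts_E)

lemma rep_cc:
  assumes "u \<in> CS"
  shows "rep_seq (cc u) \<in> CS" "(\<lambda>n. p (u n - rep_seq (cc u) n)) \<longlonglongrightarrow> 0" "cc (rep_seq (cc u)) = cc u"
proof -
  have "u \<in> cc u" using assms by (simp add: cauchy_class_def)
  then have "rep_seq (cc u) \<in> cc u" unfolding rep_seq_def by (rule someI[where P = "\<lambda>x. x \<in> cc u"])
  then show r: "rep_seq (cc u) \<in> CS" "(\<lambda>n. p (u n - rep_seq (cc u) n)) \<longlonglongrightarrow> 0"
    by (auto simp: cauchy_class_def)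
  show "cc (rep_seq (cc u)) = cc u" using cc_eq_iff[OF assms r(1)] r(2) by simp
qed

lemma add_cc:
  assumes "u \<in> CS" "w \<in> CS" shows "add E (cc u) (cc w) = cc (\<lambda>n. u n + w n)"
proof -
  have "(\<lambda>n. p (u n + w n - (rep_seq (cc u) n + rep_seq (cc w) n))) \<longlonglongrightarrow> 0"
  proof (rule Lim_null_comparison[OF _ tendsto_add_zero[OF rep_cc(2)[OF assms(1)] rep_cc(2)[OF assms(2)]]])
    show "\<forall>\<^sub>F n in sequentially. norm (p (u n + w n - (rep_seq (cc u) n + rep_seq (cc w) n)))
       \<le> p (u n - rep_seq (cc u) n) + p (w n - rep_seq (cc w) n)"
      using p_triangle[of "u n - rep_seq (cc u) n" "w n - rep_seq (cc w) n" for n]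
      by (auto simp: algebra_simps)
  qed
  then show ?thesis
    using assms rep_cc(1) cc_eq_iff[of "\<lambda>n. u n + w n" "\<lambda>n. rep_seq (cc u) n + rep_seq (cc w) n"]
    by (simp add: banach_completion_def)
qed

lemma smul_cc:
  assumes "u \<in> CS" shows "smul E c (cc u) = cc (\<lambda>n. scl V c (u n))"
proof -
  have "(\<lambda>n. p (scl V c (u n) - scl V c (rep_seq (cc u) n))) \<longlonglongrightarrow> 0"
    using tendsto_mult_left[OF rep_cc(2)[OF assms], of "cmod c"]
    by (simp flip: vs.scale_right_diff_distrib)
  then show ?thesis
    using assms rep_cc(1) cc_eq_iff[of "\<lambda>n. scl V c (u n)" "\<lambda>n. scl V c (rep_seq (cc u) n)"]
    by (simp add: banach_completion_def)
qed

lemma nrm_cc: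
  assumes "u \<in> CS" shows "(\<lambda>n. p (u n)) \<longlonglongrightarrow> nrm E (cc u)"
proof -
  let ?r = "rep_seq (cc u)"
  have 1: "(\<lambda>n. p (?r n)) \<longlonglongrightarrow> nrm E (cc u)"
    using CS_p_convergent[OF rep_cc(1)[OF assms]] by (simp add: banach_completion_def convergent_LIMSEQ_iff)
  have "(\<lambda>n. p (u n) - p (?r n)) \<longlonglongrightarrow> 0"
    by (rule Lim_null_comparison[OF _ rep_cc(2)[OF assms]]) (auto simp: p_rev)
  from tendsto_add[OF this 1] show ?thesis by simp
qed

lemma ndist_cc:
  assumes "u \<in> CS" "w \<in> CS" shows "(\<lambda>n. p (u n - w n)) \<longlonglongrightarrow> ndist E (cc u) (cc w)"
proof -
  have "add E (cc u) (smul E (-1) (cc w)) = cc (\<lambda>n. u n - w n)"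
    using add_cc[OF assms(1) CS_scl[OF assms(2), of "-1"]] smul_cc[OF assms(2), of "-1"] by simp
  then show ?thesis using nrm_cc[OF CS_diff[OF assms]] assms by (simp add: ndist_def)
qed

lemma embed_pts [simp]: "embed p v \<in> pts E"
  unfolding embed_def by simp

lemma ndist_embed [simp]: "ndist E (embed p v) (embed p w) = p (v - w)"
  using LIMSEQ_unique[OF ndist_cc[of "\<lambda>n. v" "\<lambda>n. w"] tendsto_const] unfolding embed_def by simp

lemma nrm_embed [simp]: "nrm E (embed p v) = p v"
  using LIMSEQ_unique[OF nrm_cc[of "\<lambda>n. v"] tendsto_const] unfolding embed_def by simp

lemma add_embed [simp]: "add E (embed p v) (embed p w) = embed p (v + w)"
  unfolding embed_def by (simp add: add_cc)

lemma smul_embed [simp]: "smul E c (embed p v) = embed p (scl V c v)"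
  unfolding embed_def by (simp add: smul_cc)

lemma add_pts [simp]: "A \<in> pts E \<Longrightarrow> B \<in> pts E \<Longrightarrow> add E A B \<in> pts E"
  by (auto elim!: pts_cases simp: add_cc)

lemma smul_pts [simp]: "A \<in> pts E \<Longrightarrow> smul E c A \<in> pts E"
  by (auto elim!: pts_cases simp: smul_cc)

lemma ndist_nonneg [simp]: "0 \<le> ndist E A B"
proof (cases "A \<in> pts E \<and> B \<in> pts E")
  case True
  then obtain u w where "u \<in> CS" "w \<in> CS" "A = cc u" "B = cc w" by (auto elim!: pts_cases)
  then show ?thesis using LIMSEQ_le_const[OF ndist_cc] by auto
qed (auto simp: ndist_def)

lemma ndist_commute: "ndist E A B = ndist E B A"
proof (cases "A \<in> pts E \<and> B \<in> pts E")
  case True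
  then obtain u w where u: "u \<in> CS" "w \<in> CS" "A = cc u" "B = cc w" by (auto elim!: pts_cases)
  have "(\<lambda>n. p (u n - w n)) \<longlonglongrightarrow> ndist E B A"
    using ndist_cc[OF u(2,1)] u by (simp add: p_commute[of "u _"])
  then show ?thesis using u LIMSEQ_unique ndist_cc by blast
qed (auto simp: ndist_def)

lemma ndist_eq_0: "A \<in> pts E \<Longrightarrow> B \<in> pts E \<Longrightarrow> ndist E A B = 0 \<longleftrightarrow> A = B"
proof (elim pts_cases)
  fix u w assume u: "u \<in> CS" "w \<in> CS" "A = cc u" "B = cc w"
  then show ?thesis using ndist_cc[OF u(1,2)] cc_eq_iff[OF u(1,2)] LIMSEQ_unique by auto
qed

lemma ndist_triangle:
  assumes "A \<in> pts E" "B \<in> pts E" "C \<in> pts E"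
  shows "ndist E A C \<le> ndist E A B + ndist E B C"
proof -
  obtain u w x where u: "u \<in> CS" "w \<in> CS" "x \<in> CS" "A = cc u" "B = cc w" "C = cc x"
    using assms by (auto elim!: pts_cases)
  show ?thesis unfolding u
    by (rule LIMSEQ_le[OF ndist_cc[OF u(1,3)] tendsto_add[OF ndist_cc[OF u(1,2)] ndist_cc[OF u(2,3)]]])
      (auto simp: p_tri)
qed

lemma metric_E: "Metric_space (pts E) (ndist E)"
  by unfold_locales (auto simp: ndist_commute ndist_eq_0 ndist_triangle)

lemma ndist_zero_iff_nrm: "u \<in> CS \<Longrightarrow> ndist E (cc u) (embed p 0) = nrm E (cc u)"
  using LIMSEQ_unique[OF ndist_cc[of u "\<lambda>n. 0"] nrm_cc] by (simp add: embed_def)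

lemma ndist_cc_le:
  assumes "u \<in> CS" "w \<in> CS" "eventually (\<lambda>n. p (u n - w n) \<le> c) sequentially"
  shows "ndist E (cc u) (cc w) \<le> c"
  using assms(3) by (intro tendsto_upperbound[OF ndist_cc[OF assms(1,2)]]) auto

lemma embed_tendsto:
  assumes "u \<in> CS" shows "(\<lambda>n. ndist E (embed p (u n)) (cc u)) \<longlonglongrightarrow> 0"
proof (rule LIMSEQ_I)
  fix e :: real assume e: "e > 0"
  then obtain N where N: "\<forall>m\<ge>N. \<forall>n\<ge>N. p (u m - u n) < e/2" using CS_D[OF assms, of "e/2"] by auto
  have "ndist E (embed p (u n)) (cc u) \<le> e/2" if "n \<ge> N" for n
    unfolding embed_def
    by (rule ndist_cc_le) (use assms N that in \<open>auto simp: eventually_sequentially intro!: exI[of _ N] less_imp_le\<close>)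
  then show "\<exists>N. \<forall>n\<ge>N. norm (ndist E (embed p (u n)) (cc u) - 0) < e"
    using e by (intro exI[of _ N]) force
qed

lemma ndist_add_cancel:
  assumes "A \<in> pts E" "B \<in> pts E" "C \<in> pts E"
  shows "ndist E (add E A C) (add E B C) = ndist E A B"
proof -
  obtain u w x where u: "u \<in> CS" "w \<in> CS" "x \<in> CS" "A = cc u" "B = cc w" "C = cc x"
    using assms by (auto elim!: pts_cases)
  have "(\<lambda>n. p (u n - w n)) \<longlonglongrightarrow> ndist E (add E A C) (add E B C)"
    using ndist_cc[OF CS_add[OF u(1,3)] CS_add[OF u(2,3)]] u by (simp add: add_cc)
  then show ?thesis unfolding u using LIMSEQ_unique ndist_cc[OF u(1,2)] by blast
qed

lemma ndist_smul:
  assumes "A \<in> pts E" "B \<in> pts E"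
  shows "ndist E (smul E c A) (smul E c B) = cmod c * ndist E A B"
proof -
  obtain u w where u: "u \<in> CS" "w \<in> CS" "A = cc u" "B = cc w"
    using assms by (auto elim!: pts_cases)
  have "(\<lambda>n. cmod c * p (u n - w n)) \<longlonglongrightarrow> ndist E (smul E c A) (smul E c B)"
    using ndist_cc[OF CS_scl[OF u(1), of c] CS_scl[OF u(2), of c]] u
    by (simp add: smul_cc flip: vs.scale_right_diff_distrib)
  then show ?thesis unfolding u using LIMSEQ_unique tendsto_mult_left[OF ndist_cc[OF u(1,2)]] by blast
qed

section \<open>Extension of bounded functionals to the completion\<close>

definition ext :: "('v \<Rightarrow> complex) \<Rightarrow> (nat \<Rightarrow> 'v) set \<Rightarrow> complex" where
  "ext \<xi> A = lim (\<lambda>j. \<xi> (rep_seq A j))"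

definition bfun :: "('v \<Rightarrow> complex) \<Rightarrow> bool" where
  "bfun \<xi> \<longleftrightarrow> functional V \<xi> \<and> (\<exists>C. \<forall>v. cmod (\<xi> v) \<le> C * p v)"

lemma bfun_bound: assumes "bfun \<xi>" obtains C where "C > 0" "\<And>v. cmod (\<xi> v) \<le> C * p v"
proof -
  obtain C where C: "\<And>v. cmod (\<xi> v) \<le> C * p v" using assms by (auto simp: bfun_def)
  have "C * p v \<le> max C 1 * p v" for v by (intro mult_right_mono) auto
  then show thesis using that[of "max C 1"] C order_trans by (metis less_max_iff_disj zero_less_one)
qed

lemma ext_cc:
  assumes "bfun \<xi>" "u \<in> CS" shows "(\<lambda>j. \<xi> (u j)) \<longlonglongrightarrow> ext \<xi> (cc u)"
proof -
  obtain C where C: "C > 0" "\<And>v. cmod (\<xi> v) \<le> C * p v" using bfun_bound assms(1) by blast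
  have f: "functional V \<xi>" using assms by (simp add: bfun_def)
  let ?r = "rep_seq (cc u)"
  have "Cauchy (\<lambda>j. \<xi> (?r j))"
  proof (rule metric_CauchyI)
    fix e :: real assume "e > 0"
    then obtain N where N: "\<forall>m\<ge>N. \<forall>n\<ge>N. p (?r m - ?r n) < e / C"
      using CS_D[OF rep_cc(1)[OF assms(2)], of "e / C"] C by auto
    have "dist (\<xi> (?r m)) (\<xi> (?r n)) < e" if "m \<ge> N" "n \<ge> N" for m n
    proof -
      have "dist (\<xi> (?r m)) (\<xi> (?r n)) \<le> C * p (?r m - ?r n)"
        using C(2)[of "?r m - ?r n"] by (simp add: dist_norm functionalD[OF f])
      also have "\<dots> < e" using N that C by (simp add: less_divide_eq mult.commute)
      finally show ?thesis .
    qed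
    then show "\<exists>M. \<forall>m\<ge>M. \<forall>n\<ge>M. dist (\<xi> (?r m)) (\<xi> (?r n)) < e" by blast
  qed
  then have 1: "(\<lambda>j. \<xi> (?r j)) \<longlonglongrightarrow> ext \<xi> (cc u)"
    by (simp add: ext_def Cauchy_convergent_iff convergent_LIMSEQ_iff)
  have "(\<lambda>j. \<xi> (u j) - \<xi> (?r j)) \<longlonglongrightarrow> 0"
    by (rule Lim_null_comparison[OF _ tendsto_mult_right_zero[OF rep_cc(2)[OF assms(2)], of C]])
      (use C(2) in \<open>auto simp flip: functionalD(4)[OF f]\<close>)
  from tendsto_add[OF this 1] show ?thesis by simp
qed

lemma ext_embed [simp]: "bfun \<xi> \<Longrightarrow> ext \<xi> (embed p v) = \<xi> v"
  using LIMSEQ_unique[OF ext_cc[of \<xi> "\<lambda>n. v"] tendsto_const] by (simp add: embed_def)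

lemma ext_add:
  assumes "bfun \<xi>" "A \<in> pts E" "B \<in> pts E" shows "ext \<xi> (add E A B) = ext \<xi> A + ext \<xi> B"
proof -
  obtain u w where u: "u \<in> CS" "w \<in> CS" "A = cc u" "B = cc w" using assms by (auto elim!: pts_cases)
  have f: "functional V \<xi>" using assms by (simp add: bfun_def)
  show ?thesis unfolding u(3,4) add_cc[OF u(1,2)]
    using LIMSEQ_unique[OF ext_cc[OF assms(1) CS_add[OF u(1,2)], unfolded functionalD[OF f]]
      tendsto_add[OF ext_cc[OF assms(1) u(1)] ext_cc[OF assms(1) u(2)]]] .
qed

lemma ext_smul:
  assumes "bfun \<xi>" "A \<in> pts E" shows "ext \<xi> (smul E c A) = c * ext \<xi> A"
proof -
  obtain u where u: "u \<in> CS" "A = cc u" using assms by (auto elim!: pts_cases)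
  have f: "functional V \<xi>" using assms by (simp add: bfun_def)
  show ?thesis unfolding u(2) smul_cc[OF u(1)]
    using LIMSEQ_unique[OF ext_cc[OF assms(1) CS_scl[OF u(1)], unfolded functionalD[OF f]]
      tendsto_mult_left[OF ext_cc[OF assms(1) u(1)]]] .
qed

lemma ext_bound:
  assumes "bfun \<xi>" "\<And>v. cmod (\<xi> v) \<le> C * p v" "A \<in> pts E" "B \<in> pts E"
  shows "cmod (ext \<xi> A - ext \<xi> B) \<le> C * ndist E A B"
proof -
  obtain u w where u: "u \<in> CS" "w \<in> CS" "A = cc u" "B = cc w" using assms by (auto elim!: pts_cases)
  have f: "functional V \<xi>" using assms by (simp add: bfun_def)
  show ?thesis unfolding u(3,4)
    by (rule LIMSEQ_le[OF tendsto_norm[OF tendsto_diff[OF ext_cc[OF assms(1) u(1)] ext_cc[OF assms(1) u(2)]]]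
         tendsto_mult_left[OF ndist_cc[OF u(1,2)]]])
      (use assms(2) in \<open>auto simp flip: functionalD(4)[OF f]\<close>)
qed

lemma ext_tendsto:
  assumes "bfun \<xi>" "((\<lambda>x. ndist E (F x) A) \<longlongrightarrow> 0) net" "A \<in> pts E" "\<And>x. F x \<in> pts E"
  shows "((\<lambda>x. ext \<xi> (F x)) \<longlongrightarrow> ext \<xi> A) net"
proof -
  obtain C where C: "C > 0" "\<And>v. cmod (\<xi> v) \<le> C * p v" using bfun_bound assms(1) by blast
  have "((\<lambda>x. ext \<xi> (F x) - ext \<xi> A) \<longlongrightarrow> 0) net"
    by (rule Lim_null_comparison[OF _ tendsto_mult_right_zero[OF assms(2), of C]])
      (use ext_bound[OF assms(1) C(2)] assms(3,4) in auto)
  then show ?thesis by (simp add: LIM_zero_iff)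
qed

text \<open>Joint continuity is unfolded into an estimate with one \<delta> for the group element
  and the vector; all continuity arguments about actions use this form.\<close>

lemma mtop_cont:
  defines "T \<equiv> Metric_space.mtopology (pts E) (ndist E)"
  assumes cl: "\<And>g A. g \<in> SL2 \<Longrightarrow> A \<in> pts E \<Longrightarrow> \<rho> g A \<in> pts E"
  shows "continuous_map (prod_topology (top_of_set SL2) T) T (\<lambda>(g, a). \<rho> g a) \<longleftrightarrow>
    (\<forall>g\<in>SL2. \<forall>A\<in>pts E. \<forall>\<epsilon>>0. \<exists>\<delta>>0. \<forall>h\<in>SL2. \<forall>B\<in>pts E. dist g h < \<delta> \<longrightarrow> ndist E A B < \<delta> \<longrightarrow> ndist E (\<rho> g A) (\<rho> h B) < \<epsilon>)"
  (is "?L \<longleftrightarrow> ?R")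
proof -
  interpret Metric_space "pts E" "ndist E" by (rule metric_E)
  have T: "T = mtopology" by (simp add: T_def)
  show ?thesis
  proof
    assume L: ?L
    show ?R
    proof (intro ballI allI impI)
      fix g A and \<epsilon> :: real assume g: "g \<in> SL2" "A \<in> pts E" "\<epsilon> > 0"
      have "(g, A) \<in> topspace (prod_topology (top_of_set SL2) mtopology)" using g by simp
      then have "\<exists>U. openin (prod_topology (top_of_set SL2) mtopology) U \<and> (g, A) \<in> U \<and>
          (\<forall>y\<in>U. (case y of (g, a) \<Rightarrow> \<rho> g a) \<in> mball (case (g, A) of (g, a) \<Rightarrow> \<rho> g a) \<epsilon>)"
        using L g(3) unfolding T continuous_map_to_metric by blast
      then obtain U where U: "openin (prod_topology (top_of_set SL2) T) U" "(g, A) \<in> U"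
        "\<And>y. y \<in> U \<Longrightarrow> (case y of (g, a) \<Rightarrow> \<rho> g a) \<in> mball (\<rho> g A) \<epsilon>"
        unfolding T prod.case by blast
      from U(1,2) obtain U1 U2 where U12: "openin (top_of_set SL2) U1" "openin T U2" "g \<in> U1" "A \<in> U2" "U1 \<times> U2 \<subseteq> U"
        unfolding openin_prod_topology_alt by meson
      obtain d1 where d1: "d1 > 0" "\<And>h. h \<in> SL2 \<Longrightarrow> dist h g < d1 \<Longrightarrow> h \<in> U1"
        using U12(1,3) unfolding openin_euclidean_subtopology_iff by blast
      obtain d2 where d2: "d2 > 0" "mball A d2 \<subseteq> U2"
        using U12(2,4) unfolding T openin_mtopology by blast
      have "ndist E (\<rho> g A) (\<rho> h B) < \<epsilon>" if "h \<in> SL2" "B \<in> pts E" "dist g h < min d1 d2" "ndist E A B < min d1 d2" for h B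
      proof -
        have "h \<in> U1" "B \<in> U2" using that d1 d2 g by (auto simp: dist_commute)
        then have "(h, B) \<in> U" using U12(5) by blast
        from U(3)[OF this] show ?thesis by simp
      qed
      then show "\<exists>\<delta>>0. \<forall>h\<in>SL2. \<forall>B\<in>pts E. dist g h < \<delta> \<longrightarrow> ndist E A B < \<delta> \<longrightarrow> ndist E (\<rho> g A) (\<rho> h B) < \<epsilon>"
        using d1 d2 by (intro exI[of _ "min d1 d2"]) auto
    qed
  next
    assume R: ?R
    show ?L unfolding T continuous_map_to_metric
    proof (intro ballI allI impI)
      fix x and \<epsilon> :: real assume x: "x \<in> topspace (prod_topology (top_of_set SL2) mtopology)" and e: "\<epsilon> > 0"
      obtain g A where gA: "x = (g, A)" "g \<in> SL2" "A \<in> pts E" using x by auto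
      obtain \<delta> where d: "\<delta> > 0" "\<And>h B. h \<in> SL2 \<Longrightarrow> B \<in> pts E \<Longrightarrow> dist g h < \<delta> \<Longrightarrow> ndist E A B < \<delta> \<Longrightarrow> ndist E (\<rho> g A) (\<rho> h B) < \<epsilon>"
        using R gA e by blast
      let ?U = "(SL2 \<inter> ball g \<delta>) \<times> mball A \<delta>"
      have o: "openin (prod_topology (top_of_set SL2) mtopology) ?U"
        by (simp add: openin_prod_Times_iff openin_open_Int)
      show "\<exists>U. openin (prod_topology (top_of_set SL2) mtopology) U \<and> x \<in> U \<and>
             (\<forall>y\<in>U. (case y of (g, a) \<Rightarrow> \<rho> g a) \<in> mball (case x of (g, a) \<Rightarrow> \<rho> g a) \<epsilon>)"
        by (intro exI[of _ ?U] conjI o) (use gA d cl in \<open>auto\<close>)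
    qed
  qed
qed

end

section \<open>Structure of irreducible modules\<close>

subsection \<open>Linear algebra over the complex numbers\<close>

lemma vector_space_complex: "vector_space ((*) :: complex \<Rightarrow> complex \<Rightarrow> complex)"
  by unfold_locales (auto simp: algebra_simps)

text \<open>A basis of \<open>W\<close> stays independent after adding \<open>v\<close>, so the
  values on it can be prescribed. Functionals are the means by which \<open>gk_module\<close> speaks
  about limits, so vector identities below are obtained by testing against all of them.\<close>

lemma functional_separates:
  assumes "vector_space (scl V)" "module.subspace (scl V) W" "v \<notin> W"
  obtains \<phi> where "functional V \<phi>" "\<phi> v = 1" "\<And>w. w \<in> W \<Longrightarrow> \<phi> w = 0"
proof -
  interpret vector_space_pair "scl V" "(*) :: complex \<Rightarrow> complex \<Rightarrow> complex"
    by (intro vector_space_pair.intro assms vector_space_complex)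
  obtain B where B: "B \<subseteq> W" "vs1.independent B" "W \<subseteq> vs1.span B"
    using vs1.maximal_independent_subset by blast
  have sp: "vs1.span B = W"
    using B assms(2) by (metis vs1.span_subspace)
  have "vs1.independent (insert v B)"
    using B sp assms(3) by (simp add: vs1.independent_insert)
  then obtain \<phi> where \<phi>: "Vector_Spaces.linear (scl V) (*) \<phi>" "\<forall>x\<in>insert v B. \<phi> x = (if x = v then 1 else 0)"
    using linear_independent_extend[of "insert v B" "\<lambda>x. if x = v then 1 else 0"] by blast
  have "\<phi> w = 0" if "w \<in> B" for w using \<phi>(2) that B assms(3) by auto
  then have "\<phi> w = 0" if "w \<in> W" for w
    using linear_eq_0_on_span[OF \<phi>(1)] that sp by blast
  then show thesis using that \<phi> by auto
qed

lemma functional_eqI: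
  assumes "vector_space (scl V)" "\<And>\<phi>. functional V \<phi> \<Longrightarrow> \<phi> v = \<phi> w"
  shows "v = w"
proof (rule ccontr)
  interpret vector_space "scl V" by fact
  assume "v \<noteq> w"
  then have "v - w \<notin> {0}" by simp
  then obtain \<phi> where "functional V \<phi>" "\<phi> (v - w) = 1"
    using functional_separates[OF assms(1) subspace_single_0] by metis
  then show False using assms(2)[of \<phi>] functionalD(4)[of V \<phi> v w] by simp
qed

text \<open>Take a nonzero polynomial \<open>p\<close> of least degree with
  \<open>p(T) v = 0\<close>, a root \<open>c\<close> of it, and \<open>p = (x - c) q\<close>. By
  minimality \<open>q(T) v\<close> is nonzero, and it is an eigenvector for \<open>c\<close>. It
  lies in the cyclic span of \<open>v\<close>, so it inherits membership in every invariant subspace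
  containing \<open>v\<close>.\<close>

lemma eigenvector_exists:
  assumes V: "vector_space (scl V)" and T: "endo V T" and v: "v \<noteq> 0" and B: "finite B"
    and sp: "\<And>i. (T ^^ i) v \<in> module.span (scl V) B"
  obtains u c where "u \<noteq> 0" "T u = scl V c u" "u \<in> module.span (scl V) (range (\<lambda>i. (T ^^ i) v))"
proof -
  interpret vector_space "scl V" by fact
  \<comment> \<open>\<open>ev p\<close> is the vector \<open>p(T) v\<close>.\<close>
  define ev where "ev p = (\<Sum>i\<le>degree p. scl V (coeff p i) ((T ^^ i) v))" for p
  have ev_alt: "ev p = (\<Sum>i\<le>n. scl V (coeff p i) ((T ^^ i) v))" if "degree p \<le> n" for p n
    unfolding ev_def by (rule sum.mono_neutral_left) (use that in \<open>auto simp: coeff_eq_0\<close>)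
  have ev_add: "ev (p + q) = ev p + ev q" for p q
    using ev_alt[of p "max (degree p) (degree q)"] ev_alt[of q "max (degree p) (degree q)"]
      ev_alt[of "p + q" "max (degree p) (degree q)"]
    by (simp add: degree_add_le_max scale_left_distrib sum.distrib)
  have ev_smult: "ev (Polynomial.smult c p) = scl V c (ev p)" for c p
    using ev_alt[of "Polynomial.smult c p" "degree p"] ev_def[of p]
    by (simp add: degree_smult_le scale_sum_right)
  have ev_X: "ev (pCons 0 p) = T (ev p)" for p
  proof -
    have "ev (pCons 0 p) = (\<Sum>i\<le>Suc (degree p). scl V (coeff (pCons 0 p) i) ((T ^^ i) v))"
      by (rule ev_alt) (simp add: degree_pCons_le)
    also have "\<dots> = (\<Sum>i\<le>degree p. scl V (coeff p i) (T ((T ^^ i) v)))"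
      by (subst sum.atMost_Suc_shift) simp
    also have "\<dots> = T (ev p)" by (simp add: ev_def endoD[OF T])
    finally show ?thesis .
  qed
  \<comment> \<open>Among the first \<open>card B + 1\<close> iterates either two coincide, or they
    are distinct and too many to be independent in the span of \<open>B\<close>.\<close>
  have "\<exists>p. p \<noteq> 0 \<and> ev p = 0"
  proof (cases "inj_on (\<lambda>i. (T ^^ i) v) {..card B}")
    case True
    define S where "S = (\<lambda>i. (T ^^ i) v) ` {..card B}"
    have "card S = Suc (card B)" unfolding S_def using True by (simp add: card_image)
    then have "dependent S"
      using independent_span_bound[OF B, of S] sp by (fastforce simp: S_def)
    then obtain a where a: "\<exists>x\<in>S. a x \<noteq> 0" "(\<Sum>x\<in>S. scl V (a x) x) = 0"
      using dependent_finite[of S] by (auto simp: S_def)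
    define p where "p = (\<Sum>i\<le>card B. monom (a ((T ^^ i) v)) i)"
    have cf: "coeff p i = (if i \<le> card B then a ((T ^^ i) v) else 0)" for i
      by (simp add: p_def coeff_sum)
    have "degree p \<le> card B" by (rule degree_le) (simp add: cf)
    then have "ev p = (\<Sum>i\<le>card B. scl V (a ((T ^^ i) v)) ((T ^^ i) v))"
      using ev_alt cf by simp
    also have "\<dots> = (\<Sum>x\<in>S. scl V (a x) x)" unfolding S_def by (simp add: sum.reindex[OF True])
    finally have "ev p = 0" using a by simp
    moreover have "p \<noteq> 0"
    proof -
      obtain i where "i \<le> card B" "a ((T ^^ i) v) \<noteq> 0" using a(1) by (auto simp: S_def)
      then have "coeff p i \<noteq> 0" by (simp add: cf)
      then show ?thesis by auto
    qed
    ultimately show ?thesis by blast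
  next
    case False
    then obtain i j where ij: "i \<noteq> j" "(T ^^ i) v = (T ^^ j) v" by (auto simp: inj_on_def)
    have mono: "ev (monom 1 k) = (T ^^ k) v" for k
    proof (induction k)
      case 0 then show ?case by (simp add: ev_def)
    next
      case (Suc k) then show ?case using ev_X[of "monom 1 k"] by (simp add: monom_Suc)
    qed
    have "monom 1 i - monom 1 j \<noteq> (0 :: complex poly)" using ij by (simp add: monom_eq_iff')
    moreover have "ev (monom 1 i - monom 1 j) = 0"
    proof -
      have "monom 1 i - monom 1 j = monom 1 i + Polynomial.smult (-1) (monom 1 j :: complex poly)" by simp
      then have "ev (monom 1 i - monom 1 j) = (T ^^ i) v + scl V (-1) ((T ^^ j) v)"
        by (simp only: ev_add ev_smult mono)
      then show ?thesis using ij by simp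
    qed
    ultimately show ?thesis by blast
  qed
  then obtain p where p: "p \<noteq> 0" "ev p = 0" "\<And>q. q \<noteq> 0 \<Longrightarrow> ev q = 0 \<Longrightarrow> degree p \<le> degree q"
    using exists_least_iff[of "\<lambda>n. \<exists>p. p \<noteq> 0 \<and> ev p = 0 \<and> degree p = n"] by (metis not_le)
  have "degree p \<noteq> 0"
  proof
    assume "degree p = 0"
    then obtain c where "p = [:c:]" using degree_eq_zeroE by blast
    then show False using p v by (auto simp: ev_def)
  qed
  then obtain c where "poly p c = 0"
    using fundamental_theorem_of_algebra[of p] constant_degree[of p] by auto
  then obtain q where q: "p = [:- c, 1:] * q" by (auto simp: poly_eq_0_iff_dvd dvd_def)
  have q0: "q \<noteq> 0" using p q by auto
  have "degree p = Suc (degree q)" unfolding q by (subst degree_mult_eq) (use q0 in auto)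
  then have "ev q \<noteq> 0" using p(3)[OF q0] by auto
  moreover have "ev p = T (ev q) - scl V c (ev q)"
  proof -
    have "p = Polynomial.smult (- c) q + pCons 0 q" by (simp add: q)
    then have "ev p = scl V (- c) (ev q) + T (ev q)" by (metis ev_add ev_smult ev_X)
    then show ?thesis by simp
  qed
  then have "T (ev q) = scl V c (ev q)" using p by simp
  moreover have "ev q \<in> span (range (\<lambda>i. (T ^^ i) v))"
    unfolding ev_def by (intro span_sum span_scale span_base) auto
  ultimately show thesis using that by blast
qed

subsection \<open>The action on K-types\<close>

text \<open>\<open>Ep\<close> and \<open>Em\<close> are eigenvectors of \<open>ad Y0\<close> in the
  complexification of \<open>sl2\<close>, with eigenvalues \<open>2 \<i>\<close> and
  \<open>- 2 \<i>\<close>; the factor \<open>1 / 2\<close> makes \<open>Hm\<close> their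
  sum.\<close>

definition Ep :: "('v::ab_group_add) gk \<Rightarrow> 'v \<Rightarrow> 'v" where
  "Ep V v = scl V (1/2) (lie V Hm v - scl V \<i> (lie V Zm v))"
definition Em :: "('v::ab_group_add) gk \<Rightarrow> 'v \<Rightarrow> 'v" where
  "Em V v = scl V (1/2) (lie V Hm v + scl V \<i> (lie V Zm v))"

locale gkmod =
  fixes V :: "('v::ab_group_add) gk"
  assumes gk: "gk_module V"
begin

lemma V: "vector_space (scl V)" using gk by (simp add: gk_module_def)

sublocale vs: vector_space "scl V" by (rule V)

lemma lie_endo: "X \<in> sl2 \<Longrightarrow> endo V (lie V X)"
  using gk by (simp add: gk_module_def lie_rep_def)

lemma lie_comb: "X \<in> sl2 \<Longrightarrow> Z \<in> sl2 \<Longrightarrow>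
    lie V (a *\<^sub>R X + b *\<^sub>R Z) v = scl V (of_real a) (lie V X v) + scl V (of_real b) (lie V Z v)"
  using gk by (simp add: gk_module_def lie_rep_def)

lemma lie_bracket: "X \<in> sl2 \<Longrightarrow> Z \<in> sl2 \<Longrightarrow> lie V (bracket X Z) v = lie V X (lie V Z v) - lie V Z (lie V X v)"
  using gk by (simp add: gk_module_def lie_rep_def)

lemma lie_scale: "X \<in> sl2 \<Longrightarrow> lie V (a *\<^sub>R X) v = scl V (of_real a) (lie V X v)"
  using lie_comb[of X X a 0] by simp

lemma lie_expand:
  assumes "X \<in> sl2"
  shows "lie V X v = scl V (of_real ((X$2$1 - X$1$2) / 2)) (lie V Y0 v) +
     (scl V (of_real (X$1$1)) (lie V Hm v) + scl V (of_real ((X$2$1 + X$1$2) / 2)) (lie V Zm v))"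
proof -
  have s: "X$1$1 *\<^sub>R Hm + ((X$2$1 + X$1$2) / 2) *\<^sub>R Zm \<in> sl2"
    by (simp add: sl2_def trace2 Hm_def Zm_def)
  show ?thesis
    by (subst sl2_expand[OF assms], subst lie_comb[OF basis_sl2(1) s], subst lie_comb) simp_all
qed

lemma k_endo: "k \<in> SO2 \<Longrightarrow> endo V (kact V k)"
  using gk by (simp add: gk_module_def K_rep_def)

lemma k_one: "kact V (mat 1) v = v"
  using gk by (simp add: gk_module_def K_rep_def)

lemma k_mult: "k \<in> SO2 \<Longrightarrow> l \<in> SO2 \<Longrightarrow> kact V (k ** l) v = kact V k (kact V l v)"
  using gk by (simp add: gk_module_def K_rep_def)

lemma k_rot_add: "kact V (rot (s + t)) v = kact V (rot s) (kact V (rot t) v)"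
  by (simp add: rot_add k_mult)

lemma k_lie: "X \<in> sl2 \<Longrightarrow> kact V (rot t) (lie V X v) = lie V (rot t ** X ** rot (-t)) (kact V (rot t) v)"
  using gk by (simp add: gk_module_def matrix_inv_SL2 adj2_rot)

text \<open>The definition gives the weak derivative at the identity only; composing \<phi> with a
  rotation is again a functional, which moves it to every \<open>s\<close>.\<close>

lemma k_deriv:
  assumes "functional V \<phi>"
  shows "((\<lambda>t. \<phi> (kact V (rot t) v)) has_vector_derivative \<phi> (kact V (rot s) (lie V Y0 v))) (at s)"
proof -
  have 0: "((\<lambda>t. \<phi> (kact V (mexp (t *\<^sub>R Y0)) w)) has_vector_derivative \<phi> (lie V Y0 w)) (at 0)"
    if "functional V \<phi>" for \<phi> w
    using gk that Y0_so2 unfolding gk_module_def by blast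
  have f: "functional V (\<lambda>v. \<phi> (kact V (rot s) v))"
    by (rule functionalI[OF V]) (simp_all add: endoD[OF k_endo] functionalD[OF assms])
  have "((\<lambda>t. \<phi> (kact V (rot (s + t)) v)) has_vector_derivative \<phi> (kact V (rot s) (lie V Y0 v))) (at 0)"
    using 0[OF f] by (simp add: mexp_Y0 k_rot_add)
  then have g: "((\<lambda>t. \<phi> (kact V (rot (s + t)) v)) has_vector_derivative \<phi> (kact V (rot s) (lie V Y0 v))) (at (s - s))"
    by simp
  have "((\<lambda>t. t - s) has_vector_derivative 1) (at s)"
    by (auto intro!: derivative_eq_intros)
  from vector_diff_chain_at[OF this g] show ?thesis by (simp add: o_def)
qed

lemma K_type_iff: "v \<in> K_type V n \<longleftrightarrow> (\<forall>t. kact V (rot t) v = scl V (cis (of_int n * t)) v)"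
proof -
  have "Complex (rot t $ 1 $ 1) (rot t $ 2 $ 1) = cis t" for t by (simp add: rot_def complex_eq_iff)
  then have c: "Complex (rot t $ 1 $ 1) (rot t $ 2 $ 1) powi n = cis (of_int n * t)" for t
    by (simp add: cis_power_int)
  have a: "(\<forall>k\<in>SO2. P k) \<longleftrightarrow> (\<forall>t. P (rot t))" for P using SO2_cases rot_SO2 by metis
  show ?thesis
    unfolding K_type_def mem_Collect_eq a c ..
qed

end

context gkmod
begin

lemma endo_minus: "endo V T \<Longrightarrow> T (- v) = - T v"
  using endoD(4)[of V T 0 v] endoD(3)[of V T] by simp

lemma lie_Y0_K_type:
  assumes "v \<in> K_type V n" shows "lie V Y0 v = scl V (\<i> * of_int n) v"
proof (rule functional_eqI[OF V])
  fix \<phi> assume \<phi>: "functional V \<phi>"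
  have 1: "((\<lambda>t. \<phi> (kact V (rot t) v)) has_vector_derivative \<phi> (lie V Y0 v)) (at 0)"
    using k_deriv[OF \<phi>, of v 0] by (simp add: k_one)
  have "((\<lambda>t. exp (\<i> * of_int n * of_real t) * \<phi> v) has_vector_derivative (\<i> * of_int n * \<phi> v)) (at 0)"
    by (auto intro!: derivative_eq_intros has_vector_derivative_real_field)
  then have "((\<lambda>t. \<phi> (kact V (rot t) v)) has_vector_derivative (\<i> * of_int n * \<phi> v)) (at 0)"
    using assms by (simp add: K_type_iff functionalD[OF \<phi>] cis_conv_exp algebra_simps)
  from vector_derivative_unique_at[OF 1 this]
  show "\<phi> (lie V Y0 v) = \<phi> (scl V (\<i> * of_int n) v)" by (simp add: functionalD[OF \<phi>])
qed

text \<open>The function \<open>F t = \<phi> (kact V (rot t) u)\<close> satisfies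
  \<open>F' = c F\<close>, so its product with \<open>exp (- c t)\<close> is constant.\<close>

lemma k_exp:
  assumes "lie V Y0 u = scl V c u" shows "kact V (rot t) u = scl V (exp (c * of_real t)) u"
proof (rule functional_eqI[OF V])
  fix \<phi> assume \<phi>: "functional V \<phi>"
  let ?F = "\<lambda>t. \<phi> (kact V (rot t) u)"
  have F: "(?F has_vector_derivative c * ?F s) (at s)" for s
    using k_deriv[OF \<phi>, of u s] by (simp add: assms endoD[OF k_endo] functionalD[OF \<phi>])
  have e: "((\<lambda>t. exp (- c * of_real t)) has_vector_derivative (- c * exp (- c * of_real s))) (at s)" for s
    by (auto intro!: derivative_eq_intros has_vector_derivative_real_field)
  have "((\<lambda>t. exp (- c * of_real t) * ?F t) has_vector_derivative 0) (at s within UNIV)" for s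
    using has_vector_derivative_mult[OF e F, of s] by (simp add: algebra_simps)
  then obtain d where d: "\<And>t. exp (- c * of_real t) * ?F t = d"
    using has_vector_derivative_zero_constant[of UNIV "\<lambda>t. exp (- c * of_real t) * ?F t"] by auto
  have "?F t = exp (c * of_real t) * (exp (- c * of_real t) * ?F t)"
    by (simp add: exp_minus)
  also have "\<dots> = exp (c * of_real t) * \<phi> u" using d[of t] d[of 0] by (simp add: k_one)
  finally show "?F t = \<phi> (scl V (exp (c * of_real t)) u)" by (simp add: functionalD[OF \<phi>])
qed

lemma K_type_subspace: "vs.subspace (K_type V n)"
  by (rule vs.subspaceI)
    (auto simp: K_type_iff endoD[OF k_endo] vs.scale_right_distrib vs.scale_left_commute)

text \<open>Local finiteness makes the span \<open>W\<close> of the rotation orbit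
  finite-dimensional. It is stable under \<open>Y0\<close>, so it contains an eigenvector of
  \<open>Y0\<close>, and the period \<open>2 pi\<close> of the rotations forces the eigenvalue to be
  \<open>\<i>\<close> times an integer.\<close>

lemma K_type_exists:
  assumes "(v::'v) \<noteq> 0" obtains u n where "u \<noteq> 0" "u \<in> K_type V n"
proof -
  obtain B where B: "finite B" "\<And>k. k \<in> SO2 \<Longrightarrow> kact V k v \<in> vs.span B"
  proof -
    have "\<exists>B. finite B \<and> (\<forall>k\<in>SO2. kact V k v \<in> vs.span B)" using gk by (simp add: gk_module_def)
    then show thesis using that by blast
  qed
  define W where "W = vs.span (range (\<lambda>t. kact V (rot t) v))"
  have kW: "kact V (rot t) u \<in> W" if "u \<in> W" for t u
    using that unfolding W_def
  proof (induction rule: vs.span_induct_alt)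
    case base then show ?case by (simp add: endoD[OF k_endo] vs.span_zero)
  next
    case (step c x y)
    then obtain s where "x = kact V (rot s) v" by auto
    then have "kact V (rot t) x = kact V (rot (t + s)) v" by (simp add: k_rot_add)
    then have "kact V (rot t) (scl V c x + y) = scl V c (kact V (rot (t + s)) v) + kact V (rot t) y"
      by (simp add: endoD[OF k_endo])
    moreover have "kact V (rot (t + s)) v \<in> vs.span (range (\<lambda>t. kact V (rot t) v))"
      by (rule vs.span_base) simp
    ultimately show ?case using step by (simp add: vs.span_add vs.span_scale)
  qed
  \<comment> \<open>A functional that vanishes on \<open>W\<close> vanishes along the whole orbit of
    \<open>u\<close>, hence also on its derivative.\<close>
  have YW: "lie V Y0 u \<in> W" if "u \<in> W" for u
  proof (rule ccontr)
    assume "lie V Y0 u \<notin> W"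
    then obtain \<phi> where \<phi>: "functional V \<phi>" "\<phi> (lie V Y0 u) = 1" "\<And>w. w \<in> W \<Longrightarrow> \<phi> w = 0"
      using functional_separates[OF V, of W "lie V Y0 u"] vs.subspace_span[of "range (\<lambda>t. kact V (rot t) v)"]
      unfolding W_def by blast
    have "((\<lambda>t. 0) has_vector_derivative (1::complex)) (at 0)"
      using k_deriv[OF \<phi>(1), of u 0] \<phi>(2,3) kW[OF that] by (simp add: k_one)
    from vector_derivative_unique_at[OF has_vector_derivative_const this] show False by simp
  qed
  have vW: "v \<in> W" unfolding W_def by (rule vs.span_base) (rule range_eqI[of _ _ 0], simp add: k_one)
  have it: "(lie V Y0 ^^ i) v \<in> W" for i by (induction i) (auto simp: vW YW)
  have WB: "W \<subseteq> vs.span B"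
    unfolding W_def by (intro vs.span_minimal image_subsetI B(2) rot_SO2 vs.subspace_span)
  obtain u c where u: "u \<noteq> 0" "lie V Y0 u = scl V c u"
    by (rule eigenvector_exists[OF V lie_endo[OF basis_sl2(1)] assms B(1) subsetD[OF WB it]])
  obtain \<phi> where \<phi>: "functional V \<phi>" "\<phi> u = 1"
    by (rule functional_separates[OF V vs.subspace_single_0, of u]) (use u in simp_all)
  have "u = scl V (exp (c * of_real (2 * pi))) u"
    using k_exp[OF u(2), of "2 * pi"] unfolding rot_2pi k_one .
  then have "\<phi> u = exp (c * of_real (2 * pi)) * \<phi> u"
    unfolding functionalD(2)[OF \<phi>(1), symmetric] by (rule arg_cong)
  then have e1: "exp (c * of_real (2 * pi)) = 1" unfolding \<phi>(2) by simp
  obtain n :: int where n: "Re c = 0" "Im c = of_int n"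
  proof -
    obtain n :: int where "Re (c * of_real (2 * pi)) = 0" "Im (c * of_real (2 * pi)) = of_int (2 * n) * pi"
      using e1 unfolding exp_eq_1 by blast
    then show thesis by (intro that[of n]) simp_all
  qed
  then have "c = \<i> * of_int n" by (simp add: complex_eq_iff)
  then have "u \<in> K_type V n" using k_exp[OF u(2)] by (simp add: K_type_iff cis_conv_exp algebra_simps)
  then show thesis using that u by blast
qed

lemma Ep_endo: "endo V (Ep V)" and Em_endo: "endo V (Em V)"
  by (rule endoI[OF V]; simp add: Ep_def Em_def endoD[OF lie_endo] vs.scale_right_distrib
      vs.scale_right_diff_distrib vs.scale_left_commute algebra_simps)+

lemma Hm_eq: "lie V Hm v = Ep V v + Em V v"
  by (simp add: Ep_def Em_def vs.scale_right_distrib vs.scale_right_diff_distrib flip: vs.scale_left_distrib)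

lemma Zm_eq: "lie V Zm v = scl V \<i> (Ep V v - Em V v)"
  by (simp add: Ep_def Em_def vs.scale_right_distrib vs.scale_right_diff_distrib flip: vs.scale_left_distrib)

lemma k_Hm: "kact V (rot t) (lie V Hm v) = scl V (of_real (cos (2*t))) (lie V Hm (kact V (rot t) v)) + scl V (of_real (sin (2*t))) (lie V Zm (kact V (rot t) v))"
proof -
  have "rot t ** Hm ** rot (-t) = cos (2*t) *\<^sub>R Hm + sin (2*t) *\<^sub>R Zm"
    by (simp add: mat2_eq_iff rot_def Hm_def Zm_def cos_double sin_double power2_eq_square)
  then show ?thesis by (simp add: k_lie lie_comb)
qed

lemma k_Zm: "kact V (rot t) (lie V Zm v) = scl V (of_real (- sin (2*t))) (lie V Hm (kact V (rot t) v)) + scl V (of_real (cos (2*t))) (lie V Zm (kact V (rot t) v))"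
proof -
  have "rot t ** Zm ** rot (-t) = (- sin (2*t)) *\<^sub>R Hm + cos (2*t) *\<^sub>R Zm"
    by (simp add: mat2_eq_iff rot_def Hm_def Zm_def cos_double sin_double power2_eq_square)
  then show ?thesis unfolding k_lie[OF basis_sl2(3)] by (simp only: lie_comb[OF basis_sl2(2,3)])
qed

lemma Ep_K_type:
  assumes "v \<in> K_type V n" shows "Ep V v \<in> K_type V (n + 2)"
  unfolding K_type_iff
proof
  fix t
  define w where "w = kact V (rot t) v"
  have w: "w = scl V (cis (of_int n * t)) v" using assms by (simp add: w_def K_type_iff)
  have "kact V (rot t) (Ep V v) = scl V ((1/2) * (of_real (cos (2*t)) + \<i> * of_real (sin (2*t)))) (lie V Hm w)
      + scl V ((1/2) * (of_real (sin (2*t)) - \<i> * of_real (cos (2*t)))) (lie V Zm w)"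
    unfolding Ep_def w_def
    by (simp only: endoD[OF k_endo[OF rot_SO2]] k_Hm k_Zm vs.scale_right_distrib vs.scale_right_diff_distrib
      vs.scale_scale vs.scale_left_distrib vs.scale_left_diff_distrib distrib_left right_diff_distrib)
      (simp add: algebra_simps)
  also have "(1/2) * (of_real (cos (2*t)) + \<i> * of_real (sin (2*t))) = cis (2*t) * (1/2)"
    by (simp add: complex_eq_iff)
  also have "(1/2) * (of_real (sin (2*t)) - \<i> * of_real (cos (2*t))) = cis (2*t) * (- \<i> / 2)"
    by (simp add: complex_eq_iff)
  also have "scl V (cis (2*t) * (1/2)) (lie V Hm w) + scl V (cis (2*t) * (- \<i> / 2)) (lie V Zm w)
     = scl V (cis (2*t)) (Ep V w)"
    by (simp add: Ep_def vs.scale_right_distrib vs.scale_right_diff_distrib)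
  also have "Ep V w = scl V (cis (of_int n * t)) (Ep V v)" by (simp add: w endoD[OF Ep_endo])
  finally show "kact V (rot t) (Ep V v) = scl V (cis (of_int (n + 2) * t)) (Ep V v)"
    by (simp add: cis_mult algebra_simps)
qed

lemma Em_K_type:
  assumes "v \<in> K_type V n" shows "Em V v \<in> K_type V (n - 2)"
  unfolding K_type_iff
proof
  fix t
  define w where "w = kact V (rot t) v"
  have w: "w = scl V (cis (of_int n * t)) v" using assms by (simp add: w_def K_type_iff)
  have "kact V (rot t) (Em V v) = scl V ((1/2) * (of_real (cos (2*t)) - \<i> * of_real (sin (2*t)))) (lie V Hm w)
      + scl V ((1/2) * (of_real (sin (2*t)) + \<i> * of_real (cos (2*t)))) (lie V Zm w)"
    unfolding Em_def w_def
    by (simp only: endoD[OF k_endo[OF rot_SO2]] k_Hm k_Zm vs.scale_right_distrib vs.scale_right_diff_distrib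
      vs.scale_scale vs.scale_left_distrib vs.scale_left_diff_distrib distrib_left right_diff_distrib)
      (simp add: algebra_simps)
  also have "(1/2) * (of_real (cos (2*t)) - \<i> * of_real (sin (2*t))) = cis (- (2*t)) * (1/2)"
    by (simp add: complex_eq_iff)
  also have "(1/2) * (of_real (sin (2*t)) + \<i> * of_real (cos (2*t))) = cis (- (2*t)) * (\<i> / 2)"
    by (simp add: complex_eq_iff)
  also have "scl V (cis (- (2*t)) * (1/2)) (lie V Hm w) + scl V (cis (- (2*t)) * (\<i> / 2)) (lie V Zm w)
     = scl V (cis (- (2*t))) (Em V w)"
    by (simp add: Em_def vs.scale_right_distrib vs.scale_right_diff_distrib)
  also have "Em V w = scl V (cis (of_int n * t)) (Em V v)" by (simp add: w endoD[OF Em_endo])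
  finally show "kact V (rot t) (Em V v) = scl V (cis (of_int (n - 2) * t)) (Em V v)"
    by (simp add: cis_mult algebra_simps)
qed

lemma Ep_Em_commute: "Ep V (Em V v) - Em V (Ep V v) = scl V (- \<i>) (lie V Y0 v)"
proof -
  have "bracket Hm Zm = (- 2) *\<^sub>R Y0" by (simp add: bracket_def mat2_eq_iff Hm_def Zm_def Y0_def)
  then have "lie V Hm (lie V Zm v) - lie V Zm (lie V Hm v) = scl V (-2) (lie V Y0 v)"
    using lie_bracket[of Hm Zm v] lie_scale[of Y0 "-2" v] by simp
  then have HZ: "lie V Hm (lie V Zm v) = scl V (-2) (lie V Y0 v) + lie V Zm (lie V Hm v)"
    by (simp add: algebra_simps)
  show ?thesis
    unfolding Ep_def Em_def
    by (simp add: endoD[OF lie_endo] HZ vs.scale_right_distrib vs.scale_right_diff_distrib)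
      (simp add: algebra_simps flip: vs.scale_left_distrib)
qed

lemma Ep_Em_K_type:
  assumes "v \<in> K_type V n" shows "Ep V (Em V v) = Em V (Ep V v) + scl V (of_int n) v"
  using Ep_Em_commute[of v] lie_Y0_K_type[OF assms] by (simp add: algebra_simps)

end

section \<open>The ladder spanning an irreducible module\<close>

locale irr_hc = gkmod V for V :: "('v::ab_group_add) gk" +
  assumes hc: "harish_chandra_module V" and irr: "irreducible_gk V"
begin

text \<open>Finite multiplicity provides an eigenvector of \<open>Em Ep\<close> inside one K-type.
  The commutation relation then fixes every backward step along its raised and lowered images, so
  their span is a submodule and irreducibility makes it everything. Steps leading away from
  \<open>f 0\<close> have coefficient \<open>1\<close>; the parameter \<open>c\<close> records the
  Casimir eigenvalue. Vectors \<open>f k\<close> may vanish, which covers highest and lowest weight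
  modules.\<close>

lemma K_type_basis:
  obtains n0 :: int and c :: complex and f :: "int \<Rightarrow> 'v" where
    "\<And>k. f k \<in> K_type V (n0 + 2 * k)" "f 0 \<noteq> 0"
    "\<And>k. k \<ge> 0 \<Longrightarrow> Ep V (f k) = f (k + 1)"
    "\<And>k. k \<ge> 0 \<Longrightarrow> Em V (f (k + 1)) = scl V (- ((of_int (n0 + 2 * k) + 1)\<^sup>2 + c) / 4) (f k)"
    "\<And>k. k < 0 \<Longrightarrow> Em V (f (k + 1)) = f k"
    "\<And>k. k < 0 \<Longrightarrow> Ep V (f k) = scl V (- ((of_int (n0 + 2 * k) + 1)\<^sup>2 + c) / 4) (f (k + 1))"
    "vs.span (range f) = UNIV"
proof -
  obtain v :: 'v where "v \<noteq> 0" using irr by (auto simp: irreducible_gk_def)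
  then obtain u n0 where u: "u \<noteq> 0" "u \<in> K_type V n0" using K_type_exists by blast
  let ?T = "\<lambda>v. Em V (Ep V v)"
  have T: "endo V ?T" by (rule endoI[OF V]) (simp_all add: endoD[OF Ep_endo] endoD[OF Em_endo])
  have TK: "?T v \<in> K_type V n0" if "v \<in> K_type V n0" for v
    using Em_K_type[OF Ep_K_type[OF that]] by simp
  have it: "(?T ^^ i) u \<in> K_type V n0" for i by (induction i) (auto simp: u TK)
  obtain B where B: "finite B" "K_type V n0 \<subseteq> vs.span B"
    using hc unfolding harish_chandra_module_def by blast
  have "\<And>i. (?T ^^ i) u \<in> vs.span B" using it B by blast
  from eigenvector_exists[OF V T u(1) B(1) this] obtain e d where
    e: "e \<noteq> 0" "?T e = scl V d e" "e \<in> vs.span (range (\<lambda>i. (?T ^^ i) u))" by metis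
  have "vs.span (range (\<lambda>i. (?T ^^ i) u)) \<subseteq> K_type V n0"
    by (rule vs.span_minimal) (use it K_type_subspace in auto)
  with e have eK: "e \<in> K_type V n0" by blast
  \<comment> \<open>This choice gives \<open>d = - \<beta> n0\<close>; the increment of \<beta> from
    \<open>m\<close> to \<open>m + 2\<close> is the contribution \<open>m + 2\<close> of the
    commutator, so a single \<open>c\<close> serves for all types.\<close>
  define c where "c = - 4 * d - (of_int n0 + 1)\<^sup>2"
  define \<beta> where "\<beta> m = ((of_int m + 1)\<^sup>2 + c) / 4" for m :: int
  have \<beta>: "\<beta> (m + 2) = \<beta> m + of_int (m + 2)" for m
    by (simp add: \<beta>_def power2_eq_square field_simps)
  have \<beta>0: "\<beta> n0 = - d" by (simp add: \<beta>_def c_def)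
  define U where "U j = (Ep V ^^ j) e" for j
  define D where "D j = (Em V ^^ j) e" for j
  have UK: "U j \<in> K_type V (n0 + 2 * int j)" for j
    by (induction j) (use eK Ep_K_type in \<open>force simp: U_def algebra_simps\<close>)+
  have DK: "D j \<in> K_type V (n0 - 2 * int j)" for j
    by (induction j) (use eK Em_K_type in \<open>force simp: D_def algebra_simps\<close>)+
  have US: "Ep V (U j) = U (Suc j)" and DS: "Em V (D j) = D (Suc j)" for j by (simp_all add: U_def D_def)
  have EU: "Em V (U (Suc j)) = scl V (- \<beta> (n0 + 2 * int j)) (U j)" for j
  proof (induction j)
    case 0 then show ?case using e by (simp add: U_def \<beta>0)
  next
    case (Suc j)
    have "Em V (U (Suc (Suc j))) = Ep V (Em V (U (Suc j))) - scl V (of_int (n0 + 2 * int (Suc j))) (U (Suc j))"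
      using Ep_Em_K_type[OF UK[of "Suc j"]] by (simp add: US del: of_int_add of_int_mult of_int_of_nat_eq)
    also have "\<dots> = scl V (- \<beta> (n0 + 2 * int j) - of_int (n0 + 2 * int (Suc j))) (U (Suc j))"
      unfolding Suc by (simp add: endoD[OF Ep_endo] endo_minus[OF Ep_endo] US vs.scale_left_diff_distrib del: of_int_add of_int_mult of_int_of_nat_eq)
    also have "- \<beta> (n0 + 2 * int j) - of_int (n0 + 2 * int (Suc j)) = - \<beta> (n0 + 2 * int (Suc j))"
      using \<beta>[of "n0 + 2 * int j"] by (simp add: algebra_simps)
    finally show ?case .
  qed
  have ED: "Ep V (D (Suc j)) = scl V (- \<beta> (n0 - 2 * int j - 2)) (D j)" for j
  proof (induction j)
    case 0
    have "Ep V (Em V e) = scl V (d + of_int n0) e"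
      using Ep_Em_K_type[OF eK] e(2) by (simp add: vs.scale_left_distrib)
    moreover have "d + of_int n0 = - \<beta> (n0 - 2)" using \<beta>[of "n0 - 2"] \<beta>0 by simp (metis add.commute add_minus_cancel minus_add_cancel minus_minus)
    ultimately show ?case by (simp add: D_def)
  next
    case (Suc j)
    have "Ep V (D (Suc (Suc j))) = Em V (Ep V (D (Suc j))) + scl V (of_int (n0 - 2 * int (Suc j))) (D (Suc j))"
      using Ep_Em_K_type[OF DK[of "Suc j"]] by (simp add: DS del: of_int_add of_int_mult of_int_of_nat_eq of_int_diff)
    also have "\<dots> = scl V (- \<beta> (n0 - 2 * int j - 2) + of_int (n0 - 2 * int (Suc j))) (D (Suc j))"
      unfolding Suc by (simp add: endoD[OF Em_endo] endo_minus[OF Em_endo] DS vs.scale_left_distrib vs.scale_left_diff_distrib del: of_int_add of_int_mult of_int_of_nat_eq of_int_diff)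
    also have "- \<beta> (n0 - 2 * int j - 2) + of_int (n0 - 2 * int (Suc j)) = - \<beta> (n0 - 2 * int (Suc j) - 2)"
      using \<beta>[of "n0 - 2 * int (Suc j) - 2"] by (simp add: algebra_simps)
    finally show ?case .
  qed
  define f where "f k = (if k \<ge> 0 then U (nat k) else D (nat (- k)))" for k :: int
  have f1: "Ep V (f k) = f (k + 1)" if "k \<ge> 0" for k
    using that by (simp add: f_def US nat_add_distrib)
  have f2: "Em V (f (k + 1)) = scl V (- \<beta> (n0 + 2 * k)) (f k)" if "k \<ge> 0" for k
    using that EU[of "nat k"] by (simp add: f_def nat_add_distrib)
  have f3: "Em V (f (k + 1)) = f k" and f4: "Ep V (f k) = scl V (- \<beta> (n0 + 2 * k)) (f (k + 1))" if "k < 0" for k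
  proof -
    have k: "nat (- k) = Suc (nat (- k - 1))" "int (nat (- k - 1)) = - k - 1" using that by simp_all
    have fk1: "f (k + 1) = D (nat (- k - 1))"
    proof (cases "k = -1")
      case False
      have e: "- (k + 1) = - k - 1" by simp
      show ?thesis using that False unfolding f_def e by simp
    qed (simp add: f_def U_def D_def)
    have fk: "f k = D (Suc (nat (- k - 1)))" using that k(1) by (simp add: f_def)
    show "Em V (f (k + 1)) = f k" unfolding fk fk1 by (rule DS)
    show "Ep V (f k) = scl V (- \<beta> (n0 + 2 * k)) (f (k + 1))"
      unfolding fk fk1 ED k(2) by (simp add: algebra_simps)
  qed
  have fK: "f k \<in> K_type V (n0 + 2 * k)" for k
    using UK[of "nat k"] DK[of "nat (- k)"] by (auto simp: f_def)
  define W where "W = vs.span (range f)"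
  \<comment> \<open>It suffices to check invariance of \<open>W\<close> on the ladder vectors, for
    each of the operators that generate the action.\<close>
  have clos: "T w \<in> W" if "endo V T" "\<And>k. T (f k) \<in> W" "w \<in> W" for T w
    using that(3) unfolding W_def
  proof (induction rule: vs.span_induct_alt)
    case base then show ?case by (simp add: endoD[OF that(1)] vs.span_zero)
  next
    case (step c x y)
    then show ?case using that(2) unfolding W_def
      by (auto simp: endoD[OF that(1)] intro!: vs.span_add vs.span_scale)
  qed
  have fW: "f k \<in> W" for k unfolding W_def by (rule vs.span_base) simp
  have sW: "scl V a w \<in> W" if "w \<in> W" for a w using that unfolding W_def by (rule vs.span_scale)
  have nW: "- w \<in> W" if "w \<in> W" for w using that unfolding W_def by (rule vs.span_neg)
  have aW: "v + w \<in> W" "v - w \<in> W" if "v \<in> W" "w \<in> W" for v w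
    using that unfolding W_def by (auto intro: vs.span_add vs.span_diff)
  have EpW: "Ep V w \<in> W" if "w \<in> W" for w
  proof (rule clos[OF Ep_endo _ that])
    fix k show "Ep V (f k) \<in> W" using f1[of k] f4[of k] fW sW nW by (cases "k \<ge> 0") auto
  qed
  have EmW: "Em V w \<in> W" if "w \<in> W" for w
  proof (rule clos[OF Em_endo _ that])
    fix k show "Em V (f k) \<in> W" using f2[of "k - 1"] f3[of "k - 1"] fW sW nW by (cases "k - 1 \<ge> 0") auto
  qed
  have YW: "lie V Y0 w \<in> W" if "w \<in> W" for w
    by (rule clos[OF lie_endo[OF basis_sl2(1)] _ that]) (simp add: lie_Y0_K_type[OF fK] fW sW)
  have kW: "kact V k w \<in> W" if "w \<in> W" "k \<in> SO2" for k w
  proof -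
    note k = that(2)
    obtain t where t: "k = rot t" using SO2_cases[OF k] by blast
    show ?thesis unfolding t
      by (rule clos[OF k_endo[OF rot_SO2] _ that(1)]) (use fK fW sW in \<open>auto simp: K_type_iff\<close>)
  qed
  have "lie V X w \<in> W" if "w \<in> W" "X \<in> sl2" for X w
    unfolding lie_expand[OF that(2)] Hm_eq Zm_eq
    using EpW[OF that(1)] EmW[OF that(1)] YW[OF that(1)] by (intro aW sW)
  then have "gk_submodule V W" unfolding gk_submodule_def
    using kW vs.subspace_span by (auto simp: W_def)
  moreover have "f 0 \<noteq> 0" using e by (simp add: f_def U_def)
  ultimately have "W = UNIV" using irr fW unfolding irreducible_gk_def by blast
  then show thesis
    using that[of f n0 c] fK f1 f2 f3 f4 \<open>f 0 \<noteq> 0\<close> unfolding W_def \<beta>_def by (simp add: minus_divide_left)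
qed

end

section \<open>Orthonormal K-finite bases\<close>

text \<open>The ladder operators satisfy \<open>Ep (e n) = b n (e (n + 2))\<close> and \<open>Em (e (n + 2)) = - b n (e n)\<close>
  with \<open>4 b n\<^sup>2 = (n + 1)\<^sup>2 + \<mu>\<close>. Vectors \<open>e n\<close> with \<open>n\<close> outside the set \<open>I\<close> of K-types are zero.\<close>

locale umod = gkmod V for V :: "('v::ab_group_add) gk" +
  fixes e :: "int \<Rightarrow> 'v" and co :: "int \<Rightarrow> 'v \<Rightarrow> complex" and b :: "int \<Rightarrow> real"
    and I :: "int set" and \<mu> :: real and o' :: int and hp :: "'v \<Rightarrow> real"
    and \<pi> :: "mat2 \<Rightarrow> (nat \<Rightarrow> 'v) set \<Rightarrow> (nat \<Rightarrow> 'v) set"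
  assumes e_K: "e n \<in> K_type V n" and e_0: "n \<notin> I \<Longrightarrow> e n = 0"
    and co_lin: "functional V (co n)"
    and co_e: "co m (e n) = (if m = n \<and> n \<in> I then 1 else 0)"
    and co_fin: "finite {n. co n v \<noteq> 0}"
    and co_exp: "v = (\<Sum>n | co n v \<noteq> 0. scl V (co n v) (e n))"
    and co_out: "n \<notin> I \<Longrightarrow> co n v = 0"
    and Ep_e: "Ep V (e n) = scl V (of_real (b n)) (e (n + 2))"
    and Em_e: "Em V (e (n + 2)) = scl V (- of_real (b n)) (e n)"
    and b_nonneg: "0 \<le> b n" and b_pos: "n \<in> I \<Longrightarrow> n + 2 \<in> I \<Longrightarrow> 0 < b n"
    and b_sq: "n \<in> I \<or> n + 2 \<in> I \<Longrightarrow> 4 * (b n)\<^sup>2 = (of_int n + 1)\<^sup>2 + \<mu>"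
    and o_I: "o' \<in> I" and I_even: "n \<in> I \<Longrightarrow> even (n - o')"
    and I_down: "n \<in> I \<Longrightarrow> n > o' \<Longrightarrow> n - 2 \<in> I" and I_up: "n \<in> I \<Longrightarrow> n < o' \<Longrightarrow> n + 2 \<in> I"
    and I_inf: "infinite I"
    and hp_norm: "is_norm V hp"
    and hp_sq: "(hp v)\<^sup>2 = (\<Sum>n | co n v \<noteq> 0. (cmod (co n v))\<^sup>2)"
    and hp_glob: "globalization V hp \<pi>"
    and hp_unit: "g \<in> SL2 \<Longrightarrow> A \<in> pts (banach_completion V hp) \<Longrightarrow>
       nrm (banach_completion V hp) (\<pi> g A) = nrm (banach_completion V hp) A"

section \<open>Orthonormalizing the ladder with the invariant inner product\<close>

locale unitary_hc = irr_hc V for V :: "('v::ab_group_add) gk" +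
  fixes ip and \<pi>
  assumes ip: "inner_product V ip" and Gc: "G_continuous V (ip_norm ip)"
    and gl: "globalization V (ip_norm ip) \<pi>"
    and inv: "\<And>g A B. g \<in> SL2 \<Longrightarrow> A \<in> pts (banach_completion V (ip_norm ip)) \<Longrightarrow>
       B \<in> pts (banach_completion V (ip_norm ip)) \<Longrightarrow> ip_completion ip (\<pi> g A) (\<pi> g B) = ip_completion ip A B"
    and nontriv: "\<not> trivial_gk V"
begin

abbreviation "hp \<equiv> ip_norm ip"

sublocale N: normed_gk V hp
  by unfold_locales (use Gc G_continuous_def in \<open>auto simp: G_continuous_def V\<close>)

lemma ip_simps: "ip (u + v) w = ip u w + ip v w" "ip (scl V c v) w = c * ip v w"
    "ip w (u + v) = ip w u + ip w v" "ip w (scl V c v) = cnj c * ip w v"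
  and ip_cnj: "ip w v = cnj (ip v w)"
  and ip_pos: "v \<noteq> 0 \<Longrightarrow> 0 < Re (ip v v)"
proof -
  have a: "ip (u + v) w = ip u w + ip v w" "ip (scl V c v) w = c * ip v w" "ip w v = cnj (ip v w)" for u v w c
    using ip unfolding inner_product_def by blast+
  show "ip (u + v) w = ip u w + ip v w" "ip (scl V c v) w = c * ip v w" "ip w v = cnj (ip v w)" by (rule a)+
  show "ip w (u + v) = ip w u + ip w v" "ip w (scl V c v) = cnj c * ip w v"
    by (subst a(3), subst a, simp flip: a(3))+
  show "v \<noteq> 0 \<Longrightarrow> 0 < Re (ip v v)" using ip unfolding inner_product_def by blast
qed

lemma ip_0 [simp]: "ip 0 w = 0" "ip w 0 = 0"
  using ip_simps(2,4)[of 0 0 w] ip_simps(4)[of w 0 0] by simp_all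

lemma ip_minus: "ip (- v) w = - ip v w" "ip w (- v) = - ip w v"
  using ip_simps(2)[of "-1" v w] ip_simps(4)[of w "-1" v] by simp_all

lemma ip_diff: "ip (u - v) w = ip u w - ip v w" "ip w (u - v) = ip w u - ip w v"
  using ip_simps(1)[of u "- v" w] ip_simps(3)[of w u "- v"] by (simp_all add: ip_minus)

lemma ip_self: "ip v v = of_real ((hp v)\<^sup>2)"
proof -
  have "Im (ip v v) = 0" using ip_cnj[of v v] by (metis complex_cnj_cancel_iff Reals_cnj_iff complex_is_Real_iff)
  moreover have "Re (ip v v) \<ge> 0" using ip_pos[of v] by (cases "v = 0") auto
  ultimately show ?thesis by (simp add: ip_norm_def complex_eq_iff)
qed

lemma hp_add_sq: "(hp (u + w))\<^sup>2 = (hp u)\<^sup>2 + (hp w)\<^sup>2 + 2 * Re (ip u w)"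
proof -
  have "ip (u + w) (u + w) = ip u u + ip w w + (ip u w + cnj (ip u w))"
    using ip_cnj[of w u] by (simp add: ip_simps)
  then have "of_real ((hp (u + w))\<^sup>2) = (of_real ((hp u)\<^sup>2 + (hp w)\<^sup>2 + 2 * Re (ip u w)) :: complex)"
    by (simp add: ip_self complex_add_cnj)
  then show ?thesis unfolding of_real_eq_iff .
qed

lemma hp_unit:
  assumes "g \<in> SL2" "A \<in> pts N.E" shows "nrm N.E (\<pi> g A) = nrm N.E A"
proof -
  have c: "ip_completion ip A A = of_real ((nrm N.E A)\<^sup>2)" if A: "A \<in> pts N.E" for A
  proof -
    obtain u where u: "u \<in> N.CS" "A = N.cc u" using N.pts_cases[OF A] by blast
    have "(\<lambda>n. hp (rep_seq A n)) \<longlonglongrightarrow> nrm N.E A"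
      using N.nrm_cc[OF N.rep_cc(1)[OF u(1)]] N.rep_cc(3)[OF u(1)] u by simp
    then have "(\<lambda>n. of_real ((hp (rep_seq A n))\<^sup>2)) \<longlonglongrightarrow> (of_real ((nrm N.E A)\<^sup>2) :: complex)"
      by (intro tendsto_intros)
    then show ?thesis unfolding ip_completion_def ip_self by (rule limI)
  qed
  have nn: "0 \<le> nrm N.E A" if "A \<in> pts N.E" for A
    using that by (auto elim!: N.pts_cases simp flip: N.ndist_zero_iff_nrm)
  have cr: "continuous_rep N.E \<pi>" using gl by (simp add: globalization_def Let_def)
  have "\<pi> g A \<in> pts N.E" using cr assms by (simp add: continuous_rep_def)
  then have "(nrm N.E (\<pi> g A))\<^sup>2 = (nrm N.E A)\<^sup>2" "0 \<le> nrm N.E (\<pi> g A)"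
    using inv[OF assms(1,2,2)] c assms nn by (auto simp flip: of_real_power)
  then show ?thesis using nn[OF assms(2)] by (simp add: power2_eq_iff_nonneg)
qed

lemma hp_k: "k \<in> SO2 \<Longrightarrow> hp (kact V k v) = hp v"
  using hp_unit[OF SO2_SL2, of k "embed hp v"] gl by (simp add: globalization_def Let_def)

text \<open>Polarization: expanding \<open>hp (u + w)\<close> gives the real part, and replacing
  \<open>w\<close> by \<open>\<i> w\<close> the imaginary part.\<close>

lemma ip_polar:
  assumes T: "endo V T" and "\<And>v. hp (T v) = hp v" shows "ip (T u) (T w) = ip u w"
proof -
  have "Re (ip (T u) (T w)) = Re (ip u w)" for w
    using hp_add_sq[of u w] hp_add_sq[of "T u" "T w"] assms(2)[of "u + w"] by (simp add: assms(2) endoD[OF T])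
  from this[of w] this[of "scl V \<i> w"] show ?thesis
    by (simp add: endoD[OF T] ip_simps complex_eq_iff)
qed

text \<open>The group preserves \<open>hp\<close>, and \<open>v + t X v\<close> agrees with the
  translated vector up to \<open>o(t)\<close> in the completion. Hence \<open>hp (v + t X v)\<close>
  is \<open>hp v + o(t)\<close>; comparing with the expansion of its square gives
  \<open>Re (ip v (X v)) = 0\<close>, and polarization finishes.\<close>

lemma ip_skew:
  assumes X: "X \<in> sl2" shows "ip (lie V X u) w = - ip u (lie V X w)"
proof -
  have re: "Re (ip v (lie V X v)) = 0" for v
  proof -
    have cr: "continuous_rep N.E \<pi>"
      and ld: "lie_derivative N.E \<pi> X (embed hp v) (embed hp (lie V X v))"
      using gl X by (auto simp: globalization_def Let_def)
    define x where "x = lie V X v"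
    define D where "D t = ndist N.E (smul N.E (of_real (1 / t)) (add N.E (\<pi> (mexp (t *\<^sub>R X)) (embed hp v)) (smul N.E (-1) (embed hp v)))) (embed hp x)" for t :: real
    have D: "(D \<longlongrightarrow> 0) (at 0)" using ld unfolding lie_derivative_def D_def x_def by simp
    have g: "mexp (t *\<^sub>R X) \<in> SL2" for t using mexp_group(2)[OF X] .
    \<comment> \<open>\<open>t D t\<close> is the distance in the completion between the translate
      of \<open>v\<close>, which has norm \<open>hp v\<close>, and \<open>v + t x\<close>.\<close>
    have est: "\<bar>hp (v + scl V (of_real t) x) - hp v\<bar> \<le> \<bar>t\<bar> * D t" if t: "t \<noteq> 0" for t
    proof -
      let ?g = "\<pi> (mexp (t *\<^sub>R X)) (embed hp v)"
      have gp: "?g \<in> pts N.E" using cr g by (simp add: continuous_rep_def)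
      obtain u where u: "u \<in> N.CS" "?g = N.cc u" using N.pts_cases[OF gp] by blast
      have ng: "nrm N.E ?g = hp v" using hp_unit[OF g] by simp
      have "\<bar>t\<bar> * D t = ndist N.E (smul N.E (of_real t) (smul N.E (of_real (1 / t)) (add N.E ?g (smul N.E (-1) (embed hp v))))) (smul N.E (of_real t) (embed hp x))"
        unfolding D_def using gp by (subst N.ndist_smul) (simp_all del: N.smul_embed)
      also have "smul N.E (of_real t) (smul N.E (of_real (1 / t)) (add N.E ?g (smul N.E (-1) (embed hp v)))) = add N.E ?g (smul N.E (-1) (embed hp v))"
        using u t unfolding embed_def by (simp add: N.add_cc N.smul_cc)
      also have "ndist N.E (add N.E ?g (smul N.E (-1) (embed hp v))) (smul N.E (of_real t) (embed hp x))
        = ndist N.E (add N.E (add N.E ?g (smul N.E (-1) (embed hp v))) (embed hp v)) (add N.E (smul N.E (of_real t) (embed hp x)) (embed hp v))"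
        using gp by (subst N.ndist_add_cancel) simp_all
      also have "add N.E (add N.E ?g (smul N.E (-1) (embed hp v))) (embed hp v) = ?g"
        using u unfolding embed_def by (simp add: N.add_cc N.smul_cc)
      also have "add N.E (smul N.E (of_real t) (embed hp x)) (embed hp v) = embed hp (v + scl V (of_real t) x)"
        by (simp add: add.commute)
      finally have D': "\<bar>t\<bar> * D t = ndist N.E ?g (embed hp (v + scl V (of_real t) x))" .
      have emb: "embed hp (v + scl V (of_real t) x) = N.cc (\<lambda>_. v + scl V (of_real t) x)" by (simp add: embed_def)
      have "\<bar>hp (v + scl V (of_real t) x) - nrm N.E ?g\<bar> \<le> ndist N.E ?g (embed hp (v + scl V (of_real t) x))"
        unfolding u(2) emb
        by (rule LIMSEQ_le[OF tendsto_rabs[OF tendsto_diff[OF tendsto_const N.nrm_cc[OF u(1)]]] N.ndist_cc[OF u(1) N.CS_const]])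
          (rule exI[of _ 0], use N.p_rev N.p_commute in metis)
      then show ?thesis by (simp add: D' ng)
    qed
    have sq: "(hp (v + scl V (of_real t) x))\<^sup>2 - (hp v)\<^sup>2 = t\<^sup>2 * (hp x)\<^sup>2 + 2 * t * Re (ip v x)" for t
      unfolding hp_add_sq by (simp add: ip_simps power_mult_distrib)
    have b: "\<bar>2 * Re (ip v x)\<bar> \<le> D t * (2 * hp v + \<bar>t\<bar> * hp x) + \<bar>t\<bar> * (hp x)\<^sup>2" if t: "t \<noteq> 0" for t
    proof -
      have "\<bar>t\<^sup>2 * (hp x)\<^sup>2 + 2 * t * Re (ip v x)\<bar> = \<bar>hp (v + scl V (of_real t) x) - hp v\<bar> * (hp (v + scl V (of_real t) x) + hp v)"
        unfolding sq[symmetric] by (simp add: square_diff_square_factored power2_eq_square abs_mult)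
      also have "\<dots> \<le> (\<bar>t\<bar> * D t) * ((hp v + \<bar>t\<bar> * hp x) + hp v)"
        by (intro mult_mono est[OF t] add_right_mono order_trans[OF N.p_triangle]) (auto simp: D_def)
      finally have "\<bar>2 * t * Re (ip v x)\<bar> \<le> \<bar>t\<bar> * D t * (2 * hp v + \<bar>t\<bar> * hp x) + t\<^sup>2 * (hp x)\<^sup>2"
        using abs_triangle_ineq4[of "t\<^sup>2 * (hp x)\<^sup>2 + 2 * t * Re (ip v x)" "t\<^sup>2 * (hp x)\<^sup>2"] by simp
      moreover have "\<bar>t\<bar> * (\<bar>t\<bar> * (hp x)\<^sup>2) = t\<^sup>2 * (hp x)\<^sup>2"
        by (simp only: mult.assoc[symmetric] abs_mult_self_eq power2_eq_square)
      moreover have "\<bar>2 * t * Re (ip v x)\<bar> = \<bar>t\<bar> * \<bar>2 * Re (ip v x)\<bar>" by (simp add: abs_mult)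
      ultimately have "\<bar>t\<bar> * \<bar>2 * Re (ip v x)\<bar> \<le> \<bar>t\<bar> * (D t * (2 * hp v + \<bar>t\<bar> * hp x) + \<bar>t\<bar> * (hp x)\<^sup>2)"
        unfolding distrib_left[of "\<bar>t\<bar>" "D t * _"] mult.assoc[symmetric, of "\<bar>t\<bar>" "D t"] by linarith
      then show ?thesis using t by simp
    qed
    have "((\<lambda>t. D t * (2 * hp v + \<bar>t\<bar> * hp x) + \<bar>t\<bar> * (hp x)\<^sup>2) \<longlongrightarrow> 0 * (2 * hp v + \<bar>0\<bar> * hp x) + \<bar>0\<bar> * (hp x)\<^sup>2) (at 0)"
      by (intro tendsto_intros D)
    then have "\<bar>2 * Re (ip v x)\<bar> \<le> 0"
      by (intro tendsto_lowerbound[where F = "at (0::real)" and f = "\<lambda>t. D t * (2 * hp v + \<bar>t\<bar> * hp x) + \<bar>t\<bar> * (hp x)\<^sup>2"])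
        (auto simp: eventually_at_filter intro!: always_eventually b)
    then show ?thesis by (simp add: x_def)
  qed
  have r: "Re (ip u (lie V X w)) + Re (ip (lie V X u) w) = 0" for w
  proof -
    have "Re (ip w (lie V X u)) = Re (ip (lie V X u) w)" by (subst ip_cnj) simp
    then show ?thesis using re[of "u + w"] re[of u] re[of w] by (simp add: endoD[OF lie_endo[OF X]] ip_simps)
  qed
  from r[of w] r[of "scl V \<i> w"] show ?thesis
    by (simp add: endoD[OF lie_endo[OF X]] ip_simps complex_eq_iff)
qed

lemma ip_Ep: "ip (Ep V u) w = - ip u (Em V w)"
  by (simp add: Ep_def Em_def ip_simps ip_diff ip_skew algebra_simps)

lemma ip_K_type:
  assumes "u \<in> K_type V m" "w \<in> K_type V n" "m \<noteq> n" shows "ip u w = 0"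
proof -
  \<comment> \<open>At this angle the two characters differ by the factor
    \<open>- 1\<close>.\<close>
  define t where "t = pi / of_int (m - n)"
  have "ip u w = ip (kact V (rot t) u) (kact V (rot t) w)"
    by (rule ip_polar[symmetric]) (simp_all add: k_endo hp_k)
  also have "\<dots> = (cis (of_int m * t) * cnj (cis (of_int n * t))) * ip u w"
    using assms by (simp add: K_type_iff ip_simps)
  also have "cis (of_int m * t) * cnj (cis (of_int n * t)) = cis (of_int (m - n) * t)"
    by (simp add: cis_cnj cis_mult algebra_simps)
  also have "of_int (m - n) * t = pi" using assms(3) by (simp add: t_def)
  finally show ?thesis by simp
qed

text \<open>Distinct K-types are orthogonal, and skewness makes \<open>Ep\<close> and
  \<open>- Em\<close> adjoint, so the ladder coefficients become ratios of squared norms: they are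
  real and nonnegative and vanish exactly at the ends of the ladder. Normalizing the
  \<open>f k\<close> yields the basis.\<close>

lemma model: "\<exists>e co b I \<mu> o'. umod V e co b I \<mu> o' hp \<pi>"
proof -
  obtain f n0 c where f: "\<And>k. f k \<in> K_type V (n0 + 2 * k)" "f 0 \<noteq> 0"
    "\<And>k. k \<ge> 0 \<Longrightarrow> Ep V (f k) = f (k + 1)"
    "\<And>k. k \<ge> 0 \<Longrightarrow> Em V (f (k + 1)) = scl V (- ((of_int (n0 + 2 * k) + 1)\<^sup>2 + c) / 4) (f k)"
    "\<And>k. k < 0 \<Longrightarrow> Em V (f (k + 1)) = f k"
    "\<And>k. k < 0 \<Longrightarrow> Ep V (f k) = scl V (- ((of_int (n0 + 2 * k) + 1)\<^sup>2 + c) / 4) (f (k + 1))"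
    and sp: "vs.span (range f) = UNIV" by (rule K_type_basis, rule that)
  have ev: "\<exists>k. n = n0 + 2 * k" if "even (n - n0)" for n using that by presburger
  have ev2: "\<exists>k. n = n0 + 2 * k" if "even (n + 2 - n0)" for n using that by presburger
  define \<nu> where "\<nu> k = hp (f k)" for k
  have \<nu>0: "\<nu> k = 0 \<longleftrightarrow> f k = 0" and \<nu>n: "\<nu> k \<ge> 0" for k by (simp_all add: \<nu>_def)
  have up: "complex_of_real ((\<nu> (k + 1))\<^sup>2) = cnj (((of_int (n0 + 2 * k) + 1)\<^sup>2 + c) / 4) * of_real ((\<nu> k)\<^sup>2)" if "k \<ge> 0" for k
  proof -
    have "complex_of_real ((\<nu> (k + 1))\<^sup>2) = ip (Ep V (f k)) (f (k + 1))"
      using f(3)[OF that] by (simp add: \<nu>_def ip_self)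
    also have "\<dots> = cnj (((of_int (n0 + 2 * k) + 1)\<^sup>2 + c) / 4) * ip (f k) (f k)"
      unfolding ip_Ep f(4)[OF that, unfolded minus_divide_left[symmetric]] ip_simps by simp
    finally show ?thesis by (simp add: \<nu>_def ip_self)
  qed
  define \<mu> where "\<mu> = Re c"
  \<comment> \<open>At \<open>k = 0\<close> the coefficient is a quotient of squared norms, so
    \<open>c\<close> is real.\<close>
  have c: "c = of_real \<mu>"
  proof -
    have "((of_int (n0 + 2 * 0) + 1)\<^sup>2 + cnj c) / 4 = complex_of_real ((\<nu> 1)\<^sup>2 / (\<nu> 0)\<^sup>2)"
      using up[of 0] f(2) \<nu>0[of 0] by (simp add: field_simps)
    then have "Im (((of_int (n0 + 2 * 0) + 1)\<^sup>2 + cnj c) / 4) = 0" by simp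
    moreover have "Im ((of_int (n0 + 2 * 0) + 1)\<^sup>2 :: complex) = Im (of_real ((of_int (n0 + 2 * 0) + 1)\<^sup>2))"
      by simp
    ultimately have "Im c = 0" by (simp del: of_real_power of_real_add)
    then show ?thesis by (simp add: \<mu>_def complex_eq_iff)
  qed
  define B where "B n = ((of_int n + 1)\<^sup>2 + \<mu>) / 4" for n :: int
  have Bc: "- ((of_int n + 1)\<^sup>2 + c) / 4 = complex_of_real (- B n)" for n by (simp add: B_def c) (simp add: add_divide_distrib)
  note f4 = f(4)[unfolded Bc] and f6 = f(6)[unfolded Bc]
  have up: "(\<nu> (k + 1))\<^sup>2 = B (n0 + 2 * k) * (\<nu> k)\<^sup>2" if "k \<ge> 0" for k
  proof -
    have "complex_of_real ((\<nu> (k + 1))\<^sup>2) = of_real (B (n0 + 2 * k) * (\<nu> k)\<^sup>2)"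
      using up[OF that] by (simp add: B_def c)
    then show ?thesis unfolding of_real_eq_iff .
  qed
  have dn: "(\<nu> k)\<^sup>2 = B (n0 + 2 * k) * (\<nu> (k + 1))\<^sup>2" if "k < 0" for k
  proof -
    have "complex_of_real ((\<nu> k)\<^sup>2) = cnj (ip (f k) (Em V (f (k + 1))))"
      using f(5)[OF that] by (simp add: \<nu>_def ip_self)
    also have "ip (f k) (Em V (f (k + 1))) = - ip (Ep V (f k)) (f (k + 1))" by (simp add: ip_Ep)
    also have "\<dots> = of_real (B (n0 + 2 * k) * (\<nu> (k + 1))\<^sup>2)"
      unfolding f6[OF that] by (simp add: ip_simps ip_minus \<nu>_def ip_self)
    finally show ?thesis by (simp del: of_real_mult of_real_power)
  qed
  \<comment> \<open>Below the start it is \<open>Em\<close> that acts with coefficient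
    \<open>1\<close>; alternating signs there give \<open>Em\<close> the coefficient
    \<open>- b\<close> that it has above the start.\<close>
  define sg where "sg k = (if k < 0 \<and> odd k then -1 else 1 :: real)" for k :: int
  have sg: "sg k * sg k = 1" "\<bar>sg k\<bar> = 1" for k by (simp_all add: sg_def)
  define e where "e n = (if even (n - n0) then scl V (of_real (sg ((n - n0) div 2) / \<nu> ((n - n0) div 2))) (f ((n - n0) div 2)) else 0)" for n
  have e_k: "e (n0 + 2 * k) = scl V (of_real (sg k / \<nu> k)) (f k)" for k by (simp add: e_def)
  have f_e: "f k = scl V (of_real (sg k * \<nu> k)) (e (n0 + 2 * k))" for k
    using \<nu>0[of k] by (cases "f k = 0") (auto simp: e_k sg_def)
  define co where "co n v = ip v (e n)" for n v
  define I where "I = {n. e n \<noteq> 0}"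
  have I_k: "n0 + 2 * k \<in> I \<longleftrightarrow> f k \<noteq> 0" for k using \<nu>0[of k] sg[of k] by (auto simp: I_def e_k)
  have I_even: "even (n - n0)" if "n \<in> I" for n using that by (auto simp: I_def e_def split: if_splits)
  define b where "b n = (if n \<in> I \<and> n + 2 \<in> I then sqrt (B n) else 0)" for n
  have e_odd: "e n = 0" if "odd (n - n0)" for n using that by (simp add: e_def)
  have eK: "e n \<in> K_type V n" for n
  proof (cases "even (n - n0)")
    case True
    then obtain k where "n = n0 + 2 * k" using ev by blast
    then show ?thesis using f(1)[of k] vs.subspace_scale[OF K_type_subspace] by (simp add: e_k)
  next
    case False
    then show ?thesis using vs.subspace_0[OF K_type_subspace] by (simp add: e_odd)
  qed
  have co_e: "co m (e n) = (if m = n \<and> n \<in> I then 1 else 0)" for m n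
  proof (cases "m = n \<and> n \<in> I")
    case True
    then obtain k where k: "n = n0 + 2 * k" using I_even ev by blast
    then have "\<nu> k \<noteq> 0" using True I_k \<nu>0 by blast
    then have "hp (e n) = 1" using \<nu>n[of k] sg(2)[of k] by (simp add: k e_k norm_divide flip: \<nu>_def)
    then show ?thesis using True by (simp add: co_def ip_self)
  next
    case False
    then have "ip (e n) (e m) = 0" using ip_K_type[OF eK eK, of n m] by (auto simp: I_def)
    then show ?thesis using False by (simp only: co_def if_False)
  qed
  have co_lin: "functional V (co n)" for n by (rule functionalI[OF V]) (simp_all add: co_def ip_simps)
  \<comment> \<open>Demanding the expansion over all larger finite sets makes the property additive,
    which the induction over the span requires.\<close>
  define Q where "Q v \<longleftrightarrow> (\<exists>F. finite F \<and> (\<forall>F'. finite F' \<longrightarrow> F \<subseteq> F' \<longrightarrow> v = (\<Sum>n\<in>F'. scl V (co n v) (e n))))" for v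
  have Q: "Q v" for v
  proof -
    have "v \<in> vs.span (range f)" using sp by simp
    then show ?thesis
    proof (induction rule: vs.span_induct_alt)
      case base show ?case unfolding Q_def by (rule exI[of _ "{}"]) (simp add: functionalD[OF co_lin])
    next
      case (step a x y)
      then obtain k where x: "x = f k" by blast
      obtain F where F: "finite F" "\<And>F'. finite F' \<Longrightarrow> F \<subseteq> F' \<Longrightarrow> y = (\<Sum>n\<in>F'. scl V (co n y) (e n))"
        using step(2) unfolding Q_def by blast
      show ?case unfolding Q_def
      proof (intro exI[of _ "insert (n0 + 2 * k) F"] conjI allI impI)
        fix F' assume F': "finite F'" "insert (n0 + 2 * k) F \<subseteq> F'"
        let ?m = "n0 + 2 * k"
        have cx: "co n x = (if n = ?m \<and> ?m \<in> I then of_real (sg k * \<nu> k) else 0)" for n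
          unfolding x by (subst f_e) (simp add: functionalD[OF co_lin] co_e)
        have "(\<Sum>n\<in>F'. scl V (co n x) (e n)) = (\<Sum>n\<in>F'. if n = ?m then scl V (of_real (sg k * \<nu> k)) (e ?m) else 0)"
          by (rule sum.cong) (auto simp: cx I_def)
        also have "\<dots> = x" using F' unfolding x by (subst f_e) simp
        finally have X: "(\<Sum>n\<in>F'. scl V (co n x) (e n)) = x" .
        have "(\<Sum>n\<in>F'. scl V (co n (scl V a x + y)) (e n)) = scl V a (\<Sum>n\<in>F'. scl V (co n x) (e n)) + (\<Sum>n\<in>F'. scl V (co n y) (e n))"
          by (simp add: functionalD[OF co_lin] vs.scale_left_distrib sum.distrib vs.scale_sum_right)
        then show "scl V a x + y = (\<Sum>n\<in>F'. scl V (co n (scl V a x + y)) (e n))"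
          using X F(2)[OF F'(1)] F' by simp
      qed (use F in auto)
    qed
  qed
  have supp: "finite {n. co n v \<noteq> 0} \<and> v = (\<Sum>n | co n v \<noteq> 0. scl V (co n v) (e n))" for v
  proof -
    obtain F where F: "finite F" "v = (\<Sum>n\<in>F. scl V (co n v) (e n))"
      using Q[of v] unfolding Q_def by blast
    have eq: "co m v = (\<Sum>n\<in>F. co n v * co m (e n))" for m
      by (subst F(2)) (simp add: functionalD[OF co_lin])
    have "co m v = 0" if "m \<notin> F" for m
      using that by (intro trans[OF eq] sum.neutral) (auto simp: co_e)
    then have sub: "{n. co n v \<noteq> 0} \<subseteq> F" by auto
    moreover have "v = (\<Sum>n | co n v \<noteq> 0. scl V (co n v) (e n))"
      by (subst F(2), rule sum.mono_neutral_right) (use F sub in auto)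
    ultimately show ?thesis using F finite_subset by blast
  qed
  have B_nn: "B n \<ge> 0" if "n \<in> I \<or> n + 2 \<in> I" for n
  proof -
    note nI = that
    obtain k where k: "n = n0 + 2 * k" using nI I_even[of n] I_even[of "n + 2"] ev[of n] ev2[of n] by blast
    have k1: "n + 2 = n0 + 2 * (k + 1)" by (simp add: k)
    have "f k \<noteq> 0 \<or> f (k + 1) \<noteq> 0" using nI I_k[of k] I_k[of "k + 1"] unfolding k1 unfolding k by simp
    then have *: "\<nu> k > 0 \<or> \<nu> (k + 1) > 0" using \<nu>0 \<nu>n by (metis order_le_less)
    show ?thesis
    proof (cases "k \<ge> 0")
      case True
      then have "\<nu> k > 0" using * up[OF True] \<nu>n[of k] by (cases "\<nu> k = 0") auto
      then show ?thesis using up[OF True] by (metis k zero_le_mult_iff zero_le_power2 zero_less_power not_le)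
    next
      case False
      then have "\<nu> (k + 1) > 0" using * dn[of k] \<nu>n[of "k + 1"] by (cases "\<nu> (k + 1) = 0") auto
      then show ?thesis using dn[of k] False by (metis k zero_le_mult_iff zero_le_power2 zero_less_power not_le)
    qed
  qed
  have B_0: "B n = 0" if "(n \<in> I) \<noteq> (n + 2 \<in> I)" for n
  proof -
    note nI = that
    obtain k where k: "n = n0 + 2 * k" using nI I_even[of n] I_even[of "n + 2"] ev[of n] ev2[of n] by blast
    have k1: "n + 2 = n0 + 2 * (k + 1)" by (simp add: k)
    have "(\<nu> k = 0) \<noteq> (\<nu> (k + 1) = 0)" using that I_k[of k] I_k[of "k + 1"] \<nu>0 unfolding k1 unfolding k by simp
    then show ?thesis using up[of k] dn[of k] unfolding k by (cases "k \<ge> 0") auto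
  qed
  have B_pos: "B n > 0" if "n \<in> I" "n + 2 \<in> I" for n
  proof -
    note nI = that
    obtain k where k: "n = n0 + 2 * k" using nI I_even[of n] ev[of n] by blast
    have k1: "n + 2 = n0 + 2 * (k + 1)" by (simp add: k)
    have "\<nu> k \<noteq> 0" "\<nu> (k + 1) \<noteq> 0" using that I_k[of k] I_k[of "k + 1"] \<nu>0 unfolding k1 unfolding k by simp_all
    then have "B n \<noteq> 0" using up[of k] dn[of k] unfolding k by (cases "k \<ge> 0") auto
    then show ?thesis using B_nn[of n] that by simp
  qed
  have b_sq: "4 * (b n)\<^sup>2 = (of_int n + 1)\<^sup>2 + \<mu>" if "n \<in> I \<or> n + 2 \<in> I" for n
  proof -
    have "(b n)\<^sup>2 = B n" using that B_nn[of n] B_0[of n] by (auto simp: b_def)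
    then show ?thesis by (simp add: B_def)
  qed
  have lad: "Ep V (e n) = scl V (of_real (b n)) (e (n + 2)) \<and> Em V (e (n + 2)) = scl V (- of_real (b n)) (e n)" for n
  proof (cases "even (n - n0)")
    case False
    then have "e n = 0" "e (n + 2) = 0" by (simp_all add: e_def)
    then show ?thesis by (simp add: endoD[OF Ep_endo] endoD[OF Em_endo])
  next
    case True
    then obtain k where k: "n = n0 + 2 * k" using ev by blast
    have k1: "n + 2 = n0 + 2 * (k + 1)" by (simp add: k)
    have bb: "b n * b n = B n" if "n \<in> I \<or> n + 2 \<in> I"
      using b_sq[OF that] by (simp add: B_def power2_eq_square)
    have nI: "n \<in> I \<longleftrightarrow> \<nu> k \<noteq> 0" "n + 2 \<in> I \<longleftrightarrow> \<nu> (k + 1) \<noteq> 0"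
      using I_k[of k] I_k[of "k + 1"] \<nu>0 unfolding k1 unfolding k by simp_all
    have z1: "e n = 0" if "\<nu> k = 0" using nI that by (auto simp: I_def)
    have z2: "e (n + 2) = 0" if "\<nu> (k + 1) = 0" using nI that by (auto simp: I_def)
    note z = z1 z2
    show ?thesis
    proof (cases "k \<ge> 0")
      case True
      have s: "sg k = 1" "sg (k + 1) = 1" using True by (simp_all add: sg_def)
      have r: "\<nu> (k + 1) = b n * \<nu> k"
      proof (cases "n \<in> I")
        case True
        then have "(\<nu> (k + 1))\<^sup>2 = (b n * \<nu> k)\<^sup>2"
          using up[OF \<open>k \<ge> 0\<close>] bb by (simp add: k power_mult_distrib power2_eq_square)
        then show ?thesis using \<nu>n by (simp add: power2_eq_iff_nonneg b_def B_nn)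
      next
        case False
        then show ?thesis using up[OF \<open>k \<ge> 0\<close>] nI by simp
      qed
      have "Ep V (e n) = scl V (of_real (b n)) (e (n + 2))"
      proof (cases "\<nu> k = 0")
        case False
        have "Ep V (e n) = scl V (of_real (1 / \<nu> k)) (f (k + 1))"
          unfolding k e_k by (simp add: endoD[OF Ep_endo] f(3)[OF True] s)
        also have "\<dots> = scl V (of_real (1 / \<nu> k * \<nu> (k + 1))) (e (n + 2))"
          unfolding k1 by (subst f_e) (simp add: s)
        also have "1 / \<nu> k * \<nu> (k + 1) = b n" using False r by simp
        finally show ?thesis .
      next
        case zk: True
        then have "b n = 0" using nI by (simp add: b_def)
        then show ?thesis using z zk by (simp add: endoD[OF Ep_endo])
      qed
      moreover have "Em V (e (n + 2)) = scl V (- of_real (b n)) (e n)"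
      proof (cases "\<nu> (k + 1) = 0")
        case False
        then have nz: "\<nu> k \<noteq> 0" using r by auto
        have "Em V (e (n + 2)) = scl V (of_real (1 / \<nu> (k + 1) * (- B n))) (f k)"
          unfolding k1 e_k by (simp add: endoD[OF Em_endo] f4[OF True] s k)
        also have "\<dots> = scl V (of_real (1 / \<nu> (k + 1) * (- B n) * \<nu> k)) (e n)"
          unfolding k by (subst f_e) (simp add: s)
        also have "1 / \<nu> (k + 1) * (- B n) * \<nu> k = - b n" using False nz r bb nI by (auto simp: field_simps)
        finally show ?thesis by simp
      next
        case zk: True
        then have "b n = 0" using nI by (simp add: b_def)
        then show ?thesis using z zk by (simp add: endoD[OF Em_endo])
      qed
      ultimately show ?thesis by blast
    next
      case False
      then have kn: "k < 0" by simp
      have s: "sg k * sg (k + 1) = -1"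
      proof (cases "k = -1")
        case False then show ?thesis using kn by (auto simp: sg_def)
      qed (simp add: sg_def)
      have r: "\<nu> k = b n * \<nu> (k + 1)"
      proof (cases "n + 2 \<in> I")
        case True
        then have "(\<nu> k)\<^sup>2 = (b n * \<nu> (k + 1))\<^sup>2"
          using dn[OF kn] bb by (simp add: k power_mult_distrib power2_eq_square)
        then show ?thesis using \<nu>n by (simp add: power2_eq_iff_nonneg b_def B_nn)
      next
        case False
        then show ?thesis using dn[OF kn] nI by simp
      qed
      have "Em V (e (n + 2)) = scl V (- of_real (b n)) (e n)"
      proof (cases "\<nu> (k + 1) = 0")
        case False
        have "Em V (e (n + 2)) = scl V (of_real (sg (k + 1) / \<nu> (k + 1))) (f k)"
          unfolding k1 e_k by (simp add: endoD[OF Em_endo] f(5)[OF kn])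
        also have "\<dots> = scl V (of_real (sg (k + 1) / \<nu> (k + 1) * (sg k * \<nu> k))) (e n)"
          unfolding k by (subst f_e) simp
        also have "sg (k + 1) / \<nu> (k + 1) * (sg k * \<nu> k) = - b n"
        proof -
          have "sg (k + 1) / \<nu> (k + 1) * (sg k * \<nu> k) = (sg k * sg (k + 1)) * (\<nu> k / \<nu> (k + 1))" by simp
          also have "\<dots> = - b n" unfolding s using False r by simp
          finally show ?thesis .
        qed
        finally show ?thesis by simp
      next
        case zk: True
        then have "b n = 0" using nI by (simp add: b_def)
        then show ?thesis using z zk by (simp add: endoD[OF Em_endo])
      qed
      moreover have "Ep V (e n) = scl V (of_real (b n)) (e (n + 2))"
      proof (cases "\<nu> k = 0")
        case False
        then have nz: "\<nu> (k + 1) \<noteq> 0" using r by auto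
        have "Ep V (e n) = scl V (of_real (sg k / \<nu> k * (- B n))) (f (k + 1))"
          unfolding k e_k by (simp add: endoD[OF Ep_endo] f6[OF kn])
        also have "\<dots> = scl V (of_real (sg k / \<nu> k * (- B n) * (sg (k + 1) * \<nu> (k + 1)))) (e (n + 2))"
          unfolding k1 by (subst f_e) simp
        also have "sg k / \<nu> k * (- B n) * (sg (k + 1) * \<nu> (k + 1)) = b n"
        proof -
          have "sg k / \<nu> k * (- B n) * (sg (k + 1) * \<nu> (k + 1)) = (sg k * sg (k + 1)) * (- B n * \<nu> (k + 1) / \<nu> k)" by simp
          also have "\<dots> = B n * \<nu> (k + 1) / \<nu> k" unfolding s by simp
          also have "\<dots> = b n" using False nz r bb nI by (auto simp: field_simps)
          finally show ?thesis .
        qed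
        finally show ?thesis .
      next
        case zk: True
        then have "b n = 0" using nI by (simp add: b_def)
        then show ?thesis using z zk by (simp add: endoD[OF Ep_endo])
      qed
      ultimately show ?thesis by blast
    qed
  qed
  have oI: "n0 \<in> I" using I_k[of 0] f(2) by simp
  have I_down: "n - 2 \<in> I" if "n \<in> I" "n > n0" for n
  proof -
    note nI = that
    obtain k where k: "n = n0 + 2 * (k + 1)" using ev[OF I_even[OF nI(1)]] by (metis diff_add_cancel)
    have n2: "n - 2 = n0 + 2 * k" and "k \<ge> 0" using that by (simp_all add: k)
    then show ?thesis using that(1) I_k[of "k + 1"] I_k[of k] up[of k] \<nu>0[of k] \<nu>0[of "k + 1"]
      unfolding n2 unfolding k by auto
  qed
  have I_up: "n + 2 \<in> I" if "n \<in> I" "n < n0" for n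
  proof -
    note nI = that
    obtain k where k: "n = n0 + 2 * k" using ev[OF I_even[OF nI(1)]] by blast
    have n2: "n + 2 = n0 + 2 * (k + 1)" and "k < 0" using that by (simp_all add: k)
    then show ?thesis using that(1) I_k[of "k + 1"] I_k[of k] dn[of k] \<nu>0[of k] \<nu>0[of "k + 1"]
      unfolding n2 unfolding k by auto
  qed
  have b_pos: "0 < b n" if "n \<in> I" "n + 2 \<in> I" for n using B_pos[OF that] that by (simp add: b_def)
  \<comment> \<open>For finite \<open>I\<close> the coefficient vanishes above the top type
    \<open>M\<close> and below the bottom type \<open>m\<close>, which forces
    \<open>m = - M\<close>. If \<open>M = 0\<close>, the module is one-dimensional with trivial
    action. If \<open>M > 0\<close>, a step next to one of the ends has
    \<open>(M - 1)^2 + \<mu> > 0\<close> although \<open>(M + 1)^2 + \<mu> = 0\<close>, a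
    contradiction. This is the fact that nontrivial finite-dimensional modules are not
    unitary.\<close>
  have inf: "infinite I"
  proof
    assume fin: "finite I"
    define M where "M = Max I" define m where "m = Min I"
    have M: "M \<in> I" "\<And>n. n \<in> I \<Longrightarrow> n \<le> M" and m: "m \<in> I" "\<And>n. n \<in> I \<Longrightarrow> m \<le> n"
      unfolding M_def m_def using fin oI by (auto intro: Max_in Min_in)
    have "M + 2 \<notin> I" "m - 2 \<notin> I" using M m by fastforce+
    then have "B M = 0" "B (m - 2) = 0" using B_0[of M] B_0[of "m - 2"] M m by auto
    then have Bz: "(of_int M + 1)\<^sup>2 = - \<mu>" "(of_int m - 1)\<^sup>2 = - \<mu>" by (simp_all add: B_def)
    then have "(of_int (M + 1) :: real)\<^sup>2 = (of_int (m - 1))\<^sup>2" by simp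
    then have "M + 1 = m - 1 \<or> M + 1 = - (m - 1)" by (metis of_int_eq_iff of_int_minus power2_eq_iff)
    then have mM: "m = - M" using M(2)[OF m(1)] by auto
    have M0: "M \<ge> 0" using mM M(2)[OF m(1)] by simp
    show False
    proof (cases "M = 0")
      case True
      then have I0: "I = {0}" using M m mM by force
      have Ep0: "Ep V (e 0) = 0" "Em V (e 0) = 0"
        using lad[of 0] lad[of "-2"] I0 by (simp_all add: b_def)
      have ve: "v = scl V (co 0 v) (e 0)" for v
      proof -
        have "co n v = 0" if "n \<noteq> 0" for n
        proof -
          have "n \<notin> I" using that unfolding I0 by simp
          then show ?thesis by (simp add: I_def co_def)
        qed
        then have "{n. co n v \<noteq> 0} \<subseteq> {0}" by auto
        then have s: "(\<Sum>n | co n v \<noteq> 0. scl V (co n v) (e n)) = (\<Sum>n\<in>{0}. scl V (co n v) (e n))"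
          by (intro sum.mono_neutral_left) auto
        have "v = (\<Sum>n | co n v \<noteq> 0. scl V (co n v) (e n))" using supp by blast
        also note s
        finally have "v = (\<Sum>n\<in>{0}. scl V (co n v) (e n))" .
        then show ?thesis by (rule trans) simp
      qed
      have "lie V X v = 0" if "X \<in> sl2" for X v
      proof -
        have "lie V X (e 0) = 0"
          unfolding lie_expand[OF that] Hm_eq Zm_eq Ep0 lie_Y0_K_type[OF eK] by simp
        then show ?thesis by (subst ve) (simp add: endoD[OF lie_endo[OF that]])
      qed
      moreover have "kact V k v = v" if k: "k \<in> SO2" for k v
      proof -
        obtain t where t: "k = rot t" using SO2_cases[OF k] by blast
        have "kact V k (e 0) = e 0" using eK[of 0] by (simp add: K_type_iff t)
        then show ?thesis by (subst (1 2) ve) (simp add: endoD[OF k_endo[OF k]])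
      qed
      ultimately show False using nontriv by (simp add: trivial_gk_def)
    next
      case False
      then have Mp: "M > 0" using M0 by simp
      show False
      proof (cases "M > n0")
        case True
        then have "b (M - 2) > 0" "4 * (b (M - 2))\<^sup>2 = (of_int (M - 2) + 1)\<^sup>2 + \<mu>"
          using b_pos[of "M - 2"] b_sq[of "M - 2"] I_down[OF M(1)] M(1) by auto
        moreover from this(1) have "(b (M - 2))\<^sup>2 > 0" by simp
        ultimately have "(of_int (M - 2) + 1)\<^sup>2 + \<mu> > (0::real)" by linarith
        then have "(of_int M - 1)\<^sup>2 + \<mu> > (0::real)" by simp
        then have "(of_int M - 1)\<^sup>2 > (of_int M + 1 :: real)\<^sup>2" using Bz by simp
        then show False using Mp by (simp add: power2_eq_square algebra_simps)
      next
        case False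
        then have "m < n0" using mM Mp M(2)[OF oI] by simp
        then have "b m > 0" "4 * (b m)\<^sup>2 = (of_int m + 1)\<^sup>2 + \<mu>"
          using b_pos[of m] b_sq[of m] I_up[OF m(1)] m(1) by auto
        moreover from this(1) have "(b m)\<^sup>2 > 0" by simp
        ultimately have "(of_int m + 1)\<^sup>2 + \<mu> > (0::real)" by linarith
        then have "(of_int m + 1)\<^sup>2 > (of_int m - 1 :: real)\<^sup>2" using Bz by simp
        then show False using Mp mM by (simp add: power2_eq_square algebra_simps)
      qed
    qed
  qed
  have hsq: "(hp v)\<^sup>2 = (\<Sum>n | co n v \<noteq> 0. (cmod (co n v))\<^sup>2)" for v
  proof -
    have "complex_of_real ((hp v)\<^sup>2) = cnj (ip v v)" unfolding ip_self by simp
    also have "ip v v = cnj (ip v v)" by (rule ip_cnj)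
    also have "cnj (cnj (ip v v)) = ip v v" by simp
    also have "ip v v = (\<Sum>n | co n v \<noteq> 0. cnj (co n v) * ip v (e n))"
    proof -
      have s: "ip v (sum h S) = (\<Sum>x\<in>S. ip v (h x))" for h :: "int \<Rightarrow> 'v" and S
        by (induction S rule: infinite_finite_induct) (simp_all add: ip_simps)
      have "ip v v = ip v (\<Sum>n | co n v \<noteq> 0. scl V (co n v) (e n))" using supp[of v] by simp
      then show ?thesis by (simp add: s ip_simps)
    qed
    also have "\<dots> = of_real (\<Sum>n | co n v \<noteq> 0. (cmod (co n v))\<^sup>2)"
      unfolding of_real_sum complex_norm_square by (simp add: co_def mult.commute)
    finally show ?thesis unfolding of_real_eq_iff .
  qed
  have "umod V e co b I \<mu> n0 hp \<pi>"
  proof (intro umod.intro umod_axioms.intro)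
    show "gkmod V" by (rule gkmod_axioms)
    show "e n \<in> K_type V n" for n by (rule eK)
    show "e n = 0" if "n \<notin> I" for n using that by (simp add: I_def)
    show "functional V (co n)" for n by (rule co_lin)
    show "co m (e n) = (if m = n \<and> n \<in> I then 1 else 0)" for m n by (rule co_e)
    show "finite {n. co n v \<noteq> 0}" for v using supp by blast
    show "v = (\<Sum>n | co n v \<noteq> 0. scl V (co n v) (e n))" for v using supp by blast
    show "co n v = 0" if "n \<notin> I" for n v using that by (simp add: I_def co_def)
    show "Ep V (e n) = scl V (of_real (b n)) (e (n + 2))" for n using lad by blast
    show "Em V (e (n + 2)) = scl V (- of_real (b n)) (e n)" for n using lad by blast
    show "0 \<le> b n" for n using B_nn by (simp add: b_def)
    show "0 < b n" if "n \<in> I" "n + 2 \<in> I" for n by (rule b_pos[OF that])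
    show "4 * (b n)\<^sup>2 = (of_int n + 1)\<^sup>2 + \<mu>" if "n \<in> I \<or> n + 2 \<in> I" for n by (rule b_sq[OF that])
    show "n0 \<in> I" by (rule oI)
    show "even (n - n0)" if "n \<in> I" for n by (rule I_even[OF that])
    show "n - 2 \<in> I" if "n \<in> I" "n > n0" for n by (rule I_down[OF that])
    show "n + 2 \<in> I" if "n \<in> I" "n < n0" for n by (rule I_up[OF that])
    show "infinite I" by (rule inf)
    show "is_norm V hp" by (rule N.nm)
    show "(hp v)\<^sup>2 = (\<Sum>n | co n v \<noteq> 0. (cmod (co n v))\<^sup>2)" for v by (rule hsq)
    show "globalization V hp \<pi>" by (rule gl)
    show "nrm N.E (\<pi> g A) = nrm N.E A" if "g \<in> SL2" "A \<in> pts N.E" for g A by (rule hp_unit[OF that])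
  qed
  then show ?thesis by blast
qed

end

section \<open>Matrix coefficients along the diagonal subgroup\<close>

lemma has_vector_derivative_quotient:
  fixes f :: "real \<Rightarrow> complex"
  assumes "((\<lambda>t. (f t - f 0) / of_real t) \<longlongrightarrow> f') (at 0)"
  shows "(f has_vector_derivative f') (at 0)"
proof -
  have "((\<lambda>t. norm ((f t - f 0) / of_real t - f')) \<longlongrightarrow> 0) (at 0)"
    using assms by (simp add: tendsto_norm_zero_iff LIM_zero_iff)
  moreover have "\<forall>\<^sub>F t in at 0. norm ((f t - f 0) / of_real t - f') = norm (f (0 + t) - f 0 - t *\<^sub>R f') / norm t"
  proof (rule eventually_at_filter[THEN iffD2], rule always_eventually, intro allI impI)
    fix t :: real assume "t \<noteq> 0"
    then have "(f t - f 0) / of_real t - f' = (f (0 + t) - f 0 - t *\<^sub>R f') / of_real t"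
      by (simp add: diff_divide_distrib scaleR_conv_of_real)
    then show "norm ((f t - f 0) / of_real t - f') = norm (f (0 + t) - f 0 - t *\<^sub>R f') / norm t"
      by (simp add: norm_divide)
  qed
  ultimately have "((\<lambda>t. norm (f (0 + t) - f 0 - t *\<^sub>R f') / norm t) \<longlongrightarrow> 0) (at 0)"
    by (rule Lim_transform_eventually)
  then show ?thesis
    unfolding has_vector_derivative_def has_derivative_at by (simp add: bounded_linear_scaleR_left)
qed

lemma has_vector_derivative_at_shift:
  fixes f :: "real \<Rightarrow> complex"
  assumes "((\<lambda>h. f (t + h)) has_vector_derivative f') (at 0)"
  shows "(f has_vector_derivative f') (at t)"
proof -
  have g: "((\<lambda>h. f (t + h)) has_vector_derivative f') (at (t - t))" using assms by simp
  have "((\<lambda>s. s - t) has_vector_derivative 1) (at t)" by (auto intro!: derivative_eq_intros)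
  from vector_diff_chain_at[OF this g] show ?thesis by (simp add: o_def)
qed

lemma cmod_sq_deriv:
  fixes f :: "real \<Rightarrow> complex"
  assumes "(f has_vector_derivative f') (at t)"
  shows "((\<lambda>t. (cmod (f t))\<^sup>2) has_real_derivative 2 * inner (f t) f') (at t)"
proof -
  have "((\<lambda>t. inner (f t) (f t)) has_derivative (\<lambda>h. inner (f t) (h *\<^sub>R f') + inner (h *\<^sub>R f') (f t))) (at t)"
    using assms unfolding has_vector_derivative_def by (intro has_derivative_inner)
  then show ?thesis
    by (simp add: power2_norm_eq_inner has_field_derivative_def inner_commute mult_commute_abs algebra_simps)
qed

lemma norm_bound_power:
  fixes f :: "real \<Rightarrow> complex"
  assumes f: "\<And>t. (f has_vector_derivative f' t) (at t)" "f 0 = 0"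
    and K: "\<And>t. 0 \<le> t \<Longrightarrow> t \<le> 1 \<Longrightarrow> cmod (f' t) \<le> K * t ^ k" "K \<ge> 0" and t: "0 \<le> t" "t \<le> 1"
  shows "cmod (f t) \<le> K * t ^ Suc k"
proof -
  have "cmod (f t - f 0) \<le> (K * t ^ k) * norm (t - 0)"
  proof (rule differentiable_bound)
    show "convex {0..t}" by simp
    show "(f has_derivative (\<lambda>h. h *\<^sub>R f' x)) (at x within {0..t})" for x
      using f(1) has_derivative_at_withinI unfolding has_vector_derivative_def by blast
    show "onorm (\<lambda>h. h *\<^sub>R f' x) \<le> K * t ^ k" if "x \<in> {0..t}" for x
    proof -
      have "onorm (\<lambda>h. h *\<^sub>R f' x) \<le> cmod (f' x)" by (rule onorm_le) (simp add: mult.commute)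
      also have "\<dots> \<le> K * x ^ k" using K(1)[of x] that t by simp
      also have "\<dots> \<le> K * t ^ k" using K(2) that by (intro mult_left_mono power_mono) auto
      finally show ?thesis .
    qed
  qed (use t in auto)
  then show ?thesis using f(2) t by (simp add: mult_ac)
qed

text \<open>The singular point \<open>t = 0\<close> is regular, so a solution that is flat there vanishes.\<close>

lemma ladder_system_unique:
  fixes d :: "int \<Rightarrow> real \<Rightarrow> complex" and b :: "int \<Rightarrow> real" and n :: int
  assumes d: "\<And>m t. (d m has_vector_derivative of_real (b m) * d (m+2) t - of_real (b (m-2)) * d (m-2) t) (at t)"
    and e: "\<And>m t. of_int n * d m t = of_real (cosh (2*t)) * of_int m * d m t
       + of_real (sinh (2*t)) * (of_real (b m) * d (m+2) t + of_real (b (m-2)) * d (m-2) t)"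
    and z: "\<And>m. d m 0 = 0" and t: "0 \<le> t"
  shows "d m t = 0"
proof (cases "t = 0")
  case False
  then have t0: "t > 0" using t by simp
  have cont: "continuous_on UNIV (d m)" for m
    using d by (meson UNIV_I continuous_at_imp_continuous_on has_vector_derivative_continuous)
  \<comment> \<open>The derivative of \<open>d m\<close> involves only its neighbours, with constant
    coefficients, so a bound by \<open>s^k\<close> for all types improves to \<open>s^(k+1)\<close>;
    every \<open>d m\<close> vanishes to infinite order at \<open>0\<close>.\<close>
  have flat: "\<exists>K\<ge>0. \<forall>s. 0 \<le> s \<longrightarrow> s \<le> 1 \<longrightarrow> cmod (d m s) \<le> K * s ^ k" for k m
  proof (induction k arbitrary: m)
    case 0
    have "bounded (d m ` {0..1})"
      by (intro compact_imp_bounded compact_continuous_image continuous_on_subset[OF cont]) auto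
    then obtain K where "\<forall>x\<in>d m ` {0..1}. norm x \<le> K" unfolding bounded_iff by blast
    then show ?case by (intro exI[of _ "max K 0"]) (auto simp: le_max_iff_disj)
  next
    case (Suc k)
    obtain K1 where K1: "K1 \<ge> 0" "\<And>s. 0 \<le> s \<Longrightarrow> s \<le> 1 \<Longrightarrow> cmod (d (m+2) s) \<le> K1 * s ^ k" using Suc by blast
    obtain K2 where K2: "K2 \<ge> 0" "\<And>s. 0 \<le> s \<Longrightarrow> s \<le> 1 \<Longrightarrow> cmod (d (m-2) s) \<le> K2 * s ^ k" using Suc by blast
    let ?K = "\<bar>b m\<bar> * K1 + \<bar>b (m-2)\<bar> * K2"
    have "cmod (d m s) \<le> ?K * s ^ Suc k" if "0 \<le> s" "s \<le> 1" for s
    proof (rule norm_bound_power[OF d z])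
      fix s :: real assume s: "0 \<le> s" "s \<le> 1"
      have "cmod (of_real (b m) * d (m+2) s - of_real (b (m-2)) * d (m-2) s)
        \<le> \<bar>b m\<bar> * cmod (d (m+2) s) + \<bar>b (m-2)\<bar> * cmod (d (m-2) s)"
        by (rule order_trans[OF norm_triangle_ineq4]) (simp add: norm_mult)
      also have "\<dots> \<le> \<bar>b m\<bar> * (K1 * s ^ k) + \<bar>b (m-2)\<bar> * (K2 * s ^ k)"
        using K1(2) K2(2) s by (intro add_mono mult_left_mono) auto
      finally show "cmod (of_real (b m) * d (m+2) s - of_real (b (m-2)) * d (m-2) s) \<le> ?K * s ^ k"
        by (simp add: algebra_simps)
    qed (use K1 K2 that in auto)
    then show ?case using K1 K2 by (intro exI[of _ ?K]) auto
  qed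
  \<comment> \<open>The algebraic relation \<open>e\<close> eliminates the outer neighbours of the
    pair \<open>m\<close>, \<open>m + 2\<close>, and the cross terms in the derivative of
    \<open>D\<close> cancel. What is left is a closed scalar inequality whose coefficients \<alpha>
    have a simple pole at \<open>0\<close>.\<close>
  define D where "D s = (cmod (d m s))\<^sup>2 + (cmod (d (m+2) s))\<^sup>2" for s
  define \<alpha> where "\<alpha> m s = (of_int n - of_int m * cosh (2 * s)) / sinh (2 * s)" for m :: int and s :: real
  have D': "(D has_real_derivative 2 * (\<alpha> (m+2) s * (cmod (d (m+2) s))\<^sup>2 - \<alpha> m s * (cmod (d m s))\<^sup>2)) (at s)" if s: "s > 0" for s
  proof -
    have S: "sinh (2 * s) \<noteq> 0" using s by simp
    have A: "of_real (\<alpha> m s) * d m s = of_real (b m) * d (m+2) s + of_real (b (m-2)) * d (m-2) s" for m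
      using e[of m s] S unfolding \<alpha>_def
      by (simp add: field_simps)
    have "2 * inner (d m s) (of_real (b m) * d (m+2) s - of_real (b (m-2)) * d (m-2) s)
       = 2 * inner (d m s) (of_real (2 * b m) * d (m+2) s - of_real (\<alpha> m s) * d m s)"
      unfolding A by (simp add: algebra_simps)
    also have "\<dots> = 4 * b m * inner (d m s) (d (m+2) s) - 2 * \<alpha> m s * (cmod (d m s))\<^sup>2"
      by (simp add: inner_diff_right power2_norm_eq_inner del: of_real_mult flip: scaleR_conv_of_real)
    finally have 1: "2 * inner (d m s) (of_real (b m) * d (m+2) s - of_real (b (m-2)) * d (m-2) s)
       = 4 * b m * inner (d m s) (d (m+2) s) - 2 * \<alpha> m s * (cmod (d m s))\<^sup>2" .
    have "2 * inner (d (m+2) s) (of_real (b (m+2)) * d (m+2+2) s - of_real (b (m+2-2)) * d (m+2-2) s)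
       = 2 * inner (d (m+2) s) (of_real (\<alpha> (m+2) s) * d (m+2) s - of_real (2 * b m) * d m s)"
      unfolding A by (simp add: algebra_simps)
    also have "\<dots> = 2 * \<alpha> (m+2) s * (cmod (d (m+2) s))\<^sup>2 - 4 * b m * inner (d m s) (d (m+2) s)"
      by (simp add: inner_diff_right power2_norm_eq_inner inner_commute del: of_real_mult flip: scaleR_conv_of_real)
    finally have 2: "2 * inner (d (m+2) s) (of_real (b (m+2)) * d (m+2+2) s - of_real (b (m+2-2)) * d (m+2-2) s)
       = 2 * \<alpha> (m+2) s * (cmod (d (m+2) s))\<^sup>2 - 4 * b m * inner (d m s) (d (m+2) s)" .
    show ?thesis unfolding D_def
      using DERIV_add[OF cmod_sq_deriv[OF d[of m s]] cmod_sq_deriv[OF d[of "m+2" s]], unfolded 1 2]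
      by (simp add: algebra_simps)
  qed
  \<comment> \<open>Chosen so that \<open>2 |\<alpha>| <= K / s\<close> on all of
    \<open>(0, t]\<close>, using \<open>sinh (2 s) >= 2 s\<close>.\<close>
  define K :: nat where "K = nat \<lceil>(\<bar>of_int n\<bar> + \<bar>of_int m\<bar> + 2) * cosh (2*t)\<rceil> + 1"
  have K: "real K \<ge> (\<bar>of_int n\<bar> + \<bar>of_int m\<bar> + 2) * cosh (2*t)" "K \<ge> 1"
    unfolding K_def by linarith+
  have \<alpha>: "2 * \<bar>\<alpha> m' s\<bar> \<le> real K / s" if s: "0 < s" "s \<le> t" and m': "m' = m \<or> m' = m + 2" for m' s
  proof -
    have sh: "sinh (2 * s) \<ge> 2 * s"
    proof -
      have "sinh 0 - 0 \<le> sinh (2 * s) - 2 * s"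
      proof (rule DERIV_nonneg_imp_nondecreasing[where f = "\<lambda>x. sinh x - x"])
        fix x :: real
        show "\<exists>y. ((\<lambda>x. sinh x - x) has_real_derivative y) (at x) \<and> 0 \<le> y"
          by (rule exI[of _ "cosh x - 1"]) (auto intro!: derivative_eq_intros simp: cosh_real_ge_1)
      qed (use s in simp)
      then show ?thesis by simp
    qed
    have c1: "cosh (2 * s) \<le> cosh (2*t)" "1 \<le> cosh (2 * s)"
      using s by (simp_all add: cosh_real_nonneg_le_iff cosh_real_ge_1)
    have "\<bar>of_int n - of_int m' * cosh (2 * s)\<bar> \<le> \<bar>of_int n\<bar> + \<bar>of_int m'\<bar> * cosh (2 * s)"
      by (rule order_trans[OF abs_triangle_ineq4]) (simp add: abs_mult)
    also have "\<dots> \<le> \<bar>of_int n\<bar> * cosh (2*t) + (\<bar>of_int m\<bar> + 2) * cosh (2*t)"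
      using c1 m' by (intro add_mono mult_mono) (auto simp: mult_le_cancel_left1)
    also have "\<dots> \<le> real K" using K(1) by (simp add: algebra_simps)
    finally have "\<bar>\<alpha> m' s\<bar> \<le> real K / sinh (2 * s)"
      using s by (simp add: \<alpha>_def abs_divide divide_right_mono)
    also have "\<dots> \<le> real K / (2 * s)" using sh s by (intro divide_left_mono) auto
    finally show ?thesis by simp
  qed
  have D0: "D s \<ge> 0" for s by (simp add: D_def)
  \<comment> \<open>\<open>D' <= (K / s) D\<close> makes \<open>D / s^K\<close> nonincreasing,
    whereas flatness of order \<open>K\<close> for both components makes it tend to \<open>0\<close>
    at \<open>0\<close>.\<close>
  define G where "G s = D s / s ^ K" for s
  have mono: "G t \<le> G s" if s: "0 < s" "s \<le> t" for s
  proof (rule DERIV_nonpos_imp_nonincreasing[OF s(2)])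
    fix x assume x: "s \<le> x" "x \<le> t"
    then have x0: "x > 0" using s by simp
    let ?D' = "2 * (\<alpha> (m+2) x * (cmod (d (m+2) x))\<^sup>2 - \<alpha> m x * (cmod (d m x))\<^sup>2)"
    have "?D' \<le> (2 * \<bar>\<alpha> (m+2) x\<bar>) * (cmod (d (m+2) x))\<^sup>2 + (2 * \<bar>\<alpha> m x\<bar>) * (cmod (d m x))\<^sup>2"
    proof -
      have "\<alpha> (m+2) x * (cmod (d (m+2) x))\<^sup>2 \<le> \<bar>\<alpha> (m+2) x\<bar> * (cmod (d (m+2) x))\<^sup>2"
        "- \<alpha> m x * (cmod (d m x))\<^sup>2 \<le> \<bar>\<alpha> m x\<bar> * (cmod (d m x))\<^sup>2"
        by (intro mult_right_mono; simp)+
      then show ?thesis by simp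
    qed
    also have "\<dots> \<le> real K / x * (cmod (d (m+2) x))\<^sup>2 + real K / x * (cmod (d m x))\<^sup>2"
      using \<alpha>[OF x0 x(2)] by (intro add_mono mult_right_mono) auto
    also have "\<dots> = real K / x * D x" by (simp add: D_def algebra_simps)
    finally have le: "?D' \<le> real K / x * D x" .
    have "(G has_real_derivative (?D' * x ^ K - D x * (real K * x ^ (K - 1))) / (x ^ K * x ^ K)) (at x)"
      unfolding G_def using x0 by (auto intro!: derivative_eq_intros D'[OF x0])
    moreover have "?D' * x ^ K - D x * (real K * x ^ (K - 1)) \<le> 0"
    proof -
      have "x ^ K = x * x ^ (K - 1)" using K(2) by (metis power_eq_if not_one_le_zero)
      then have "real K / x * D x * x ^ K = D x * (real K * x ^ (K - 1))" using x0 by simp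
      moreover have "?D' * x ^ K \<le> real K / x * D x * x ^ K" using le x0 by (intro mult_right_mono) auto
      ultimately show ?thesis by simp
    qed
    ultimately show "\<exists>y. (G has_real_derivative y) (at x) \<and> y \<le> 0"
      using x0 by (intro exI conjI) (auto intro!: divide_nonpos_pos)
  qed
  obtain K1 where K1: "K1 \<ge> 0" "\<And>s. 0 \<le> s \<Longrightarrow> s \<le> 1 \<Longrightarrow> cmod (d m s) \<le> K1 * s ^ K" using flat by blast
  obtain K2 where K2: "K2 \<ge> 0" "\<And>s. 0 \<le> s \<Longrightarrow> s \<le> 1 \<Longrightarrow> cmod (d (m+2) s) \<le> K2 * s ^ K" using flat by blast
  have Gs: "G s \<le> (K1\<^sup>2 + K2\<^sup>2) * s" if s: "0 < s" "s \<le> 1" for s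
  proof -
    have "D s \<le> (K1 * s ^ K)\<^sup>2 + (K2 * s ^ K)\<^sup>2"
      unfolding D_def using K1 K2 s by (intro add_mono power_mono) auto
    also have "\<dots> = (K1\<^sup>2 + K2\<^sup>2) * s ^ K * s ^ K" by (simp add: power_mult_distrib power2_eq_square algebra_simps)
    finally have "G s \<le> (K1\<^sup>2 + K2\<^sup>2) * s ^ K" using s by (simp add: G_def divide_le_eq)
    also have "s ^ K \<le> s" using power_decreasing[of 1 K s] K(2) s by simp
    finally show ?thesis by (simp add: mult_left_mono)
  qed
  have "G t \<le> (K1\<^sup>2 + K2\<^sup>2) * s" if "0 < s" "s \<le> min 1 t" for s
    using mono[of s] Gs[of s] that by simp
  then have ev: "\<forall>\<^sub>F s in at_right 0. G t \<le> (K1\<^sup>2 + K2\<^sup>2) * s"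
    using t0 by (auto simp: eventually_at_right intro!: exI[of _ "min 1 t"])
  have "((\<lambda>s. (K1\<^sup>2 + K2\<^sup>2) * s) \<longlongrightarrow> (K1\<^sup>2 + K2\<^sup>2) * 0) (at_right 0)"
    by (intro tendsto_intros)
  from tendsto_lowerbound[OF this ev] have "G t \<le> 0" by simp
  then have "D t \<le> 0" using zero_less_power[OF t0, of K] unfolding G_def divide_le_0_iff by linarith
  then have "(cmod (d m t))\<^sup>2 \<le> 0" unfolding D_def by (smt (verit) zero_le_power2)
  then show ?thesis by simp
qed (simp add: z)

section \<open>K-bounded norms\<close>

definition ang :: "nat \<Rightarrow> nat \<Rightarrow> real" where "ang L l = 2 * pi * real l / real L"

text \<open>The discrete form of orthogonality of characters. On a vector with finitely many
  K-types, the sum over the \<open>L\<close>-th roots of unity agrees with the Haar average as soon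
  as \<open>L\<close> exceeds the frequencies that occur.\<close>

lemma sum_roots_of_unity:
  assumes "L > 0"
  shows "(\<Sum>l<L. cis (of_int n * ang L l)) = (if int L dvd n then of_nat L else 0)"
proof -
  define \<omega> where "\<omega> = cis (of_int n * (2 * pi / real L))"
  have pw: "cis (of_int n * ang L l) = \<omega> ^ l" for l
    unfolding \<omega>_def Complex.DeMoivre ang_def by (rule arg_cong[where f = cis]) simp
  have wL: "\<omega> ^ L = 1"
  proof -
    have "\<omega> ^ L = cis (2 * pi * of_int n)"
      unfolding \<omega>_def Complex.DeMoivre by (rule arg_cong[where f = cis]) (use assms in simp)
    then show ?thesis by (simp add: cis_multiple_2pi)
  qed
  show ?thesis
  proof (cases "int L dvd n")
    case True
    then obtain k where k: "n = int L * k" by (elim dvdE)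
    have "\<omega> = cis (2 * pi * of_int k)"
      unfolding \<omega>_def k by (rule arg_cong[where f = cis]) (use assms in simp)
    then have "\<omega> = 1" by (simp add: cis_multiple_2pi)
    then show ?thesis using True unfolding pw by simp
  next
    case False
    have "\<omega> \<noteq> 1"
    proof
      assume "\<omega> = 1"
      then have "cos (of_int n * (2 * pi / real L)) = 1" by (simp add: \<omega>_def complex_eq_iff)
      then obtain k :: int where "of_int n * (2 * pi / real L) = of_int k * 2 * pi"
        unfolding cos_one_2pi_int by blast
      then have "real_of_int n = real L * of_int k" using assms by (simp add: field_simps)
      then have "n = int L * k" by (metis of_int_eq_iff of_int_mult of_int_of_nat_eq)
      then show False using False by simp
    qed
    then show ?thesis using False wL unfolding pw by (simp add: geometric_sum)
  qed
qed

context umod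
begin

lemma co_exp': "finite F \<Longrightarrow> {n. co n v \<noteq> 0} \<subseteq> F \<Longrightarrow> v = (\<Sum>n\<in>F. scl V (co n v) (e n))"
  by (rule trans[OF co_exp sum.mono_neutral_left]) auto

lemma v_eqI: "(\<And>n. co n v = co n w) \<Longrightarrow> v = w"
  by (rule trans[OF co_exp trans[OF _ co_exp[symmetric]]]) simp

lemma v_eq_iff: "v = w \<longleftrightarrow> (\<forall>n. co n v = co n w)" using v_eqI by blast

lemmas co_simps = functionalD[OF co_lin]

definition vec :: "int set \<Rightarrow> (int \<Rightarrow> complex) \<Rightarrow> 'v" where
  "vec F a = (\<Sum>n\<in>F. scl V (a n) (e n))"

lemma co_vec: "finite F \<Longrightarrow> co m (vec F a) = (if m \<in> F \<and> m \<in> I then a m else 0)"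
proof -
  assume F: "finite F"
  have "co m (vec F a) = (\<Sum>x\<in>F. if x = m then (if m \<in> I then a m else 0) else 0)"
    unfolding vec_def co_simps by (rule sum.cong) (auto simp: co_e)
  then show ?thesis using F by simp
qed

text \<open>A diagonal multiplier; the action of K, the Fejer means and the Sobolev operators are
  all of this form.\<close>

definition mult :: "(int \<Rightarrow> complex) \<Rightarrow> 'v \<Rightarrow> 'v" where
  "mult c v = vec {n. co n v \<noteq> 0} (\<lambda>n. c n * co n v)"

lemma co_mult [simp]: "co n (mult c v) = c n * co n v"
  unfolding mult_def by (simp add: co_vec co_fin) (use co_out in auto)

lemma mult_endo: "endo V (mult c)"
  by (rule endoI[OF V]) (simp_all add: v_eq_iff co_simps algebra_simps)

lemma mult_e: "mult c (e n) = scl V (c n) (e n)"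
  by (simp add: v_eq_iff co_simps co_e)

lemma k_e: "kact V (rot t) (e n) = scl V (cis (of_int n * t)) (e n)"
  using e_K[of n] by (simp add: K_type_iff)

lemma k_mult: "kact V (rot t) v = mult (\<lambda>n. cis (of_int n * t)) v"
proof -
  have "kact V (rot t) v = kact V (rot t) (\<Sum>n | co n v \<noteq> 0. scl V (co n v) (e n))"
    by (rule arg_cong[OF co_exp])
  also have "\<dots> = mult (\<lambda>n. cis (of_int n * t)) v"
    by (simp add: endoD[OF k_endo] k_e mult_def vec_def mult.commute)
  finally show ?thesis .
qed

lemma co_k [simp]: "co n (kact V (rot t) v) = cis (of_int n * t) * co n v"
  by (simp add: k_mult)

lemma lie_Y0_e: "lie V Y0 (e n) = scl V (\<i> * of_int n) (e n)"
  by (rule lie_Y0_K_type[OF e_K])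

lemma lie_Hm_e: "lie V Hm (e n) = scl V (of_real (b n)) (e (n + 2)) - scl V (of_real (b (n - 2))) (e (n - 2))"
  using Em_e[of "n - 2"] by (simp add: Hm_eq Ep_e)

lemma lie_Zm_e: "lie V Zm (e n) = scl V \<i> (scl V (of_real (b n)) (e (n + 2)) + scl V (of_real (b (n - 2))) (e (n - 2)))"
  using Em_e[of "n - 2"] by (simp add: Zm_eq Ep_e)

end

section \<open>Averages over K in a K-bounded norm\<close>

locale knorm = umod V e co b I \<mu> o' hp \<pi>
  for V :: "('v::ab_group_add) gk" and e co b I \<mu> o' hp \<pi> +
  fixes p :: "'v \<Rightarrow> real" and C :: real
  assumes p_norm: "is_norm V p" and p_K: "k \<in> SO2 \<Longrightarrow> p (kact V k v) \<le> C * p v"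
begin

sublocale N: normed_gk V p by (intro normed_gk.intro V p_norm)

lemma C_ge: "C \<ge> 1"
proof -
  have "e o' \<noteq> 0" using co_e[of o' o'] o_I by (auto simp: co_simps)
  then have "p (e o') > 0" using N.p_nonneg[of "e o'"] N.p_eq_0[of "e o'"] by linarith
  moreover have "p (e o') \<le> C * p (e o')" using p_K[OF rot_SO2, of 0 "e o'"] by (simp add: k_one)
  ultimately show ?thesis by simp
qed

lemma p_vec: "p (vec F a) \<le> (\<Sum>n\<in>F. cmod (a n) * p (e n))"
  unfolding vec_def by (rule order_trans[OF N.p_sum]) simp

text \<open>A weighted sum of rotated copies is a convolution on K: it acts by the discrete Fourier
  coefficients of the weight, and by the triangle inequality it costs at most the mean of
  \<open>|f|\<close>.\<close>

lemma K_average: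
  fixes f :: "nat \<Rightarrow> complex"
  assumes L: "L > 0"
  obtains A where
    "\<And>n. co n A = co n v * ((\<Sum>l<L. f l * cis (of_int n * ang L l)) / of_nat L)"
    "p A \<le> (\<Sum>l<L. cmod (f l)) / real L * (C * p v)"
proof
  define A where "A = scl V (1 / of_nat L) (\<Sum>l<L. scl V (f l) (kact V (rot (ang L l)) v))"
  show "co n A = co n v * ((\<Sum>l<L. f l * cis (of_int n * ang L l)) / of_nat L)" for n
    by (simp add: A_def co_simps sum_distrib_left sum_divide_distrib mult_ac)
  have "p A = (1 / real L) * p (\<Sum>l<L. scl V (f l) (kact V (rot (ang L l)) v))"
    by (simp add: A_def norm_divide)
  also have "\<dots> \<le> (1 / real L) * (\<Sum>l<L. p (scl V (f l) (kact V (rot (ang L l)) v)))"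
    by (intro mult_left_mono N.p_sum) auto
  also have "\<dots> \<le> (1 / real L) * (\<Sum>l<L. cmod (f l) * (C * p v))"
    by (intro mult_left_mono sum_mono) (simp_all add: mult_left_mono p_K)
  also have "\<dots> = (\<Sum>l<L. cmod (f l)) / real L * (C * p v)" by (simp add: sum_distrib_right)
  finally show "p A \<le> (\<Sum>l<L. cmod (f l)) / real L * (C * p v)" .
qed

lemma large_modulus:
  assumes "finite S" obtains L :: nat where "L > M" "\<And>n. n \<in> S \<Longrightarrow> int L > \<bar>n\<bar>"
proof -
  have "\<exists>L::nat. L > M \<and> (\<forall>n\<in>S. int L > \<bar>n\<bar>)" using assms
  proof (induction S rule: finite_induct)
    case empty show ?case by (auto intro: exI[of _ "Suc M"])
  next
    case (insert x S)
    then obtain L where L: "L > M" "\<forall>n\<in>S. int L > \<bar>n\<bar>" by blast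
    show ?case by (rule exI[of _ "L + nat \<bar>x\<bar> + 1"]) (use L in force)
  qed
  then show thesis using that by blast
qed

text \<open>Averaging against the conjugate character projects onto the K-type \<open>m\<close>, and
  the weight has modulus \<open>1\<close>.\<close>

lemma co_p_bound: "cmod (co m v) * p (e m) \<le> C * p v"
proof -
  obtain L where L: "L > 0" "\<And>n. n \<in> (\<lambda>n. n - m) ` {n. co n v \<noteq> 0} \<Longrightarrow> int L > \<bar>n\<bar>"
    using large_modulus[of "(\<lambda>n. n - m) ` {n. co n v \<noteq> 0}" 0] co_fin by blast
  obtain A where A: "\<And>n. co n A = co n v * ((\<Sum>l<L. cis (- of_int m * ang L l) * cis (of_int n * ang L l)) / of_nat L)"
    "p A \<le> (\<Sum>l<L. cmod (cis (- of_int m * ang L l))) / real L * (C * p v)"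
    using K_average[OF L(1), of v "\<lambda>l. cis (- of_int m * ang L l)"] by blast
  have "A = scl V (co m v) (e m)"
  proof (rule v_eqI)
    fix n
    have "(\<Sum>l<L. cis (- of_int m * ang L l) * cis (of_int n * ang L l))
       = (\<Sum>l<L. cis (of_int (n - m) * ang L l))"
      by (simp add: cis_mult algebra_simps)
    then have c: "co n A = co n v * ((if int L dvd n - m then of_nat L else 0) / of_nat L)"
      using A(1)[of n] sum_roots_of_unity[OF L(1), of "n - m"] by simp
    show "co n A = co n (scl V (co m v) (e m))"
    proof (cases "co n v = 0 \<or> n = m")
      case True
      then show ?thesis using c L(1) co_out[of m v] by (auto simp: co_simps co_e)
    next
      case False
      then have "\<not> int L dvd n - m" using L(2)[of "n - m"] dvd_imp_le_int[of "n - m" "int L"] by force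
      then show ?thesis using c False by (simp add: co_simps co_e)
    qed
  qed
  then show ?thesis using A(2) L(1) by simp
qed

lemma p_e_pos: "m \<in> I \<Longrightarrow> p (e m) > 0"
  using N.p_nonneg[of "e m"] N.p_eq_0[of "e m"] co_e[of m m] by (auto simp: co_simps less_le)

lemma co_bfun: "N.bfun (co m)"
  unfolding N.bfun_def
proof (intro conjI co_lin)
  show "\<exists>C. \<forall>v. cmod (co m v) \<le> C * p v"
  proof (cases "m \<in> I")
    case True
    then show ?thesis using co_p_bound[of m] p_e_pos[OF True]
      by (intro exI[of _ "C / p (e m)"]) (simp add: field_simps)
  qed (auto simp: co_out intro: exI[of _ 0])
qed

text \<open>Fejer means: they are uniformly bounded and recover a vector from its coefficients, so a Cauchy
  sequence with vanishing coefficients has norm limit \<open>0\<close>.\<close>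

definition wt :: "nat \<Rightarrow> int \<Rightarrow> real" where
  "wt N n = real (card {x \<in> {..<N} \<times> {..<N}. int (snd x) = int (fst x) + n}) / real N"

text \<open>Counting pairs at distance \<open>n\<close> is how the triangular weight arises from the
  square of a Dirichlet kernel; the count is \<open>N - |n|\<close>, or \<open>0\<close> once
  \<open>|n|\<close> reaches \<open>N\<close>.\<close>

lemma wt_bounds: assumes "N > 0" shows "\<bar>wt N n - 1\<bar> \<le> \<bar>of_int n\<bar> / real N" and "\<bar>n\<bar> \<ge> int N \<Longrightarrow> wt N n = 0"
proof -
  let ?S = "{x \<in> {..<N} \<times> {..<N}. int (snd x) = int (fst x) + n}"
  have S: "?S = (\<lambda>j. (j, nat (int j + n))) ` {j. j < N \<and> 0 \<le> int j + n \<and> int j + n < int N}"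
    by (auto simp: image_iff)
  have c: "card ?S = card {j. j < N \<and> 0 \<le> int j + n \<and> int j + n < int N}"
    unfolding S by (rule card_image) (auto simp: inj_on_def)
  have sub: "{nat \<bar>n\<bar>..<N} \<subseteq> {j. j < N \<and> 0 \<le> int j + n \<and> int j + n < int N} \<or>
     {..<N - nat \<bar>n\<bar>} \<subseteq> {j. j < N \<and> 0 \<le> int j + n \<and> int j + n < int N}"
    by (cases "n \<ge> 0") auto
  have fin: "finite {j. j < N \<and> 0 \<le> int j + n \<and> int j + n < int N}" by auto
  have "card ?S \<ge> N - nat \<bar>n\<bar>"
    unfolding c using sub card_mono[OF fin, of "{nat \<bar>n\<bar>..<N}"] card_mono[OF fin, of "{..<N - nat \<bar>n\<bar>}"]
    by (auto simp del: card_Collect_le_nat)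
  moreover have "card ?S \<le> N" unfolding c
    using card_mono[of "{..<N}" "{j. j < N \<and> 0 \<le> int j + n \<and> int j + n < int N}"] by auto
  ultimately have "\<bar>real (card ?S) - real N\<bar> \<le> \<bar>of_int n\<bar>" by linarith
  then have "\<bar>real (card ?S) - real N\<bar> / real N \<le> \<bar>of_int n\<bar> / real N"
    by (rule divide_right_mono) simp
  moreover have "wt N n - 1 = (real (card ?S) - real N) / real N"
    using assms by (simp add: wt_def diff_divide_distrib)
  ultimately show "\<bar>wt N n - 1\<bar> \<le> \<bar>of_int n\<bar> / real N" by (simp add: abs_divide)
  assume "\<bar>n\<bar> \<ge> int N"
  then have "?S = {}" by auto
  then show "wt N n = 0" unfolding wt_def by (simp only: card.empty)
qed

lemma wt_tendsto: "(\<lambda>N. wt N n) \<longlonglongrightarrow> 1"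
proof -
  have "(\<lambda>N. \<bar>of_int n\<bar> / real N) \<longlonglongrightarrow> 0" by (rule lim_const_over_n)
  then have "(\<lambda>N. wt N n - 1) \<longlonglongrightarrow> 0"
    by (rule Lim_null_comparison[rotated])
      (auto simp: eventually_sequentially wt_bounds intro!: exI[of _ 1])
  then show ?thesis by (simp add: LIM_zero_iff)
qed

text \<open>The Fejer kernel \<open>|D l|^2 / N\<close> is nonnegative, so the mean of its modulus
  is its coefficient at \<open>0\<close>, which equals \<open>1\<close>. The constant
  \<open>C\<close> is therefore independent of \<open>N\<close>. Since \<open>L\<close> exceeds
  \<open>|n| + N\<close> for every type of \<open>v\<close>, no aliasing occurs.\<close>

lemma fejer_bound: assumes N: "N > 0" shows "p (mult (\<lambda>n. of_real (wt N n)) v) \<le> C * p v"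
proof -
  obtain L where L: "L > N" "\<And>x. x \<in> (\<lambda>n. \<bar>n\<bar> + int N) ` {n. co n v \<noteq> 0} \<Longrightarrow> int L > \<bar>x\<bar>"
    using large_modulus[of "(\<lambda>n. \<bar>n\<bar> + int N) ` {n. co n v \<noteq> 0}" N] co_fin by blast
  have L0: "L > 0" using L by simp
  define D where "D l = (\<Sum>j<N. cis (of_nat j * ang L l))" for l
  define f where "f l = (cmod (D l))\<^sup>2 / real N" for l
  have f: "complex_of_real (f l) = (\<Sum>x\<in>{..<N}\<times>{..<N}. cis (of_int (int (fst x) - int (snd x)) * ang L l)) / of_nat N" for l
  proof -
    have "complex_of_real ((cmod (D l))\<^sup>2) = D l * cnj (D l)" by (rule complex_norm_square)
    also have "\<dots> = (\<Sum>x\<in>{..<N}\<times>{..<N}. cis (of_nat (fst x) * ang L l) * cnj (cis (of_nat (snd x) * ang L l)))"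
      unfolding D_def by (simp add: sum_product sum.cartesian_product split_def)
    also have "\<dots> = (\<Sum>x\<in>{..<N}\<times>{..<N}. cis (of_int (int (fst x) - int (snd x)) * ang L l))"
      by (simp add: cis_cnj cis_mult algebra_simps)
    finally show ?thesis by (simp add: f_def del: of_real_power)
  qed
  have S: "(\<Sum>l<L. of_real (f l) * cis (of_int n * ang L l)) / of_nat L
     = of_nat (card {x \<in> {..<N} \<times> {..<N}. int L dvd n + int (fst x) - int (snd x)}) / of_nat N" for n
  proof -
    let ?A = "{..<N} \<times> {..<N}"
    have "of_real (f l) * cis (of_int n * ang L l) = (\<Sum>x\<in>?A. cis (of_int (n + int (fst x) - int (snd x)) * ang L l)) / of_nat N" for l
      unfolding f times_divide_eq_left sum_distrib_right
      by (intro arg_cong2[where f = "(/)"] sum.cong refl) (simp add: cis_mult algebra_simps)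
    then have "(\<Sum>l<L. of_real (f l) * cis (of_int n * ang L l))
       = (\<Sum>l<L. \<Sum>x\<in>?A. cis (of_int (n + int (fst x) - int (snd x)) * ang L l)) / of_nat N"
      by (simp add: sum_divide_distrib)
    also have "(\<Sum>l<L. \<Sum>x\<in>?A. cis (of_int (n + int (fst x) - int (snd x)) * ang L l))
      = (\<Sum>x\<in>?A. \<Sum>l<L. cis (of_int (n + int (fst x) - int (snd x)) * ang L l))"
      by (rule sum.swap)
    also have "\<dots> = (\<Sum>x\<in>?A. if int L dvd n + int (fst x) - int (snd x) then of_nat L else 0)"
      unfolding sum_roots_of_unity[OF L0] ..
    also have "\<dots> = (\<Sum>x\<in>{x \<in> ?A. int L dvd n + int (fst x) - int (snd x)}. of_nat L)"
      by (rule sum.inter_filter[symmetric]) simp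
    finally show ?thesis using L0 by (simp del: mem_Collect_eq)
  qed
  obtain A where A: "\<And>n. co n A = co n v * ((\<Sum>l<L. of_real (f l) * cis (of_int n * ang L l)) / of_nat L)"
    "p A \<le> (\<Sum>l<L. cmod (of_real (f l))) / real L * (C * p v)"
    using K_average[OF L0, of v "\<lambda>l. of_real (f l)"] by blast
  have eqset: "{x \<in> {..<N} \<times> {..<N}. int L dvd n + int (fst x) - int (snd x)} = {x \<in> {..<N} \<times> {..<N}. int (snd x) = int (fst x) + n}"
    if "int L > \<bar>n\<bar> + int N" for n
  proof -
    have "int L dvd n + int j - int k \<longleftrightarrow> int k = int j + n" if jk: "j < N" "k < N" for j k
    proof
      assume "int L dvd n + int j - int k"
      moreover have "\<bar>n + int j - int k\<bar> < int L" using jk \<open>int L > \<bar>n\<bar> + int N\<close> by linarith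
      ultimately have "n + int j - int k = 0" using dvd_imp_le_int[of "n + int j - int k" "int L"] by linarith
      then show "int k = int j + n" by simp
    qed simp
    then show ?thesis by auto
  qed
  have "A = mult (\<lambda>n. of_real (wt N n)) v"
  proof (rule v_eqI)
    fix n show "co n A = co n (mult (\<lambda>n. of_real (wt N n)) v)"
    proof (cases "co n v = 0")
      case False
      then have "int L > \<bar>n\<bar> + int N" using L(2)[of "\<bar>n\<bar> + int N"] by auto
      then show ?thesis unfolding A(1) S eqset[OF \<open>int L > \<bar>n\<bar> + int N\<close>] co_mult wt_def by simp
    qed (simp add: A)
  qed
  moreover have "(\<Sum>l<L. cmod (of_real (f l))) / real L = 1"
  proof -
    have "(\<Sum>l<L. complex_of_real (f l)) / of_nat L = of_nat (card {x \<in> {..<N} \<times> {..<N}. int (snd x) = int (fst x) + 0}) / of_nat N"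
      using S[of 0] eqset[of 0] L(1) by simp
    also have "{x \<in> {..<N} \<times> {..<N}. int (snd x) = int (fst x) + 0} = (\<lambda>j. (j, j)) ` {..<N}" by auto
    also have "card \<dots> = N" by (subst card_image) (auto simp: inj_on_def)
    finally have "complex_of_real ((\<Sum>l<L. f l) / real L) = 1" using N by simp
    then have "(\<Sum>l<L. f l) / real L = 1" using of_real_eq_1_iff by blast
    moreover have "f l \<ge> 0" for l by (simp add: f_def)
    ultimately show ?thesis by simp
  qed
  ultimately show ?thesis using A(2) by simp
qed

lemma closable:
  assumes u: "u \<in> N.CS" and z: "\<And>n. (\<lambda>j. co n (u j)) \<longlonglongrightarrow> 0"
  shows "(\<lambda>j. p (u j)) \<longlonglongrightarrow> 0"
proof (rule LIMSEQ_I)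
  fix \<epsilon> :: real assume e: "\<epsilon> > 0"
  \<comment> \<open>The final estimate has three terms below \<eta> and one bounded by
    \<open>C * \<eta>\<close>.\<close>
  define \<eta> where "\<eta> = \<epsilon> / (C + 4)"
  have h: "\<eta> > 0" using e C_ge by (simp add: \<eta>_def)
  obtain i where i: "\<forall>m\<ge>i. \<forall>n\<ge>i. p (u m - u n) < \<eta>" using N.CS_D[OF u h] by blast
  let ?F = "\<lambda>N. mult (\<lambda>n. of_real (wt N n))"
  have "(\<lambda>N. \<Sum>n | co n (u i) \<noteq> 0. cmod ((1 - of_real (wt N n)) * co n (u i)) * p (e n))
      \<longlonglongrightarrow> (\<Sum>n | co n (u i) \<noteq> 0. cmod ((1 - of_real 1) * co n (u i)) * p (e n))"
    by (intro tendsto_intros wt_tendsto)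
  then have "\<forall>\<^sub>F N in sequentially. (\<Sum>n | co n (u i) \<noteq> 0. cmod ((1 - of_real (wt N n)) * co n (u i)) * p (e n)) < \<eta>"
    using h by (intro order_tendstoD(2)) auto
  then obtain N0 where N0: "\<And>N. N \<ge> N0 \<Longrightarrow> (\<Sum>n | co n (u i) \<noteq> 0. cmod ((1 - of_real (wt N n)) * co n (u i)) * p (e n)) < \<eta>"
    unfolding eventually_sequentially by blast
  define N where "N = Suc N0"
  have N: "N > 0" "(\<Sum>n | co n (u i) \<noteq> 0. cmod ((1 - of_real (wt N n)) * co n (u i)) * p (e n)) < \<eta>"
    using N0[of N] by (simp_all add: N_def)
  have "u i - ?F N (u i) = vec {n. co n (u i) \<noteq> 0} (\<lambda>n. (1 - of_real (wt N n)) * co n (u i))"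
    by (rule v_eqI) (auto simp: co_vec co_fin co_simps algebra_simps co_out)
  then have 1: "p (u i - ?F N (u i)) < \<eta>" using le_less_trans[OF p_vec N(2)] by simp
  have F: "?F N v = vec {- int N..int N} (\<lambda>n. of_real (wt N n) * co n v)" for v
    using wt_bounds(2)[OF N(1)] by (intro v_eqI) (auto simp: co_vec co_out)
  have "(\<lambda>j. \<Sum>n\<in>{- int N..int N}. cmod (of_real (wt N n) * co n (u j)) * p (e n))
     \<longlonglongrightarrow> (\<Sum>n\<in>{- int N..int N}. cmod (of_real (wt N n) * 0) * p (e n))"
    by (intro tendsto_intros z)
  then have "\<forall>\<^sub>F j in sequentially. (\<Sum>n\<in>{- int N..int N}. cmod (of_real (wt N n) * co n (u j)) * p (e n)) < \<eta>"
    using h by (intro order_tendstoD(2)) auto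
  then obtain J where J: "\<And>j. j \<ge> J \<Longrightarrow> (\<Sum>n\<in>{- int N..int N}. cmod (of_real (wt N n) * co n (u j)) * p (e n)) < \<eta>"
    unfolding eventually_sequentially by blast
  have "p (u j) < \<epsilon>" if j: "j \<ge> max i J" for j
  proof -
    have a: "p (u j - u i) < \<eta>" "p (u i - u j) < \<eta>" using i j by auto
    have b: "p (?F N (u i) - ?F N (u j)) \<le> C * \<eta>"
    proof -
      have "p (?F N (u i) - ?F N (u j)) = p (?F N (u i - u j))" by (simp add: endoD[OF mult_endo])
      also have "\<dots> \<le> C * p (u i - u j)" by (rule fejer_bound[OF N(1)])
      also have "\<dots> \<le> C * \<eta>" using a C_ge by (intro mult_left_mono) auto
      finally show ?thesis .
    qed
    have c: "p (?F N (u j)) < \<eta>"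
      unfolding F by (rule le_less_trans[OF p_vec J]) (use j in simp)
    have "p (u j) \<le> p (u j - u i) + p (u i - ?F N (u i)) + p (?F N (u i) - ?F N (u j)) + p (?F N (u j))"
      using N.p_tri[of "u j" 0 "u i"] N.p_tri[of "u i" 0 "?F N (u i)"] N.p_tri[of "?F N (u i)" 0 "?F N (u j)"] by simp
    also have "\<dots> < \<eta> + \<eta> + C * \<eta> + \<eta>" using a b c 1 by linarith
    also have "\<dots> \<le> \<epsilon>"
    proof -
      have "(C + 4) * \<eta> = \<epsilon>" using C_ge by (simp add: \<eta>_def)
      then show ?thesis using h by (simp add: algebra_simps)
    qed
    finally show ?thesis .
  qed
  then show "\<exists>no. \<forall>n\<ge>no. norm (p (u n) - 0) < \<epsilon>" by (intro exI[of _ "max i J"]) simp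
qed

definition cx :: "int \<Rightarrow> (nat \<Rightarrow> 'v) set \<Rightarrow> complex" where "cx n = N.ext (co n)"

lemma cx_cc: "u \<in> N.CS \<Longrightarrow> (\<lambda>j. co n (u j)) \<longlonglongrightarrow> cx n (N.cc u)"
  unfolding cx_def by (rule N.ext_cc[OF co_bfun])

lemma cx_embed [simp]: "cx n (embed p v) = co n v"
  unfolding cx_def by (rule N.ext_embed[OF co_bfun])

text \<open>By \<open>closable\<close> no nonzero element of the completion is invisible to all
  coefficients. Identities in completions can therefore be checked one K-type at a time.\<close>

lemma cx_eqI:
  assumes "A \<in> pts N.E" "B \<in> pts N.E" "\<And>n. cx n A = cx n B" shows "A = B"
proof -
  obtain u w where u: "u \<in> N.CS" "w \<in> N.CS" "A = N.cc u" "B = N.cc w"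
    using assms(1,2) by (auto elim!: N.pts_cases)
  have "(\<lambda>j. co n (u j - w j)) \<longlonglongrightarrow> 0" for n
    using tendsto_diff[OF cx_cc[OF u(1), of n] cx_cc[OF u(2), of n]] assms(3)[of n] u by (simp add: co_simps)
  then have "(\<lambda>j. p (u j - w j)) \<longlonglongrightarrow> 0" by (rule closable[OF N.CS_diff[OF u(1,2)]])
  then show ?thesis using u N.cc_eq_iff by blast
qed

end

section \<open>Matrix coefficients of globalizations\<close>

locale gnorm = knorm V e co b I \<mu> o' hp \<pi> p C
  for V :: "('v::ab_group_add) gk" and e co b I \<mu> o' hp \<pi> p C +
  fixes \<rho> :: "mat2 \<Rightarrow> (nat \<Rightarrow> 'v) set \<Rightarrow> (nat \<Rightarrow> 'v) set"
  assumes glob: "globalization V p \<rho>"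
begin

lemma cr: "continuous_rep N.E \<rho>"
  and ld: "X \<in> sl2 \<Longrightarrow> lie_derivative N.E \<rho> X (embed p v) (embed p (lie V X v))"
  and \<rho>k: "k \<in> SO2 \<Longrightarrow> \<rho> k (embed p v) = embed p (kact V k v)"
  using glob by (auto simp: globalization_def Let_def)

lemma \<rho>_pts [simp]: "g \<in> SL2 \<Longrightarrow> A \<in> pts N.E \<Longrightarrow> \<rho> g A \<in> pts N.E"
  and \<rho>_add: "g \<in> SL2 \<Longrightarrow> A \<in> pts N.E \<Longrightarrow> B \<in> pts N.E \<Longrightarrow> \<rho> g (add N.E A B) = add N.E (\<rho> g A) (\<rho> g B)"
  and \<rho>_smul: "g \<in> SL2 \<Longrightarrow> A \<in> pts N.E \<Longrightarrow> \<rho> g (smul N.E c A) = smul N.E c (\<rho> g A)"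
  and \<rho>_one: "A \<in> pts N.E \<Longrightarrow> \<rho> (mat 1) A = A"
  and \<rho>_mult: "g \<in> SL2 \<Longrightarrow> h \<in> SL2 \<Longrightarrow> A \<in> pts N.E \<Longrightarrow> \<rho> (g ** h) A = \<rho> g (\<rho> h A)"
  using cr by (simp_all add: continuous_rep_def)

lemma \<rho>_cont:
  assumes "g \<in> SL2" "A \<in> pts N.E" "\<epsilon> > 0"
  obtains \<delta> where "\<delta> > 0" "\<And>h B. h \<in> SL2 \<Longrightarrow> B \<in> pts N.E \<Longrightarrow> dist g h < \<delta> \<Longrightarrow> ndist N.E A B < \<delta> \<Longrightarrow> ndist N.E (\<rho> g A) (\<rho> h B) < \<epsilon>"
proof -
  have "continuous_map (prod_topology (top_of_set SL2) (Metric_space.mtopology (pts N.E) (ndist N.E)))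
       (Metric_space.mtopology (pts N.E) (ndist N.E)) (\<lambda>(g, a). \<rho> g a)"
    using cr by (simp add: continuous_rep_def)
  then have "\<forall>g\<in>SL2. \<forall>A\<in>pts N.E. \<forall>\<epsilon>>0. \<exists>\<delta>>0. \<forall>h\<in>SL2. \<forall>B\<in>pts N.E. dist g h < \<delta> \<longrightarrow> ndist N.E A B < \<delta> \<longrightarrow> ndist N.E (\<rho> g A) (\<rho> h B) < \<epsilon>"
    by (subst (asm) N.mtop_cont) auto
  then have "\<exists>\<delta>>0. \<forall>h\<in>SL2. \<forall>B\<in>pts N.E. dist g h < \<delta> \<longrightarrow> ndist N.E A B < \<delta> \<longrightarrow> ndist N.E (\<rho> g A) (\<rho> h B) < \<epsilon>"
    using assms by simp
  then obtain \<delta> where d: "\<delta> > 0" "\<forall>h\<in>SL2. \<forall>B\<in>pts N.E. dist g h < \<delta> \<longrightarrow> ndist N.E A B < \<delta> \<longrightarrow> ndist N.E (\<rho> g A) (\<rho> h B) < \<epsilon>"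
    by (elim exE conjE)
  show thesis by (rule that[OF d(1)]) (use d(2) in simp)
qed

lemma \<rho>_tendsto:
  assumes "g \<in> SL2" "A \<in> pts N.E" "\<And>x. F x \<in> pts N.E" "((\<lambda>x. ndist N.E (F x) A) \<longlongrightarrow> 0) net"
  shows "((\<lambda>x. ndist N.E (\<rho> g (F x)) (\<rho> g A)) \<longlongrightarrow> 0) net"
proof (rule tendstoI)
  fix \<epsilon> :: real assume "\<epsilon> > 0"
  then obtain \<delta> where d: "\<delta> > 0" "\<And>h B. h \<in> SL2 \<Longrightarrow> B \<in> pts N.E \<Longrightarrow> dist g h < \<delta> \<Longrightarrow> ndist N.E A B < \<delta> \<Longrightarrow> ndist N.E (\<rho> g A) (\<rho> h B) < \<epsilon>"
    using \<rho>_cont[OF assms(1,2)] by blast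
  have "\<forall>\<^sub>F x in net. dist (ndist N.E (F x) A) 0 < \<delta>" by (rule tendstoD[OF assms(4) d(1)])
  then show "\<forall>\<^sub>F x in net. dist (ndist N.E (\<rho> g (F x)) (\<rho> g A)) 0 < \<epsilon>"
  proof eventually_elim
    case (elim x)
    then have "ndist N.E A (F x) < \<delta>" by (simp add: N.ndist_commute)
    then have "ndist N.E (\<rho> g A) (\<rho> g (F x)) < \<epsilon>" using d assms(1,3) by simp
    then show ?case by (simp add: N.ndist_commute)
  qed
qed

lemma cx_add: "A \<in> pts N.E \<Longrightarrow> B \<in> pts N.E \<Longrightarrow> cx n (add N.E A B) = cx n A + cx n B"
  and cx_smul: "A \<in> pts N.E \<Longrightarrow> cx n (smul N.E c A) = c * cx n A"
  unfolding cx_def by (simp_all add: N.ext_add[OF co_bfun] N.ext_smul[OF co_bfun])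

lemma cx_tendsto:
  "((\<lambda>x. ndist N.E (F x) A) \<longlongrightarrow> 0) net \<Longrightarrow> A \<in> pts N.E \<Longrightarrow> (\<And>x. F x \<in> pts N.E) \<Longrightarrow> ((\<lambda>x. cx n (F x)) \<longlongrightarrow> cx n A) net"
  unfolding cx_def by (rule N.ext_tendsto[OF co_bfun])

lemma cx_rot:
  assumes "A \<in> pts N.E" shows "cx n (\<rho> (rot t) A) = cis (of_int n * t) * cx n A"
proof -
  obtain u where u: "u \<in> N.CS" "A = N.cc u" using N.pts_cases[OF assms] by blast
  have "(\<lambda>j. ndist N.E (\<rho> (rot t) (embed p (u j))) (\<rho> (rot t) A)) \<longlonglongrightarrow> 0"
    using N.embed_tendsto[OF u(1)] assms u(2) by (intro \<rho>_tendsto) auto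
  then have "(\<lambda>j. cx n (\<rho> (rot t) (embed p (u j)))) \<longlonglongrightarrow> cx n (\<rho> (rot t) A)"
    by (rule cx_tendsto) (use assms in auto)
  moreover have "(\<lambda>j. cx n (\<rho> (rot t) (embed p (u j)))) \<longlonglongrightarrow> cis (of_int n * t) * cx n A"
    using tendsto_mult_left[OF cx_cc[OF u(1)]] by (simp add: \<rho>k u(2))
  ultimately show ?thesis using LIMSEQ_unique by blast
qed

definition mc :: "int \<Rightarrow> mat2 \<Rightarrow> 'v \<Rightarrow> complex" where "mc n g v = cx n (\<rho> g (embed p v))"

lemma mc_lin: assumes "g \<in> SL2" shows "functional V (mc n g)"
proof (rule functionalI[OF V])
  show "mc n g (u + v) = mc n g u + mc n g v" for u v
    using assms by (simp add: mc_def cx_add \<rho>_add flip: N.add_embed)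
  show "mc n g (scl V c v) = c * mc n g v" for c v
    using assms by (simp add: mc_def cx_smul \<rho>_smul flip: N.smul_embed)
qed

lemma mc_one [simp]: "mc n (mat 1) v = co n v"
  by (simp add: mc_def \<rho>_one)

lemma mc_rot_left: "g \<in> SL2 \<Longrightarrow> mc n (rot t ** g) v = cis (of_int n * t) * mc n g v"
  by (simp add: mc_def \<rho>_mult cx_rot)

lemma mc_rot_right: "g \<in> SL2 \<Longrightarrow> mc n (g ** rot t) v = mc n g (kact V (rot t) v)"
  by (simp add: mc_def \<rho>_mult \<rho>k)

lemma mc_deriv0:
  assumes g: "g \<in> SL2" and X: "X \<in> sl2"
  shows "((\<lambda>t. mc n (g ** mexp (t *\<^sub>R X)) v) has_vector_derivative mc n g (lie V X v)) (at 0)"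
proof (rule has_vector_derivative_quotient)
  let ?m = "\<lambda>t. mexp (t *\<^sub>R X)"
  have m: "?m t \<in> SL2" for t using mexp_group(2)[OF X] .
  define D where "D t = smul N.E (of_real (1 / t)) (add N.E (\<rho> (?m t) (embed p v)) (smul N.E (-1) (embed p v)))" for t :: real
  have Dp: "D t \<in> pts N.E" for t unfolding D_def using m by simp
  have "((\<lambda>t. ndist N.E (D t) (embed p (lie V X v))) \<longlongrightarrow> 0) (at 0)"
    using ld[OF X, of v] unfolding lie_derivative_def D_def .
  then have "((\<lambda>t. ndist N.E (\<rho> g (D t)) (\<rho> g (embed p (lie V X v)))) \<longlongrightarrow> 0) (at 0)"
    by (intro \<rho>_tendsto g Dp) auto
  then have "((\<lambda>t. cx n (\<rho> g (D t))) \<longlongrightarrow> mc n g (lie V X v)) (at 0)"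
    unfolding mc_def by (rule cx_tendsto) (use g Dp in auto)
  moreover have "cx n (\<rho> g (D t)) = (mc n (g ** ?m t) v - mc n (g ** ?m 0) v) / of_real t" for t
  proof -
    have "\<rho> g (D t) = smul N.E (of_real (1 / t)) (add N.E (\<rho> g (\<rho> (?m t) (embed p v))) (smul N.E (-1) (\<rho> g (embed p v))))"
      unfolding D_def using g m by (simp add: \<rho>_smul \<rho>_add del: N.smul_embed)
    then have "cx n (\<rho> g (D t)) = of_real (1 / t) * (cx n (\<rho> g (\<rho> (?m t) (embed p v))) - cx n (\<rho> g (embed p v)))"
      using g m by (simp add: cx_smul cx_add del: N.smul_embed)
    then show ?thesis using g m mexp_group(3)[OF X] by (simp add: mc_def \<rho>_mult \<rho>_one)
  qed
  ultimately show "((\<lambda>t. (mc n (g ** ?m t) v - mc n (g ** ?m 0) v) / of_real t) \<longlongrightarrow> mc n g (lie V X v)) (at 0)"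
    by simp
qed

lemma mc_deriv:
  assumes g: "g \<in> SL2" and X: "X \<in> sl2"
  shows "((\<lambda>t. mc n (g ** mexp (t *\<^sub>R X)) v) has_vector_derivative mc n (g ** mexp (t *\<^sub>R X)) (lie V X v)) (at t)"
proof (rule has_vector_derivative_at_shift)
  have "g ** mexp (t *\<^sub>R X) \<in> SL2" using g mexp_group(2)[OF X] by simp
  from mc_deriv0[OF this X]
  show "((\<lambda>h. mc n (g ** mexp ((t + h) *\<^sub>R X)) v) has_vector_derivative mc n (g ** mexp (t *\<^sub>R X)) (lie V X v)) (at 0)"
    by (simp only: mexp_group(1)[OF X] matrix_mul_assoc)
qed

text \<open>The coefficient of \<open>rot t ** g\<close> is differentiated in two ways: on the left
  as a character of K, on the right through \<open>mexp_conj_Y0\<close>.\<close>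

lemma mc_Ad:
  assumes g: "g \<in> SL2" shows "mc n g (lie V (adj2 g ** Y0 ** g) v) = \<i> * of_int n * mc n g v"
proof -
  have "((\<lambda>t. mc n (rot t ** g) v) has_vector_derivative mc n g (lie V (adj2 g ** Y0 ** g) v)) (at 0)"
    using mc_deriv0[OF g mexp_conj_Y0(2)[OF g]] by (simp only: mexp_conj_Y0(1)[OF g])
  moreover have "((\<lambda>t. mc n (rot t ** g) v) has_vector_derivative \<i> * of_int n * mc n g v) (at 0)"
  proof -
    have "((\<lambda>t. exp (\<i> * of_int n * of_real t) * mc n g v) has_vector_derivative (\<i> * of_int n * mc n g v)) (at 0)"
      by (auto intro!: derivative_eq_intros has_vector_derivative_real_field)
    then show ?thesis by (simp add: mc_rot_left[OF g] cis_conv_exp mult_ac)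
  qed
  ultimately show ?thesis by (rule vector_derivative_unique_at)
qed

lemma mc_hyp_deriv:
  "((\<lambda>t. mc n (hyp t) (e m)) has_vector_derivative
     of_real (b m) * mc n (hyp t) (e (m + 2)) - of_real (b (m - 2)) * mc n (hyp t) (e (m - 2))) (at t)"
  using mc_deriv[OF SL2_1 basis_sl2(2), of n "e m" t]
  by (simp add: mexp_Hm lie_Hm_e functionalD[OF mc_lin])

text \<open>The case \<open>g = hyp t\<close>, where conjugation mixes \<open>Y0\<close> and
  \<open>Zm\<close> hyperbolically. Together with \<open>mc_hyp_deriv\<close> it is the system
  treated in \<open>ladder_system_unique\<close>.\<close>

lemma mc_hyp_rel:
  "of_int n * mc n (hyp t) (e m) = of_real (cosh (2 * t)) * of_int m * mc n (hyp t) (e m)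
     + of_real (sinh (2 * t)) * (of_real (b m) * mc n (hyp t) (e (m + 2)) + of_real (b (m - 2)) * mc n (hyp t) (e (m - 2)))"
proof -
  have "\<i> * (of_int n * mc n (hyp t) (e m)) = mc n (hyp t) (lie V (cosh (2 * t) *\<^sub>R Y0 + sinh (2 * t) *\<^sub>R Zm) (e m))"
    using mc_Ad[OF hyp_SL2[of t], of n "e m"] by (simp add: adj2_hyp_Y0)
  also have "\<dots> = \<i> * (of_real (cosh (2 * t)) * of_int m * mc n (hyp t) (e m)
     + of_real (sinh (2 * t)) * (of_real (b m) * mc n (hyp t) (e (m + 2)) + of_real (b (m - 2)) * mc n (hyp t) (e (m - 2))))"
    by (simp add: lie_comb lie_Y0_e lie_Zm_e functionalD[OF mc_lin] algebra_simps)
  finally show ?thesis by simp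
qed

lemma mc_cont: "continuous_on SL2 (\<lambda>g. mc n g v)"
  unfolding continuous_on_iff
proof (intro ballI allI impI)
  fix g and \<epsilon> :: real assume g: "g \<in> SL2" "\<epsilon> > 0"
  obtain K where K: "K > 0" "\<And>v. cmod (co n v) \<le> K * p v" using N.bfun_bound[OF co_bfun] by blast
  obtain \<delta> where d: "\<delta> > 0" "\<And>h B. h \<in> SL2 \<Longrightarrow> B \<in> pts N.E \<Longrightarrow> dist g h < \<delta> \<Longrightarrow> ndist N.E (embed p v) B < \<delta> \<Longrightarrow> ndist N.E (\<rho> g (embed p v)) (\<rho> h B) < \<epsilon> / K"
    using \<rho>_cont[OF g(1) N.embed_pts, of "\<epsilon> / K"] g K by auto
  show "\<exists>d>0. \<forall>x'\<in>SL2. dist x' g < d \<longrightarrow> dist (mc n x' v) (mc n g v) < \<epsilon>"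
  proof (intro exI[of _ \<delta>] conjI d ballI impI)
    fix h assume h: "h \<in> SL2" "dist h g < \<delta>"
    then have "ndist N.E (\<rho> g (embed p v)) (\<rho> h (embed p v)) < \<epsilon> / K"
      using d by (simp add: dist_commute)
    moreover have "cmod (mc n h v - mc n g v) \<le> K * ndist N.E (\<rho> h (embed p v)) (\<rho> g (embed p v))"
      unfolding mc_def cx_def by (rule N.ext_bound[OF co_bfun K(2)]) (use g h in auto)
    ultimately show "dist (mc n h v) (mc n g v) < \<epsilon>"
      using K(1) by (simp add: dist_norm N.ndist_commute less_divide_eq mult.commute)
  qed
qed

lemma mc_approx:
  assumes "g \<in> SL2"
  obtains u where "u \<in> N.CS" "\<rho> g (embed p v) = N.cc u" "\<And>n. (\<lambda>j. co n (u j)) \<longlonglongrightarrow> mc n g v"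
    "(\<lambda>j. p (u j)) \<longlonglongrightarrow> nrm N.E (\<rho> g (embed p v))"
proof -
  obtain u where u: "u \<in> N.CS" "\<rho> g (embed p v) = N.cc u"
    using N.pts_cases[OF \<rho>_pts[OF assms N.embed_pts]] by blast
  show thesis using that[OF u] cx_cc[OF u(1)] N.nrm_cc[OF u(1)] unfolding mc_def u(2) by blast
qed

end

lemma (in umod) hp_k: "k \<in> SO2 \<Longrightarrow> hp (kact V k v) = hp v"
proof -
  interpret N: normed_gk V hp by (intro normed_gk.intro V hp_norm)
  assume "k \<in> SO2"
  then show ?thesis
    using hp_unit[OF SO2_SL2, of k "embed hp v"] hp_glob by (simp add: globalization_def Let_def)
qed

text \<open>The unitary norm is an instance of the general situation; its coefficients become the
  reference for all other norms.\<close>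

sublocale umod \<subseteq> H: gnorm V e co b I \<mu> o' hp \<pi> hp 1 \<pi>
proof -
  have "knorm V e co b I \<mu> o' hp \<pi> hp 1"
    by (intro knorm.intro knorm_axioms.intro umod_axioms hp_norm) (simp add: hp_k)
  then show "gnorm V e co b I \<mu> o' hp \<pi> hp 1 \<pi>"
    by (intro gnorm.intro gnorm_axioms.intro hp_glob)
qed

context gnorm
begin

text \<open>By the Cartan decomposition and K-equivariance only \<open>g = hyp t\<close> matters;
  there both families solve the same system and agree at \<open>t = 0\<close>, where they are the
  coordinates of the vector.\<close>

lemma mc_unique:
  assumes "g \<in> SL2" shows "mc n g v = H.mc n g v"
proof -
  obtain s t u where g: "0 \<le> t" "g = rot s ** hyp t ** rot u" by (rule KAK[OF assms])
  define d where "d m t = mc n (hyp t) (e m) - H.mc n (hyp t) (e m)" for m t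
  have "d m t = 0" for m
  proof (rule ladder_system_unique[of d b n])
    show "(d m has_vector_derivative of_real (b m) * d (m+2) t - of_real (b (m-2)) * d (m-2) t) (at t)" for m t
      unfolding d_def using has_vector_derivative_diff[OF mc_hyp_deriv[of n m t] H.mc_hyp_deriv[of n m t]]
      by (simp add: algebra_simps)
    show "of_int n * d m t = of_real (cosh (2*t)) * of_int m * d m t
       + of_real (sinh (2*t)) * (of_real (b m) * d (m+2) t + of_real (b (m-2)) * d (m-2) t)" for m t
      unfolding d_def right_diff_distrib mc_hyp_rel[of n t m] H.mc_hyp_rel[of n t m]
      by (simp add: algebra_simps)
    show "d m 0 = 0" for m by (simp add: d_def)
  qed (rule g)
  then have eq: "mc n (hyp t) (e m) = H.mc n (hyp t) (e m)" for m by (simp add: d_def)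
  have eqv: "mc n (hyp t) w = H.mc n (hyp t) w" for w
  proof -
    have "mc n (hyp t) w = mc n (hyp t) (\<Sum>n | co n w \<noteq> 0. scl V (co n w) (e n))" by (rule arg_cong[OF co_exp])
    also have "\<dots> = H.mc n (hyp t) (\<Sum>n | co n w \<noteq> 0. scl V (co n w) (e n))"
      by (simp add: functionalD[OF mc_lin] functionalD[OF H.mc_lin] eq)
    also have "\<dots> = H.mc n (hyp t) w" by (rule arg_cong[OF co_exp[symmetric]])
    finally show ?thesis .
  qed
  show ?thesis
    unfolding g(2) matrix_mul_assoc[symmetric]
    by (simp add: mc_rot_left H.mc_rot_left mc_rot_right H.mc_rot_right eqv)
qed

end

section \<open>Bounds for unitary matrix coefficients\<close>

context umod
begin

abbreviation "M \<equiv> H.mc"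

lemma hp_sq': "finite F \<Longrightarrow> {n. co n v \<noteq> 0} \<subseteq> F \<Longrightarrow> (hp v)\<^sup>2 = (\<Sum>n\<in>F. (cmod (co n v))\<^sup>2)"
  unfolding hp_sq by (rule sum.mono_neutral_left) auto

lemma bessel: "finite F \<Longrightarrow> (\<Sum>n\<in>F. (cmod (co n v))\<^sup>2) \<le> (hp v)\<^sup>2"
  using hp_sq'[of "F \<union> {n. co n v \<noteq> 0}" v] co_fin by (auto intro: sum_mono2)

lemma hp_add_e:
  assumes "n \<in> I" shows "(hp (x + scl V c (e n)))\<^sup>2 = (hp x)\<^sup>2 + (cmod c)\<^sup>2 + 2 * Re (cnj c * co n x)"
proof -
  let ?F = "insert n {n. co n x \<noteq> 0}"
  have F: "finite ?F" using co_fin by simp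
  have k: "cmod (co k (x + scl V c (e n)))^2 = (cmod (co k x))\<^sup>2 + (if k = n then (cmod c)\<^sup>2 + 2 * Re (cnj c * co n x) else 0)" for k
  proof (cases "k = n")
    case True
    have "(cmod (co n x + c))\<^sup>2 = (cmod (co n x))\<^sup>2 + (cmod c)\<^sup>2 + 2 * Re (cnj c * co n x)"
      unfolding cmod_power2 by (simp add: power2_eq_square algebra_simps)
    then show ?thesis using True assms by (simp add: co_simps co_e)
  qed (simp add: co_simps co_e)
  have "(hp (x + scl V c (e n)))\<^sup>2 = (\<Sum>k\<in>?F. (cmod (co k (x + scl V c (e n))))\<^sup>2)"
    by (rule hp_sq'[OF F]) (auto simp: co_simps co_e)
  also have "\<dots> = (\<Sum>k\<in>?F. (cmod (co k x))\<^sup>2) + ((cmod c)\<^sup>2 + 2 * Re (cnj c * co n x))"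
    unfolding k sum.distrib using F by (simp add: sum.delta del: sum.insert)
  also have "(\<Sum>k\<in>?F. (cmod (co k x))\<^sup>2) = (hp x)\<^sup>2" by (rule hp_sq'[symmetric, OF F]) auto
  finally show ?thesis by simp
qed

lemma hp_e: "n \<in> I \<Longrightarrow> hp (e n) = 1"
  using hp_add_e[of n 0 1] H.N.p_nonneg[of "e n"] by (simp add: co_simps power2_eq_1_iff)

lemma hp_e_le: "hp (e n) \<le> 1"
  using hp_e[of n] e_0[of n] by (cases "n \<in> I") auto

lemma M_bessel:
  assumes "g \<in> SL2" "finite F" shows "(\<Sum>n\<in>F. (cmod (M n g v))\<^sup>2) \<le> (hp v)\<^sup>2"
proof -
  obtain u where u: "\<And>n. (\<lambda>j. co n (u j)) \<longlonglongrightarrow> M n g v" "(\<lambda>j. hp (u j)) \<longlonglongrightarrow> nrm H.N.E (\<pi> g (embed hp v))"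
    by (rule H.mc_approx[OF assms(1), where v = v]) blast
  have "nrm H.N.E (\<pi> g (embed hp v)) = hp v" using hp_unit[OF assms(1)] by simp
  then have a: "(\<lambda>j. (hp (u j))\<^sup>2) \<longlonglongrightarrow> (hp v)\<^sup>2" using tendsto_power[OF u(2)] by simp
  have c: "(\<lambda>j. \<Sum>n\<in>F. (cmod (co n (u j)))\<^sup>2) \<longlonglongrightarrow> (\<Sum>n\<in>F. (cmod (M n g v))\<^sup>2)"
    by (intro tendsto_intros u)
  show ?thesis by (rule LIMSEQ_le[OF c a]) (use bessel[OF assms(2)] in blast)
qed

lemma M_le: "g \<in> SL2 \<Longrightarrow> cmod (M n g v) \<le> hp v"
  using M_bessel[of g "{n}" v] by (simp add: power2_le_iff_abs_le)

lemma M_out: assumes "g \<in> SL2" "n \<notin> I" shows "M n g v = 0"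
proof -
  obtain u where u: "\<And>n. (\<lambda>j. co n (u j)) \<longlonglongrightarrow> M n g v"
    by (rule H.mc_approx[OF assms(1), where v = v]) blast
  show ?thesis using u[of n] by (simp add: co_out[OF assms(2)] LIMSEQ_const_iff)
qed

text \<open>Invariance of the norm is used on a sum: \<open>g e_m + c e_n\<close> and
  \<open>e_m + c g^-1 e_n\<close> have equal norms. Comparing the mixed terms for
  \<open>c = 1\<close> and \<open>c = \<i>\<close> gives the real and imaginary parts.\<close>

lemma M_adj:
  assumes g: "g \<in> SL2" and mn: "m \<in> I" "n \<in> I"
  shows "M n g (e m) = cnj (M m (adj2 g) (e n))"
proof -
  let ?h = "adj2 g"
  have h: "?h \<in> SL2" using g by simp
  obtain u where u: "u \<in> H.N.CS" "\<pi> g (embed hp (e m)) = H.N.cc u" "\<And>n. (\<lambda>j. co n (u j)) \<longlonglongrightarrow> M n g (e m)"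
     "(\<lambda>j. hp (u j)) \<longlonglongrightarrow> nrm H.N.E (\<pi> g (embed hp (e m)))"
    by (rule H.mc_approx[OF g, where v = "e m"]) blast
  obtain w where w: "w \<in> H.N.CS" "\<pi> ?h (embed hp (e n)) = H.N.cc w" "\<And>k. (\<lambda>j. co k (w j)) \<longlonglongrightarrow> M k ?h (e n)"
     "(\<lambda>j. hp (w j)) \<longlonglongrightarrow> nrm H.N.E (\<pi> ?h (embed hp (e n)))"
    by (rule H.mc_approx[OF h, where v = "e n"]) blast
  have nu: "(\<lambda>j. hp (u j)) \<longlonglongrightarrow> 1" "(\<lambda>j. hp (w j)) \<longlonglongrightarrow> 1"
    using u(4) w(4) hp_unit[OF g] hp_unit[OF h] hp_e mn by simp_all
  have key: "Re (cnj c * M n g (e m)) = Re (c * M m ?h (e n))" for c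
  proof -
    let ?A = "add H.N.E (H.N.cc u) (embed hp (scl V c (e n)))"
    have A: "?A = H.N.cc (\<lambda>j. u j + scl V c (e n))"
      unfolding embed_def by (simp add: H.N.add_cc u(1))
    have "\<pi> ?h (H.N.cc u) = embed hp (e m)"
      unfolding u(2)[symmetric] using g by (simp add: adj2_mult H.\<rho>_one flip: H.\<rho>_mult)
    then have "\<pi> ?h ?A = add H.N.E (embed hp (e m)) (smul H.N.E c (H.N.cc w))"
      using h u(1) by (simp add: H.\<rho>_add H.\<rho>_smul w(2) del: H.N.add_embed H.N.smul_embed flip: H.N.smul_embed)
    also have "\<dots> = H.N.cc (\<lambda>j. e m + scl V c (w j))"
      unfolding embed_def by (simp add: H.N.add_cc H.N.smul_cc w(1))
    finally have B: "\<pi> ?h ?A = H.N.cc (\<lambda>j. e m + scl V c (w j))" .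
    have n: "nrm H.N.E (\<pi> ?h ?A) = nrm H.N.E ?A"
      by (rule hp_unit[OF h]) (simp add: u(1))
    have eq: "nrm H.N.E (H.N.cc (\<lambda>j. u j + scl V c (e n))) = nrm H.N.E (H.N.cc (\<lambda>j. e m + scl V c (w j)))"
      by (rule n[unfolded B, unfolded A, symmetric])
    have "(\<lambda>j. (hp (u j + scl V c (e n)))\<^sup>2) \<longlonglongrightarrow> (nrm H.N.E (H.N.cc (\<lambda>j. u j + scl V c (e n))))\<^sup>2"
      using u(1) by (intro tendsto_power H.N.nrm_cc) simp
    moreover have "(\<lambda>j. (hp (u j + scl V c (e n)))\<^sup>2) \<longlonglongrightarrow> 1\<^sup>2 + (cmod c)\<^sup>2 + 2 * Re (cnj c * M n g (e m))"
      unfolding hp_add_e[OF mn(2)] by (intro tendsto_intros nu u)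
    ultimately have 1: "(nrm H.N.E (H.N.cc (\<lambda>j. u j + scl V c (e n))))\<^sup>2 = 1\<^sup>2 + (cmod c)\<^sup>2 + 2 * Re (cnj c * M n g (e m))"
      by (rule LIMSEQ_unique)
    have "(\<lambda>j. (hp (e m + scl V c (w j)))\<^sup>2) \<longlonglongrightarrow> (nrm H.N.E (H.N.cc (\<lambda>j. e m + scl V c (w j))))\<^sup>2"
      using w(1) by (intro tendsto_power H.N.nrm_cc) simp
    moreover have "(hp (e m + scl V c (w j)))\<^sup>2 = (cmod c * hp (w j))\<^sup>2 + 1 + 2 * Re (c * co m (w j))" for j
      using hp_add_e[OF mn(1), of "scl V c (w j)" 1] by (simp add: add.commute co_simps)
    then have "(\<lambda>j. (hp (e m + scl V c (w j)))\<^sup>2) \<longlonglongrightarrow> (cmod c * 1)\<^sup>2 + 1 + 2 * Re (c * M m ?h (e n))"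
      by (simp only:) (intro tendsto_intros nu w)
    ultimately have 2: "(nrm H.N.E (H.N.cc (\<lambda>j. e m + scl V c (w j))))\<^sup>2 = (cmod c * 1)\<^sup>2 + 1 + 2 * Re (c * M m ?h (e n))"
      by (rule LIMSEQ_unique)
    show ?thesis using 1 2 eq by simp
  qed
  from key[of 1] key[of \<i>] show ?thesis by (simp add: complex_eq_iff)
qed

lemma M_adj': "g \<in> SL2 \<Longrightarrow> m \<in> I \<Longrightarrow> n \<in> I \<Longrightarrow> cmod (M n g (e m)) = cmod (M m (adj2 g) (e n))"
  by (simp add: M_adj)

lemma M_bessel_row:
  assumes "g \<in> SL2" "finite F" "n \<in> I" shows "(\<Sum>m\<in>F. (cmod (M n g (e m)))\<^sup>2) \<le> 1"
proof -
  have "(\<Sum>m\<in>F. (cmod (M n g (e m)))\<^sup>2) \<le> (\<Sum>m\<in>F. (cmod (M m (adj2 g) (e n)))\<^sup>2)"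
  proof (rule sum_mono)
    fix m show "(cmod (M n g (e m)))\<^sup>2 \<le> (cmod (M m (adj2 g) (e n)))\<^sup>2"
      using M_adj'[OF assms(1) _ assms(3), of m] e_0[of m] functionalD(3)[OF H.mc_lin[OF assms(1)], of n] by (cases "m \<in> I") auto
  qed
  also have "\<dots> \<le> 1" using M_bessel[of "adj2 g" F "e n"] assms by (simp add: hp_e)
  finally show ?thesis .
qed

subsection \<open>Rapid decay\<close>

text \<open>The sum of \<open>hp\<close> over all words of length \<open>k\<close> in the basis
  \<open>Y0\<close>, \<open>Hm\<close>, \<open>Zm\<close> applied to \<open>v\<close>.\<close>

fun sob :: "nat \<Rightarrow> 'v \<Rightarrow> real" where
  "sob 0 v = hp v"
| "sob (Suc k) v = sob k (lie V Y0 v) + sob k (lie V Hm v) + sob k (lie V Zm v)"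

lemma sob_nonneg: "0 \<le> sob k v" by (induction k arbitrary: v) (simp_all add: add_nonneg_nonneg)

text \<open>A crude bound for the coordinates of \<open>adj2 g ** Y0 ** g\<close>, which are
  quadratic in the entries of \<open>g\<close>.\<close>

definition sz :: "mat2 \<Rightarrow> real" where "sz g = (\<bar>g$1$1\<bar> + \<bar>g$1$2\<bar> + \<bar>g$2$1\<bar> + \<bar>g$2$2\<bar>)\<^sup>2"

text \<open>By \<open>mc_Ad\<close> a factor \<open>n\<close> can be traded for one Lie algebra
  element on the vector, at the cost of a factor \<open>sz g\<close>.\<close>

lemma M_decay_pow:
  assumes "g \<in> SL2" shows "\<bar>of_int n\<bar> ^ k * cmod (M n g v) \<le> sz g ^ k * sob k v"
proof (induction k arbitrary: v)
  case 0 then show ?case using M_le[OF assms] by simp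
next
  case (Suc k)
  let ?X = "adj2 g ** Y0 ** g"
  have X: "?X \<in> sl2" by (rule mexp_conj_Y0(2)[OF assms])
  have e: "\<bar>x * y\<bar> + \<bar>z * t\<bar> \<le> sz g"
    if "\<bar>x\<bar> + \<bar>z\<bar> \<le> \<bar>g$1$1\<bar> + \<bar>g$1$2\<bar> + \<bar>g$2$1\<bar> + \<bar>g$2$2\<bar>" "\<bar>y\<bar> \<le> \<bar>g$1$1\<bar> + \<bar>g$1$2\<bar> + \<bar>g$2$1\<bar> + \<bar>g$2$2\<bar>" "\<bar>t\<bar> \<le> \<bar>g$1$1\<bar> + \<bar>g$1$2\<bar> + \<bar>g$2$1\<bar> + \<bar>g$2$2\<bar>" for x y z t
  proof -
    let ?s = "\<bar>g$1$1\<bar> + \<bar>g$1$2\<bar> + \<bar>g$2$1\<bar> + \<bar>g$2$2\<bar>"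
    have "\<bar>x * y\<bar> + \<bar>z * t\<bar> \<le> \<bar>x\<bar> * ?s + \<bar>z\<bar> * ?s"
      unfolding abs_mult using that by (intro add_mono mult_left_mono) auto
    also have "\<dots> \<le> ?s * ?s" using that(1) by (simp add: mult_right_mono flip: distrib_right)
    finally show ?thesis by (simp add: sz_def power2_eq_square)
  qed
  have e1: "\<bar>g$2$2 * g$2$1\<bar> + \<bar>g$1$2 * g$1$1\<bar> \<le> sz g" "\<bar>g$2$1 * g$2$1\<bar> + \<bar>g$1$1 * g$1$1\<bar> \<le> sz g"
     "\<bar>g$2$2 * g$2$2\<bar> + \<bar>g$1$2 * g$1$2\<bar> \<le> sz g"
    by (rule e; simp)+
  have "?X$1$1 = - (g$2$2 * g$2$1) - g$1$2 * g$1$1" "?X$2$1 = g$2$1 * g$2$1 + g$1$1 * g$1$1" "?X$1$2 = - (g$2$2 * g$2$2) - g$1$2 * g$1$2"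
    by (simp_all add: adj2_def Y0_def)
  then have x: "\<bar>?X$1$1\<bar> \<le> sz g" "\<bar>?X$2$1\<bar> \<le> sz g" "\<bar>?X$1$2\<bar> \<le> sz g"
    using e1 by linarith+
  have half: "\<bar>(y - z) / 2\<bar> \<le> s \<and> \<bar>(y + z) / 2\<bar> \<le> s" if "\<bar>y\<bar> \<le> s" "\<bar>z\<bar> \<le> s" for y z s :: real
    using that by (auto simp: abs_le_iff)
  have c: "\<bar>(?X$2$1 - ?X$1$2) / 2\<bar> \<le> sz g" "\<bar>?X$1$1\<bar> \<le> sz g" "\<bar>(?X$2$1 + ?X$1$2) / 2\<bar> \<le> sz g"
    using half[OF x(2,3)] x(1) by blast+
  have "\<bar>of_int n\<bar> * cmod (M n g v) = cmod (M n g (lie V ?X v))"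
    by (simp add: H.mc_Ad[OF assms] norm_mult)
  also have "\<dots> \<le> \<bar>(?X$2$1 - ?X$1$2) / 2\<bar> * cmod (M n g (lie V Y0 v)) + (\<bar>?X$1$1\<bar> * cmod (M n g (lie V Hm v))
      + \<bar>(?X$2$1 + ?X$1$2) / 2\<bar> * cmod (M n g (lie V Zm v)))"
    unfolding lie_expand[OF X] functionalD[OF H.mc_lin[OF assms]]
    by (rule order_trans[OF norm_triangle_ineq] order_trans[OF add_left_mono[OF norm_triangle_ineq]])+
      (simp only: norm_mult norm_of_real order_refl)
  also have "\<dots> \<le> sz g * cmod (M n g (lie V Y0 v)) + (sz g * cmod (M n g (lie V Hm v)) + sz g * cmod (M n g (lie V Zm v)))"
    using c by (intro add_mono mult_right_mono) auto
  finally have 1: "\<bar>of_int n\<bar> * cmod (M n g v) \<le> sz g * (cmod (M n g (lie V Y0 v)) + cmod (M n g (lie V Hm v)) + cmod (M n g (lie V Zm v)))"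
    by (simp add: distrib_left)
  have "\<bar>of_int n\<bar> ^ Suc k * cmod (M n g v) = \<bar>of_int n\<bar> ^ k * (\<bar>of_int n\<bar> * cmod (M n g v))" by simp
  also have "\<dots> \<le> \<bar>of_int n\<bar> ^ k * (sz g * (cmod (M n g (lie V Y0 v)) + cmod (M n g (lie V Hm v)) + cmod (M n g (lie V Zm v))))"
    by (intro mult_left_mono 1) simp
  also have "\<dots> = sz g * (\<bar>of_int n\<bar> ^ k * cmod (M n g (lie V Y0 v)) + \<bar>of_int n\<bar> ^ k * cmod (M n g (lie V Hm v)) + \<bar>of_int n\<bar> ^ k * cmod (M n g (lie V Zm v)))"
    by (simp add: algebra_simps)
  also have "\<dots> \<le> sz g * (sz g ^ k * sob k (lie V Y0 v) + sz g ^ k * sob k (lie V Hm v) + sz g ^ k * sob k (lie V Zm v))"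
    by (intro mult_left_mono add_mono Suc) (simp add: sz_def)
  also have "\<dots> = sz g ^ Suc k * sob (Suc k) v" by (simp add: algebra_simps)
  finally show ?case .
qed

text \<open>Of the three powers of decay that this bound controls, one is consumed by the linear
  growth of the norms of \<open>e n\<close> and the other two make the tails summable. The factor
  \<open>8\<close> comes from \<open>(1 + x)^3 <= 8 (1 + x^3)\<close> for \<open>x = 0\<close> and
  for \<open>x >= 1\<close>.\<close>

definition dcy :: "mat2 \<Rightarrow> 'v \<Rightarrow> real" where "dcy g v = 8 * (sob 0 v + sz g ^ 3 * sob 3 v)"

lemma M_decay: assumes "g \<in> SL2" shows "(1 + \<bar>of_int n\<bar>) ^ 3 * cmod (M n g v) \<le> dcy g v"
proof -
  let ?n = "\<bar>of_int n :: real\<bar>"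
  have "(1 + ?n) ^ 3 \<le> 8 * (1 + ?n ^ 3)"
  proof (cases "n = 0")
    case False
    then have n: "?n \<ge> 1" by simp
    have "(1 + ?n) ^ 3 \<le> (2 * ?n) ^ 3" using n by (intro power_mono) auto
    then show ?thesis by (simp add: power_mult_distrib)
  qed simp
  then have "(1 + ?n) ^ 3 * cmod (M n g v) \<le> 8 * (1 + ?n ^ 3) * cmod (M n g v)" by (rule mult_right_mono) simp
  also have "\<dots> = 8 * (?n ^ 0 * cmod (M n g v) + ?n ^ 3 * cmod (M n g v))" by (simp add: algebra_simps)
  also have "\<dots> \<le> 8 * (sz g ^ 0 * sob 0 v + sz g ^ 3 * sob 3 v)"
    by (intro mult_left_mono add_mono M_decay_pow assms) auto
  finally show ?thesis by (simp add: dcy_def)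
qed

lemma dcy_nonneg: "0 \<le> dcy g v" by (simp add: dcy_def sob_nonneg sz_def add_nonneg_nonneg)

lemma dcy_cont: "continuous_on UNIV (\<lambda>g. dcy g v)"
  unfolding dcy_def sz_def by (intro continuous_intros)

lemma dcy_local:
  obtains \<delta> where "\<delta> > 0" "\<And>g. dist g g0 < \<delta> \<Longrightarrow> dcy g v \<le> dcy g0 v + 1"
proof -
  have "\<exists>d>0. \<forall>g\<in>UNIV. dist g g0 < d \<longrightarrow> dist (dcy g v) (dcy g0 v) < 1"
    using dcy_cont[of v] unfolding continuous_on_iff by (meson UNIV_I zero_less_one)
  then obtain d where d: "d > 0" "\<forall>g\<in>UNIV. dist g g0 < d \<longrightarrow> dist (dcy g v) (dcy g0 v) < 1" by blast
  show thesis by (rule that[OF d(1)]) (use d(2) in \<open>auto simp: dist_real_def abs_less_iff\<close>)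
qed

text \<open>Inverse squares are dominated by the telescoping differences of \<open>1 / k\<close>;
  the factor \<open>2\<close> accounts for the two signs of \<open>n\<close>.\<close>

lemma tail_sum:
  assumes F: "finite F" "\<And>n. n \<in> F \<Longrightarrow> \<bar>n\<bar> > int N" and a: "\<And>n. n \<in> F \<Longrightarrow> a n \<le> D / (1 + \<bar>of_int n\<bar>)\<^sup>2" and D: "D \<ge> 0"
  shows "(\<Sum>n\<in>F. a n) \<le> 2 * D / (real N + 1)"
proof -
  define h where "h k = D / (1 + real k)\<^sup>2" for k :: nat
  have h: "h k \<ge> 0" for k using D by (simp add: h_def)
  obtain L where L: "L > N" "\<And>n. n \<in> F \<Longrightarrow> \<bar>n\<bar> \<le> int L"
  proof -
    define L where "L = N + 1 + nat (\<Sum>n\<in>F. \<bar>n\<bar>)"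
    have "\<bar>n\<bar> \<le> int L" if "n \<in> F" for n
      using member_le_sum[of n F "\<lambda>n. \<bar>n\<bar>"] F(1) that by (simp add: L_def)
    then show thesis using that[of L] by (simp add: L_def)
  qed
  have tel: "(\<Sum>k\<in>{N<..N+j}. h k) \<le> D * (1 / (real N + 1) - 1 / (real (N + j) + 1))" for j
  proof (induction j)
    case (Suc j)
    have s: "{N<..N + Suc j} = insert (N + Suc j) {N<..N+j}" by auto
    let ?x = "real (N + j) + 1"
    have x: "?x > 0" by simp
    have "1 / (?x + 1)\<^sup>2 \<le> 1 / ?x - 1 / (?x + 1)"
    proof -
      have "1 / ?x - 1 / (?x + 1) = 1 / (?x * (?x + 1))" using x by (simp add: field_simps)
      moreover have "1 / (?x + 1)\<^sup>2 \<le> 1 / (?x * (?x + 1))"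
        using x by (intro divide_left_mono) (auto simp: power2_eq_square intro!: mult_right_mono)
      ultimately show ?thesis by simp
    qed
    then have "D * (1 / (?x + 1)\<^sup>2) \<le> D * (1 / ?x - 1 / (?x + 1))" by (rule mult_left_mono[OF _ D])
    moreover have "h (N + Suc j) = D * (1 / (?x + 1)\<^sup>2)" by (simp add: h_def algebra_simps)
    ultimately have "h (N + Suc j) \<le> D * (1 / ?x - 1 / (?x + 1))" by simp
    then show ?case unfolding s using Suc by (simp add: algebra_simps)
  qed simp
  have hs: "(\<Sum>k\<in>{N<..L}. h k) \<le> D / (real N + 1)"
  proof -
    have "(\<Sum>k\<in>{N<..L}. h k) \<le> D * (1 / (real N + 1) - 1 / (real L + 1))" using tel[of "L - N"] L(1) by simp
    also have "\<dots> \<le> D * (1 / (real N + 1))" using D by (intro mult_left_mono) auto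
    finally show ?thesis by simp
  qed
  have "(\<Sum>n\<in>F. a n) \<le> (\<Sum>n\<in>F. h (nat \<bar>n\<bar>))" using a by (intro sum_mono) (simp add: h_def)
  also have "\<dots> \<le> (\<Sum>n\<in>int ` {N<..L} \<union> (\<lambda>k. - int k) ` {N<..L}. h (nat \<bar>n\<bar>))"
  proof (rule sum_mono2)
    show "F \<subseteq> int ` {N<..L} \<union> (\<lambda>k. - int k) ` {N<..L}"
    proof
      fix n assume n: "n \<in> F"
      have k: "nat \<bar>n\<bar> \<in> {N<..L}" using F(2)[OF n] L(2)[OF n] by auto
      have "n = int (nat \<bar>n\<bar>) \<or> n = - int (nat \<bar>n\<bar>)" by linarith
      then show "n \<in> int ` {N<..L} \<union> (\<lambda>k. - int k) ` {N<..L}" using k by (metis UnI1 UnI2 image_eqI)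
    qed
  qed (use h in auto)
  also have "\<dots> \<le> (\<Sum>n\<in>int ` {N<..L}. h (nat \<bar>n\<bar>)) + (\<Sum>n\<in>(\<lambda>k. - int k) ` {N<..L}. h (nat \<bar>n\<bar>))"
    using h by (subst sum_Un) (auto intro: sum_nonneg)
  also have "\<dots> = 2 * (\<Sum>k\<in>{N<..L}. h k)"
    by (simp add: sum.reindex inj_on_def)
  also have "\<dots> \<le> 2 * D / (real N + 1)" using hs by simp
  finally show ?thesis .
qed

definition S :: "nat \<Rightarrow> mat2 \<Rightarrow> 'v \<Rightarrow> 'v" where
  "S N g v = vec {- int N..int N} (\<lambda>n. M n g v)"

lemma co_S: "g \<in> SL2 \<Longrightarrow> co n (S N g v) = (if \<bar>n\<bar> \<le> int N then M n g v else 0)"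
  by (auto simp: S_def co_vec M_out)

text \<open>Only subadditivity and homogeneity of \<open>q\<close> enter, so that the bound applies
  to norms and, in \<open>famI\<close>, to the seminorms attached to single group elements.\<close>

lemma S_tail:
  assumes g: "g \<in> SL2" and w: "\<And>n. q (e n) \<le> W * (1 + \<bar>of_int n\<bar>)" "W \<ge> 0"
    and q: "\<And>u v. q (u + v) \<le> q u + q v" "\<And>c v. q (scl V c v) = cmod c * q v" and N: "N \<le> N'"
  shows "q (S N' g v - S N g v) \<le> 2 * (W * dcy g v) / (real N + 1)"
proof -
  let ?F = "{- int N'..int N'} - {- int N..int N}"
  have q0: "q 0 = 0" using q(2)[of 0 0] by simp
  have "S N' g v - S N g v = vec ?F (\<lambda>n. M n g v)"
    by (rule v_eqI) (use g N in \<open>auto simp: co_simps co_S co_vec M_out\<close>)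
  also have "q \<dots> \<le> (\<Sum>n\<in>?F. q (scl V (M n g v) (e n)))"
    unfolding vec_def by (induction rule: infinite_finite_induct) (auto simp: q0 intro: order_trans[OF q(1)])
  also have "\<dots> \<le> 2 * (W * dcy g v) / (real N + 1)"
  proof (rule tail_sum)
    fix n assume "n \<in> ?F"
    let ?x = "1 + \<bar>of_int n :: real\<bar>"
    have x: "?x > 0" by simp
    have "q (scl V (M n g v) (e n)) \<le> cmod (M n g v) * (W * ?x)"
      unfolding q(2) by (intro mult_left_mono w) simp
    also have "\<dots> = W * (?x ^ 3 * cmod (M n g v)) / ?x\<^sup>2"
      using x by (simp add: power2_eq_square power3_eq_cube)
    also have "\<dots> \<le> W * dcy g v / ?x\<^sup>2"
      by (intro divide_right_mono mult_left_mono M_decay g w) simp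
    finally show "q (scl V (M n g v) (e n)) \<le> W * dcy g v / ?x\<^sup>2" .
  qed (use w dcy_nonneg in auto)
  finally show ?thesis .
qed

end

context gnorm
begin

text \<open>The same truncations, built from the reference coefficients, converge to the orbit
  vector in every completion whose norm grows at most linearly in \<open>n\<close>: they are Cauchy
  by the tail bound and have the right coefficients.\<close>

lemma S_conv:
  assumes g: "g \<in> SL2" and w: "\<And>n. p (e n) \<le> W * (1 + \<bar>of_int n\<bar>)" "W \<ge> 0"
  shows "(\<lambda>N. S N g v) \<in> N.CS" "\<rho> g (embed p v) = N.cc (\<lambda>N. S N g v)"
proof -
  have t: "p (S N' g v - S N g v) \<le> 2 * (W * dcy g v) / (real N + 1)" if "N \<le> N'" for N N'
    by (rule S_tail[OF g w N.p_triangle N.p_scl that])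
  have l: "(\<lambda>N. 2 * (W * dcy g v) / (real N + 1)) \<longlonglongrightarrow> 0" using LIMSEQ_Suc[OF lim_const_over_n[of "2 * (W * dcy g v)"]] by (simp add: add.commute)
  show cs: "(\<lambda>N. S N g v) \<in> N.CS"
  proof (rule N.CS_I)
    fix \<epsilon> :: real assume "\<epsilon> > 0"
    then obtain N0 where N0: "\<And>N. N \<ge> N0 \<Longrightarrow> 2 * (W * dcy g v) / (real N + 1) < \<epsilon>"
      using order_tendstoD(2)[OF l] unfolding eventually_sequentially by blast
    have "p (S m g v - S n g v) < \<epsilon>" if "m \<ge> N0" "n \<ge> N0" for m n
    proof (cases "m \<ge> n")
      case True then show ?thesis using t[of n m] N0[of n] that by linarith
    next
      case False then show ?thesis using t[of m n] N0[of m] that N.p_commute[of "S m g v"] by force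
    qed
    then show "\<exists>N. \<forall>m\<ge>N. \<forall>n\<ge>N. p (S m g v - S n g v) < \<epsilon>" by blast
  qed
  show "\<rho> g (embed p v) = N.cc (\<lambda>N. S N g v)"
  proof (rule cx_eqI)
    fix n
    have "(\<lambda>N. co n (S N g v)) \<longlonglongrightarrow> M n g v"
      by (rule tendsto_eventually) (auto simp: co_S[OF g] eventually_sequentially intro!: exI[of _ "nat \<bar>n\<bar>"])
    moreover have "(\<lambda>N. co n (S N g v)) \<longlonglongrightarrow> cx n (N.cc (\<lambda>N. S N g v))" by (rule cx_cc[OF cs])
    ultimately have "cx n (N.cc (\<lambda>N. S N g v)) = M n g v" by (rule LIMSEQ_unique[symmetric])
    then show "cx n (\<rho> g (embed p v)) = cx n (N.cc (\<lambda>N. S N g v))"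
      using mc_unique[OF g] by (simp add: mc_def)
  qed (use g cs in simp_all)
qed

end

text \<open>The group law expressed inside \<open>V\<close>, with the orbit vector replaced by its
  truncations. It lets other norms inherit multiplicativity.\<close>

lemma (in umod) M_S_conv:
  assumes "g \<in> SL2" "h \<in> SL2" shows "(\<lambda>N. M n h (S N g v)) \<longlonglongrightarrow> M n (h ** g) v"
proof -
  have w: "hp (e n) \<le> 1 * (1 + \<bar>of_int n\<bar>)" for n using hp_e_le[of n] by simp
  note c = H.S_conv[OF assms(1) w, of v]
  have "(\<lambda>N. ndist H.N.E (embed hp (S N g v)) (\<pi> g (embed hp v))) \<longlonglongrightarrow> 0"
    unfolding c(2)[simplified] by (rule H.N.embed_tendsto) (use c(1) in simp)
  then have "(\<lambda>N. ndist H.N.E (\<pi> h (embed hp (S N g v))) (\<pi> h (\<pi> g (embed hp v)))) \<longlonglongrightarrow> 0"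
    using assms by (intro H.\<rho>_tendsto) auto
  then have "(\<lambda>N. H.cx n (\<pi> h (embed hp (S N g v)))) \<longlonglongrightarrow> H.cx n (\<pi> h (\<pi> g (embed hp v)))"
    using assms by (intro H.cx_tendsto) auto
  then show ?thesis using assms by (simp add: H.mc_def H.\<rho>_mult)
qed

section \<open>A criterion for membership in Norm(V)\<close>

text \<open>The last condition is \<open>q (g v) \<le> q v\<close> up to the tail of the expansion of \<open>g v\<close>, which makes sense
  without a completion. For a norm it gives back a globalization.\<close>

definition (in umod) fam :: "(int \<Rightarrow> real) \<Rightarrow> real \<Rightarrow> ('v \<Rightarrow> real) \<Rightarrow> bool" where
  "fam w W q \<longleftrightarrow> (\<forall>v. 0 \<le> q v) \<and> (\<forall>u v. q (u + v) \<le> q u + q v) \<and> (\<forall>c v. q (scl V c v) = cmod c * q v) \<and>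
     (\<forall>n. q (e n) \<le> w n) \<and> (\<forall>g\<in>SL2. \<forall>v N. q (S N g v) \<le> q v + 2 * (W * dcy g v) / (real N + 1))"

lemma null_over_Suc: "(\<lambda>N. c / (real N + 1)) \<longlonglongrightarrow> (0::real)"
  using LIMSEQ_Suc[OF lim_const_over_n[of c]] by (simp add: add.commute)

context umod
begin

lemma S_diff: "g \<in> SL2 \<Longrightarrow> S N g (u - v) = S N g u - S N g v"
  by (rule v_eqI) (auto simp: co_simps co_S functionalD[OF H.mc_lin])

lemma S_comb: "g \<in> SL2 \<Longrightarrow> S N g (scl V a u + scl V c v) = scl V a (S N g u) + scl V c (S N g v)"
  by (rule v_eqI) (auto simp: co_simps co_S functionalD[OF H.mc_lin])

lemma S_rot:
  assumes "\<And>n. co n v \<noteq> 0 \<Longrightarrow> \<bar>n\<bar> \<le> int N" shows "S N (rot t) v = kact V (rot t) v"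
proof (rule v_eqI)
  fix n
  have "M n (rot t) v = cis (of_int n * t) * co n v"
    using H.mc_rot_left[OF SL2_1, of n t v] by simp
  then show "co n (S N (rot t) v) = co n (kact V (rot t) v)" using assms[of n] by (auto simp: co_S)
qed

lemma supp_bound: obtains N where "\<And>n. co n v \<noteq> 0 \<Longrightarrow> \<bar>n\<bar> \<le> int N"
proof -
  have "\<bar>n\<bar> \<le> int (nat (\<Sum>n | co n v \<noteq> 0. \<bar>n\<bar>))" if "co n v \<noteq> 0" for n
    using member_le_sum[of n "{n. co n v \<noteq> 0}" "\<lambda>n. \<bar>n\<bar>"] co_fin that by simp
  then show thesis using that by blast
qed

end

section \<open>The globalization built from truncations\<close>

locale famnorm = umod V e co b I \<mu> o' hp \<pi>
  for V :: "('v::ab_group_add) gk" and e co b I \<mu> o' hp \<pi> +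
  fixes w :: "int \<Rightarrow> real" and W :: real and p :: "'v \<Rightarrow> real"
  assumes w_le: "w n \<le> W * (1 + \<bar>of_int n\<bar>)" and W_nonneg: "0 \<le> W"
    and p_norm': "is_norm V p" and p_fam: "fam w W p"
begin

definition tl :: "nat \<Rightarrow> mat2 \<Rightarrow> 'v \<Rightarrow> real" where "tl N g v = 2 * (W * dcy g v) / (real N + 1)"

lemma p_S: "g \<in> SL2 \<Longrightarrow> p (S N g v) \<le> p v + tl N g v"
  using p_fam by (simp add: fam_def tl_def)

lemma p_e: "p (e n) \<le> W * (1 + \<bar>of_int n\<bar>)"
  using p_fam w_le order_trans unfolding fam_def by blast

lemma tl_lim: "(\<lambda>N. tl N g v) \<longlonglongrightarrow> 0"
  unfolding tl_def by (rule null_over_Suc)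

lemma p_K': assumes "k \<in> SO2" shows "p (kact V k v) \<le> 1 * p v"
proof -
  obtain t where t: "k = rot t" using SO2_cases[OF assms] by blast
  obtain N0 where N0: "\<And>n. co n v \<noteq> 0 \<Longrightarrow> \<bar>n\<bar> \<le> int N0" using supp_bound by blast
  have "p (kact V k v) \<le> p v + tl N (rot t) v" if "N \<ge> N0" for N
  proof -
    have "S N (rot t) v = kact V (rot t) v" by (rule S_rot) (use N0 that in fastforce)
    then show ?thesis using p_S[of "rot t" N v] by (simp add: t)
  qed
  moreover have "(\<lambda>N. p v + tl N (rot t) v) \<longlonglongrightarrow> p v + 0" by (intro tendsto_intros tl_lim)
  ultimately show ?thesis using LIMSEQ_le_const[of "\<lambda>N. p v + tl N (rot t) v" "p v" "p (kact V k v)"] by auto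
qed

sublocale knorm V e co b I \<mu> o' hp \<pi> p 1
  by (intro knorm.intro knorm_axioms.intro umod_axioms p_norm' p_K')

lemma p_S_tail: "g \<in> SL2 \<Longrightarrow> N \<le> N' \<Longrightarrow> p (S N' g v - S N g v) \<le> tl N g v"
  unfolding tl_def by (rule S_tail[OF _ p_e W_nonneg N.p_triangle N.p_scl])

text \<open>The truncation order is chosen so that the tail is at most \<open>1 / (j + 1)\<close>. A
  Cauchy sequence can then be moved by \<open>g\<close> term by term, with errors tending to
  \<open>0\<close>.\<close>

definition Tr :: "nat \<Rightarrow> mat2 \<Rightarrow> 'v \<Rightarrow> 'v" where
  "Tr j g v = S (nat \<lceil>2 * (W * dcy g v) * (real j + 1)\<rceil>) g v"

lemma Tr_S:
  assumes "g \<in> SL2" obtains N0 where "\<And>N. N \<ge> N0 \<Longrightarrow> p (S N g v - Tr j g v) \<le> 1 / (real j + 1)"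
proof -
  let ?a = "2 * (W * dcy g v)"
  let ?N = "nat \<lceil>?a * (real j + 1)\<rceil>"
  have a: "?a \<ge> 0" using W_nonneg dcy_nonneg by simp
  have "tl ?N g v \<le> 1 / (real j + 1)"
  proof -
    have "?a * (real j + 1) \<le> real ?N + 1" by linarith
    then show ?thesis unfolding tl_def by (simp add: divide_le_eq pos_le_divide_eq)
  qed
  note t = this
  show thesis
  proof (rule that[of ?N])
    fix N assume "?N \<le> N"
    from p_S_tail[OF assms this, of v] t show "p (S N g v - Tr j g v) \<le> 1 / (real j + 1)"
      unfolding Tr_def by (rule order_trans)
  qed
qed

text \<open>Translation is a contraction up to the two truncation errors: \<open>p_S\<close> is
  applied to \<open>u - v\<close> and its tail sent to \<open>0\<close>. This one estimate makes
  \<open>R\<close> well defined and nonexpansive.\<close>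

lemma Tr_est:
  assumes "g \<in> SL2" shows "p (Tr i g u - Tr j g v) \<le> p (u - v) + 1 / (real i + 1) + 1 / (real j + 1)"
proof -
  obtain N1 where N1: "\<And>N. N \<ge> N1 \<Longrightarrow> p (S N g u - Tr i g u) \<le> 1 / (real i + 1)" using Tr_S[OF assms] by blast
  obtain N2 where N2: "\<And>N. N \<ge> N2 \<Longrightarrow> p (S N g v - Tr j g v) \<le> 1 / (real j + 1)" using Tr_S[OF assms] by blast
  have "p (Tr i g u - Tr j g v) \<le> p (u - v) + tl N g (u - v) + 1 / (real i + 1) + 1 / (real j + 1)" if "N \<ge> max N1 N2" for N
    using N.p_tri[of "Tr i g u" "Tr j g v" "S N g u"] N.p_tri[of "S N g u" "Tr j g v" "S N g v"]
      N1[of N] N2[of N] that p_S[OF assms, of N "u - v"] N.p_commute[of "Tr i g u" "S N g u"] by (simp add: S_diff[OF assms])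
  note b = this
  have l: "(\<lambda>N. p (u - v) + tl N g (u - v) + 1 / (real i + 1) + 1 / (real j + 1)) \<longlonglongrightarrow> p (u - v) + 0 + 1 / (real i + 1) + 1 / (real j + 1)"
    by (intro tendsto_intros tl_lim)
  have "p (Tr i g u - Tr j g v) \<le> p (u - v) + 0 + 1 / (real i + 1) + 1 / (real j + 1)"
    by (rule LIMSEQ_le_const[OF l]) (use b in blast)
  then show ?thesis by simp
qed

lemma Tr_comb:
  assumes "g \<in> SL2"
  shows "p (scl V a (Tr j g u) + scl V c (Tr j g v) - Tr j g (scl V a u + scl V c v)) \<le> (cmod a + cmod c + 1) / (real j + 1)"
proof -
  let ?x = "scl V a u + scl V c v"
  obtain N1 where N1: "\<And>N. N \<ge> N1 \<Longrightarrow> p (S N g u - Tr j g u) \<le> 1 / (real j + 1)" using Tr_S[OF assms] by blast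
  obtain N2 where N2: "\<And>N. N \<ge> N2 \<Longrightarrow> p (S N g v - Tr j g v) \<le> 1 / (real j + 1)" using Tr_S[OF assms] by blast
  obtain N3 where N3: "\<And>N. N \<ge> N3 \<Longrightarrow> p (S N g ?x - Tr j g ?x) \<le> 1 / (real j + 1)" using Tr_S[OF assms] by blast
  define N where "N = max N1 (max N2 N3)"
  have eq: "scl V a (Tr j g u) + scl V c (Tr j g v) - Tr j g ?x
     = (S N g ?x - Tr j g ?x) - (scl V a (S N g u - Tr j g u) + scl V c (S N g v - Tr j g v))"
    by (simp add: S_comb[OF assms] vs.scale_right_diff_distrib)
  have "p (scl V a (Tr j g u) + scl V c (Tr j g v) - Tr j g ?x)
     \<le> p (S N g ?x - Tr j g ?x) + (cmod a * p (S N g u - Tr j g u) + cmod c * p (S N g v - Tr j g v))"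
    unfolding eq N.p_scl[symmetric] by (rule order_trans[OF N.p_diff add_left_mono[OF N.p_triangle]])
  also have "\<dots> \<le> 1 / (real j + 1) + (cmod a * (1 / (real j + 1)) + cmod c * (1 / (real j + 1)))"
    by (intro add_mono mult_left_mono N1 N2 N3) (auto simp: N_def)
  also have "\<dots> = (cmod a + cmod c + 1) / (real j + 1)" by (simp add: add_divide_distrib)
  finally show ?thesis .
qed

definition R :: "mat2 \<Rightarrow> (nat \<Rightarrow> 'v) set \<Rightarrow> (nat \<Rightarrow> 'v) set" where
  "R g A = N.cc (\<lambda>j. Tr j g (rep_seq A j))"

lemma Tr_CS: assumes g: "g \<in> SL2" and u: "u \<in> N.CS" shows "(\<lambda>j. Tr j g (u j)) \<in> N.CS"
proof (rule N.CS_I)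
  fix \<epsilon> :: real assume e: "\<epsilon> > 0"
  obtain N1 where N1: "\<forall>m\<ge>N1. \<forall>n\<ge>N1. p (u m - u n) < \<epsilon> / 3" using N.CS_D[OF u, of "\<epsilon>/3"] e by auto
  obtain N2 where N2: "\<And>j. j \<ge> N2 \<Longrightarrow> 1 / (real j + 1) < \<epsilon> / 3"
    using order_tendstoD(2)[OF null_over_Suc[of 1], of "\<epsilon>/3"] e unfolding eventually_sequentially by auto
  have "p (Tr m g (u m) - Tr n g (u n)) < \<epsilon>" if "m \<ge> max N1 N2" "n \<ge> max N1 N2" for m n
  proof -
    have "p (u m - u n) < \<epsilon> / 3" "1 / (real m + 1) < \<epsilon> / 3" "1 / (real n + 1) < \<epsilon> / 3" using that N1 N2 by auto
    then show ?thesis using Tr_est[OF g, of m "u m" n "u n"] by simp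
  qed
  then show "\<exists>N. \<forall>m\<ge>N. \<forall>n\<ge>N. p (Tr m g (u m) - Tr n g (u n)) < \<epsilon>" by blast
qed

lemma Tr_lim:
  assumes g: "g \<in> SL2" and u: "(\<lambda>j. p (u j - v j)) \<longlonglongrightarrow> l"
  shows "(\<lambda>j. p (u j - v j) + 1 / (real j + 1) + 1 / (real j + 1)) \<longlonglongrightarrow> l"
  using tendsto_add[OF tendsto_add[OF u null_over_Suc[of 1]] null_over_Suc[of 1]] by simp

lemma R_cc: assumes g: "g \<in> SL2" and u: "u \<in> N.CS" shows "R g (N.cc u) = N.cc (\<lambda>j. Tr j g (u j))"
proof -
  have "(\<lambda>j. p (Tr j g (u j) - Tr j g (rep_seq (N.cc u) j))) \<longlonglongrightarrow> 0"
    by (rule Lim_null_comparison[OF _ Tr_lim[OF g N.rep_cc(2)[OF u]]])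
      (intro always_eventually allI, simp only: real_norm_def abs_of_nonneg[OF N.p_nonneg], rule Tr_est[OF g])
  then show ?thesis unfolding R_def
    using N.cc_eq_iff[OF Tr_CS[OF g u] Tr_CS[OF g N.rep_cc(1)[OF u]]] by simp
qed

lemma R_pts [simp]: "g \<in> SL2 \<Longrightarrow> A \<in> pts N.E \<Longrightarrow> R g A \<in> pts N.E"
  by (auto elim!: N.pts_cases simp: R_cc Tr_CS)

lemma R_lip:
  assumes g: "g \<in> SL2" and "A \<in> pts N.E" "B \<in> pts N.E"
  shows "ndist N.E (R g A) (R g B) \<le> ndist N.E A B"
proof -
  obtain u v where u: "u \<in> N.CS" "v \<in> N.CS" "A = N.cc u" "B = N.cc v" using assms by (auto elim!: N.pts_cases)
  show ?thesis unfolding u(3,4) R_cc[OF g u(1)] R_cc[OF g u(2)]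
    by (rule LIMSEQ_le[OF N.ndist_cc[OF Tr_CS[OF g u(1)] Tr_CS[OF g u(2)]] Tr_lim[OF g N.ndist_cc[OF u(1,2)]]])
      (use Tr_est[OF g] in blast)
qed

lemma R_tendsto:
  assumes "g \<in> SL2" "\<And>x. F x \<in> pts N.E" "A \<in> pts N.E" "((\<lambda>x. ndist N.E (F x) A) \<longlongrightarrow> 0) net"
  shows "((\<lambda>x. ndist N.E (R g (F x)) (R g A)) \<longlongrightarrow> 0) net"
  by (rule Lim_null_comparison[OF _ assms(4)]) (use R_lip assms in simp)

lemma R_comb:
  assumes g: "g \<in> SL2" and u: "u \<in> N.CS" "v \<in> N.CS"
  shows "R g (N.cc (\<lambda>j. scl V a (u j) + scl V c (v j))) = N.cc (\<lambda>j. scl V a (Tr j g (u j)) + scl V c (Tr j g (v j)))"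
proof -
  have cs: "(\<lambda>j. scl V a (u j) + scl V c (v j)) \<in> N.CS" using u by simp
  have cs': "(\<lambda>j. scl V a (Tr j g (u j)) + scl V c (Tr j g (v j))) \<in> N.CS" using Tr_CS[OF g] u by simp
  have "(\<lambda>j. p (scl V a (Tr j g (u j)) + scl V c (Tr j g (v j)) - Tr j g (scl V a (u j) + scl V c (v j)))) \<longlonglongrightarrow> 0"
    by (rule Lim_null_comparison[OF _ null_over_Suc[of "cmod a + cmod c + 1"]]) (use Tr_comb[OF g] in simp)
  then show ?thesis unfolding R_cc[OF g cs] using N.cc_eq_iff[OF cs' Tr_CS[OF g cs]] by simp
qed

lemma R_add:
  assumes g: "g \<in> SL2" and "A \<in> pts N.E" "B \<in> pts N.E"
  shows "R g (add N.E A B) = add N.E (R g A) (R g B)"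
proof -
  obtain u v where u: "u \<in> N.CS" "v \<in> N.CS" "A = N.cc u" "B = N.cc v" using assms by (auto elim!: N.pts_cases)
  show ?thesis using R_comb[OF g u(1,2), of 1 1] u g by (simp add: N.add_cc R_cc Tr_CS)
qed

lemma R_smul:
  assumes g: "g \<in> SL2" and "A \<in> pts N.E" shows "R g (smul N.E c A) = smul N.E c (R g A)"
proof -
  obtain u where u: "u \<in> N.CS" "A = N.cc u" using assms by (auto elim!: N.pts_cases)
  show ?thesis using R_comb[OF g u(1) u(1), of c 0] u g by (simp add: N.smul_cc R_cc Tr_CS)
qed

lemma R_embed:
  assumes g: "g \<in> SL2"
  shows "(\<lambda>N. S N g v) \<in> N.CS" "R g (embed p v) = N.cc (\<lambda>N. S N g v)"
proof -
  show cs: "(\<lambda>N. S N g v) \<in> N.CS"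
  proof (rule N.CS_I)
    fix \<epsilon> :: real assume "\<epsilon> > 0"
    then obtain N0 where N0: "\<And>N. N \<ge> N0 \<Longrightarrow> tl N g v < \<epsilon>"
      using order_tendstoD(2)[OF tl_lim] unfolding eventually_sequentially by blast
    have "p (S m g v - S n g v) < \<epsilon>" if "m \<ge> N0" "n \<ge> N0" for m n
    proof (cases "m \<ge> n")
      case True then show ?thesis using p_S_tail[OF g, of n m v] N0[of n] that by linarith
    next
      case False then show ?thesis using p_S_tail[OF g, of m n v] N0[of m] that N.p_commute[of "S m g v"] by force
    qed
    then show "\<exists>N. \<forall>m\<ge>N. \<forall>n\<ge>N. p (S m g v - S n g v) < \<epsilon>" by blast
  qed
  have "p (S N g v - Tr N g v) \<le> tl N g v + 1 / (real N + 1)" for N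
  proof -
    obtain N0 where N0: "\<And>K. K \<ge> N0 \<Longrightarrow> p (S K g v - Tr N g v) \<le> 1 / (real N + 1)" using Tr_S[OF g] by blast
    show ?thesis using N0[of "max N0 N"] p_S_tail[OF g, of N "max N0 N" v]
        N.p_tri[of "S N g v" "Tr N g v" "S (max N0 N) g v"] N.p_commute[of "S N g v" "S (max N0 N) g v"] by simp
  qed
  then have "(\<lambda>N. p (S N g v - Tr N g v)) \<longlonglongrightarrow> 0"
    by (intro Lim_null_comparison[OF _ tendsto_add_zero[OF tl_lim null_over_Suc[of 1]]] always_eventually allI) simp
  then show "R g (embed p v) = N.cc (\<lambda>N. S N g v)"
    unfolding embed_def R_cc[OF g N.CS_const] using N.cc_eq_iff[OF cs Tr_CS[OF g N.CS_const[of v]]] by simp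
qed

lemma cx_R: assumes g: "g \<in> SL2" shows "cx n (R g (embed p v)) = M n g v"
proof -
  have "(\<lambda>N. co n (S N g v)) \<longlonglongrightarrow> M n g v"
    by (rule tendsto_eventually) (auto simp: co_S[OF g] eventually_sequentially intro!: exI[of _ "nat \<bar>n\<bar>"])
  then show ?thesis using LIMSEQ_unique cx_cc[OF R_embed(1)[OF g]] R_embed(2)[OF g] by metis
qed

lemma cx_lim:
  "((\<lambda>x. ndist N.E (F x) A) \<longlongrightarrow> 0) net \<Longrightarrow> A \<in> pts N.E \<Longrightarrow> (\<And>x. F x \<in> pts N.E) \<Longrightarrow> ((\<lambda>x. cx n (F x)) \<longlongrightarrow> cx n A) net"
  unfolding cx_def by (rule N.ext_tendsto[OF co_bfun])

text \<open>Both sides have the coefficients \<open>M n (g ** h) v\<close>, by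
  \<open>M_S_conv\<close> for the right-hand side.\<close>

lemma R_mult_embed:
  assumes g: "g \<in> SL2" and h: "h \<in> SL2" shows "R (g ** h) (embed p v) = R g (R h (embed p v))"
proof (rule cx_eqI)
  fix n
  have "(\<lambda>N. ndist N.E (embed p (S N h v)) (R h (embed p v))) \<longlonglongrightarrow> 0"
    unfolding R_embed(2)[OF h] by (rule N.embed_tendsto[OF R_embed(1)[OF h]])
  then have "(\<lambda>N. ndist N.E (R g (embed p (S N h v))) (R g (R h (embed p v)))) \<longlonglongrightarrow> 0"
    using g h by (intro R_tendsto) auto
  then have "(\<lambda>N. cx n (R g (embed p (S N h v)))) \<longlonglongrightarrow> cx n (R g (R h (embed p v)))"
    using g h by (intro cx_lim) auto
  then have "(\<lambda>N. M n g (S N h v)) \<longlonglongrightarrow> cx n (R g (R h (embed p v)))" by (simp add: cx_R[OF g])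
  then have "M n (g ** h) v = cx n (R g (R h (embed p v)))"
    using LIMSEQ_unique M_S_conv[OF h g] by blast
  then show "cx n (R (g ** h) (embed p v)) = cx n (R g (R h (embed p v)))" using g h by (simp add: cx_R)
qed (use g h in auto)

lemma R_mult:
  assumes g: "g \<in> SL2" and h: "h \<in> SL2" and A: "A \<in> pts N.E" shows "R (g ** h) A = R g (R h A)"
proof -
  obtain u where u: "u \<in> N.CS" "A = N.cc u" using N.pts_cases[OF A] by blast
  have l: "(\<lambda>j. ndist N.E (embed p (u j)) A) \<longlonglongrightarrow> 0" unfolding u(2) by (rule N.embed_tendsto[OF u(1)])
  have gh: "g ** h \<in> SL2" using g h by simp
  have "ndist N.E (R (g ** h) A) (R g (R h A)) \<le> 2 * ndist N.E (embed p (u j)) A" for j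
  proof -
    have "ndist N.E (R (g ** h) A) (R g (R h A)) \<le> ndist N.E (R (g ** h) A) (R (g ** h) (embed p (u j))) + ndist N.E (R g (R h (embed p (u j)))) (R g (R h A))"
      using N.ndist_triangle[of "R (g ** h) A" "R (g ** h) (embed p (u j))" "R g (R h A)"] g h A gh
      by (simp add: R_mult_embed)
    also have "ndist N.E (R (g ** h) A) (R (g ** h) (embed p (u j))) \<le> ndist N.E (embed p (u j)) A"
      using R_lip[OF gh A N.embed_pts] by (simp add: N.ndist_commute)
    also have "ndist N.E (R g (R h (embed p (u j)))) (R g (R h A)) \<le> ndist N.E (embed p (u j)) A"
      using R_lip[OF g, of "R h (embed p (u j))" "R h A"] R_lip[OF h, of "embed p (u j)" A] g h A by simp
    finally show ?thesis by simp
  qed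
  then have "ndist N.E (R (g ** h) A) (R g (R h A)) \<le> 2 * 0"
    by (intro LIMSEQ_le_const[OF tendsto_mult_left[OF l]]) auto
  then have "ndist N.E (R (g ** h) A) (R g (R h A)) = 0" using N.ndist_nonneg[of "R (g ** h) A" "R g (R h A)"] by linarith
  then show ?thesis using N.ndist_eq_0 g h A gh by simp
qed

lemma R_one: assumes A: "A \<in> pts N.E" shows "R (mat 1) A = A"
proof -
  obtain u where u: "u \<in> N.CS" "A = N.cc u" using N.pts_cases[OF A] by blast
  have "p (Tr j (mat 1) (u j) - u j) \<le> 1 / (real j + 1)" for j
  proof -
    obtain N0 where N0: "\<And>N. N \<ge> N0 \<Longrightarrow> p (S N (mat 1) (u j) - Tr j (mat 1) (u j)) \<le> 1 / (real j + 1)"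
      using Tr_S[OF SL2_1] by blast
    obtain N1 where N1: "\<And>n. co n (u j) \<noteq> 0 \<Longrightarrow> \<bar>n\<bar> \<le> int N1" using supp_bound by blast
    have "S (max N0 N1) (mat 1) (u j) = u j"
      using S_rot[of "u j" "max N0 N1" 0] N1 by (fastforce simp: k_one)
    then show ?thesis using N0[of "max N0 N1"] by (simp add: N.p_commute)
  qed
  then have "(\<lambda>j. p (Tr j (mat 1) (u j) - u j)) \<longlonglongrightarrow> 0"
    by (intro Lim_null_comparison[OF _ null_over_Suc[of 1]]) auto
  then show ?thesis unfolding u(2) R_cc[OF SL2_1 u(1)] using N.cc_eq_iff[OF Tr_CS[OF SL2_1 u(1)] u(1)] by simp
qed

text \<open>Up to \<open>N0\<close> only finitely many continuous coefficients matter; beyond it the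
  tails are small uniformly near \<open>g\<close>, because \<open>dcy\<close> is locally
  bounded.\<close>

lemma R_orbit_cont:
  assumes g: "g \<in> SL2" and e: "\<epsilon> > 0"
  obtains \<delta> where "\<delta> > 0" "\<And>h. h \<in> SL2 \<Longrightarrow> dist g h < \<delta> \<Longrightarrow> ndist N.E (R g (embed p v)) (R h (embed p v)) < \<epsilon>"
proof -
  obtain \<delta>1 where d1: "\<delta>1 > 0" "\<And>h. dist h g < \<delta>1 \<Longrightarrow> dcy h v \<le> dcy g v + 1" using dcy_local by blast
  let ?c = "2 * (W * (dcy g v + 1))"
  obtain N0 where N0: "\<And>N. N \<ge> N0 \<Longrightarrow> ?c / (real N + 1) < \<epsilon> / 4"
    using order_tendstoD(2)[OF null_over_Suc[of ?c], of "\<epsilon>/4"] e unfolding eventually_sequentially by auto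
  define f where "f h = (\<Sum>n\<in>{- int N0..int N0}. cmod (M n g v - M n h v) * p (e n))" for h
  have "continuous_on SL2 f" unfolding f_def by (intro continuous_intros H.mc_cont)
  then have "\<forall>x\<in>SL2. \<forall>e>0. \<exists>d>0. \<forall>h\<in>SL2. dist h x < d \<longrightarrow> dist (f h) (f x) < e" unfolding continuous_on_iff .
  from spec[OF bspec[OF this g], of "\<epsilon> / 4"] have "\<exists>d>0. \<forall>h\<in>SL2. dist h g < d \<longrightarrow> dist (f h) (f g) < \<epsilon> / 4"
    using e by simp
  then obtain \<delta>2 where d: "\<delta>2 > 0" "\<forall>h\<in>SL2. dist h g < \<delta>2 \<longrightarrow> dist (f h) (f g) < \<epsilon> / 4" by blast
  have "f g = 0" by (simp add: f_def)
  then have d2: "\<delta>2 > 0" "\<And>h. h \<in> SL2 \<Longrightarrow> dist h g < \<delta>2 \<Longrightarrow> f h < \<epsilon> / 4"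
    using d by (auto simp: dist_real_def abs_less_iff)
  have "ndist N.E (R g (embed p v)) (R h (embed p v)) < \<epsilon>" if h: "h \<in> SL2" "dist g h < min \<delta>1 \<delta>2" for h
  proof -
    have "p (S N g v - S N h v) \<le> 3 * (\<epsilon> / 4)" if N: "N \<ge> N0" for N
    proof -
      have d: "dcy h v \<le> dcy g v + 1" using d1(2)[of h] h(2) by (simp add: dist_commute)
      have "tl N0 g v \<le> ?c / (real N0 + 1)" "tl N0 h v \<le> ?c / (real N0 + 1)"
        unfolding tl_def using d W_nonneg by (intro divide_right_mono mult_left_mono; simp)+
      then have t: "tl N0 g v \<le> \<epsilon> / 4" "tl N0 h v \<le> \<epsilon> / 4" using N0[of N0] by simp_all
      have "S N0 g v - S N0 h v = vec {- int N0..int N0} (\<lambda>n. M n g v - M n h v)"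
        by (rule v_eqI) (use g h(1) in \<open>auto simp: co_simps co_S co_vec M_out\<close>)
      then have "p (S N0 g v - S N0 h v) \<le> f h" using p_vec unfolding f_def by simp
      also have "f h \<le> \<epsilon> / 4" using d2(2)[OF h(1)] h(2) by (simp add: dist_commute)
      finally have "p (S N0 g v - S N0 h v) \<le> \<epsilon> / 4" .
      then show ?thesis
        using p_S_tail[OF g N, of v] p_S_tail[OF h(1) N, of v] t
          N.p_tri[of "S N g v" "S N h v" "S N0 g v"] N.p_tri[of "S N0 g v" "S N h v" "S N0 h v"] N.p_commute[of "S N0 h v" "S N h v"]
        by simp
    qed
    then have "ndist N.E (R g (embed p v)) (R h (embed p v)) \<le> 3 * (\<epsilon> / 4)"
      unfolding R_embed(2)[OF g] R_embed(2)[OF h(1)]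
      by (intro N.ndist_cc_le R_embed(1) g h(1)) (auto simp: eventually_sequentially)
    then show ?thesis using e by simp
  qed
  then show thesis using d1(1) d2(1) that[of "min \<delta>1 \<delta>2"] by simp
qed

text \<open>Joint continuity follows from two facts: every \<open>R g\<close> is nonexpansive, and
  orbit maps of vectors in the dense subspace \<open>V\<close> are continuous.\<close>

lemma R_continuous_rep: "continuous_rep N.E R"
  unfolding continuous_rep_def
proof (intro conjI ballI allI)
  show "continuous_map (prod_topology (top_of_set SL2) (Metric_space.mtopology (pts N.E) (ndist N.E)))
     (Metric_space.mtopology (pts N.E) (ndist N.E)) (\<lambda>(g, a). R g a)"
  proof (subst N.mtop_cont)
    show "\<forall>g\<in>SL2. \<forall>A\<in>pts N.E. \<forall>\<epsilon>>0. \<exists>\<delta>>0. \<forall>h\<in>SL2. \<forall>B\<in>pts N.E.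
       dist g h < \<delta> \<longrightarrow> ndist N.E A B < \<delta> \<longrightarrow> ndist N.E (R g A) (R h B) < \<epsilon>"
    proof (intro ballI allI impI)
      fix g A and \<epsilon> :: real assume g: "g \<in> SL2" and A: "A \<in> pts N.E" and e: "\<epsilon> > 0"
      obtain u where u: "u \<in> N.CS" "A = N.cc u" using N.pts_cases[OF A] by blast
      obtain j where "ndist N.E (embed p (u j)) A < \<epsilon> / 4"
        using order_tendstoD(2)[OF N.embed_tendsto[OF u(1)], of "\<epsilon>/4"] e unfolding eventually_sequentially u(2) by auto
      then obtain v where v: "ndist N.E A (embed p v) < \<epsilon> / 4" by (auto simp: N.ndist_commute)
      obtain \<delta> where d: "\<delta> > 0" "\<And>h. h \<in> SL2 \<Longrightarrow> dist g h < \<delta> \<Longrightarrow> ndist N.E (R g (embed p v)) (R h (embed p v)) < \<epsilon> / 4"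
        using R_orbit_cont[OF g, of "\<epsilon>/4" v] e by auto
      have "ndist N.E (R g A) (R h B) < \<epsilon>" if h: "h \<in> SL2" "B \<in> pts N.E" "dist g h < min \<delta> (\<epsilon>/4)" "ndist N.E A B < min \<delta> (\<epsilon>/4)" for h B
      proof -
        have "ndist N.E (R g A) (R h B) \<le> ndist N.E (R g A) (R g (embed p v)) + (ndist N.E (R g (embed p v)) (R h (embed p v)) + ndist N.E (R h (embed p v)) (R h B))"
          using N.ndist_triangle[of "R g A" "R g (embed p v)" "R h B"] N.ndist_triangle[of "R g (embed p v)" "R h (embed p v)" "R h B"] g h A by simp
        moreover have "ndist N.E (R g A) (R g (embed p v)) < \<epsilon> / 4" using R_lip[OF g A N.embed_pts, of v] v by simp
        moreover have "ndist N.E (R h (embed p v)) (R h B) \<le> ndist N.E (embed p v) A + ndist N.E A B"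
          using R_lip[OF h(1) N.embed_pts h(2), of v] N.ndist_triangle[of "embed p v" A B] A h by simp
        moreover have "ndist N.E (R g (embed p v)) (R h (embed p v)) < \<epsilon> / 4" using d(2)[OF h(1)] h(3) by simp
        ultimately show ?thesis using v h(4) N.ndist_commute[of "embed p v" A] by simp
      qed
      then show "\<exists>\<delta>>0. \<forall>h\<in>SL2. \<forall>B\<in>pts N.E. dist g h < \<delta> \<longrightarrow> ndist N.E A B < \<delta> \<longrightarrow> ndist N.E (R g A) (R h B) < \<epsilon>"
        using d(1) e by (intro exI[of _ "min \<delta> (\<epsilon>/4)"]) auto
    qed
  qed simp
qed (simp_all add: R_add R_smul R_one R_mult)

lemma R_k: assumes "k \<in> SO2" shows "R k (embed p v) = embed p (kact V k v)"
proof -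
  obtain t where t: "k = rot t" using SO2_cases[OF assms] by blast
  show ?thesis
    by (rule cx_eqI) (use H.mc_rot_left[OF SL2_1, of _ t v] in \<open>auto simp: t cx_R\<close>)
qed

lemma cx_add': "A \<in> pts N.E \<Longrightarrow> B \<in> pts N.E \<Longrightarrow> cx n (add N.E A B) = cx n A + cx n B"
  and cx_smul': "A \<in> pts N.E \<Longrightarrow> cx n (smul N.E c A) = c * cx n A"
  unfolding cx_def by (simp_all add: N.ext_add[OF co_bfun] N.ext_smul[OF co_bfun])

lemma cx_R_rot:
  assumes "A \<in> pts N.E" shows "cx n (R (rot t) A) = cis (of_int n * t) * cx n A"
proof -
  obtain u where u: "u \<in> N.CS" "A = N.cc u" using N.pts_cases[OF assms] by blast
  have "(\<lambda>j. ndist N.E (R (rot t) (embed p (u j))) (R (rot t) A)) \<longlonglongrightarrow> 0"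
    using N.embed_tendsto[OF u(1)] assms u(2) by (intro R_tendsto) auto
  then have "(\<lambda>j. cx n (R (rot t) (embed p (u j)))) \<longlonglongrightarrow> cx n (R (rot t) A)"
    by (rule cx_lim) (use assms in auto)
  moreover have "(\<lambda>j. cx n (R (rot t) (embed p (u j)))) \<longlonglongrightarrow> cis (of_int n * t) * cx n A"
    using tendsto_mult_left[OF cx_cc[OF u(1)]] by (simp add: R_k u(2))
  ultimately show ?thesis using LIMSEQ_unique by blast
qed

text \<open>Suppose the rotations of \<open>A\<close> stay in the span of \<open>B\<close> while
  \<open>A\<close> has more than \<open>card B\<close> nonzero coefficients. Some linear relation
  between coefficients then holds on \<open>B\<close>, hence on all rotations of \<open>A\<close>;
  averaging over K isolates one coefficient and shows that it is zero.\<close>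

lemma R_K_finite: "K_finite_vectors N.E R = range (embed p)"
proof
  show "range (embed p) \<subseteq> K_finite_vectors N.E R"
  proof
    fix A assume "A \<in> range (embed p)"
    then obtain v where A: "A = embed p v" by blast
    let ?B = "(\<lambda>n. embed p (e n)) ` {n. co n v \<noteq> 0}"
    have "R k A \<in> nspan N.E ?B" if k: "k \<in> SO2" for k
      unfolding nspan_def
    proof (intro InterI, clarify)
      fix U assume B: "?B \<subseteq> U" and z: "zer N.E \<in> U" and ad: "\<forall>a\<in>U. \<forall>b\<in>U. add N.E a b \<in> U" and sm: "\<forall>c. \<forall>a\<in>U. smul N.E c a \<in> U"
      obtain t where t: "k = rot t" using SO2_cases[OF k] by blast
      have fin: "embed p (\<Sum>n\<in>F. scl V (a n) (e n)) \<in> U" if "finite F" "F \<subseteq> {n. co n v \<noteq> 0}" for F a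
        using that
      proof (induction F rule: finite_induct)
        case empty then show ?case using z by (simp add: banach_completion_def embed_def)
      next
        case (insert n F)
        then have 1: "embed p (e n) \<in> U" and 2: "embed p (\<Sum>n\<in>F. scl V (a n) (e n)) \<in> U"
          using B by auto
        from 1 sm have "smul N.E (a n) (embed p (e n)) \<in> U" by blast
        with 2 ad have "add N.E (smul N.E (a n) (embed p (e n))) (embed p (\<Sum>n\<in>F. scl V (a n) (e n))) \<in> U" by blast
        then show ?case using insert by simp
      qed
      from fin[OF co_fin subset_refl, of "\<lambda>n. cis (of_int n * t) * co n v"]
      have "embed p (mult (\<lambda>n. cis (of_int n * t)) v) \<in> U" by (simp add: mult_def vec_def)
      then show "R k A \<in> U" unfolding A R_k[OF k] unfolding t k_mult .
    qed
    then show "A \<in> K_finite_vectors N.E R" unfolding K_finite_vectors_def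
      using co_fin by (auto simp: A intro!: exI[of _ ?B])
  qed
  show "K_finite_vectors N.E R \<subseteq> range (embed p)"
  proof
    fix A assume "A \<in> K_finite_vectors N.E R"
    then obtain B where A: "A \<in> pts N.E" and B: "finite B" "B \<subseteq> pts N.E" "\<And>k. k \<in> SO2 \<Longrightarrow> R k A \<in> nspan N.E B"
      unfolding K_finite_vectors_def by blast
    have fin: "finite {n. cx n A \<noteq> 0}"
    proof (rule ccontr)
      assume "infinite {n. cx n A \<noteq> 0}"
      then obtain F where F: "finite F" "card F = Suc (card B)" "F \<subseteq> {n. cx n A \<noteq> 0}"
        using infinite_arbitrarily_large by blast
      have FI: "F \<subseteq> I"
      proof
        fix n assume "n \<in> F"
        then have "cx n A \<noteq> 0" using F by blast
        obtain u where u: "u \<in> N.CS" "A = N.cc u" using N.pts_cases[OF A] by blast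
        show "n \<in> I"
        proof (rule ccontr)
          assume "n \<notin> I"
          then have "cx n A = 0" using cx_cc[OF u(1), of n] u by (simp add: co_out LIMSEQ_const_iff)
          then show False using \<open>cx n A \<noteq> 0\<close> by simp
        qed
      qed
      have inj: "inj_on e F"
      proof (rule inj_onI)
        fix m n assume "m \<in> F" "n \<in> F" "e m = e n"
        then have "co m (e n) = 1" using FI co_e[of m m] by auto
        then show "m = n" by (simp add: co_e split: if_splits)
      qed
      define x where "x Y = vec F (\<lambda>n. cx n Y)" for Y
      have ind: "vs.independent (e ` F)"
      proof (rule vs.independent_if_scalars_zero)
        fix f y assume s: "(\<Sum>y\<in>e ` F. scl V (f y) y) = 0" and "y \<in> e ` F"
        then obtain n where n: "n \<in> F" "y = e n" by blast
        have "vec F (\<lambda>n. f (e n)) = 0" using s by (simp add: vec_def sum.reindex[OF inj])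
        then have "co n (vec F (\<lambda>n. f (e n))) = 0" by (simp add: co_simps)
        then show "f y = 0" using n FI F(1) by (auto simp: co_vec)
      qed (use F in simp)
      have "\<exists>m\<in>F. e m \<notin> vs.span (x ` B)"
      proof (rule ccontr)
        assume "\<not> ?thesis"
        then have "e ` F \<subseteq> vs.span (x ` B)" by blast
        then have "card (e ` F) \<le> card (x ` B)"
          using vs.independent_span_bound[OF _ ind] B(1) by blast
        also have "\<dots> \<le> card B" by (rule card_image_le[OF B(1)])
        finally show False using F(2) card_image[OF inj] by simp
      qed
      then obtain m where m: "m \<in> F" "e m \<notin> vs.span (x ` B)" by blast
      \<comment> \<open>The relation in question: \<phi> kills the coefficient vectors of all
        elements of \<open>B\<close> but not \<open>e m\<close>.\<close>
      obtain \<phi> where \<phi>: "functional V \<phi>" "\<phi> (e m) = 1" "\<And>y. y \<in> vs.span (x ` B) \<Longrightarrow> \<phi> y = 0"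
        using functional_separates[OF V vs.subspace_span m(2)] by blast
      have ns: "nspan N.E B \<subseteq> {Y \<in> pts N.E. (\<Sum>n\<in>F. cx n Y * \<phi> (e n)) = 0}"
        unfolding nspan_def
      proof (rule Inter_lower, intro CollectI conjI allI ballI)
        show "B \<subseteq> {Y \<in> pts N.E. (\<Sum>n\<in>F. cx n Y * \<phi> (e n)) = 0}"
        proof
        fix Y assume Y: "Y \<in> B"
        have "\<phi> (x Y) = 0" by (intro \<phi>(3) vs.span_base imageI Y)
        then have "(\<Sum>n\<in>F. cx n Y * \<phi> (e n)) = 0" by (simp add: x_def vec_def functionalD[OF \<phi>(1)])
        then show "Y \<in> {Y \<in> pts N.E. (\<Sum>n\<in>F. cx n Y * \<phi> (e n)) = 0}" using Y B by blast
        qed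
      next
        have "zer N.E = embed p 0" by (simp add: banach_completion_def embed_def)
        then show "zer N.E \<in> pts N.E" "(\<Sum>n\<in>F. cx n (zer N.E) * \<phi> (e n)) = 0" by (simp_all add: co_simps)
      next
        fix Y Z assume "Y \<in> {Y \<in> pts N.E. (\<Sum>n\<in>F. cx n Y * \<phi> (e n)) = 0}" "Z \<in> {Y \<in> pts N.E. (\<Sum>n\<in>F. cx n Y * \<phi> (e n)) = 0}"
        then show "add N.E Y Z \<in> pts N.E" "(\<Sum>n\<in>F. cx n (add N.E Y Z) * \<phi> (e n)) = 0"
          by (simp_all add: cx_add' distrib_right sum.distrib)
      next
        fix c Y assume "Y \<in> {Y \<in> pts N.E. (\<Sum>n\<in>F. cx n Y * \<phi> (e n)) = 0}"
        then have Y: "Y \<in> pts N.E" "(\<Sum>n\<in>F. cx n Y * \<phi> (e n)) = 0" by simp_all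
        show "smul N.E c Y \<in> pts N.E" using Y by simp
        have "(\<Sum>n\<in>F. cx n (smul N.E c Y) * \<phi> (e n)) = c * (\<Sum>n\<in>F. cx n Y * \<phi> (e n))"
          by (simp only: cx_smul'[OF Y(1)] sum_distrib_left mult.assoc)
        then show "(\<Sum>n\<in>F. cx n (smul N.E c Y) * \<phi> (e n)) = 0" unfolding Y(2) by simp
      qed
      have zero: "(\<Sum>n\<in>F. (cis (of_int n * t) * cx n A) * \<phi> (e n)) = 0" for t
        using subsetD[OF ns B(3)[OF rot_SO2[of t]]] by (simp add: cx_R_rot[OF A])
      obtain L where L: "L > (0::nat)" "\<And>n. n \<in> (\<lambda>n. n - m) ` F \<Longrightarrow> int L > \<bar>n\<bar>"
        using large_modulus[of "(\<lambda>n. n - m) ` F" 0] F(1) by blast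
      have "0 = (\<Sum>l<L. cis (- of_int m * ang L l) * (\<Sum>n\<in>F. (cis (of_int n * ang L l) * cx n A) * \<phi> (e n)))"
        by (simp add: zero)
      also have "\<dots> = (\<Sum>l<L. \<Sum>n\<in>F. cis (of_int (n - m) * ang L l) * (cx n A * \<phi> (e n)))"
      proof (rule sum.cong[OF refl])
        fix l
        have "cis (- of_int m * ang L l) * ((cis (of_int n * ang L l) * cx n A) * \<phi> (e n)) = cis (of_int (n - m) * ang L l) * (cx n A * \<phi> (e n))" for n
        proof -
          have "cis (- of_int m * ang L l) * ((cis (of_int n * ang L l) * cx n A) * \<phi> (e n)) = (cis (- of_int m * ang L l) * cis (of_int n * ang L l)) * (cx n A * \<phi> (e n))"
            by (simp only: mult.assoc)
          also have "cis (- of_int m * ang L l) * cis (of_int n * ang L l) = cis (of_int (n - m) * ang L l)"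
            unfolding cis_mult by (rule arg_cong[where f = cis]) (simp add: algebra_simps)
          finally show ?thesis .
        qed
        then show "cis (- of_int m * ang L l) * (\<Sum>n\<in>F. (cis (of_int n * ang L l) * cx n A) * \<phi> (e n)) = (\<Sum>n\<in>F. cis (of_int (n - m) * ang L l) * (cx n A * \<phi> (e n)))"
          by (simp only: sum_distrib_left)
      qed
      also have "\<dots> = (\<Sum>n\<in>F. (\<Sum>l<L. cis (of_int (n - m) * ang L l)) * (cx n A * \<phi> (e n)))"
        by (subst sum.swap) (simp add: sum_distrib_right)
      also have "\<dots> = (\<Sum>n\<in>F. if n = m then of_nat L * (cx m A * \<phi> (e m)) else 0)"
      proof (rule sum.cong[OF refl])
        fix n assume n: "n \<in> F"
        have "int L dvd n - m \<longleftrightarrow> n = m" using L(2)[of "n - m"] n dvd_imp_le_int[of "n - m" "int L"] by force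
        then show "(\<Sum>l<L. cis (of_int (n - m) * ang L l)) * (cx n A * \<phi> (e n)) = (if n = m then of_nat L * (cx m A * \<phi> (e m)) else 0)"
          unfolding sum_roots_of_unity[OF L(1)] by simp
      qed
      also have "\<dots> = of_nat L * cx m A" using F(1) m(1) \<phi>(2) by simp
      finally have "cx m A = 0" using L(1) by simp
      then show False using m(1) F(3) by blast
    qed
    have "A = embed p (vec {n. cx n A \<noteq> 0} (\<lambda>n. cx n A))"
    proof (rule cx_eqI[OF A N.embed_pts])
      fix n
      have "cx n A = 0" if "n \<notin> I"
      proof -
        obtain u where u: "u \<in> N.CS" "A = N.cc u" using N.pts_cases[OF A] by blast
        show ?thesis using cx_cc[OF u(1), of n] u that by (simp add: co_out LIMSEQ_const_iff)
      qed
      then show "cx n A = cx n (embed p (vec {n. cx n A \<noteq> 0} (\<lambda>n. cx n A)))"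
        using fin by (auto simp: co_vec)
    qed
    then show "A \<in> range (embed p)" by blast
  qed
qed

end

context famnorm
begin

text \<open>Low types converge one by one by differentiability of the coefficients. For high types
  the coordinates of \<open>v\<close> and of \<open>X v\<close> are zero, and the mean value theorem
  bounds the difference quotient by the decay of the coefficients of \<open>X v\<close>, uniformly
  near the identity.\<close>

lemma R_lie:
  assumes X: "X \<in> sl2" shows "lie_derivative N.E R X (embed p v) (embed p (lie V X v))"
  unfolding lie_derivative_def
proof (rule tendstoI)
  fix \<epsilon> :: real assume e: "\<epsilon> > 0"
  define x where "x = lie V X v"
  define m where "m t = mexp (t *\<^sub>R X)" for t
  have m: "m t \<in> SL2" and m0: "m 0 = mat 1" for t
    unfolding m_def using mexp_group(2)[OF X] mexp_group(3)[OF X] by simp_all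
  have mc: "continuous_on UNIV m" unfolding m_def by (rule mexp_group(4)[OF X])
  define K where "K = dcy (mat 1) x + 1"
  have K: "K \<ge> 0" using dcy_nonneg by (simp add: K_def)
  obtain \<delta> where d: "\<delta> > 0" "\<And>g. dist g (mat 1) < \<delta> \<Longrightarrow> dcy g x \<le> K"
    using dcy_local[of "mat 1" x] unfolding K_def by blast
  obtain r where r: "r > 0" "\<And>s. \<bar>s\<bar> < r \<Longrightarrow> dist (m s) (mat 1) < \<delta>"
  proof -
    have "\<forall>y\<in>UNIV. \<forall>e>0. \<exists>d>0. \<forall>s\<in>UNIV. dist s y < d \<longrightarrow> dist (m s) (m y) < e"
      using mc unfolding continuous_on_iff .
    then obtain r where "r > 0" "\<forall>s\<in>UNIV. dist s 0 < r \<longrightarrow> dist (m s) (m 0) < \<delta>"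
      using d(1) by blast
    then show thesis using that[of r] by (simp add: m0)
  qed
  have der: "((\<lambda>t. M n (m t) v) has_vector_derivative M n (m t) x) (at t)" for n t
    using H.mc_deriv[OF SL2_1 X, of n v t] by (simp add: m_def x_def)
  \<comment> \<open>The decay bound is applied to the derivative along the whole segment from
    \<open>0\<close> to \<open>t\<close>, where \<open>dcy\<close> is at most
    \<open>K\<close>.\<close>
  have mv: "cmod (M n (m t) v - co n v) \<le> \<bar>t\<bar> * (K / (1 + \<bar>of_int n\<bar>) ^ 3)" if t: "\<bar>t\<bar> < r" for n t
  proof -
    have "cmod (M n (m t) v - M n (m 0) v) \<le> (K / (1 + \<bar>of_int n\<bar>) ^ 3) * norm (t - 0)"
    proof (rule differentiable_bound)
      show "convex (closed_segment 0 t)" by simp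
      show "((\<lambda>t. M n (m t) v) has_derivative (\<lambda>h. h *\<^sub>R M n (m s) x)) (at s within closed_segment 0 t)" for s
        using der[of n s] has_derivative_at_withinI unfolding has_vector_derivative_def by blast
      show "onorm (\<lambda>h. h *\<^sub>R M n (m s) x) \<le> K / (1 + \<bar>of_int n\<bar>) ^ 3" if s: "s \<in> closed_segment 0 t" for s
      proof -
        have "\<bar>s\<bar> < r" using s t by (auto simp: closed_segment_eq_real_ivl split: if_splits)
        then have "(1 + \<bar>of_int n\<bar>) ^ 3 * cmod (M n (m s) x) \<le> K"
          using M_decay[OF m, of n s x] d(2)[OF r(2)] by (meson order_trans)
        moreover have "0 < (1 + \<bar>of_int n :: real\<bar>) ^ 3" by (intro zero_less_power) linarith
        ultimately have "cmod (M n (m s) x) \<le> K / (1 + \<bar>of_int n\<bar>) ^ 3"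
          by (simp add: pos_le_divide_eq mult.commute)
        then show ?thesis by (intro order_trans[OF onorm_le]) (auto simp: mult.commute)
      qed
    qed auto
    then show ?thesis by (simp add: m0 mult.commute)
  qed
  obtain N1 where N1: "\<And>n. co n v \<noteq> 0 \<Longrightarrow> \<bar>n\<bar> \<le> int N1" using supp_bound by blast
  obtain N2 where N2: "\<And>n. co n x \<noteq> 0 \<Longrightarrow> \<bar>n\<bar> \<le> int N2" using supp_bound by blast
  obtain N3 where N3: "\<And>N. N \<ge> N3 \<Longrightarrow> 2 * (W * K) / (real N + 1) < \<epsilon> / 3"
    using order_tendstoD(2)[OF null_over_Suc[of "2 * (W * K)"], of "\<epsilon>/3"] e unfolding eventually_sequentially by auto
  define N0 where "N0 = max N1 (max N2 N3)"
  define c where "c t n = (M n (m t) v - co n v) / of_real t - co n x" for t n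
  have c_lim: "((\<lambda>t. c t n) \<longlongrightarrow> 0) (at 0)" for n
  proof -
    have "((\<lambda>t. M n (m t) v) has_vector_derivative co n x) (at 0)" using der[of n 0] by (simp add: m0)
    then have "((\<lambda>h. norm (M n (m (0 + h)) v - M n (m 0) v - h *\<^sub>R co n x) / norm h) \<longlongrightarrow> 0) (at 0)"
      unfolding has_vector_derivative_def has_derivative_at by blast
    moreover have "\<forall>\<^sub>F h in at 0. norm (M n (m (0 + h)) v - M n (m 0) v - h *\<^sub>R co n x) / norm h = norm (c h n)"
    proof (rule eventually_at_filter[THEN iffD2], rule always_eventually, intro allI impI)
      fix h :: real assume h: "h \<noteq> 0"
      have "c h n = (M n (m (0 + h)) v - M n (m 0) v - h *\<^sub>R co n x) / of_real h"
        using h by (simp add: c_def m0 diff_divide_distrib scaleR_conv_of_real)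
      then show "norm (M n (m (0 + h)) v - M n (m 0) v - h *\<^sub>R co n x) / norm h = norm (c h n)"
        by (simp add: norm_divide)
    qed
    ultimately have "((\<lambda>h. norm (c h n)) \<longlongrightarrow> 0) (at 0)" by (rule Lim_transform_eventually)
    then show ?thesis by (simp add: tendsto_norm_zero_iff)
  qed
  have "((\<lambda>t. \<Sum>n\<in>{- int N0..int N0}. cmod (c t n) * p (e n)) \<longlongrightarrow> (\<Sum>n\<in>{- int N0..int N0}. cmod 0 * p (e n))) (at 0)"
    by (intro tendsto_intros c_lim)
  then have "\<forall>\<^sub>F t in at 0. (\<Sum>n\<in>{- int N0..int N0}. cmod (c t n) * p (e n)) < \<epsilon> / 3"
    using e by (intro order_tendstoD(2)) auto
  moreover have "\<forall>\<^sub>F t in at 0. \<bar>t\<bar> < r \<and> t \<noteq> 0"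
    unfolding eventually_at using r(1) by (intro exI[of _ r]) auto
  ultimately show "\<forall>\<^sub>F t in at 0. dist (ndist N.E (smul N.E (of_real (1 / t)) (add N.E (R (mexp (t *\<^sub>R X)) (embed p v)) (smul N.E (-1) (embed p v)))) (embed p (lie V X v))) 0 < \<epsilon>"
  proof eventually_elim
    case (elim t)
    define y where "y N = scl V (of_real (1 / t)) (S N (m t) v + scl V (-1) v)" for N
    have cs: "(\<lambda>N. S N (m t) v) \<in> N.CS" by (rule R_embed(1)[OF m])
    have ycs: "y \<in> N.CS" unfolding y_def by (intro N.CS_scl N.CS_add cs N.CS_const)
    have eq: "smul N.E (of_real (1 / t)) (add N.E (R (m t) (embed p v)) (smul N.E (-1) (embed p v))) = N.cc y"
      unfolding R_embed(2)[OF m] N.smul_embed unfolding embed_def y_def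
      by (subst N.add_cc[OF cs N.CS_const], subst N.smul_cc[OF N.CS_add[OF cs N.CS_const]]) simp
    have "p (y N - x) \<le> 2 * (\<epsilon> / 3)" if N: "N \<ge> N0" for N
    proof -
      have z: "co n v = 0" "co n x = 0" if "\<bar>n\<bar> > int N0" for n
        using N1[of n] N2[of n] that by (force simp: N0_def)+
      have "y N - x = vec {- int N..int N} (\<lambda>n. c t n)"
      proof (rule v_eqI)
        fix n show "co n (y N - x) = co n (vec {- int N..int N} (\<lambda>n. c t n))"
        proof (cases "\<bar>n\<bar> \<le> int N")
          case True
          then show ?thesis
            using M_out[OF m, of n t v] co_out[of n]
            by (cases "n \<in> I") (auto simp: y_def co_simps co_S[OF m] co_vec c_def diff_divide_distrib)
        next
          case False
          then show ?thesis using z[of n] N by (auto simp: y_def co_simps co_S[OF m] co_vec)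
        qed
      qed
      then have "p (y N - x) \<le> (\<Sum>n\<in>{- int N..int N}. cmod (c t n) * p (e n))" using p_vec by simp
      also have "\<dots> = (\<Sum>n\<in>{- int N..int N} - {- int N0..int N0}. cmod (c t n) * p (e n)) + (\<Sum>n\<in>{- int N0..int N0}. cmod (c t n) * p (e n))"
        by (rule sum.subset_diff) (use N in auto)
      also have "(\<Sum>n\<in>{- int N..int N} - {- int N0..int N0}. cmod (c t n) * p (e n)) \<le> 2 * (W * K) / (real N0 + 1)"
      proof (rule tail_sum)
        fix n assume n: "n \<in> {- int N..int N} - {- int N0..int N0}"
        then have n0: "\<bar>n\<bar> > int N0" by auto
        let ?x = "1 + \<bar>of_int n :: real\<bar>"
        have x: "?x > 0" by simp
        have "cmod (c t n) = cmod (M n (m t) v - co n v) / \<bar>t\<bar>"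
          using z[OF n0] by (simp add: c_def norm_divide)
        also have "\<dots> \<le> K / ?x ^ 3"
          using mv[of t n] elim(2) by (simp add: divide_le_eq mult.commute)
        finally have "cmod (c t n) * p (e n) \<le> (K / ?x ^ 3) * (W * ?x)"
          using p_e[of n] K by (intro mult_mono) auto
        also have "\<dots> = W * K / ?x\<^sup>2" using x by (simp add: power3_eq_cube power2_eq_square)
        finally show "cmod (c t n) * p (e n) \<le> W * K / ?x\<^sup>2" .
      qed (use K W_nonneg in auto)
      also have "2 * (W * K) / (real N0 + 1) \<le> \<epsilon> / 3" by (rule less_imp_le[OF N3]) (simp add: N0_def)
      finally show ?thesis using elim(1) by simp
    qed
    then have "ndist N.E (N.cc y) (embed p x) \<le> 2 * (\<epsilon> / 3)"
      unfolding embed_def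
      by (intro N.ndist_cc_le ycs N.CS_const) (auto simp: eventually_sequentially)
    then have "ndist N.E (N.cc y) (embed p x) < \<epsilon>" using e by simp
    then show ?case unfolding m_def[symmetric] eq x_def[symmetric] by simp
  qed
qed

lemma R_globalization: "globalization V p R"
  unfolding globalization_def Let_def
  by (intro conjI ballI allI R_continuous_rep R_K_finite R_lie R_k)

lemma in_Norms: "p \<in> Norms V"
proof -
  have "nrm N.E (R g (embed p v)) \<le> 1 * p v" if g: "g \<in> SL2" for g v
  proof -
    have "nrm N.E (R g (embed p v)) \<le> p v + 0"
      unfolding R_embed(2)[OF g]
      by (rule LIMSEQ_le[OF N.nrm_cc[OF R_embed(1)[OF g]] tendsto_add[OF tendsto_const tl_lim]])
        (use p_S[OF g] in blast)
    then show ?thesis by simp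
  qed
  then show ?thesis unfolding Norms_def G_continuous_def
    using p_norm' R_globalization zero_less_one by blast
qed

end

section \<open>Norms with uniformly bounded action\<close>

context umod
begin

lemma Norms_approx:
  assumes "p \<in> Norms V"
  obtains C \<rho> where "C \<ge> 1" "gnorm V e co b I \<mu> o' hp \<pi> p C \<rho>"
    "\<And>g v. g \<in> SL2 \<Longrightarrow> nrm (banach_completion V p) (\<rho> g (embed p v)) \<le> C * p v"
proof -
  obtain \<rho> C where p: "is_norm V p" "globalization V p \<rho>" "C > 0"
    "\<And>g v. g \<in> SL2 \<Longrightarrow> nrm (banach_completion V p) (\<rho> g (embed p v)) \<le> C * p v"
    using assms unfolding Norms_def G_continuous_def by blast
  interpret N: normed_gk V p by (intro normed_gk.intro V p)
  have k: "p (kact V k v) \<le> C * p v" if "k \<in> SO2" for k v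
    using p(4)[OF SO2_SL2[OF that], of v] p(2) that by (simp add: globalization_def Let_def)
  have g: "gnorm V e co b I \<mu> o' hp \<pi> p C \<rho>"
    by (intro gnorm.intro gnorm_axioms.intro knorm.intro knorm_axioms.intro umod_axioms p k)
  interpret gnorm V e co b I \<mu> o' hp \<pi> p C \<rho> by (rule g)
  show thesis by (rule that[OF C_ge g p(4)])
qed

end

section \<open>Growth along the ladder\<close>

text \<open>Handles finitely many K-types, for which nonvanishing alone suffices: a continuous
  function that is nonzero at some \<open>t > 0\<close> has positive integral over
  \<open>[t/2, t]\<close>.\<close>

lemma eventually_positive_integrals:
  fixes f :: "'k \<Rightarrow> real \<Rightarrow> real"
  assumes "finite K" and c: "\<And>k. k \<in> K \<Longrightarrow> continuous_on UNIV (f k)" and nn: "\<And>k t. 0 \<le> f k t"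
    and nz: "\<And>k. k \<in> K \<Longrightarrow> \<exists>t>0. f k t \<noteq> 0"
  shows "\<exists>\<delta>>0. \<exists>c>0. \<exists>T0. \<forall>\<delta>'\<in>{0<..\<delta>}. \<forall>k\<in>K. \<forall>T\<ge>T0. c \<le> integral {\<delta>'..T} (f k)"
  using assms(1) c nz
proof (induction K rule: finite_induct)
  case empty
  show ?case by (simp add: gt_ex)
next
  case (insert x K)
  obtain \<delta> c T0 where IH: "\<delta> > 0" "c > 0" "\<And>\<delta>' k T. 0 < \<delta>' \<Longrightarrow> \<delta>' \<le> \<delta> \<Longrightarrow> k \<in> K \<Longrightarrow> T \<ge> T0 \<Longrightarrow> c \<le> integral {\<delta>'..T} (f k)"
  proof -
    have "\<exists>\<delta>>0. \<exists>c>0. \<exists>T0. \<forall>\<delta>'\<in>{0<..\<delta>}. \<forall>k\<in>K. \<forall>T\<ge>T0. c \<le> integral {\<delta>'..T} (f k)"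
      by (rule insert.IH) (use insert.prems in auto)
    then obtain \<delta> c T0 where *: "\<delta> > 0" "c > 0" "\<forall>\<delta>'\<in>{0<..\<delta>}. \<forall>k\<in>K. \<forall>T\<ge>T0. c \<le> integral {\<delta>'..T} (f k)" by blast
    show thesis by (rule that[OF *(1,2), of T0]) (use *(3) in simp)
  qed
  obtain t where t: "t > 0" "f x t \<noteq> 0" using insert.prems by blast
  have ci: "continuous_on S (f x)" for S using insert.prems(1)[of x] continuous_on_subset by blast
  have io: "f x integrable_on {a..b}" for a b by (intro integrable_continuous_real ci)
  define c' where "c' = integral {t/2..t} (f x)"
  have "c' \<noteq> 0"
    unfolding c'_def using integral_eq_0_iff[of "t/2" t "f x"] ci t nn by (auto intro!: bexI[of _ t])
  moreover have "c' \<ge> 0" unfolding c'_def by (rule integral_nonneg[OF io]) (use nn in auto)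
  ultimately have c': "c' > 0" by simp
  have b: "c' \<le> integral {\<delta>'..T} (f x)" if "0 < \<delta>'" "\<delta>' \<le> t/2" "T \<ge> t" for \<delta>' T
    unfolding c'_def by (rule integral_subset_le[OF _ io io]) (use that nn in auto)
  show ?case
  proof (rule exI[of _ "min \<delta> (t/2)"], intro conjI, goal_cases)
    case 1 show ?case using IH(1) t(1) by simp
  next
    case 2
    show ?case
    proof (rule exI[of _ "min c c'"], intro conjI exI[of _ "max T0 t"] ballI allI impI)
      fix \<delta>' k T assume "\<delta>' \<in> {0<..min \<delta> (t/2)}" "k \<in> insert x K" "max T0 t \<le> T"
      then show "min c c' \<le> integral {\<delta>'..T} (f k)"
        using IH(3)[of \<delta>' k T] b[of \<delta>' T] by (auto simp: min_le_iff_disj)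
    qed (use IH c' in simp)
  qed
qed

text \<open>With \<open>C = cosh (2 t)\<close>, \<open>S = sinh (2 t)\<close> and
  \<open>r = - X / S\<close> this is \<open>\<kappa> <= r^2 - r' + 2 \<epsilon> r\<close> multiplied
  by \<open>S^2\<close>, where \<kappa> is the first factor on the left. The terms
  \<open>m^2 S^2\<close> match because \<open>C^2 = 1 + S^2\<close>, and the surplus
  \<open>m^2\<close> absorbs everything else once \<open>m\<close> is large against
  \<open>n\<close>.\<close>

lemma ladder_pointwise:
  fixes m n \<epsilon> C S :: real
  assumes CS: "C\<^sup>2 = 1 + S\<^sup>2" "S > 0" "C > 0" and \<epsilon>: "0 < \<epsilon>" "\<epsilon> \<le> 1" and m: "m \<ge> 5 + 2 * \<bar>n\<bar>"
  defines "X \<equiv> m * C - n"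
  shows "(m\<^sup>2 - 2 * \<epsilon> * m - (2 * n\<^sup>2 + 1)) * S\<^sup>2 \<le> X\<^sup>2 - 2 * (m - n * C) - 2 * \<epsilon> * X * S"
proof -
  \<comment> \<open>Replaces \<open>C S\<close> by \<open>S^2\<close> in the \<epsilon>-term at
    bounded cost, so that its coefficient stays exactly \<open>2 \<epsilon> m\<close>.\<close>
  have CmS: "S * (C - S) \<le> 1 / 2"
  proof -
    have "2 * (S * (C - S)) = (C\<^sup>2 - S\<^sup>2) - (C - S)\<^sup>2" by (simp add: power2_eq_square algebra_simps)
    then show ?thesis using CS(1) zero_le_power2[of "C - S"] by linarith
  qed
  have m0: "m \<ge> 0" using m by linarith
  have 1: "2 * \<epsilon> * m * (S * (C - S)) \<le> m"
  proof -
    have "2 * \<epsilon> * m * (S * (C - S)) \<le> 2 * \<epsilon> * m * (1 / 2)" using CmS \<epsilon> m0 by (intro mult_left_mono) auto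
    also have "\<dots> \<le> m" using \<epsilon> m0 by (simp add: mult_left_le_one_le)
    finally show ?thesis .
  qed
  have 2: "- (n\<^sup>2 + S\<^sup>2) \<le> 2 * \<epsilon> * n * S"
  proof -
    have "0 \<le> (\<epsilon> * n + S)\<^sup>2" by simp
    then have "- ((\<epsilon> * n)\<^sup>2 + S\<^sup>2) \<le> 2 * \<epsilon> * n * S" by (simp add: power2_eq_square algebra_simps)
    moreover have "(\<epsilon> * n)\<^sup>2 \<le> n\<^sup>2" using \<epsilon> by (simp add: power_mult_distrib mult_left_le_one_le power_le_one)
    ultimately show ?thesis by linarith
  qed
  have 3: "2 * (m - 1) * (n * C) \<le> (m - 1)\<^sup>2 / 2 + 2 * n\<^sup>2 * (1 + S\<^sup>2)"
  proof -
    have "2 * x * y \<le> x\<^sup>2 / 2 + 2 * y\<^sup>2" for x y :: real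
      using zero_le_power2[of "x - 2 * y"] by (simp add: power2_eq_square field_simps)
    from this[of "m - 1" "n * C"] show ?thesis by (simp add: power_mult_distrib CS(1))
  qed
  \<comment> \<open>Twice the right-hand side is \<open>m (m - 4) - 1 - 4 n^2\<close>, which is
    where the threshold \<open>5 + 2 |n|\<close> comes from.\<close>
  have 4: "0 \<le> m\<^sup>2 - (m - 1)\<^sup>2 / 2 - 3 * m - 2 * n\<^sup>2"
  proof -
    have "(5 + 2 * \<bar>n\<bar>) * (1 + 2 * \<bar>n\<bar>) \<le> m * (m - 4)" using m by (intro mult_mono) auto
    then have "1 + 4 * n\<^sup>2 \<le> m * (m - 4)" by (simp add: power2_eq_square algebra_simps)
    then show ?thesis by (simp add: power2_eq_square field_simps)
  qed
  have "X\<^sup>2 - 2 * (m - n * C) - 2 * \<epsilon> * X * S - (m\<^sup>2 - 2 * \<epsilon> * m - (2 * n\<^sup>2 + 1)) * S\<^sup>2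
    = m\<^sup>2 * (C\<^sup>2 - S\<^sup>2) - 2 * (m - 1) * (n * C) + n\<^sup>2 - 2 * m - 2 * \<epsilon> * m * (S * (C - S)) + 2 * \<epsilon> * n * S + (2 * n\<^sup>2 + 1) * S\<^sup>2"
    by (simp add: X_def power2_eq_square algebra_simps)
  also have "\<dots> \<ge> m\<^sup>2 - (m - 1)\<^sup>2 / 2 - 3 * m - 2 * n\<^sup>2"
    using 1 2 3 CS(1) by (simp add: algebra_simps)
  finally show ?thesis using 4 by linarith
qed

text \<open>Integrating \<open>\<bar>2 \<beta> h\<bar>\<^sup>2 w = \<bar>g' + r g\<bar>\<^sup>2 w\<close> by parts, with weight \<open>w = exp (- 2 \<epsilon> t)\<close>; the
  boundary term at \<open>\<delta>\<close> has the good sign.\<close>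

lemma ladder_step:
  fixes g h :: "real \<Rightarrow> complex"
  assumes g: "\<And>t. (g has_vector_derivative g' t) (at t)" and h: "continuous_on UNIV h"
    and rel: "\<And>t. t > 0 \<Longrightarrow> 2 * \<beta> * cmod (h t) = cmod (g' t + of_real ((n - m * cosh (2 * t)) / sinh (2 * t)) * g t)"
    and \<beta>: "4 * \<beta>\<^sup>2 = (m + 1)\<^sup>2 + \<mu>" and bd: "\<And>t. cmod (g t) \<le> 1"
    and \<epsilon>: "0 < \<epsilon>" "\<epsilon> \<le> 1" and m: "m \<ge> 5 + 2 * \<bar>n\<bar>" and T: "0 < \<delta>" "\<delta> \<le> T"
  shows "(m\<^sup>2 - 2 * \<epsilon> * m - (2 * n\<^sup>2 + 1)) * integral {\<delta>..T} (\<lambda>t. (cmod (g t))\<^sup>2 * exp (- 2 * \<epsilon> * t))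
    \<le> ((m + 1)\<^sup>2 + \<mu>) * integral {\<delta>..T} (\<lambda>t. (cmod (h t))\<^sup>2 * exp (- 2 * \<epsilon> * t))
      + (m * cosh (2 * T) - n) / sinh (2 * T) * exp (- 2 * \<epsilon> * T)"
proof -
  define w where "w t = exp (- 2 * \<epsilon> * t)" for t
  define r where "r t = (n - m * cosh (2 * t)) / sinh (2 * t)" for t
  define \<Phi> where "\<Phi> t = r t * w t * (cmod (g t))\<^sup>2" for t
  define D where "D t = (2 * (m - n * cosh (2 * t)) / (sinh (2 * t))\<^sup>2 - 2 * \<epsilon> * r t) * w t * (cmod (g t))\<^sup>2 + r t * w t * (2 * inner (g t) (g' t))" for t
  define \<kappa> where "\<kappa> = m\<^sup>2 - 2 * \<epsilon> * m - (2 * n\<^sup>2 + 1)"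
  have gc: "continuous_on UNIV g" using g by (meson continuous_at_imp_continuous_on has_vector_derivative_continuous)
  have S: "sinh (2 * t) > 0" if "t > 0" for t :: real using that by simp
  have r': "(r has_real_derivative 2 * (m - n * cosh (2 * t)) / (sinh (2 * t))\<^sup>2) (at t)" if "t > 0" for t
  proof -
    have "(r has_real_derivative (- (m * (sinh (2 * t) * 2)) * sinh (2 * t) - (n - m * cosh (2 * t)) * (cosh (2 * t) * 2)) / (sinh (2 * t) * sinh (2 * t))) (at t)"
      unfolding r_def using S[OF that] by (auto intro!: derivative_eq_intros)
    moreover have "- (m * (sinh (2 * t) * 2)) * sinh (2 * t) - (n - m * cosh (2 * t)) * (cosh (2 * t) * 2) = 2 * (m - n * cosh (2 * t))"
      using hyperbolic_pythagoras[of "2 * t"] by algebra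
    ultimately show ?thesis by (simp only: power2_eq_square)
  qed
  have D': "(\<Phi> has_real_derivative D t) (at t)" if "t > 0" for t
    unfolding \<Phi>_def D_def w_def
    by (rule derivative_eq_intros r'[OF that] cmod_sq_deriv[OF g] refl | simp)+ (simp add: algebra_simps)
  have ftc: "(D has_integral (\<Phi> T - \<Phi> \<delta>)) {\<delta>..T}"
  proof (rule fundamental_theorem_of_calculus[OF T(2)])
    fix t assume "t \<in> {\<delta>..T}"
    then have "t > 0" using T by simp
    then show "(\<Phi> has_vector_derivative D t) (at t within {\<delta>..T})"
      using D' has_field_derivative_at_within has_real_derivative_iff_has_vector_derivative by blast
  qed
  have i1: "((\<lambda>t. (cmod (g t))\<^sup>2 * w t) has_integral integral {\<delta>..T} (\<lambda>t. (cmod (g t))\<^sup>2 * w t)) {\<delta>..T}"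
    unfolding w_def by (intro integrable_integral integrable_continuous_real continuous_intros continuous_on_subset[OF gc]) auto
  have i2: "((\<lambda>t. (cmod (h t))\<^sup>2 * w t) has_integral integral {\<delta>..T} (\<lambda>t. (cmod (h t))\<^sup>2 * w t)) {\<delta>..T}"
    unfolding w_def by (intro integrable_integral integrable_continuous_real continuous_intros continuous_on_subset[OF h]) auto
  \<comment> \<open>Dropping \<open>|g'|^2\<close> from \<open>|g' + r g|^2\<close> leaves
    \<open>r^2 |g|^2 + 2 r <g, g'>\<close>; its second term is part of the derivative of \<Phi>, and
    the rest is the pointwise inequality between \<kappa> and \<open>r\<close>.\<close>
  have pw: "D t \<le> ((m + 1)\<^sup>2 + \<mu>) * ((cmod (h t))\<^sup>2 * w t) - \<kappa> * ((cmod (g t))\<^sup>2 * w t)" if t: "t \<in> {\<delta>..T}" for t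
  proof -
    have t0: "t > 0" using t T by simp
    let ?S = "sinh (2 * t)" and ?C = "cosh (2 * t)"
    have Sp: "?S > 0" using S[OF t0] .
    have "4 * \<beta>\<^sup>2 * (cmod (h t))\<^sup>2 = (2 * \<beta> * cmod (h t))\<^sup>2" by (simp add: power2_eq_square)
    also have "\<dots> = (cmod (g' t + of_real (r t) * g t))\<^sup>2" unfolding rel[OF t0] r_def ..
    also have "\<dots> = (cmod (g' t))\<^sup>2 + (r t)\<^sup>2 * (cmod (g t))\<^sup>2 + 2 * r t * inner (g t) (g' t)"
    proof -
      have "(cmod (x + y))\<^sup>2 = (cmod x)\<^sup>2 + (cmod y)\<^sup>2 + 2 * inner y x" for x y
        by (simp add: power2_norm_eq_inner inner_add_left inner_add_right inner_commute)
      from this[of "g' t" "r t *\<^sub>R g t"] show ?thesis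
        by (simp add: power_mult_distrib flip: scaleR_conv_of_real)
    qed
    finally have 1: "((m + 1)\<^sup>2 + \<mu>) * (cmod (h t))\<^sup>2 \<ge> (r t)\<^sup>2 * (cmod (g t))\<^sup>2 + 2 * r t * inner (g t) (g' t)"
      unfolding \<beta> by simp
    have 2: "\<kappa> + (2 * (m - n * ?C) / ?S\<^sup>2 - 2 * \<epsilon> * r t) \<le> (r t)\<^sup>2"
    proof -
      have "\<kappa> * ?S\<^sup>2 \<le> (m * ?C - n)\<^sup>2 - 2 * (m - n * ?C) - 2 * \<epsilon> * (m * ?C - n) * ?S"
        unfolding \<kappa>_def by (rule ladder_pointwise[OF _ Sp _ \<epsilon> m]) (simp_all add: cosh_square_eq)
      then have "\<kappa> * ?S\<^sup>2 / ?S\<^sup>2 \<le> ((m * ?C - n)\<^sup>2 - 2 * (m - n * ?C) - 2 * \<epsilon> * (m * ?C - n) * ?S) / ?S\<^sup>2"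
        by (intro divide_right_mono) auto
      also have "\<kappa> * ?S\<^sup>2 / ?S\<^sup>2 = \<kappa>" using Sp by simp
      also have "((m * ?C - n)\<^sup>2 - 2 * (m - n * ?C) - 2 * \<epsilon> * (m * ?C - n) * ?S) / ?S\<^sup>2
         = (r t)\<^sup>2 - 2 * (m - n * ?C) / ?S\<^sup>2 + 2 * \<epsilon> * r t"
      proof -
        have a: "(m * ?C - n)\<^sup>2 / ?S\<^sup>2 = (r t)\<^sup>2" by (simp add: r_def power_divide power2_commute)
        have b: "2 * \<epsilon> * (m * ?C - n) * ?S / ?S\<^sup>2 = - (2 * \<epsilon> * r t)"
          using Sp by (simp add: r_def power2_eq_square field_simps)
        show ?thesis unfolding diff_divide_distrib a b by simp
      qed
      finally show ?thesis by simp
    qed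
    have wp: "w t \<ge> 0" by (simp add: w_def)
    have "D t + \<kappa> * ((cmod (g t))\<^sup>2 * w t) = (\<kappa> + (2 * (m - n * ?C) / ?S\<^sup>2 - 2 * \<epsilon> * r t)) * ((cmod (g t))\<^sup>2 * w t) + r t * w t * (2 * inner (g t) (g' t))"
      unfolding D_def by (simp add: algebra_simps)
    also have "\<dots> \<le> (r t)\<^sup>2 * ((cmod (g t))\<^sup>2 * w t) + r t * w t * (2 * inner (g t) (g' t))"
      using wp by (intro add_right_mono mult_right_mono 2) auto
    also have "\<dots> = ((r t)\<^sup>2 * (cmod (g t))\<^sup>2 + 2 * r t * inner (g t) (g' t)) * w t" by (simp add: algebra_simps)
    also have "\<dots> \<le> ((m + 1)\<^sup>2 + \<mu>) * (cmod (h t))\<^sup>2 * w t" by (rule mult_right_mono[OF 1 wp])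
    finally show ?thesis by (simp add: mult.assoc)
  qed
  have "\<Phi> T - \<Phi> \<delta> \<le> ((m + 1)\<^sup>2 + \<mu>) * integral {\<delta>..T} (\<lambda>t. (cmod (h t))\<^sup>2 * w t) - \<kappa> * integral {\<delta>..T} (\<lambda>t. (cmod (g t))\<^sup>2 * w t)"
    by (rule has_integral_le[OF ftc has_integral_diff[OF has_integral_mult_right[OF i2] has_integral_mult_right[OF i1]]]) (use pw in auto)
  moreover have neg: "n - m * cosh (2 * t) \<le> 0" for t
  proof -
    have "\<bar>n\<bar> \<le> m" using m by linarith
    also have "m \<le> m * cosh (2 * t)" using m cosh_real_ge_1[of "2 * t"] by (simp add: mult_le_cancel_left1)
    finally show ?thesis by linarith
  qed
  then have "\<Phi> \<delta> \<le> 0" using S[OF T(1)] unfolding \<Phi>_def r_def w_def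
    by (intro mult_nonpos_nonneg divide_nonpos_pos) auto
  moreover have "- \<Phi> T \<le> (m * cosh (2 * T) - n) / sinh (2 * T) * w T"
  proof -
    have ST: "sinh (2 * T) > 0" using S T by auto
    have "- \<Phi> T = ((m * cosh (2 * T) - n) / sinh (2 * T) * w T) * (cmod (g T))\<^sup>2"
    proof -
      have "(m * cosh (2 * T) - n) / sinh (2 * T) = - r T" by (simp add: r_def diff_divide_distrib)
      then show ?thesis by (simp add: \<Phi>_def)
    qed
    also have "\<dots> \<le> ((m * cosh (2 * T) - n) / sinh (2 * T) * w T) * 1"
    proof (rule mult_left_mono)
      show "(cmod (g T))\<^sup>2 \<le> 1" by (rule power_le_one) (use bd in auto)
      show "0 \<le> (m * cosh (2 * T) - n) / sinh (2 * T) * w T"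
        using neg[of T] ST by (intro mult_nonneg_nonneg divide_nonneg_pos) (simp_all add: w_def)
    qed
    finally show ?thesis by simp
  qed
  ultimately show ?thesis unfolding w_def \<kappa>_def by linarith
qed

text \<open>As \<open>T\<close> grows the boundary term of \<open>ladder_step\<close> disappears and
  the full integrals satisfy \<open>F (k+1) >= q F k\<close>, with \<open>q\<close> about
  \<open>1 - (2 + 2 \<epsilon>) / M k\<close>. Since \<open>((M + 2) / M)^a\<close> is about
  \<open>1 + (2 + 4 \<epsilon>) / M\<close> for \<open>a = 1 + 2 \<epsilon>\<close>, the quantity
  \<open>F k * M k powr a\<close> is eventually nondecreasing; here \<epsilon> > 0 gives the strict
  gain. The finitely many rungs up to \<open>k1\<close> are covered by positivity.\<close>

lemma ladder_lower_bound:
  fixes g :: "nat \<Rightarrow> real \<Rightarrow> complex" and m n :: real and \<beta> :: "nat \<Rightarrow> real"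
  assumes g: "\<And>k t. (g k has_vector_derivative g' k t) (at t)"
    and rel: "\<And>k t. t > 0 \<Longrightarrow> 2 * \<beta> k * cmod (g (Suc k) t) = cmod (g' k t + of_real ((n - (m + 2 * real k) * cosh (2 * t)) / sinh (2 * t)) * g k t)"
    and \<beta>: "\<And>k. 4 * (\<beta> k)\<^sup>2 = (m + 2 * real k + 1)\<^sup>2 + \<mu>" and bd: "\<And>k t. cmod (g k t) \<le> 1"
    and nz: "\<And>k. \<exists>t>0. g k t \<noteq> 0" and \<epsilon>: "0 < \<epsilon>" "\<epsilon> \<le> 1"
  shows "\<exists>\<delta>>0. \<exists>c>0. \<forall>\<delta>'\<in>{0<..\<delta>}. \<forall>k. \<exists>T0. \<forall>T\<ge>T0.
    c * (1 + real k) powr (- (1 + 2 * \<epsilon>)) \<le> integral {\<delta>'..T} (\<lambda>t. (cmod (g k t))\<^sup>2 * exp (- 2 * \<epsilon> * t))"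
proof -
  define a where "a = 1 + 2 * \<epsilon>"
  let ?K = "2 * n\<^sup>2 + 1"
  \<comment> \<open>The ratio of the two coefficients in \<open>ladder_step\<close>, corrected by
    the expected power of \<open>M\<close>, expands as
    \<open>1 + 2 \<epsilon> / x + ...\<close>.\<close>
  have e1: "eventually (\<lambda>x. (x\<^sup>2 - 2*\<epsilon>*x - ?K)/((x+1)\<^sup>2 + \<mu>) * ((x+2)/x) powr a \<ge> 1) at_top"
    unfolding a_def using \<epsilon>(1) by real_asymp
  have e2: "eventually (\<lambda>x. (x+1)\<^sup>2 + \<mu> > 0) at_top" by real_asymp
  obtain x0 where x0: "\<And>x. x \<ge> x0 \<Longrightarrow> (x\<^sup>2 - 2*\<epsilon>*x - ?K)/((x+1)\<^sup>2 + \<mu>) * ((x+2)/x) powr a \<ge> 1"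
     "\<And>x. x \<ge> x0 \<Longrightarrow> (x+1)\<^sup>2 + \<mu> > 0"
  proof -
    assume that: "\<And>x0. (\<And>x. x \<ge> x0 \<Longrightarrow> (x\<^sup>2 - 2*\<epsilon>*x - ?K)/((x+1)\<^sup>2 + \<mu>) * ((x+2)/x) powr a \<ge> 1) \<Longrightarrow> (\<And>x. x \<ge> x0 \<Longrightarrow> (x+1)\<^sup>2 + \<mu> > 0) \<Longrightarrow> thesis"
    have "eventually (\<lambda>x. (x\<^sup>2 - 2*\<epsilon>*x - ?K)/((x+1)\<^sup>2 + \<mu>) * ((x+2)/x) powr a \<ge> 1 \<and> (x+1)\<^sup>2 + \<mu> > 0) at_top"
      by (rule eventually_conj[OF e1 e2])
    then obtain x0 where h: "\<forall>x\<ge>x0. (x\<^sup>2 - 2*\<epsilon>*x - ?K)/((x+1)\<^sup>2 + \<mu>) * ((x+2)/x) powr a \<ge> 1 \<and> (x+1)\<^sup>2 + \<mu> > 0"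
      unfolding eventually_at_top_linorder by blast
    have x: "(x\<^sup>2 - 2*\<epsilon>*x - ?K)/((x+1)\<^sup>2 + \<mu>) * ((x+2)/x) powr a \<ge> 1 \<and> (x+1)\<^sup>2 + \<mu> > 0" if "x \<ge> x0" for x
      by (rule h[rule_format, OF that])
    show thesis by (rule that[OF conjunct1[OF x] conjunct2[OF x]])
  qed
  define M where "M k = m + 2 * real k" for k
  obtain k1 :: nat where k1: "real k1 \<ge> \<bar>x0\<bar> + \<bar>m\<bar> + 5 + 2 * \<bar>n\<bar>" using real_arch_simple by blast
  have Mk: "M k \<ge> x0" "M k \<ge> 5 + 2 * \<bar>n\<bar>" "M k \<ge> 5" "M k \<ge> real k" if "k \<ge> k1" for k
  proof -
    have "real k \<ge> real k1" using that by simp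
    then show "M k \<ge> x0" "M k \<ge> 5 + 2 * \<bar>n\<bar>" "M k \<ge> 5" "M k \<ge> real k"
      using k1 abs_ge_self[of x0] abs_ge_minus_self[of m] abs_ge_zero[of x0] abs_ge_zero[of n] unfolding M_def by linarith+
  qed
  define f where "f k t = (cmod (g k t))\<^sup>2 * exp (- 2 * \<epsilon> * t)" for k t
  have gc: "continuous_on UNIV (g k)" for k using g by (meson continuous_at_imp_continuous_on has_vector_derivative_continuous)
  have fc: "continuous_on UNIV (f k)" for k unfolding f_def by (intro continuous_intros gc)
  have fnn: "f k t \<ge> 0" for k t by (simp add: f_def)
  have fi: "f k integrable_on {x..y}" for k x y
    by (intro integrable_continuous_real continuous_on_subset[OF fc]) auto
  have "\<exists>t>0. f k t \<noteq> 0" for k using nz[of k] by (simp add: f_def)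
  then have "\<exists>\<delta>>0. \<exists>c>0. \<exists>T0. \<forall>\<delta>'\<in>{0<..\<delta>}. \<forall>k\<in>{..k1}. \<forall>T\<ge>T0. c \<le> integral {\<delta>'..T} (f k)"
    by (intro eventually_positive_integrals fc fnn) auto
  then obtain \<delta> c T0 where i: "\<delta> > 0" "c > 0" "\<forall>\<delta>'\<in>{0<..\<delta>}. \<forall>k\<in>{..k1}. \<forall>T\<ge>T0. c \<le> integral {\<delta>'..T} (f k)" by blast
  then have ini: "\<delta> > 0" "c > 0" "\<And>\<delta>' k T. 0 < \<delta>' \<Longrightarrow> \<delta>' \<le> \<delta> \<Longrightarrow> k \<le> k1 \<Longrightarrow> T \<ge> T0 \<Longrightarrow> c \<le> integral {\<delta>'..T} (f k)"
    by auto
  \<comment> \<open>The first entry of the minimum serves the rungs up to \<open>k1\<close>, the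
    second carries the bound from \<open>k1\<close> upwards, using
    \<open>M k <= (|m| + 2) (1 + k)\<close>. The factor \<open>1 / 2\<close> makes the inequality
    for the limit \<open>F k\<close> strict, so that a finite \<open>T\<close> already achieves
    it.\<close>
  define c' where "c' = min c (c * (M k1 / (\<bar>m\<bar> + 2)) powr a) / 2"
  have Mk1: "M k1 > 0" using Mk(3)[of k1] by simp
  have m2: "\<bar>m\<bar> + 2 > 0" by simp
  have c': "c' > 0" using ini(2) Mk1 by (simp add: c'_def)
  have main: "\<exists>T0. \<forall>T\<ge>T0. c' * (1 + real k) powr (- a) \<le> integral {\<delta>'..T} (f k)" if \<delta>': "0 < \<delta>'" "\<delta>' \<le> \<delta>" for \<delta>' k
  proof -
    define J where "J k T = integral {\<delta>'..T} (f k)" for k T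
    have Jnn: "J k T \<ge> 0" for k T unfolding J_def by (rule integral_nonneg[OF fi fnn])
    have Jmono: "J k T \<le> J k T'" if "T \<le> T'" for k T T'
      unfolding J_def by (rule integral_subset_le[OF _ fi fi]) (use that fnn in auto)
    have Jbd: "J k T \<le> 1 / (2 * \<epsilon>)" for k T
    proof (cases "\<delta>' \<le> T")
      case True
      have "((\<lambda>t. exp (- 2 * \<epsilon> * t)) has_integral (- exp (- 2 * \<epsilon> * T) / (2 * \<epsilon>) - (- exp (- 2 * \<epsilon> * \<delta>') / (2 * \<epsilon>)))) {\<delta>'..T}"
      proof (rule fundamental_theorem_of_calculus[OF True])
        fix t
        have "((\<lambda>t. - exp (- 2 * \<epsilon> * t) / (2 * \<epsilon>)) has_real_derivative exp (- 2 * \<epsilon> * t)) (at t within {\<delta>'..T})"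
          using \<epsilon> by (auto intro!: derivative_eq_intros)
        then show "((\<lambda>t. - exp (- 2 * \<epsilon> * t) / (2 * \<epsilon>)) has_vector_derivative exp (- 2 * \<epsilon> * t)) (at t within {\<delta>'..T})"
          by (simp add: has_real_derivative_iff_has_vector_derivative)
      qed
      then have "J k T \<le> - exp (- 2 * \<epsilon> * T) / (2 * \<epsilon>) - (- exp (- 2 * \<epsilon> * \<delta>') / (2 * \<epsilon>))"
        unfolding J_def
        by (rule has_integral_le[OF integrable_integral[OF fi]]) (use bd in \<open>auto simp: f_def power_le_one mult_le_cancel_right1\<close>)
      also have "\<dots> \<le> exp (- 2 * \<epsilon> * \<delta>') / (2 * \<epsilon>)" using \<epsilon> by simp
      also have "\<dots> \<le> 1 / (2 * \<epsilon>)" using \<epsilon> \<delta>' by (intro divide_right_mono) auto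
      finally show ?thesis .
    qed (use \<epsilon> in \<open>simp add: J_def\<close>)
    define F where "F k = lim (\<lambda>j. J k (real j))" for k
    have JF: "(\<lambda>j. J k (real j)) \<longlonglongrightarrow> F k" for k
    proof -
      have "incseq (\<lambda>j. J k (real j))" by (rule incseq_SucI) (simp add: Jmono)
      then obtain l where "(\<lambda>j. J k (real j)) \<longlonglongrightarrow> l"
        by (rule incseq_convergent[of "\<lambda>j. J k (real j)" "1 / (2 * \<epsilon>)"]) (use Jbd in auto)
      then show ?thesis unfolding F_def by (simp add: limI)
    qed
    have step: "(M k ^ 2 - 2 * \<epsilon> * M k - ?K) * F k \<le> ((M k + 1)\<^sup>2 + \<mu>) * F (Suc k)" if k: "k \<ge> k1" for k
    proof -
      have b0: "((\<lambda>T. (M k * cosh (2 * T) - n) / sinh (2 * T) * exp (- 2 * \<epsilon> * T)) \<longlongrightarrow> 0) at_top"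
        unfolding cosh_field_def sinh_field_def using \<epsilon>(1) Mk(3)[OF k] by real_asymp
      have b: "(\<lambda>j. (M k * cosh (2 * real j) - n) / sinh (2 * real j) * exp (- 2 * \<epsilon> * real j)) \<longlonglongrightarrow> 0"
        by (rule filterlim_compose[OF b0 filterlim_real_sequentially])
      have "(M k ^ 2 - 2 * \<epsilon> * M k - ?K) * F k \<le> ((M k + 1)\<^sup>2 + \<mu>) * F (Suc k) + 0"
      proof (rule LIMSEQ_le[OF tendsto_mult_left[OF JF] tendsto_add[OF tendsto_mult_left[OF JF] b]])
        obtain j0 :: nat where j0: "real j0 \<ge> \<delta>'" using real_arch_simple by blast
        show "\<exists>N. \<forall>j\<ge>N. (M k ^ 2 - 2 * \<epsilon> * M k - ?K) * J k (real j) \<le> ((M k + 1)\<^sup>2 + \<mu>) * J (Suc k) (real j) + (M k * cosh (2 * real j) - n) / sinh (2 * real j) * exp (- 2 * \<epsilon> * real j)"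
        proof (intro exI[of _ j0] allI impI)
          fix j assume "j0 \<le> j"
          then have j: "\<delta>' \<le> real j" using j0 by linarith
          show "(M k ^ 2 - 2 * \<epsilon> * M k - ?K) * J k (real j) \<le> ((M k + 1)\<^sup>2 + \<mu>) * J (Suc k) (real j) + (M k * cosh (2 * real j) - n) / sinh (2 * real j) * exp (- 2 * \<epsilon> * real j)"
            unfolding J_def f_def
            by (rule ladder_step[OF g gc _ _ bd \<epsilon> Mk(2)[OF k] \<delta>'(1) j])
              (use rel[of _ k] \<beta>[of k] in \<open>simp_all add: M_def\<close>)
        qed
      qed
      then show ?thesis by simp
    qed
    have Fnn: "F k \<ge> 0" for k by (rule LIMSEQ_le_const[OF JF]) (use Jnn in auto)
    have F0: "c \<le> F k" if "k \<le> k1" for k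
    proof -
      obtain j0 :: nat where j0: "real j0 \<ge> T0" using real_arch_simple by blast
      show ?thesis
        by (rule LIMSEQ_le_const[OF JF])
          (use ini(3)[OF \<delta>' that] j0 in \<open>auto simp: J_def intro!: exI[of _ j0]\<close>)
    qed
    have inc: "F k * M k powr a \<le> F (Suc k) * M (Suc k) powr a" if k: "k \<ge> k1" for k
    proof -
      have Mp: "M k > 0" using Mk(3)[OF k] by simp
      let ?q = "(M k ^ 2 - 2 * \<epsilon> * M k - ?K) / ((M k + 1)\<^sup>2 + \<mu>)"
      have q: "?q * F k \<le> F (Suc k)"
        using step[OF k] x0(2)[OF Mk(1)[OF k]] by (simp add: pos_divide_le_eq mult.commute)
      have "1 \<le> ?q * ((M k + 2) / M k) powr a" by (rule x0(1)[OF Mk(1)[OF k]])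
      then have "F k * M k powr a * 1 \<le> F k * M k powr a * (?q * ((M k + 2) / M k) powr a)"
        using Fnn by (intro mult_left_mono) auto
      also have "\<dots> = ?q * F k * (M k powr a * ((M k + 2) / M k) powr a)" by (simp only: mult_ac)
      also have "M k powr a * ((M k + 2) / M k) powr a = (M k + 2) powr a"
        using Mp by (simp flip: powr_mult)
      also have "?q * F k * (M k + 2) powr a \<le> F (Suc k) * (M k + 2) powr a"
        by (rule mult_right_mono[OF q]) simp
      finally show ?thesis by (simp add: M_def algebra_simps)
    qed
    have inc': "F k1 * M k1 powr a \<le> F k * M k powr a" if "k \<ge> k1" for k
      using that
    proof (induction k rule: dec_induct)
      case (step k) then show ?case using inc[of k] by simp
    qed simp
    have "2 * (c' * (1 + real k) powr (- a)) \<le> F k"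
    proof (cases "k \<le> k1")
      case True
      have "(1 + real k) powr (- a) \<le> 1"
      proof -
        have "1 \<le> (1 + real k) powr a" by (rule ge_one_powr_ge_zero) (use \<epsilon> in \<open>simp_all add: a_def\<close>)
        then show ?thesis by (simp add: powr_minus inverse_le_1_iff)
      qed
      then have "2 * (c' * (1 + real k) powr (- a)) \<le> 2 * c'" using c' by simp
      also have "\<dots> \<le> c" by (simp add: c'_def)
      also have "\<dots> \<le> F k" by (rule F0[OF True])
      finally show ?thesis .
    next
      case False
      then have k: "k \<ge> k1" by simp
      have Mp: "M k > 0" using Mk(3)[OF k] by simp
      have up: "M k \<le> (\<bar>m\<bar> + 2) * (1 + real k)"
        by (simp add: M_def algebra_simps) (smt (verit) abs_ge_self mult_nonneg_nonneg of_nat_0_le_iff)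
      have "2 * (c' * (1 + real k) powr (- a)) \<le> c * (M k1 / (\<bar>m\<bar> + 2)) powr a * (1 + real k) powr (- a)"
        using mult_right_mono[of "2 * c'" "c * (M k1 / (\<bar>m\<bar> + 2)) powr a" "(1 + real k) powr (- a)"] by (simp add: c'_def)
      also have "\<dots> = c * M k1 powr a / ((\<bar>m\<bar> + 2) * (1 + real k)) powr a"
      proof -
        have "(M k1 / (\<bar>m\<bar> + 2)) powr a = M k1 powr a / (\<bar>m\<bar> + 2) powr a"
          by (rule powr_divide)
        moreover have "((\<bar>m\<bar> + 2) * (1 + real k)) powr a = (\<bar>m\<bar> + 2) powr a * (1 + real k) powr a"
          by (rule powr_mult)
        ultimately show ?thesis by (simp add: powr_minus field_simps)
      qed
      also have "\<dots> \<le> c * M k1 powr a / M k powr a"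
        using up Mp ini(2) Mk1 \<epsilon> by (intro divide_left_mono powr_mono2) (auto simp: a_def)
      also have "\<dots> \<le> F k1 * M k1 powr a / M k powr a"
        by (intro divide_right_mono mult_right_mono F0) auto
      also have "\<dots> \<le> F k" using inc'[OF k] Mp by (simp add: divide_le_eq)
      finally show ?thesis .
    qed
    moreover have "0 < c' * (1 + real k) powr (- a)" using c' by simp
    ultimately have "c' * (1 + real k) powr (- a) < F k" by linarith
    then obtain j where "c' * (1 + real k) powr (- a) < J k (real j)"
      using order_tendstoD(1)[OF JF] unfolding eventually_sequentially by blast
    then show ?thesis using Jmono[of "real j" _ k] unfolding J_def by (intro exI[of _ "real j"]) force
  qed
  show ?thesis
    by (rule exI[of _ \<delta>], rule conjI[OF ini(1)], rule exI[of _ c'], rule conjI[OF c'])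
      (intro ballI allI, rule main[unfolded f_def a_def], simp_all)
qed

text \<open>Multiplying the recursion by \<open>2 G k\<close> and using
  \<open>2 x y <= x^2 + y^2\<close> bounds \<open>u k = \<beta> k (G k)^2\<close> by
  \<open>u (k + 2)\<close> plus terms that are summable by Bessel. Iterating to infinity, where
  \<open>u\<close> tends to \<open>0\<close>, leaves only the total of these terms.\<close>

lemma ladder_upper_bound:
  fixes G \<beta> d :: "nat \<Rightarrow> real"
  assumes \<beta>: "\<And>k. 0 \<le> \<beta> k" "\<And>k. \<beta> k \<le> \<beta> (Suc k)" "\<And>k. \<beta> (Suc k) \<le> \<beta> k + D" and G: "\<And>k. 0 \<le> G k"
    and rel: "\<And>k. \<beta> k * G k \<le> \<beta> (Suc k) * G (k + 2) + d (Suc k)" and d: "\<And>k. 0 \<le> d k" "\<And>F. finite F \<Longrightarrow> (\<Sum>k\<in>F. (d k)\<^sup>2) \<le> B"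
    and G1: "\<And>F. finite F \<Longrightarrow> (\<Sum>k\<in>F. (G k)\<^sup>2) \<le> 1" and lim: "(\<lambda>k. \<beta> k * (G k)\<^sup>2) \<longlonglongrightarrow> 0" and D: "D \<ge> 0"
  shows "\<beta> k * (G k)\<^sup>2 \<le> B + (1 + D)"
proof -
  define u where "u k = \<beta> k * (G k)\<^sup>2" for k
  have step: "u k \<le> u (k + 2) + ((d (Suc k))\<^sup>2 + (1 + D) * (G k)\<^sup>2)" for k
  proof -
    have am: "2 * (x * y) \<le> x\<^sup>2 + y\<^sup>2" for x y :: real
      using zero_le_power2[of "x - y"] by (simp add: power2_eq_square algebra_simps)
    have "2 * u k = 2 * (\<beta> k * G k * G k)" by (simp add: u_def power2_eq_square)
    also have "\<dots> \<le> 2 * ((\<beta> (Suc k) * G (k + 2) + d (Suc k)) * G k)"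
      using mult_right_mono[OF rel G] by simp
    also have "\<dots> = \<beta> (Suc k) * (2 * (G (k + 2) * G k)) + 2 * (d (Suc k) * G k)" by (simp add: algebra_simps)
    also have "\<dots> \<le> \<beta> (Suc k) * ((G (k + 2))\<^sup>2 + (G k)\<^sup>2) + ((d (Suc k))\<^sup>2 + (G k)\<^sup>2)"
      using \<beta>(1) by (intro add_mono mult_left_mono am)
    also have "\<dots> = \<beta> (Suc k) * (G (k + 2))\<^sup>2 + \<beta> (Suc k) * (G k)\<^sup>2 + (d (Suc k))\<^sup>2 + (G k)\<^sup>2" by (simp add: algebra_simps)
    also have "\<beta> (Suc k) * (G (k + 2))\<^sup>2 \<le> u (k + 2)"
      using \<beta>(2)[of "Suc k"] by (simp add: u_def mult_right_mono)
    also have "\<beta> (Suc k) * (G k)\<^sup>2 \<le> u k + D * (G k)\<^sup>2"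
      using mult_right_mono[OF \<beta>(3)[of k], of "(G k)\<^sup>2"] by (simp add: u_def algebra_simps)
    finally show ?thesis by (simp add: algebra_simps)
  qed
  have it: "u k \<le> u (k + 2 * J) + (\<Sum>j<J. (d (Suc (k + 2 * j)))\<^sup>2 + (1 + D) * (G (k + 2 * j))\<^sup>2)" for J
  proof (induction J)
    case (Suc J) then show ?case using step[of "k + 2 * J"] by simp
  qed simp
  have "u k \<le> u (k + 2 * J) + (B + (1 + D))" for J
  proof -
    have "(\<Sum>j<J. (d (Suc (k + 2 * j)))\<^sup>2) = (\<Sum>i\<in>(\<lambda>j. Suc (k + 2 * j)) ` {..<J}. (d i)\<^sup>2)"
      by (subst sum.reindex) (auto simp: inj_on_def)
    then have 1: "(\<Sum>j<J. (d (Suc (k + 2 * j)))\<^sup>2) \<le> B" using d(2)[of "(\<lambda>j. Suc (k + 2 * j)) ` {..<J}"] by simp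
    have "(\<Sum>j<J. (G (k + 2 * j))\<^sup>2) = (\<Sum>i\<in>(\<lambda>j. k + 2 * j) ` {..<J}. (G i)\<^sup>2)"
      by (subst sum.reindex) (auto simp: inj_on_def)
    then have 2: "(\<Sum>j<J. (G (k + 2 * j))\<^sup>2) \<le> 1" using G1[of "(\<lambda>j. k + 2 * j) ` {..<J}"] by simp
    have "(1 + D) * (\<Sum>j<J. (G (k + 2 * j))\<^sup>2) \<le> (1 + D) * 1" using 2 D by (intro mult_left_mono) auto
    then show ?thesis using it[of J] 1 by (simp add: sum.distrib flip: sum_distrib_left)
  qed
  moreover have "(\<lambda>J. u (k + 2 * J) + (B + (1 + D))) \<longlonglongrightarrow> 0 + (B + (1 + D))"
  proof (intro tendsto_intros)
    have "filterlim (\<lambda>J. k + 2 * J) sequentially sequentially"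
      by (rule filterlim_subseq) (simp add: strict_mono_def)
    from filterlim_compose[OF lim this] show "(\<lambda>J. u (k + 2 * J)) \<longlonglongrightarrow> 0" unfolding u_def .
  qed
  ultimately have "u k \<le> 0 + (B + (1 + D))" by (intro LIMSEQ_le_const[where X = "\<lambda>J. u (k + 2 * J) + (B + (1 + D))"]) auto
  then show ?thesis by (simp add: u_def)
qed

text \<open>For types above \<open>|\<mu>| + 2\<close> the coefficients \<beta> are increasing and
  comparable to the type, so the bound on \<open>\<beta> G^2\<close> is one on
  \<open>(1 + |n|) G^2\<close>; the remaining types are bounded and use \<open>G <= 1\<close>. The
  cubic decay in \<open>K\<close> supplies the vanishing at infinity.\<close>

lemma ladder_decay:
  fixes G \<beta> d :: "nat \<Rightarrow> real" and m \<mu> B K :: real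
  assumes \<beta>: "\<And>k. 0 \<le> \<beta> k" "\<And>k. 4 * (\<beta> k)\<^sup>2 = (m + 2 * real k + 1)\<^sup>2 + \<mu>" and G: "\<And>k. 0 \<le> G k"
    and rel: "\<And>k. \<beta> k * G k \<le> \<beta> (Suc k) * G (k + 2) + d (Suc k)" and d: "\<And>k. 0 \<le> d k" "\<And>F. finite F \<Longrightarrow> (\<Sum>k\<in>F. (d k)\<^sup>2) \<le> B"
    and G1: "\<And>F. finite F \<Longrightarrow> (\<Sum>k\<in>F. (G k)\<^sup>2) \<le> 1" and K: "\<And>k. (1 + \<bar>m + 2 * real k\<bar>) ^ 3 * G k \<le> K"
  shows "(1 + \<bar>m + 2 * real k\<bar>) * (G k)\<^sup>2 \<le> 4 * (B + 3) + \<bar>m\<bar> + \<bar>\<mu>\<bar> + 3"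
proof (cases "m + 2 * real k < \<bar>\<mu>\<bar> + 2")
  case True
  have "(G k)\<^sup>2 \<le> 1" using G1[of "{k}"] by simp
  moreover have "B \<ge> 0" using d(2)[of "{}"] by simp
  moreover have "(1 + \<bar>m + 2 * real k\<bar>) * (G k)\<^sup>2 \<le> (1 + \<bar>m + 2 * real k\<bar>) * 1"
    by (rule mult_left_mono) (use calculation in auto)
  moreover have "1 + \<bar>m + 2 * real k\<bar> \<le> \<bar>m\<bar> + \<bar>\<mu>\<bar> + 3" using True by linarith
  ultimately show ?thesis by simp
next
  case False
  define M where "M j = m + 2 * real (k + j)" for j
  have M2: "M j \<ge> \<bar>\<mu>\<bar> + 2" for j using False by (simp add: M_def)
  have b4: "4 * (\<beta> (k + j))\<^sup>2 = (M j + 1)\<^sup>2 + \<mu>" for j using \<beta>(2)[of "k + j"] by (simp add: M_def)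
  have low: "(M j + 1) / 4 \<le> \<beta> (k + j)" for j
  proof (rule power2_le_imp_le[OF _ \<beta>(1)])
    have "\<bar>\<mu>\<bar> * 2 \<le> (M j + 1) * (M j + 1)" by (rule mult_mono) (use M2[of j] in auto)
    then have "\<bar>\<mu>\<bar> * 2 \<le> (M j + 1)\<^sup>2" by (simp add: power2_eq_square)
    moreover have "((M j + 1) / 4)\<^sup>2 = (M j + 1)\<^sup>2 / 16" by (simp add: power_divide)
    ultimately show "((M j + 1) / 4)\<^sup>2 \<le> (\<beta> (k + j))\<^sup>2" using b4[of j] by linarith
  qed
  have high: "\<beta> (k + j) \<le> (M j + 1) * (1 + \<bar>\<mu>\<bar>)" for j
  proof (rule power2_le_imp_le)
    have "1 \<le> (M j + 1)\<^sup>2" by (rule one_le_power) (use M2[of j] in auto)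
    then have "1 * \<bar>\<mu>\<bar> \<le> (M j + 1)\<^sup>2 * \<bar>\<mu>\<bar>" by (rule mult_right_mono) auto
    then have "4 * (\<beta> (k + j))\<^sup>2 \<le> (M j + 1)\<^sup>2 * (1 + \<bar>\<mu>\<bar>)" using b4[of j] by (simp add: distrib_left)
    also have "\<dots> \<le> (M j + 1)\<^sup>2 * (1 + \<bar>\<mu>\<bar>)\<^sup>2" by (rule mult_left_mono[OF _ zero_le_power2]) (auto simp: power2_eq_square algebra_simps)
    finally show "(\<beta> (k + j))\<^sup>2 \<le> ((M j + 1) * (1 + \<bar>\<mu>\<bar>))\<^sup>2"
      unfolding power_mult_distrib using zero_le_power2[of "\<beta> (k + j)"] by linarith
  qed (use M2[of j] in auto)
  have step: "4 * (\<beta> (k + Suc j))\<^sup>2 = 4 * (\<beta> (k + j))\<^sup>2 + 4 * (M j + 2)" for j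
    unfolding b4 by (simp add: M_def power2_eq_square algebra_simps)
  have mono: "\<beta> (k + j) \<le> \<beta> (k + Suc j)" for j
    by (rule power2_le_imp_le[OF _ \<beta>(1)]) (use step[of j] M2[of j] in simp)
  \<comment> \<open>A jump above \<open>2\<close> would mean \<open>4 \<beta> + 4 < M + 2\<close>,
    against \<open>4 \<beta> >= M + 1\<close>.\<close>
  have D: "\<beta> (k + Suc j) \<le> \<beta> (k + j) + 2" for j
  proof (rule ccontr)
    assume "\<not> \<beta> (k + Suc j) \<le> \<beta> (k + j) + 2"
    then have A: "\<beta> (k + Suc j) > \<beta> (k + j) + 2" by simp
    have "(\<beta> (k + j) + 2)\<^sup>2 < (\<beta> (k + Suc j))\<^sup>2" by (rule power_strict_mono) (use A \<beta>(1)[of "k + j"] in auto)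
    then have "4 * \<beta> (k + j) + 4 < M j + 2" using step[of j] by (simp add: power2_eq_square algebra_simps)
    then show False using low[of j] by simp
  qed
  have lim: "(\<lambda>j. \<beta> (k + j) * (G (k + j))\<^sup>2) \<longlonglongrightarrow> 0"
  proof (rule Lim_null_comparison[OF _ null_over_Suc])
    show "\<forall>\<^sub>F j in sequentially. norm (\<beta> (k + j) * (G (k + j))\<^sup>2) \<le> ((1 + \<bar>\<mu>\<bar>) * K\<^sup>2) / (real j + 1)"
    proof (rule always_eventually, intro allI)
      fix j
      let ?x = "1 + M j"
      have x: "?x \<ge> real j + 1" "?x \<ge> 1" using M2[of j] False by (auto simp: M_def)
      have Kj: "?x ^ 3 * G (k + j) \<le> K" using K[of "k + j"] M2[of j] by (simp add: M_def)
      have "(?x ^ 3 * G (k + j))\<^sup>2 \<le> K\<^sup>2" by (rule power_mono[OF Kj]) (use x G in auto)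
      then have 1: "?x ^ 6 * (G (k + j))\<^sup>2 \<le> K\<^sup>2" by (simp add: power_mult_distrib flip: power_mult)
      have "\<beta> (k + j) * (G (k + j))\<^sup>2 \<le> ?x * (1 + \<bar>\<mu>\<bar>) * (G (k + j))\<^sup>2"
        using high[of j] by (intro mult_right_mono) (auto simp: algebra_simps)
      also have "\<dots> * (real j + 1) \<le> \<dots> * ?x ^ 5"
      proof (rule mult_left_mono)
        have "real j + 1 \<le> ?x ^ 1" using x by simp
        also have "\<dots> \<le> ?x ^ 5" by (rule power_increasing) (use x in auto)
        finally show "real j + 1 \<le> ?x ^ 5" .
      qed (use x in auto)
      also have "?x * (1 + \<bar>\<mu>\<bar>) * (G (k + j))\<^sup>2 * ?x ^ 5 = (1 + \<bar>\<mu>\<bar>) * (?x ^ 6 * (G (k + j))\<^sup>2)" by (simp add: eval_nat_numeral)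
      also have "\<dots> \<le> (1 + \<bar>\<mu>\<bar>) * K\<^sup>2" by (rule mult_left_mono[OF 1]) auto
      finally have "\<beta> (k + j) * (G (k + j))\<^sup>2 * (real j + 1) \<le> (1 + \<bar>\<mu>\<bar>) * K\<^sup>2" by (simp add: mult_right_mono)
      then show "norm (\<beta> (k + j) * (G (k + j))\<^sup>2) \<le> ((1 + \<bar>\<mu>\<bar>) * K\<^sup>2) / (real j + 1)"
        using \<beta>(1)[of "k + j"] by (simp add: field_simps abs_mult)
    qed
  qed
  have shift: "(\<Sum>j\<in>F. h (k + j)) = (\<Sum>i\<in>(+) k ` F. h i)" for h :: "nat \<Rightarrow> real" and F
    by (simp add: sum.reindex inj_on_def)
  have main: "\<beta> (k + 0) * (G (k + 0))\<^sup>2 \<le> B + (1 + 2)"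
  proof (rule ladder_upper_bound[where \<beta> = "\<lambda>j. \<beta> (k + j)" and G = "\<lambda>j. G (k + j)" and d = "\<lambda>j. d (k + j)"])
    show "\<beta> (k + j) * G (k + j) \<le> \<beta> (k + Suc j) * G (k + (j + 2)) + d (k + Suc j)" for j
      using rel[of "k + j"] by (simp add: add.assoc)
    show "(\<Sum>j\<in>F. (d (k + j))\<^sup>2) \<le> B" if "finite F" for F
      using d(2)[of "(+) k ` F"] shift[of "\<lambda>i. (d i)\<^sup>2"] that by simp
    show "(\<Sum>j\<in>F. (G (k + j))\<^sup>2) \<le> 1" if "finite F" for F
      using G1[of "(+) k ` F"] shift[of "\<lambda>i. (G i)\<^sup>2"] that by simp
  qed (use \<beta> mono D G d lim in auto)
  have "(1 + M 0) / 4 * (G k)\<^sup>2 \<le> \<beta> k * (G k)\<^sup>2"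
    by (rule mult_right_mono) (use low[of 0] in auto)
  then have "(1 + M 0) * (G k)\<^sup>2 \<le> 4 * (B + 3)" using main by simp
  then show ?thesis using M2[of 0] by (simp add: M_def)
qed

section \<open>Two-sided bounds for the radial coefficients\<close>

context umod
begin

lemma functional_e_eqI:
  assumes "functional V \<phi>" "functional V \<psi>" "\<And>n. \<phi> (e n) = \<psi> (e n)" shows "\<phi> v = \<psi> v"
  using assms(3) by (subst (1 2) co_exp[of v]) (simp add: functionalD[OF assms(1)] functionalD[OF assms(2)])

lemma b_boundary: assumes "(n \<in> I) \<noteq> (n + 2 \<in> I)" shows "b n = 0"
proof (cases "n \<in> I")
  case True
  then have "co n (Em V (e (n + 2))) = - of_real (b n)" by (simp add: Em_e co_simps co_e del: vs.scale_minus_left)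
  then show ?thesis using True assms by (simp add: e_0 endoD[OF Em_endo] co_simps)
next
  case False
  with assms have I: "n + 2 \<in> I" by simp
  then have "co (n + 2) (Ep V (e n)) = of_real (b n)" by (simp add: Ep_e co_simps co_e)
  then show ?thesis using False by (simp add: e_0 endoD[OF Ep_endo] co_simps)
qed

lemma co_lie_Hm:
  assumes "n \<in> I" shows "co n (lie V Hm v) = of_real (b (n - 2)) * co (n - 2) v - of_real (b n) * co (n + 2) v"
proof (rule functional_e_eqI[of "\<lambda>v. co n (lie V Hm v)" "\<lambda>v. of_real (b (n - 2)) * co (n - 2) v - of_real (b n) * co (n + 2) v"])
  show "co n (lie V Hm (e m)) = of_real (b (n - 2)) * co (n - 2) (e m) - of_real (b n) * co (n + 2) (e m)" for m
    using b_boundary[of n] b_boundary[of "n - 2"] assms by (auto simp: lie_Hm_e co_simps co_e)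
qed (rule functionalI[OF V]; simp add: co_simps endoD[OF lie_endo] algebra_simps)+

lemma I_between:
  shows "n \<in> I \<Longrightarrow> o' \<le> n - 2 * int j \<Longrightarrow> n - 2 * int j \<in> I"
    and "n \<in> I \<Longrightarrow> n + 2 * int j \<le> o' \<Longrightarrow> n + 2 * int j \<in> I"
proof (induction j)
  case (Suc j)
  { case 1 then show ?case using Suc(1) I_down[of "n - 2 * int j"] by (simp add: algebra_simps) }
  { case 2 then show ?case using Suc(2) I_up[of "n + 2 * int j"] by (simp add: algebra_simps) }
qed simp_all

lemma I_dist: assumes "n \<in> I" obtains j where "n = o' + 2 * int j" | j where "n = o' - 2 * int j"
proof -
  obtain q where q: "n - o' = 2 * q" using I_even[OF assms] by (blast elim: evenE)
  show ?thesis
  proof (cases "q \<ge> 0")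
    case True then show ?thesis using that(1)[of "nat q"] q by simp
  next
    case False then show ?thesis using that(2)[of "nat (- q)"] q by simp
  qed
qed

text \<open>Each application of \<open>Hm\<close> lowers the lowest occurring type by exactly
  \<open>2\<close>, and the extreme coefficient is multiplied by \<open>- b\<close>, nonzero between
  two K-types. After \<open>k\<close> steps the type \<open>o'\<close> is reached with nonzero
  coefficient.\<close>

lemma co_Hm_power_up:
  assumes "o' + 2 * int k \<in> I" "j \<le> k"
  shows "(\<forall>n < o' + 2 * (int k - int j). co n ((lie V Hm ^^ j) (e (o' + 2 * int k))) = 0) \<and>
    co (o' + 2 * (int k - int j)) ((lie V Hm ^^ j) (e (o' + 2 * int k))) \<noteq> 0"
  using assms(2)
proof (induction j)
  case 0 then show ?case using assms(1) by (auto simp: co_e)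
next
  case (Suc j)
  let ?v = "(lie V Hm ^^ j) (e (o' + 2 * int k))" and ?n = "o' + 2 * (int k - int (Suc j))"
  have IH: "n < ?n + 2 \<Longrightarrow> co n ?v = 0" "co (?n + 2) ?v \<noteq> 0" for n
    using Suc by (auto simp: algebra_simps)
  have I: "?n \<in> I" "?n + 2 \<in> I"
    using I_between(1)[OF assms(1), of "Suc j"] I_between(1)[OF assms(1), of j] Suc(2) by (simp_all add: algebra_simps)
  have "co n (lie V Hm ?v) = 0" if n: "n < ?n" for n
    by (cases "n \<in> I") (use IH(1)[of "n + 2"] IH(1)[of "n - 2"] n in \<open>auto simp: co_lie_Hm co_out\<close>)
  moreover have "co ?n (lie V Hm ?v) = - of_real (b ?n) * co (?n + 2) ?v"
    using IH(1)[of "?n - 2"] I by (simp add: co_lie_Hm)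
  then have "co ?n (lie V Hm ?v) \<noteq> 0" using IH(2) b_pos[OF I] by simp
  ultimately show ?case by simp
qed

lemma co_Hm_power_down:
  assumes "o' - 2 * int k \<in> I" "j \<le> k"
  shows "(\<forall>n > o' - 2 * (int k - int j). co n ((lie V Hm ^^ j) (e (o' - 2 * int k))) = 0) \<and>
    co (o' - 2 * (int k - int j)) ((lie V Hm ^^ j) (e (o' - 2 * int k))) \<noteq> 0"
  using assms(2)
proof (induction j)
  case 0 then show ?case using assms(1) by (auto simp: co_e)
next
  case (Suc j)
  let ?v = "(lie V Hm ^^ j) (e (o' - 2 * int k))" and ?n = "o' - 2 * (int k - int (Suc j))"
  have IH: "n > ?n - 2 \<Longrightarrow> co n ?v = 0" "co (?n - 2) ?v \<noteq> 0" for n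
    using Suc by (auto simp: algebra_simps)
  have I: "?n - 2 \<in> I" "?n \<in> I"
    using I_between(2)[OF assms(1), of "Suc j"] I_between(2)[OF assms(1), of j] Suc(2) by (simp_all add: algebra_simps)
  have below: "co n (lie V Hm ?v) = 0" if n: "n > ?n" for n
    by (cases "n \<in> I") (use IH(1)[of "n + 2"] IH(1)[of "n - 2"] n in \<open>auto simp: co_lie_Hm co_out\<close>)
  have "co ?n (lie V Hm ?v) = of_real (b (?n - 2)) * co (?n - 2) ?v"
    using IH(1)[of "?n + 2"] I by (simp add: co_lie_Hm)
  moreover have "b (?n - 2) > 0" by (rule b_pos[OF I(1)]) (use I(2) in \<open>simp only: diff_add_cancel\<close>)
  ultimately have "co ?n (lie V Hm ?v) \<noteq> 0" using IH(2) by simp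
  with below show ?case by simp
qed

definition rad :: "int \<Rightarrow> real \<Rightarrow> complex" where "rad m t = M o' (hyp t) (e m)"

lemma M_hyp_deriv: "((\<lambda>t. M n (hyp t) v) has_vector_derivative M n (hyp t) (lie V Hm v)) (at t)"
  using H.mc_deriv[of "mat 1" Hm n v t] by (simp add: mexp_Hm)

lemma M_hyp_cont: "continuous_on UNIV (\<lambda>t. M n (hyp t) v)"
  by (rule continuous_at_imp_continuous_on) (use M_hyp_deriv has_vector_derivative_continuous in blast)

text \<open>If \<open>rad m\<close> vanished for all \<open>t > 0\<close>, so would its derivatives;
  their limits at \<open>0\<close> are the coordinates at \<open>o'\<close> of the vectors
  \<open>Hm^j (e m)\<close>, one of which is nonzero by the ladder computation.\<close>

lemma rad_nonzero: assumes "m \<in> I" shows "\<exists>t>0. rad m t \<noteq> 0"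
proof (rule ccontr)
  assume "\<not> ?thesis"
  then have z: "\<And>t. t > 0 \<Longrightarrow> M o' (hyp t) (e m) = 0" by (auto simp: rad_def)
  have Z: "\<forall>t>0. M o' (hyp t) ((lie V Hm ^^ j) (e m)) = 0" for j
  proof (induction j)
    case (Suc j)
    show ?case
    proof (intro allI impI)
      fix t :: real assume t: "t > 0"
      have "((\<lambda>t. M o' (hyp t) ((lie V Hm ^^ j) (e m))) has_vector_derivative 0) (at t)"
        by (rule has_vector_derivative_transform_within_open[OF has_vector_derivative_const[of 0], where S = "{0<..}"])
          (use Suc t in auto)
      from vector_derivative_unique_at[OF this M_hyp_deriv]
      show "M o' (hyp t) ((lie V Hm ^^ Suc j) (e m)) = 0" by simp
    qed
  qed (use z in simp)
  have co0: "co o' ((lie V Hm ^^ j) (e m)) = 0" for j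
  proof -
    let ?h = "\<lambda>t. M o' (hyp t) ((lie V Hm ^^ j) (e m))"
    have "(?h \<longlongrightarrow> ?h 0) (at_right 0)"
      using M_hyp_cont by (meson continuous_on_def UNIV_I tendsto_within_subset subset_UNIV continuous_on_subset)
    moreover have "(?h \<longlongrightarrow> 0) (at_right 0)"
      by (rule tendsto_eventually) (use Z[of j] in \<open>auto simp: eventually_at_filter\<close>)
    ultimately have "?h 0 = 0" by (rule tendsto_unique[rotated]) simp
    then show ?thesis by simp
  qed
  show False
  proof (cases rule: I_dist[OF assms])
    case (1 j) then show False using co_Hm_power_up[of j j] co0[of j] assms by simp
  next
    case (2 j) then show False using co_Hm_power_down[of j j] co0[of j] assms by simp
  qed
qed

lemma rad_deriv: "(rad m has_vector_derivative of_real (b m) * rad (m + 2) t - of_real (b (m - 2)) * rad (m - 2) t) (at t)"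
  unfolding rad_def by (rule H.mc_hyp_deriv)

lemma rad_cont: "continuous_on UNIV (rad m)"
  unfolding rad_def by (rule M_hyp_cont)

lemma rad_le1: "cmod (rad m t) \<le> 1"
  unfolding rad_def using order_trans[OF M_le hp_e_le] by simp

lemma rad_rel:
  assumes "t > 0"
  shows "of_real ((of_int o' - of_int m * cosh (2 * t)) / sinh (2 * t)) * rad m t =
    of_real (b m) * rad (m + 2) t + of_real (b (m - 2)) * rad (m - 2) t"
proof -
  have S: "complex_of_real (sinh (2 * t)) \<noteq> 0" using assms by simp
  show ?thesis using H.mc_hyp_rel[of o' t m] S by (simp add: rad_def field_simps)
qed

text \<open>The derivative and \<open>rad_rel\<close> contain the two neighbours with opposite
  relative signs, so adding them isolates one neighbour. This is the form \<open>g' + r g\<close>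
  that \<open>ladder_step\<close> integrates.\<close>

lemma rad_up:
  assumes "t > 0"
  shows "2 * b m * cmod (rad (m + 2) t) = cmod ((of_real (b m) * rad (m + 2) t - of_real (b (m - 2)) * rad (m - 2) t)
    + of_real ((of_int o' - of_int m * cosh (2 * t)) / sinh (2 * t)) * rad m t)"
  unfolding rad_rel[OF assms] by (simp add: norm_mult b_nonneg flip: mult_2)

lemma rad_down:
  assumes "t > 0"
  shows "2 * b (m - 2) * cmod (rad (m - 2) t) = cmod ((of_real (b m) * rad (m + 2) t - of_real (b (m - 2)) * rad (m - 2) t)
    + of_real ((- of_int o' + of_int m * cosh (2 * t)) / sinh (2 * t)) * rad m t)"
proof -
  have "of_real ((- of_int o' + of_int m * cosh (2 * t)) / sinh (2 * t)) * rad m t = - (of_real (b m) * rad (m + 2) t + of_real (b (m - 2)) * rad (m - 2) t)"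
    unfolding rad_rel[OF assms, symmetric] by (simp add: field_simps minus_divide_left)
  then show ?thesis by (simp add: norm_mult b_nonneg)
qed

text \<open>The constants \<open>\<delta>\<close> and \<open>c\<close> are uniform over the K-types,
  which the Sobolev bounds require, whereas \<open>T0\<close> depends on the type because the whole
  half-line may be needed to collect the mass. The lower limit stays positive since the relations
  divide by \<open>sinh (2 t)\<close>.\<close>

definition rad_low :: "real \<Rightarrow> int set \<Rightarrow> bool" where
  "rad_low \<epsilon> A \<longleftrightarrow> (\<exists>\<delta>>0. \<exists>c>0. \<forall>\<delta>'\<in>{0<..\<delta>}. \<forall>n\<in>A. \<exists>T0. \<forall>T\<ge>T0.
     c * (1 + \<bar>of_int n\<bar>) powr (- (1 + 2 * \<epsilon>)) \<le> integral {\<delta>'..T} (\<lambda>t. (cmod (rad n t))\<^sup>2 * exp (- 2 * \<epsilon> * t)))"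

lemma rad_lowI:
  assumes "\<delta> > 0" "c > 0" "\<And>\<delta>' n. 0 < \<delta>' \<Longrightarrow> \<delta>' \<le> \<delta> \<Longrightarrow> n \<in> A \<Longrightarrow> \<exists>T0. \<forall>T\<ge>T0.
     c * (1 + \<bar>of_int n\<bar>) powr (- (1 + 2 * \<epsilon>)) \<le> integral {\<delta>'..T} (\<lambda>t. (cmod (rad n t))\<^sup>2 * exp (- 2 * \<epsilon> * t))"
  shows "rad_low \<epsilon> A"
  unfolding rad_low_def using assms by (intro exI[of _ \<delta>] exI[of _ c] conjI) auto

lemma rad_low_Un: assumes "rad_low \<epsilon> A" "rad_low \<epsilon> B" shows "rad_low \<epsilon> (A \<union> B)"
proof -
  obtain d1 c1 where 1: "d1 > 0" "c1 > 0" "\<forall>\<delta>'\<in>{0<..d1}. \<forall>n\<in>A. \<exists>T0. \<forall>T\<ge>T0.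
     c1 * (1 + \<bar>of_int n\<bar>) powr (- (1 + 2 * \<epsilon>)) \<le> integral {\<delta>'..T} (\<lambda>t. (cmod (rad n t))\<^sup>2 * exp (- 2 * \<epsilon> * t))"
    using assms(1) unfolding rad_low_def by blast
  obtain d2 c2 where 2: "d2 > 0" "c2 > 0" "\<forall>\<delta>'\<in>{0<..d2}. \<forall>n\<in>B. \<exists>T0. \<forall>T\<ge>T0.
     c2 * (1 + \<bar>of_int n\<bar>) powr (- (1 + 2 * \<epsilon>)) \<le> integral {\<delta>'..T} (\<lambda>t. (cmod (rad n t))\<^sup>2 * exp (- 2 * \<epsilon> * t))"
    using assms(2) unfolding rad_low_def by blast
  show ?thesis
  proof (rule rad_lowI[of "min d1 d2" "min c1 c2"])
    fix \<delta>' n assume d: "0 < \<delta>'" "\<delta>' \<le> min d1 d2" and n: "n \<in> A \<union> B"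
    have c: "min c1 c2 * (1 + \<bar>of_int n\<bar>) powr (- (1 + 2 * \<epsilon>)) \<le> c1 * (1 + \<bar>of_int n\<bar>) powr (- (1 + 2 * \<epsilon>))"
      "min c1 c2 * (1 + \<bar>of_int n\<bar>) powr (- (1 + 2 * \<epsilon>)) \<le> c2 * (1 + \<bar>of_int n\<bar>) powr (- (1 + 2 * \<epsilon>))"
      by (rule mult_right_mono; simp)+
    have d12: "\<delta>' \<in> {0<..d1}" "\<delta>' \<in> {0<..d2}" using d by auto
    show "\<exists>T0. \<forall>T\<ge>T0. min c1 c2 * (1 + \<bar>of_int n\<bar>) powr (- (1 + 2 * \<epsilon>)) \<le> integral {\<delta>'..T} (\<lambda>t. (cmod (rad n t))\<^sup>2 * exp (- 2 * \<epsilon> * t))"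
    proof (cases "n \<in> A")
      case True then obtain T0 where "\<forall>T\<ge>T0. c1 * (1 + \<bar>of_int n\<bar>) powr (- (1 + 2 * \<epsilon>)) \<le> integral {\<delta>'..T} (\<lambda>t. (cmod (rad n t))\<^sup>2 * exp (- 2 * \<epsilon> * t))"
        using bspec[OF bspec[OF 1(3) d12(1)]] by blast
      then show ?thesis using c(1) by (intro exI[of _ T0]) (blast intro: order_trans)
    next
      case False with n have "n \<in> B" by simp
      then obtain T0 where "\<forall>T\<ge>T0. c2 * (1 + \<bar>of_int n\<bar>) powr (- (1 + 2 * \<epsilon>)) \<le> integral {\<delta>'..T} (\<lambda>t. (cmod (rad n t))\<^sup>2 * exp (- 2 * \<epsilon> * t))"
        using bspec[OF bspec[OF 2(3) d12(2)]] by blast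
      then show ?thesis using c(2) by (intro exI[of _ T0]) (blast intro: order_trans)
    qed
  qed (use 1 2 in auto)
qed

lemma rad_low_finite: assumes A: "finite A" "A \<subseteq> I" and \<epsilon>: "\<epsilon> > 0" shows "rad_low \<epsilon> A"
proof -
  have "\<exists>\<delta>>0. \<exists>c>0. \<exists>T0. \<forall>\<delta>'\<in>{0<..\<delta>}. \<forall>k\<in>A. \<forall>T\<ge>T0. c \<le> integral {\<delta>'..T} (\<lambda>t. (cmod (rad k t))\<^sup>2 * exp (- 2 * \<epsilon> * t))"
    by (rule eventually_positive_integrals) (use A rad_nonzero in \<open>auto intro!: continuous_intros rad_cont\<close>)
  then obtain \<delta> c T0 where *: "\<delta> > 0" "c > 0" "\<forall>\<delta>'\<in>{0<..\<delta>}. \<forall>k\<in>A. \<forall>T\<ge>T0. c \<le> integral {\<delta>'..T} (\<lambda>t. (cmod (rad k t))\<^sup>2 * exp (- 2 * \<epsilon> * t))"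
    by blast
  show ?thesis
  proof (rule rad_lowI[OF *(1,2)])
    fix \<delta>' n assume "0 < \<delta>'" "\<delta>' \<le> \<delta>" "n \<in> A"
    then have c: "\<forall>T\<ge>T0. c \<le> integral {\<delta>'..T} (\<lambda>t. (cmod (rad n t))\<^sup>2 * exp (- 2 * \<epsilon> * t))" using *(3) by simp
    have "(1 + \<bar>of_int n\<bar> :: real) powr (- (1 + 2 * \<epsilon>)) \<le> 1"
      using powr_mono[of "- (1 + 2 * \<epsilon>)" 0 "1 + \<bar>of_int n\<bar>"] \<epsilon> by (simp split: if_splits)
    then have "c * (1 + \<bar>of_int n\<bar>) powr (- (1 + 2 * \<epsilon>)) \<le> c * 1" by (rule mult_left_mono) (use *(2) in simp)
    then show "\<exists>T0. \<forall>T\<ge>T0. c * (1 + \<bar>of_int n\<bar>) powr (- (1 + 2 * \<epsilon>)) \<le> integral {\<delta>'..T} (\<lambda>t. (cmod (rad n t))\<^sup>2 * exp (- 2 * \<epsilon> * t))"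
      using c by (intro exI[of _ T0]) force
  qed
qed

lemma rad_low_ladder:
  assumes \<sigma>: "\<And>k. \<bar>\<sigma> k - o'\<bar> = 2 * int k" and \<epsilon>: "\<epsilon> > 0"
    and *: "\<exists>\<delta>>0. \<exists>c>0. \<forall>\<delta>'\<in>{0<..\<delta>}. \<forall>k. \<exists>T0. \<forall>T\<ge>T0.
    c * (1 + real k) powr (- (1 + 2 * \<epsilon>)) \<le> integral {\<delta>'..T} (\<lambda>t. (cmod (rad (\<sigma> k) t))\<^sup>2 * exp (- 2 * \<epsilon> * t))"
  shows "rad_low \<epsilon> (range \<sigma>)"
proof -
  let ?K = "1 + \<bar>of_int o'\<bar> :: real"
  from * obtain \<delta> c where c: "\<delta> > 0" "c > 0" "\<forall>\<delta>'\<in>{0<..\<delta>}. \<forall>k. \<exists>T0. \<forall>T\<ge>T0.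
    c * (1 + real k) powr (- (1 + 2 * \<epsilon>)) \<le> integral {\<delta>'..T} (\<lambda>t. (cmod (rad (\<sigma> k) t))\<^sup>2 * exp (- 2 * \<epsilon> * t))"
    by blast
  show ?thesis
  proof (rule rad_lowI[of \<delta> "c * ?K powr (- (1 + 2 * \<epsilon>))"])
    fix \<delta>' n assume d: "0 < \<delta>'" "\<delta>' \<le> \<delta>" and "n \<in> range \<sigma>"
    then obtain k where n: "n = \<sigma> k" by auto
    have "2 * int k \<le> \<bar>n\<bar> + \<bar>o'\<bar>" using \<sigma>[of k] n by linarith
    then have k2: "2 * real k \<le> \<bar>of_int n\<bar> + \<bar>of_int o'\<bar>" by linarith
    have "1 + real k \<le> 1 + (\<bar>of_int n\<bar> + \<bar>of_int o'\<bar>)" using k2 by linarith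
    also have "\<dots> \<le> ?K * (1 + \<bar>of_int n\<bar>)" by (simp add: algebra_simps)
    finally have "(?K * (1 + \<bar>of_int n\<bar>)) powr (- (1 + 2 * \<epsilon>)) \<le> (1 + real k) powr (- (1 + 2 * \<epsilon>))"
      by (intro powr_mono2') (use \<epsilon> in auto)
    then have "c * ?K powr (- (1 + 2 * \<epsilon>)) * (1 + \<bar>of_int n\<bar>) powr (- (1 + 2 * \<epsilon>)) \<le> c * (1 + real k) powr (- (1 + 2 * \<epsilon>))"
      using c(2) by (simp add: powr_mult mult.assoc)
    moreover obtain T0 where "\<forall>T\<ge>T0. c * (1 + real k) powr (- (1 + 2 * \<epsilon>)) \<le> integral {\<delta>'..T} (\<lambda>t. (cmod (rad n t))\<^sup>2 * exp (- 2 * \<epsilon> * t))"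
      using c(3) d unfolding n by (meson greaterThanAtMost_iff)
    ultimately show "\<exists>T0. \<forall>T\<ge>T0. c * ?K powr (- (1 + 2 * \<epsilon>)) * (1 + \<bar>of_int n\<bar>) powr (- (1 + 2 * \<epsilon>)) \<le> integral {\<delta>'..T} (\<lambda>t. (cmod (rad n t))\<^sup>2 * exp (- 2 * \<epsilon> * t))"
      by (intro exI[of _ T0]) (blast intro: order_trans)
  qed (use c in auto)
qed

lemma rad_low_up: assumes "\<And>k. o' + 2 * int k \<in> I" "0 < \<epsilon>" "\<epsilon> \<le> 1" shows "rad_low \<epsilon> (range (\<lambda>k. o' + 2 * int k))"
proof (rule rad_low_ladder)
  show "\<exists>\<delta>>0. \<exists>c>0. \<forall>\<delta>'\<in>{0<..\<delta>}. \<forall>k. \<exists>T0. \<forall>T\<ge>T0. c * (1 + real k) powr (- (1 + 2 * \<epsilon>)) \<le>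
      integral {\<delta>'..T} (\<lambda>t. (cmod (rad (o' + 2 * int k) t))\<^sup>2 * exp (- 2 * \<epsilon> * t))"
  proof (rule ladder_lower_bound[where m = "of_int o'" and n = "of_int o'" and \<mu> = \<mu> and \<beta> = "\<lambda>k. b (o' + 2 * int k)"])
    show "(rad (o' + 2 * int k) has_vector_derivative of_real (b (o' + 2 * int k)) * rad (o' + 2 * int k + 2) t - of_real (b (o' + 2 * int k - 2)) * rad (o' + 2 * int k - 2) t) (at t)" for k t
      by (rule rad_deriv)
    show "2 * b (o' + 2 * int k) * cmod (rad (o' + 2 * int (Suc k)) t) = cmod (of_real (b (o' + 2 * int k)) * rad (o' + 2 * int k + 2) t - of_real (b (o' + 2 * int k - 2)) * rad (o' + 2 * int k - 2) t
       + of_real ((of_int o' - (of_int o' + 2 * real k) * cosh (2 * t)) / sinh (2 * t)) * rad (o' + 2 * int k) t)" if t: "t > 0" for k t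
      using rad_up[OF t, of "o' + 2 * int k"] by (simp add: algebra_simps)
    show "4 * (b (o' + 2 * int k))\<^sup>2 = (of_int o' + 2 * real k + 1)\<^sup>2 + \<mu>" for k
      using b_sq[of "o' + 2 * int k"] assms(1) by simp
  qed (use assms rad_le1 rad_nonzero in auto)
qed (use assms in auto)

text \<open>Reversing the sign of all weights turns the descending ladder into an ascending one with
  \<open>m = n = - o'\<close>; the coefficient of the step below type \<open>x\<close> is
  \<open>b (x - 2)\<close>.\<close>

lemma rad_low_down: assumes "\<And>k. o' - 2 * int k \<in> I" "0 < \<epsilon>" "\<epsilon> \<le> 1" shows "rad_low \<epsilon> (range (\<lambda>k. o' - 2 * int k))"
proof (rule rad_low_ladder)
  show "\<exists>\<delta>>0. \<exists>c>0. \<forall>\<delta>'\<in>{0<..\<delta>}. \<forall>k. \<exists>T0. \<forall>T\<ge>T0. c * (1 + real k) powr (- (1 + 2 * \<epsilon>)) \<le>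
      integral {\<delta>'..T} (\<lambda>t. (cmod (rad (o' - 2 * int k) t))\<^sup>2 * exp (- 2 * \<epsilon> * t))"
  proof (rule ladder_lower_bound[where m = "- of_int o'" and n = "- of_int o'" and \<mu> = \<mu> and \<beta> = "\<lambda>k. b (o' - 2 * int k - 2)"])
    show "(rad (o' - 2 * int k) has_vector_derivative of_real (b (o' - 2 * int k)) * rad (o' - 2 * int k + 2) t - of_real (b (o' - 2 * int k - 2)) * rad (o' - 2 * int k - 2) t) (at t)" for k t
      by (rule rad_deriv)
    show "2 * b (o' - 2 * int k - 2) * cmod (rad (o' - 2 * int (Suc k)) t) = cmod (of_real (b (o' - 2 * int k)) * rad (o' - 2 * int k + 2) t - of_real (b (o' - 2 * int k - 2)) * rad (o' - 2 * int k - 2) t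
       + of_real ((- of_int o' - (- of_int o' + 2 * real k) * cosh (2 * t)) / sinh (2 * t)) * rad (o' - 2 * int k) t)" if t: "t > 0" for k t
      using rad_down[OF t, of "o' - 2 * int k"] by (simp add: algebra_simps)
    show "4 * (b (o' - 2 * int k - 2))\<^sup>2 = (- of_int o' + 2 * real k + 1)\<^sup>2 + \<mu>" for k
      using b_sq[of "o' - 2 * int k - 2"] assms(1)[of k] by (simp add: power2_eq_square algebra_simps)
  qed (use assms rad_le1 rad_nonzero in auto)
qed (use assms in auto)

lemma I_upE: assumes "n \<in> I" "n \<ge> o'" obtains k where "n = o' + 2 * int k"
proof (cases rule: I_dist[OF assms(1)])
  case (2 j) then show ?thesis using assms(2) that[of 0] by simp
qed (rule that)

lemma I_downE: assumes "n \<in> I" "n \<le> o'" obtains k where "n = o' - 2 * int k"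
proof (cases rule: I_dist[OF assms(1)])
  case (1 j) then show ?thesis using assms(2) that[of 0] by simp
qed (rule that)

text \<open>A missing rung cannot be jumped over from \<open>o'\<close>, so each side of the ladder
  is complete or finite. This treats modules unbounded in both directions and those with a highest
  or lowest weight alike.\<close>

lemma I_sides:
  shows "(\<forall>k. o' + 2 * int k \<in> I) \<or> finite (I \<inter> {o'..})" and "(\<forall>k. o' - 2 * int k \<in> I) \<or> finite (I \<inter> {..o'})"
proof -
  have up: "I \<inter> {o'..} \<subseteq> {o'..o' + 2 * int k}" if k: "o' + 2 * int k \<notin> I" for k
  proof
    fix n assume n: "n \<in> I \<inter> {o'..}"
    then obtain j where j: "n = o' + 2 * int j" by (auto elim: I_upE)
    have "j < k"
    proof (rule ccontr)
      assume "\<not> j < k"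
      then show False using I_between(1)[of n "j - k"] n k j by simp
    qed
    then show "n \<in> {o'..o' + 2 * int k}" using n j by simp
  qed
  then show "(\<forall>k. o' + 2 * int k \<in> I) \<or> finite (I \<inter> {o'..})" using finite_subset[OF up] by blast
  have down: "I \<inter> {..o'} \<subseteq> {o' - 2 * int k..o'}" if k: "o' - 2 * int k \<notin> I" for k
  proof
    fix n assume n: "n \<in> I \<inter> {..o'}"
    then obtain j where j: "n = o' - 2 * int j" by (auto elim: I_downE)
    have "j < k"
    proof (rule ccontr)
      assume "\<not> j < k"
      then show False using I_between(2)[of n "j - k"] n k j by simp
    qed
    then show "n \<in> {o' - 2 * int k..o'}" using n j by simp
  qed
  then show "(\<forall>k. o' - 2 * int k \<in> I) \<or> finite (I \<inter> {..o'})" using finite_subset[OF down] by blast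
qed

lemma rad_low_mono: assumes "rad_low \<epsilon> A" "B \<subseteq> A" shows "rad_low \<epsilon> B"
proof -
  obtain \<delta> c where *: "\<delta> > 0" "c > 0" "\<forall>\<delta>'\<in>{0<..\<delta>}. \<forall>n\<in>A. \<exists>T0. \<forall>T\<ge>T0.
     c * (1 + \<bar>of_int n\<bar>) powr (- (1 + 2 * \<epsilon>)) \<le> integral {\<delta>'..T} (\<lambda>t. (cmod (rad n t))\<^sup>2 * exp (- 2 * \<epsilon> * t))"
    using assms(1) unfolding rad_low_def by blast
  show ?thesis by (rule rad_lowI[OF *(1,2)]) (rule bspec[OF bspec[OF *(3)]]; use assms(2) in auto)
qed

lemma rad_lower_bound: assumes "0 < \<epsilon>" "\<epsilon> \<le> 1" shows "rad_low \<epsilon> I"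
proof -
  have "rad_low \<epsilon> (I \<inter> {o'..})" using I_sides(1)
  proof
    assume "\<forall>k. o' + 2 * int k \<in> I"
    then have "rad_low \<epsilon> (range (\<lambda>k. o' + 2 * int k))" using rad_low_up assms by simp
    then show ?thesis by (rule rad_low_mono) (auto elim: I_upE)
  qed (use rad_low_finite assms in auto)
  moreover have "rad_low \<epsilon> (I \<inter> {..o'})" using I_sides(2)
  proof
    assume "\<forall>k. o' - 2 * int k \<in> I"
    then have "rad_low \<epsilon> (range (\<lambda>k. o' - 2 * int k))" using rad_low_down assms by simp
    then show ?thesis by (rule rad_low_mono) (auto elim: I_downE)
  qed (use rad_low_finite assms in auto)
  ultimately have "rad_low \<epsilon> (I \<inter> {o'..} \<union> I \<inter> {..o'})" by (rule rad_low_Un)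
  moreover have "I \<subseteq> I \<inter> {o'..} \<union> I \<inter> {..o'}" by auto
  ultimately show ?thesis by (rule rad_low_mono)
qed

lemma rad_adj: assumes "m \<in> I" shows "rad m t = cnj (M m (hyp (- t)) (e o'))"
  using M_adj[OF hyp_SL2 assms o_I, of t] by (simp add: rad_def adj2_hyp)

text \<open>By unitarity the derivative at type \<open>m\<close> is, up to conjugation and sign, a
  coefficient of the fixed vector \<open>Hm (e o')\<close> in the varying type \<open>m\<close>. Its
  squares are therefore summable over \<open>m\<close> uniformly in \<open>t\<close>, the input
  \<open>d\<close> of \<open>ladder_upper_bound\<close>.\<close>

lemma rad_deriv_norm:
  assumes "m \<in> I"
  shows "cmod (of_real (b m) * rad (m + 2) t - of_real (b (m - 2)) * rad (m - 2) t) = cmod (M m (hyp (- t)) (lie V Hm (e o')))"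
proof -
  have d: "(uminus has_vector_derivative - 1) (at t)" by (auto intro!: derivative_eq_intros)
  have "((\<lambda>t. M m (hyp (- t)) (e o')) has_vector_derivative - 1 *\<^sub>R M m (hyp (- t)) (lie V Hm (e o'))) (at t)"
    using vector_diff_chain_at[OF d M_hyp_deriv, of m "e o'"] by (simp add: o_def)
  moreover have "rad m = (\<lambda>t. cnj (M m (hyp (- t)) (e o')))" using rad_adj[OF assms] by auto
  ultimately have "(rad m has_vector_derivative cnj (- 1 *\<^sub>R M m (hyp (- t)) (lie V Hm (e o')))) (at t)"
    by (simp only: has_vector_derivative_cnj)
  from vector_derivative_unique_at[OF rad_deriv this] show ?thesis by simp
qed

lemma rad_upper_aux:
  assumes \<sigma>: "inj \<sigma>" "range \<sigma> \<subseteq> I"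
    and m: "\<And>k. \<bar>of_int (\<sigma> k)\<bar> = \<bar>m + 2 * real k\<bar>" and \<beta>: "\<And>k. 0 \<le> \<beta> k" "\<And>k. 4 * (\<beta> k)\<^sup>2 = (m + 2 * real k + 1)\<^sup>2 + \<mu>"
    and rel: "\<And>k. \<beta> k * cmod (rad (\<sigma> k) t) \<le> \<beta> (Suc k) * cmod (rad (\<sigma> (k + 2)) t) + cmod (M (\<sigma> (Suc k)) (hyp (- t)) (lie V Hm (e o')))"
  shows "(1 + \<bar>of_int (\<sigma> k)\<bar>) * (cmod (rad (\<sigma> k) t))\<^sup>2 \<le> 4 * ((hp (lie V Hm (e o')))\<^sup>2 + 3) + \<bar>m\<bar> + \<bar>\<mu>\<bar> + 3"
  unfolding m
proof (rule ladder_decay[OF \<beta>])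
  show "(1 + \<bar>m + 2 * real k\<bar>) ^ 3 * cmod (rad (\<sigma> k) t) \<le> dcy (hyp (- t)) (e o')" for k
    using M_decay[of "hyp (- t)" "\<sigma> k" "e o'"] \<sigma>(2) m[of k] by (simp add: rad_adj image_subset_iff)
  show "(\<Sum>k\<in>F. (cmod (M (\<sigma> k) (hyp (- t)) (lie V Hm (e o'))))\<^sup>2) \<le> (hp (lie V Hm (e o')))\<^sup>2" if "finite F" for F
    using M_bessel[of "hyp (- t)" "\<sigma> ` F" "lie V Hm (e o')"] that \<sigma>(1) by (simp add: sum.reindex inj_on_def)
  show "(\<Sum>k\<in>F. (cmod (rad (\<sigma> k) t))\<^sup>2) \<le> 1" if "finite F" for F
    using M_bessel_row[of "hyp t" "\<sigma> ` F" o'] that \<sigma>(1) o_I by (simp add: sum.reindex inj_on_def rad_def)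
qed (use rel in auto)

lemma rad_upper_bound:
  obtains C where "C > 0" "\<And>n t. n \<in> I \<Longrightarrow> (1 + \<bar>of_int n\<bar>) * (cmod (rad n t))\<^sup>2 \<le> C"
proof -
  define C0 where "C0 = 4 * ((hp (lie V Hm (e o')))\<^sup>2 + 3) + \<bar>of_int o'\<bar> + \<bar>\<mu>\<bar> + 3"
  have fin: "\<exists>C. \<forall>n\<in>A. \<forall>t. (1 + \<bar>of_int n\<bar>) * (cmod (rad n t))\<^sup>2 \<le> C" if A: "finite A" for A
  proof (intro exI ballI allI)
    fix n t assume n: "n \<in> A"
    have "(cmod (rad n t))\<^sup>2 \<le> 1" using rad_le1[of n t] by (simp add: power_le_one)
    then have "(1 + \<bar>of_int n\<bar>) * (cmod (rad n t))\<^sup>2 \<le> (1 + \<bar>of_int n\<bar>) * 1" by (intro mult_left_mono) auto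
    also have "\<dots> \<le> (\<Sum>n\<in>A. (1 + \<bar>of_int n\<bar>) * 1)" by (rule member_le_sum) (use A n in auto)
    finally show "(1 + \<bar>of_int n\<bar>) * (cmod (rad n t))\<^sup>2 \<le> (\<Sum>n\<in>A. (1 + \<bar>of_int n\<bar>) * 1)" .
  qed
  have up: "\<exists>C. \<forall>n\<in>I \<inter> {o'..}. \<forall>t. (1 + \<bar>of_int n\<bar>) * (cmod (rad n t))\<^sup>2 \<le> C" using I_sides(1)
  proof
    assume I: "\<forall>k. o' + 2 * int k \<in> I"
    have "(1 + \<bar>of_int (o' + 2 * int k)\<bar>) * (cmod (rad (o' + 2 * int k) t))\<^sup>2 \<le> C0" for k t
      unfolding C0_def
    proof (rule rad_upper_aux[where \<beta> = "\<lambda>k. b (o' + 2 * int k)"])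
      show "4 * (b (o' + 2 * int k))\<^sup>2 = (of_int o' + 2 * real k + 1)\<^sup>2 + \<mu>" for k
        using b_sq[of "o' + 2 * int k"] I by simp
      show "b (o' + 2 * int k) * cmod (rad (o' + 2 * int k) t) \<le> b (o' + 2 * int (Suc k)) * cmod (rad (o' + 2 * int (k + 2)) t) + cmod (M (o' + 2 * int (Suc k)) (hyp (- t)) (lie V Hm (e o')))" for k
        using I rad_deriv_norm[OF I[rule_format, of "Suc k"], of t] norm_triangle_ineq3[of "of_real (b (o' + 2 * int (Suc k))) * rad (o' + 2 * int (Suc k) + 2) t" "of_real (b (o' + 2 * int (Suc k) - 2)) * rad (o' + 2 * int (Suc k) - 2) t"]
        by (simp add: norm_mult b_nonneg algebra_simps abs_le_iff)
    qed (use I b_nonneg in \<open>auto simp: inj_def\<close>)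
    then show ?thesis by (intro exI[of _ C0]) (auto elim!: I_upE)
  qed (use fin in auto)
  have down: "\<exists>C. \<forall>n\<in>I \<inter> {..o'}. \<forall>t. (1 + \<bar>of_int n\<bar>) * (cmod (rad n t))\<^sup>2 \<le> C" using I_sides(2)
  proof
    assume I: "\<forall>k. o' - 2 * int k \<in> I"
    have "(1 + \<bar>of_int (o' - 2 * int k)\<bar>) * (cmod (rad (o' - 2 * int k) t))\<^sup>2 \<le> 4 * ((hp (lie V Hm (e o')))\<^sup>2 + 3) + \<bar>- of_int o'\<bar> + \<bar>\<mu>\<bar> + 3" for k t
    proof (rule rad_upper_aux[where \<beta> = "\<lambda>k. b (o' - 2 * int k - 2)"])
      show "4 * (b (o' - 2 * int k - 2))\<^sup>2 = (- of_int o' + 2 * real k + 1)\<^sup>2 + \<mu>" for k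
        using b_sq[of "o' - 2 * int k - 2"] I by (simp add: power2_eq_square algebra_simps)
      show "b (o' - 2 * int k - 2) * cmod (rad (o' - 2 * int k) t) \<le> b (o' - 2 * int (Suc k) - 2) * cmod (rad (o' - 2 * int (k + 2)) t) + cmod (M (o' - 2 * int (Suc k)) (hyp (- t)) (lie V Hm (e o')))" for k
        using I rad_deriv_norm[OF I[rule_format, of "Suc k"], of t] norm_triangle_ineq3[of "of_real (b (o' - 2 * int (Suc k))) * rad (o' - 2 * int (Suc k) + 2) t" "of_real (b (o' - 2 * int (Suc k) - 2)) * rad (o' - 2 * int (Suc k) - 2) t"]
        by (simp add: norm_mult b_nonneg algebra_simps abs_le_iff)
    qed (use I b_nonneg in \<open>auto simp: inj_def\<close>)
    then show ?thesis by (intro exI[of _ C0]) (auto elim!: I_downE simp: C0_def)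
  qed (use fin in auto)
  from up down obtain C1 C2 where C: "\<And>n t. n \<in> I \<inter> {o'..} \<Longrightarrow> (1 + \<bar>of_int n\<bar>) * (cmod (rad n t))\<^sup>2 \<le> C1"
    "\<And>n t. n \<in> I \<inter> {..o'} \<Longrightarrow> (1 + \<bar>of_int n\<bar>) * (cmod (rad n t))\<^sup>2 \<le> C2" by metis
  show ?thesis
  proof (rule that[of "max 1 (max C1 C2)"])
    show "(1 + \<bar>of_int n\<bar>) * (cmod (rad n t))\<^sup>2 \<le> max 1 (max C1 C2)" if n: "n \<in> I" for n t
      using C[of n t] n by (cases "n \<ge> o'") (auto simp: le_max_iff_disj)
  qed simp
qed
end

lemma SL2_ne: "SL2 \<noteq> {}" using SL2_1 by blast

section \<open>The least norm, the admissible family and the greatest norm\<close>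

context umod
begin

text \<open>Adding a small multiple of \<open>hp\<close> turns \<open>q\<close> into a K-bounded
  norm with constant \<open>1\<close>, to which \<open>co_p_bound\<close> applies; the multiple is
  chosen below the assumed defect.\<close>

lemma seminorm_co_bound:
  assumes q: "\<And>v. 0 \<le> q v" "\<And>u v. q (u + v) \<le> q u + q v" "\<And>c v. q (scl V c v) = cmod c * q v"
    and K: "\<And>k v. k \<in> SO2 \<Longrightarrow> q (kact V k v) \<le> q v"
  shows "cmod (co m v) * q (e m) \<le> q v"
proof (rule ccontr)
  assume "\<not> ?thesis"
  then have A: "cmod (co m v) * q (e m) - q v > 0" by simp
  define \<epsilon> where "\<epsilon> = (cmod (co m v) * q (e m) - q v) / (hp v + 1)"
  have \<epsilon>: "\<epsilon> > 0" using A by (simp add: \<epsilon>_def add_nonneg_pos)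
  let ?p = "\<lambda>v. q v + \<epsilon> * hp v"
  have 0: "q 0 = 0" using q(3)[of 0 0] by simp
  have "is_norm V ?p"
    unfolding is_norm_def
  proof (intro conjI allI)
    show "?p v = 0 \<longleftrightarrow> v = 0" for v using q(1)[of v] \<epsilon> 0 by (auto simp: add_nonneg_eq_0_iff)
    show "?p (v + w) \<le> ?p v + ?p w" for v w
      using q(2)[of v w] mult_left_mono[OF H.N.p_triangle[of v w], of \<epsilon>] \<epsilon> by (simp add: algebra_simps)
  qed (use q \<epsilon> in \<open>auto simp: algebra_simps\<close>)
  then interpret kn: knorm V e co b I \<mu> o' hp \<pi> ?p 1
    by (intro knorm.intro knorm_axioms.intro umod_axioms) (use K in \<open>auto simp: hp_k\<close>)
  have "cmod (co m v) * q (e m) \<le> cmod (co m v) * ?p (e m)" by (rule mult_left_mono) (use \<epsilon> in auto)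
  also have "\<dots> \<le> q v + \<epsilon> * hp v" using kn.co_p_bound[of m v] by simp
  finally have "cmod (co m v) * q (e m) - q v \<le> \<epsilon> * hp v" by simp
  also have "\<dots> < \<epsilon> * (hp v + 1)" using \<epsilon> by simp
  also have "\<dots> = cmod (co m v) * q (e m) - q v" unfolding \<epsilon>_def by (simp add: add_nonneg_eq_0_iff)
  finally show False by simp
qed

definition q0 :: "int \<Rightarrow> 'v \<Rightarrow> real" where "q0 n v = (SUP g\<in>SL2. cmod (M n g v))"

lemma M_q0: "g \<in> SL2 \<Longrightarrow> cmod (M n g v) \<le> q0 n v"
  unfolding q0_def by (rule cSUP_upper) (auto intro!: bdd_aboveI2 M_le)

lemma q0_le: "(\<And>g. g \<in> SL2 \<Longrightarrow> cmod (M n g v) \<le> B) \<Longrightarrow> q0 n v \<le> B"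
  unfolding q0_def by (rule cSUP_least[OF SL2_ne])

lemma q0_nonneg: "0 \<le> q0 n v"
  using M_q0[of "mat 1" n v] norm_ge_zero order_trans SL2_1 by blast

lemma q0_triangle: "q0 n (u + v) \<le> q0 n u + q0 n v"
proof (rule q0_le)
  fix g assume "g \<in> SL2"
  then show "cmod (M n g (u + v)) \<le> q0 n u + q0 n v"
    using norm_triangle_ineq[of "M n g u" "M n g v"] M_q0[of g n u] M_q0[of g n v] by (simp add: functionalD[OF H.mc_lin])
qed

lemma q0_scl_le: "q0 n (scl V c v) \<le> cmod c * q0 n v"
  by (rule q0_le) (simp add: functionalD[OF H.mc_lin] norm_mult mult_left_mono M_q0)

lemma q0_scl: "q0 n (scl V c v) = cmod c * q0 n v"
proof (cases "c = 0")
  case True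
  then show ?thesis using q0_scl_le[of n c v] q0_nonneg[of n "scl V c v"] by simp
next
  case False
  have "q0 n v \<le> cmod (1 / c) * q0 n (scl V c v)" using q0_scl_le[of n "1 / c" "scl V c v"] False by simp
  then show ?thesis using q0_scl_le[of n c v] False by (simp add: norm_divide field_simps)
qed

lemma q0_k: assumes "k \<in> SO2" shows "q0 n (kact V k v) \<le> q0 n v"
proof (rule SO2_cases[OF assms], rule q0_le)
  fix t g assume "k = rot t" "g \<in> SL2"
  then show "cmod (M n g (kact V k v)) \<le> q0 n v" using M_q0[of "g ** rot t" n v] by (simp add: H.mc_rot_right)
qed

lemma q0_le_hp: "q0 n v \<le> hp v" by (rule q0_le) (rule M_le)

lemma q0_e_le1: "q0 n (e m) \<le> 1" using q0_le_hp hp_e_le order_trans by blast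

lemma rad_le_q0: "cmod (rad n t) \<le> q0 o' (e n)"
  unfolding rad_def by (rule M_q0) simp

lemma q0_e_le_f: assumes "\<And>t. cmod (rad n t) \<le> B" shows "q0 o' (e n) \<le> B"
proof (rule q0_le)
  fix g assume "g \<in> SL2"
  then obtain s t u where g: "g = rot s ** hyp t ** rot u" by (rule KAK)
  have "cmod (M o' g (e n)) = cmod (rad n t)"
    unfolding g by (simp add: H.mc_rot_right H.mc_rot_left k_e functionalD[OF H.mc_lin] norm_mult rad_def matrix_mul_assoc[symmetric])
  then show "cmod (M o' g (e n)) \<le> B" using assms by simp
qed

lemma q0_e_pos: assumes "n \<in> I" shows "0 < q0 o' (e n)"
proof -
  obtain t where "rad n t \<noteq> 0" using rad_nonzero[OF assms] by blast
  then show ?thesis using rad_le_q0[of n t] by (meson less_le_trans zero_less_norm_iff)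
qed

lemma q0_co: "cmod (co m v) * q0 n (e m) \<le> q0 n v"
  by (rule seminorm_co_bound[OF q0_nonneg q0_triangle q0_scl q0_k])

lemma q0_norm: "is_norm V (q0 o')"
  unfolding is_norm_def
proof (intro conjI allI)
  fix v show "q0 o' v = 0 \<longleftrightarrow> v = 0"
  proof
    assume v: "q0 o' v = 0"
    show "v = 0"
    proof (rule v_eqI)
      fix m show "co m v = co m 0"
      proof (cases "m \<in> I")
        case True
        then show ?thesis using q0_co[of m v o'] q0_e_pos[OF True] v
          by (simp add: co_simps mult_le_0_iff)
      qed (simp add: co_out)
    qed
  next
    assume "v = 0" then show "q0 o' v = 0" using q0_scl[of o' 0 0] by simp
  qed
qed (use q0_nonneg q0_triangle q0_scl in auto)

text \<open>The weight dual to the least norm. Outside \<open>I\<close>, where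
  \<open>e n = 0\<close>, the value \<open>1\<close> keeps \<open>w n >= 1\<close> for all
  \<open>n\<close>.\<close>

definition w :: "int \<Rightarrow> real" where "w n = (if n \<in> I then 1 / q0 o' (e n) else 1)"

lemma w_ge1: "1 \<le> w n"
  using q0_e_pos[of n] q0_e_le1[of o' n] by (auto simp: w_def)

text \<open>The integral lower bound with \<epsilon> = 1/2 has exponent \<open>- 2\<close>, and
  \<open>exp (- t)\<close> has total mass at most \<open>1\<close> on the half-line, so the supremum
  of \<open>rad n\<close> is at least a constant over \<open>1 + |n|\<close>. Linear growth is just
  what the cubic decay of coefficients tolerates.\<close>

lemma w_growth: "\<exists>W\<ge>0. \<forall>n. w n \<le> W * (1 + \<bar>of_int n\<bar>)"
proof -
  have "rad_low (1 / 2) I" by (rule rad_lower_bound) auto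
  then obtain \<delta> c where c: "\<delta> > 0" "c > 0" "\<forall>\<delta>'\<in>{0<..\<delta>}. \<forall>n\<in>I. \<exists>T0. \<forall>T\<ge>T0. c * (1 + \<bar>of_int n\<bar>) powr (- (1 + 2 * (1 / 2)))
      \<le> integral {\<delta>'..T} (\<lambda>t. (cmod (rad n t))\<^sup>2 * exp (- 2 * (1 / 2) * t))"
    unfolding rad_low_def by blast
  have b: "1 / q0 o' (e n) \<le> (1 / sqrt c) * (1 + \<bar>of_int n\<bar>)" if n: "n \<in> I" for n
  proof -
    from c n obtain T0 where "\<forall>T\<ge>T0. c * (1 + \<bar>of_int n\<bar>) powr (- (1 + 2 * (1 / 2)))
      \<le> integral {\<delta>..T} (\<lambda>t. (cmod (rad n t))\<^sup>2 * exp (- 2 * (1 / 2) * t))" by force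
    then have T: "c * (1 + \<bar>of_int n\<bar>) powr (- 2) \<le> integral {\<delta>..max T0 \<delta>} (\<lambda>t. (cmod (rad n t))\<^sup>2 * exp (- t))" by simp
    let ?T = "max T0 \<delta>"
    have E: "((\<lambda>t. (q0 o' (e n))\<^sup>2 * exp (- t)) has_integral (q0 o' (e n))\<^sup>2 * (- exp (- ?T) - - exp (- \<delta>))) {\<delta>..?T}"
      by (rule has_integral_mult_right, rule fundamental_theorem_of_calculus) (auto intro!: derivative_eq_intros simp flip: has_real_derivative_iff_has_vector_derivative)
    have "integral {\<delta>..?T} (\<lambda>t. (cmod (rad n t))\<^sup>2 * exp (- t)) \<le> integral {\<delta>..?T} (\<lambda>t. (q0 o' (e n))\<^sup>2 * exp (- t))"
      by (rule integral_le) (auto intro!: integrable_continuous_interval continuous_intros continuous_on_subset[OF rad_cont] mult_right_mono power_mono rad_le_q0)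
    also have "\<dots> = (q0 o' (e n))\<^sup>2 * (- exp (- ?T) - - exp (- \<delta>))" using E by (rule integral_unique)
    also have "\<dots> \<le> (q0 o' (e n))\<^sup>2 * 1"
    proof (rule mult_left_mono)
      have "exp (- \<delta>) \<le> 1" "exp (- ?T) \<ge> 0" using c(1) by simp_all
      then show "- exp (- ?T) - - exp (- \<delta>) \<le> 1" by linarith
    qed simp
    finally have "c * (1 + \<bar>of_int n\<bar>) powr (- 2) \<le> (q0 o' (e n))\<^sup>2" using T by simp
    then have "c / (1 + \<bar>of_int n\<bar>)\<^sup>2 \<le> (q0 o' (e n))\<^sup>2" by (simp add: powr_minus_divide)
    then have "sqrt (c / (1 + \<bar>of_int n\<bar>)\<^sup>2) \<le> q0 o' (e n)" using q0_nonneg by (intro real_le_lsqrt) auto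
    then have "sqrt c / (1 + \<bar>of_int n\<bar>) \<le> q0 o' (e n)" by (simp add: real_sqrt_divide)
    then show ?thesis using c(2) q0_e_pos[OF n] by (simp add: field_simps)
  qed
  have "w n \<le> (1 + 1 / sqrt c) * (1 + \<bar>of_int n\<bar>)" for n
  proof (cases "n \<in> I")
    case True
    have "(1 / sqrt c) * (1 + \<bar>of_int n\<bar>) \<le> (1 + 1 / sqrt c) * (1 + \<bar>of_int n\<bar>)" by (rule mult_right_mono) auto
    then show ?thesis using b[OF True] True by (simp add: w_def)
  next
    case False
    have "1 * 1 \<le> (1 + 1 / sqrt c) * (1 + \<bar>of_int n\<bar>)" by (rule mult_mono) (use c(2) in auto)
    then show ?thesis using False by (simp add: w_def)
  qed
  then show ?thesis by (intro exI[of _ "1 + 1 / sqrt c"]) (use c(2) in auto)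
qed

definition W0 :: real where "W0 = (SOME W. W \<ge> 0 \<and> (\<forall>n. w n \<le> W * (1 + \<bar>of_int n\<bar>)))"

lemma W0: "0 \<le> W0" "w n \<le> W0 * (1 + \<bar>of_int n\<bar>)"
  using someI_ex[OF w_growth] unfolding W0_def by blast+

text \<open>A supremum over the orbit becomes invariant because \<open>q h\<close> evaluated at the
  truncations for \<open>g\<close> tends to \<open>q (h ** g)\<close>. It is applied to absolute
  values of coefficients and to orbit norms in a completion.\<close>

lemma famI:
  assumes q: "\<And>h v. h \<in> SL2 \<Longrightarrow> 0 \<le> q h v" "\<And>h u v. h \<in> SL2 \<Longrightarrow> q h (u + v) \<le> q h u + q h v" "\<And>h c v. h \<in> SL2 \<Longrightarrow> q h (scl V c v) = cmod c * q h v"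
    and e: "\<And>h n. h \<in> SL2 \<Longrightarrow> q h (e n) \<le> w n" and lim: "\<And>h g v. h \<in> SL2 \<Longrightarrow> g \<in> SL2 \<Longrightarrow> (\<lambda>N. q h (S N g v)) \<longlonglongrightarrow> q (h ** g) v"
    and bdd: "\<And>v. bdd_above ((\<lambda>h. q h v) ` SL2)"
  shows "fam w W0 (\<lambda>v. SUP h\<in>SL2. q h v)"
proof -
  let ?Q = "\<lambda>v. SUP h\<in>SL2. q h v"
  have up: "h \<in> SL2 \<Longrightarrow> q h v \<le> ?Q v" for h v by (rule cSUP_upper[OF _ bdd])
  have nn: "0 \<le> ?Q v" for v using up[OF SL2_1, of v] q(1)[OF SL2_1, of v] by linarith
  have le: "?Q (scl V c v) \<le> cmod c * ?Q v" for c v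
    by (rule cSUP_least[OF SL2_ne]) (simp add: q(3) mult_left_mono up)
  show ?thesis
    unfolding fam_def
  proof (intro conjI allI ballI nn)
    show "?Q (u + v) \<le> ?Q u + ?Q v" for u v
      by (rule cSUP_least[OF SL2_ne]) (rule order_trans[OF q(2) add_mono[OF up up]])
    show "?Q (scl V c v) = cmod c * ?Q v" for c v
    proof (cases "c = 0")
      case True then show ?thesis using le[of c v] nn[of "scl V c v"] by simp
    next
      case False
      have "?Q v \<le> cmod (1 / c) * ?Q (scl V c v)" using le[of "1 / c" "scl V c v"] False by simp
      then show ?thesis using le[of c v] False by (simp add: norm_divide field_simps)
    qed
    show "?Q (e n) \<le> w n" for n by (rule cSUP_least[OF SL2_ne e])
    show "?Q (S N g v) \<le> ?Q v + 2 * (W0 * dcy g v) / (real N + 1)" if g: "g \<in> SL2" for g v N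
    proof (rule cSUP_least[OF SL2_ne])
      fix h assume h: "h \<in> SL2"
      \<comment> \<open>The truncation at \<open>N\<close> is compared with longer ones at
        \<open>N'\<close>, whose limit is known; the difference is covered by the tail bound for all
        \<open>N'\<close> at once.\<close>
      have "q h (S N g v) \<le> q (h ** g) v + 2 * (W0 * dcy g v) / (real N + 1)"
      proof (rule LIMSEQ_le_const[OF tendsto_add[OF lim[OF h g] tendsto_const]], intro exI[of _ N] allI impI)
        fix N' assume N: "N \<le> N'"
        have "q h (S N' g v - S N g v) \<le> 2 * (W0 * dcy g v) / (real N + 1)"
          by (rule S_tail[OF g _ W0(1) q(2)[OF h] q(3)[OF h] N]) (rule order_trans[OF e[OF h] W0(2)])
        moreover have "q h (S N g v) \<le> q h (S N' g v) + q h (scl V (-1) (S N' g v - S N g v))"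
          using q(2)[OF h, of "S N' g v" "scl V (-1) (S N' g v - S N g v)"] by simp
        ultimately show "q h (S N g v) \<le> q h (S N' g v) + 2 * (W0 * dcy g v) / (real N + 1)" by (simp only: q(3)[OF h]) simp
      qed
      then show "q h (S N g v) \<le> ?Q v + 2 * (W0 * dcy g v) / (real N + 1)"
        using up[of "h ** g" v] h g by simp
    qed
  qed
qed

lemma fam_q0: assumes c: "c \<ge> 0" "\<And>m. c * q0 n (e m) \<le> w m" shows "fam w W0 (\<lambda>v. c * q0 n v)"
proof -
  have "fam w W0 (\<lambda>v. SUP h\<in>SL2. c * cmod (M n h v))"
  proof (rule famI)
    show "c * cmod (M n h (e m)) \<le> w m" if "h \<in> SL2" for h m
      using order_trans[OF mult_left_mono[OF M_q0[OF that] c(1)] c(2)] .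
    show "(\<lambda>N. c * cmod (M n h (S N g v))) \<longlonglongrightarrow> c * cmod (M n (h ** g) v)" if "h \<in> SL2" "g \<in> SL2" for h g v
      by (intro tendsto_intros M_S_conv that)
    show "bdd_above ((\<lambda>h. c * cmod (M n h v)) ` SL2)" for v
      by (rule bdd_aboveI2[of _ _ "c * hp v"]) (simp add: mult_left_mono c M_le)
    show "c * cmod (M n h (u + v)) \<le> c * cmod (M n h u) + c * cmod (M n h v)" if "h \<in> SL2" for h u v
      using mult_left_mono[OF norm_triangle_ineq c(1)] that by (simp add: functionalD[OF H.mc_lin] distrib_left)
  qed (use c in \<open>auto simp: functionalD[OF H.mc_lin] norm_mult\<close>)
  moreover have "(SUP h\<in>SL2. c * cmod (M n h v)) = c * q0 n v" for v
  proof (rule antisym)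
    show "(SUP h\<in>SL2. c * cmod (M n h v)) \<le> c * q0 n v"
      by (rule cSUP_least[OF SL2_ne]) (auto intro: mult_left_mono M_q0 c)
    show "c * q0 n v \<le> (SUP h\<in>SL2. c * cmod (M n h v))"
    proof (cases "c = 0")
      case True then show ?thesis using SL2_ne by (auto simp: image_constant_conv)
    next
      case False
      have "q0 n v \<le> (SUP h\<in>SL2. c * cmod (M n h v)) / c"
      proof (rule q0_le)
        fix g assume "g \<in> SL2"
        then have "c * cmod (M n g v) \<le> (SUP h\<in>SL2. c * cmod (M n h v))"
          by (rule cSUP_upper) (rule bdd_aboveI2[of _ _ "c * hp v"], simp add: mult_left_mono c M_le)
        then show "cmod (M n g v) \<le> (SUP h\<in>SL2. c * cmod (M n h v)) / c" using False c by (simp add: field_simps)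
      qed
      then show ?thesis using False c by (simp add: field_simps)
    qed
  qed
  ultimately show ?thesis by simp
qed

lemma fam_q0_base: "fam w W0 (q0 o')"
  using fam_q0[of 1 o'] order_trans[OF q0_e_le1 w_ge1] by simp

lemma famnorm_q0: "famnorm V e co b I \<mu> o' hp \<pi> w W0 (q0 o')"
  by (intro famnorm.intro famnorm_axioms.intro umod_axioms W0 q0_norm fam_q0_base)

lemma q0_Norms: "q0 o' \<in> Norms V"
  by (rule famnorm.in_Norms[OF famnorm_q0])

text \<open>By unitarity \<open>M n g (e m)\<close> is a coefficient of \<open>g\<^sup>-\<^sup>1 (e n)\<close>, whose norm \<open>q0 o'\<close> is at most
  \<open>q0 o' (e n)\<close>.\<close>

lemma q0_e_mult: assumes "m \<in> I" "n \<in> I" shows "q0 n (e m) * q0 o' (e m) \<le> q0 o' (e n)"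
proof -
  have "cmod (M n g (e m)) * q0 o' (e m) \<le> q0 o' (e n)" if g: "g \<in> SL2" for g
  proof -
    let ?h = "adj2 g"
    have h: "?h \<in> SL2" using g by simp
    have "cmod (M m ?h (e n)) * q0 o' (e m) \<le> q0 o' (e n) + 0"
    proof (rule LIMSEQ_le_const[OF tendsto_add[OF tendsto_const null_over_Suc[of "2 * (W0 * dcy ?h (e n))"]]], intro exI[of _ "nat \<bar>m\<bar>"] allI impI)
      fix N assume "nat \<bar>m\<bar> \<le> N"
      then have "co m (S N ?h (e n)) = M m ?h (e n)" using h by (simp add: co_S)
      then have "cmod (M m ?h (e n)) * q0 o' (e m) \<le> q0 o' (S N ?h (e n))" using q0_co[of m "S N ?h (e n)" o'] by simp
      also have "\<dots> \<le> q0 o' (e n) + 2 * (W0 * dcy ?h (e n)) / (real N + 1)"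
        using fam_q0_base h unfolding fam_def by blast
      finally show "cmod (M m ?h (e n)) * q0 o' (e m) \<le> q0 o' (e n) + 2 * (W0 * dcy ?h (e n)) / (real N + 1)" .
    qed
    then show ?thesis using M_adj'[OF g assms] by simp
  qed
  then have "q0 n (e m) \<le> q0 o' (e n) / q0 o' (e m)"
    using q0_e_pos[OF assms(1)] by (intro q0_le) (simp add: field_simps)
  then show ?thesis using q0_e_pos[OF assms(1)] by (simp add: field_simps)
qed

text \<open>Dividing \<open>q0_e_mult\<close> by both values of \<open>q0 o'\<close> turns it into
  \<open>w n * q0 n (e m) <= w m\<close>, the normalization condition of the family.\<close>

lemma fam_qn: assumes "n \<in> I" shows "fam w W0 (\<lambda>v. w n * q0 n v)"
proof (rule fam_q0)
  show "0 \<le> w n" using w_ge1[of n] by simp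
  fix m show "w n * q0 n (e m) \<le> w m"
  proof (cases "m \<in> I")
    case True
    then show ?thesis using q0_e_mult[OF True assms] q0_e_pos[OF True] q0_e_pos[OF assms] assms by (simp add: w_def field_simps)
  next
    case False
    then show ?thesis using q0_scl[of n 0 0] w_ge1[of m] by (simp add: e_0)
  qed
qed

text \<open>The maximal element is taken inside the family because the family is closed under
  suprema and bounded above by \<open>fam_bound\<close>.\<close>

definition pmax :: "'v \<Rightarrow> real" where "pmax v = (SUP q\<in>{q. fam w W0 q}. q v)"

lemma fam_bound: assumes "fam w W0 q" shows "q v \<le> (\<Sum>n | co n v \<noteq> 0. cmod (co n v) * w n)"
proof -
  have q: "q (u + v) \<le> q u + q v" "q (scl V c v) = cmod c * q v" "q (e n) \<le> w n" for u v c n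
    using assms unfolding fam_def by blast+
  have "q (\<Sum>n\<in>F. scl V (co n v) (e n)) \<le> (\<Sum>n\<in>F. cmod (co n v) * w n)" if "finite F" for F
    using that
  proof (induction F)
    case empty show ?case using q(2)[of 0 0] by simp
  next
    case (insert n F)
    have "cmod (co n v) * q (e n) \<le> cmod (co n v) * w n" by (rule mult_left_mono[OF q(3)]) simp
    then show ?case using insert q(1)[of "scl V (co n v) (e n)" "\<Sum>n\<in>F. scl V (co n v) (e n)"] by (simp add: q(2))
  qed
  then show ?thesis using co_exp[of v] co_fin[of v] by metis
qed

lemma pmax_upper: "fam w W0 q \<Longrightarrow> q v \<le> pmax v"
  unfolding pmax_def by (rule cSUP_upper) (auto intro!: bdd_aboveI2 fam_bound)

lemma pmax_least: "(\<And>q. fam w W0 q \<Longrightarrow> q v \<le> B) \<Longrightarrow> pmax v \<le> B"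
  unfolding pmax_def by (rule cSUP_least) (use fam_q0_base in auto)

text \<open>Each condition is an inequality and passes to the supremum, except homogeneity, which
  follows from its inequality for \<open>c\<close> and for \<open>1 / c\<close>. Definiteness comes
  from \<open>q0 o'\<close>, a member of the family.\<close>

lemma pmax_fam: "fam w W0 pmax" and pmax_norm: "is_norm V pmax"
proof -
  have nn: "0 \<le> pmax v" for v using pmax_upper[OF fam_q0_base, of v] q0_nonneg[of o' v] by linarith
  have tri: "pmax (u + v) \<le> pmax u + pmax v" for u v
  proof (rule pmax_least)
    fix q assume q: "fam w W0 q"
    then have "q (u + v) \<le> q u + q v" unfolding fam_def by blast
    then show "q (u + v) \<le> pmax u + pmax v" using pmax_upper[OF q, of u] pmax_upper[OF q, of v] by linarith
  qed
  have le: "pmax (scl V c v) \<le> cmod c * pmax v" for c v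
  proof (rule pmax_least)
    fix q assume q: "fam w W0 q"
    then have "q (scl V c v) = cmod c * q v" unfolding fam_def by blast
    then show "q (scl V c v) \<le> cmod c * pmax v" using pmax_upper[OF q, of v] by (simp add: mult_left_mono)
  qed
  have hom: "pmax (scl V c v) = cmod c * pmax v" for c v
  proof (cases "c = 0")
    case True then show ?thesis using le[of c v] nn[of "scl V c v"] by simp
  next
    case False
    have "pmax v \<le> cmod (1 / c) * pmax (scl V c v)" using le[of "1 / c" "scl V c v"] False by simp
    then show ?thesis using le[of c v] False by (simp add: norm_divide field_simps)
  qed
  show "fam w W0 pmax"
    unfolding fam_def
  proof (intro conjI allI ballI nn tri hom)
    show "pmax (e n) \<le> w n" for n by (rule pmax_least) (auto simp: fam_def)
    show "pmax (S N g v) \<le> pmax v + 2 * (W0 * dcy g v) / (real N + 1)" if g: "g \<in> SL2" for g v N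
    proof (rule pmax_least)
      fix q assume q: "fam w W0 q"
      then have "q (S N g v) \<le> q v + 2 * (W0 * dcy g v) / (real N + 1)" using g unfolding fam_def by blast
      then show "q (S N g v) \<le> pmax v + 2 * (W0 * dcy g v) / (real N + 1)" using pmax_upper[OF q, of v] by linarith
    qed
  qed
  show "is_norm V pmax"
    unfolding is_norm_def
  proof (intro conjI allI nn tri hom)
    fix v
    have "q0 o' v = 0 \<longleftrightarrow> v = 0" using q0_norm unfolding is_norm_def by blast
    moreover have "0 \<le> q0 o' v" "q0 o' v \<le> pmax v" by (rule q0_nonneg, rule pmax_upper[OF fam_q0_base])
    ultimately show "pmax v = 0 \<longleftrightarrow> v = 0" using hom[of 0 0] by auto
  qed
qed

lemma pmax_Norms: "pmax \<in> Norms V"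
  by (rule famnorm.in_Norms[of V e co b I \<mu> o' hp \<pi> w W0]) (intro famnorm.intro famnorm_axioms.intro umod_axioms W0 pmax_norm pmax_fam)

text \<open>Witnessed by the member \<open>w n * q0 n\<close>, since the coefficient of
  \<open>e n\<close> at the identity is \<open>1\<close>. With the defining bound this gives
  equality.\<close>

lemma w_le_pmax: assumes "n \<in> I" shows "w n \<le> pmax (e n)"
proof -
  have "1 \<le> q0 n (e n)" using M_q0[OF SL2_1, of n "e n"] assms by (simp add: co_e)
  then have "w n * 1 \<le> w n * q0 n (e n)" using w_ge1[of n] by (intro mult_left_mono) auto
  also have "\<dots> \<le> pmax (e n)" by (rule pmax_upper[OF fam_qn[OF assms]])
  finally show ?thesis by simp
qed

end

section \<open>Sobolev bounds by discrete averages over K and over the radial variable\<close>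

lemma parseval_roots_of_unity:
  fixes z :: "int \<Rightarrow> complex"
  assumes F: "finite F" and L: "L > 0" "\<And>m n. m \<in> F \<Longrightarrow> n \<in> F \<Longrightarrow> int L > \<bar>n - m\<bar>"
  shows "(\<Sum>l<L. (cmod (\<Sum>n\<in>F. z n * cis (of_int n * ang L l)))\<^sup>2) = real L * (\<Sum>n\<in>F. (cmod (z n))\<^sup>2)"
proof -
  have *: "(\<Sum>l<L. cis (of_int n * ang L l) * cis (- (of_int m * ang L l))) = (if n = m then of_nat L else 0)" if "n \<in> F" "m \<in> F" for n m
  proof -
    have "int L dvd n - m \<longleftrightarrow> n = m" using L(2)[OF that(2,1)] zdvd_imp_le[of "int L" "\<bar>n - m\<bar>"] by (cases "n = m") auto
    then show ?thesis using sum_roots_of_unity[OF L(1), of "n - m"] by (simp add: cis_mult left_diff_distrib)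
  qed
  have "complex_of_real (\<Sum>l<L. (cmod (\<Sum>n\<in>F. z n * cis (of_int n * ang L l)))\<^sup>2)
      = (\<Sum>l<L. \<Sum>n\<in>F. \<Sum>m\<in>F. z n * cnj (z m) * (cis (of_int n * ang L l) * cis (- (of_int m * ang L l))))"
    unfolding of_real_sum complex_norm_square cnj_sum sum_product by (simp add: cis_cnj mult_ac)
  also have "\<dots> = (\<Sum>n\<in>F. \<Sum>m\<in>F. z n * cnj (z m) * (\<Sum>l<L. cis (of_int n * ang L l) * cis (- (of_int m * ang L l))))"
    by (simp only: sum_distrib_left sum.swap[of _ F "{..<L}"])
  also have "\<dots> = (\<Sum>n\<in>F. \<Sum>m\<in>F. if n = m then z n * cnj (z m) * of_nat L else 0)"
    by (intro sum.cong refl) (simp add: *)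
  also have "\<dots> = complex_of_real (real L * (\<Sum>n\<in>F. (cmod (z n))\<^sup>2))"
    by (simp add: F sum_distrib_left mult_ac flip: complex_norm_square)
  finally show ?thesis by (simp only: of_real_eq_iff)
qed

text \<open>A common refinement of finitely many gauges yields one Riemann sum that works for all
  functions; its weights are lengths, hence nonnegative. Indices are tagged intervals and
  \<open>fst\<close> is the tag.\<close>

lemma quadrature_exists:
  fixes h :: "'k \<Rightarrow> real \<Rightarrow> real"
  assumes "finite K" "\<And>k. k \<in> K \<Longrightarrow> continuous_on {a..b} (h k)" "\<eta> > 0"
  shows "\<exists>(P :: (real \<times> real set) set) \<mu>. finite P \<and> (\<forall>i. 0 \<le> \<mu> i) \<and> (\<forall>k\<in>K. \<bar>(\<Sum>i\<in>P. \<mu> i * h k (fst i)) - integral {a..b} (h k)\<bar> < \<eta>)"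
proof -
  have "\<forall>k\<in>K. \<exists>\<gamma>. gauge \<gamma> \<and> (\<forall>D. D tagged_division_of {a..b} \<and> \<gamma> fine D \<longrightarrow> norm ((\<Sum>(x, k')\<in>D. measure lborel k' *\<^sub>R h k x) - integral {a..b} (h k)) < \<eta>)"
  proof
    fix k assume "k \<in> K"
    then have "(h k has_integral integral {a..b} (h k)) {a..b}"
      by (intro integrable_integral integrable_continuous_interval assms(2))
    then show "\<exists>\<gamma>. gauge \<gamma> \<and> (\<forall>D. D tagged_division_of {a..b} \<and> \<gamma> fine D \<longrightarrow> norm ((\<Sum>(x, k')\<in>D. measure lborel k' *\<^sub>R h k x) - integral {a..b} (h k)) < \<eta>)"
      by (rule has_integral_real[THEN iffD1, rule_format, OF _ assms(3)])
  qed
  from bchoice[OF this] obtain \<gamma> where G: "\<forall>k\<in>K. gauge (\<gamma> k) \<and> (\<forall>D. D tagged_division_of {a..b} \<and> \<gamma> k fine D \<longrightarrow>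
      norm ((\<Sum>(x, k')\<in>D. measure lborel k' *\<^sub>R h k x) - integral {a..b} (h k)) < \<eta>)"
    by (rule exE)
  have \<gamma>: "gauge (\<gamma> k)" "D tagged_division_of {a..b} \<Longrightarrow> \<gamma> k fine D \<Longrightarrow>
      norm ((\<Sum>(x, k')\<in>D. measure lborel k' *\<^sub>R h k x) - integral {a..b} (h k)) < \<eta>" if "k \<in> K" for k D
    using bspec[OF G that] by simp_all
  have "gauge (\<lambda>x. \<Inter>{\<gamma> k x |k. k \<in> K})" by (rule gauge_Inter[OF assms(1)]) (rule \<gamma>(1))
  then obtain P where P: "P tagged_division_of {a..b}" "(\<lambda>x. \<Inter>{\<gamma> k x |k. k \<in> K}) fine P"
    by (rule fine_division_exists_real)
  show ?thesis
  proof (intro exI conjI allI ballI)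
    show "finite P" using P(1) by (simp add: tagged_division_of_def tagged_partial_division_of_def)
    show "0 \<le> measure lborel (snd i)" for i :: "real \<times> real set" by simp
    show "\<bar>(\<Sum>i\<in>P. measure lborel (snd i) * h k (fst i)) - integral {a..b} (h k)\<bar> < \<eta>" if "k \<in> K" for k
      using \<gamma>(2)[OF that P(1)] P(2) that by (simp add: fine_Inter case_prod_beta)
  qed
qed

context umod
begin

text \<open>The same nodes and weights serve every type in \<open>F\<close>, and the two constants
  do not depend on \<open>F\<close>; this uniformity yields Sobolev constants valid for all
  vectors.\<close>

lemma rad_quadrature:
  assumes \<epsilon>: "0 < \<epsilon>" "\<epsilon> \<le> 1"
  obtains c where "c > 0" "\<And>F. finite F \<Longrightarrow> F \<subseteq> I \<Longrightarrow> \<exists>(P :: (real \<times> real set) set) \<mu>. finite P \<and> (\<forall>i. 0 \<le> \<mu> i) \<and>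
     (\<Sum>i\<in>P. \<mu> i * exp (- 2 * \<epsilon> * fst i)) \<le> 1 / (2 * \<epsilon>) + 1 \<and>
     (\<forall>n\<in>F. c * (1 + \<bar>of_int n\<bar>) powr (- (1 + 2 * \<epsilon>)) \<le> (\<Sum>i\<in>P. \<mu> i * ((cmod (rad n (fst i)))\<^sup>2 * exp (- 2 * \<epsilon> * fst i))))"
proof -
  have "rad_low \<epsilon> I" by (rule rad_lower_bound[OF \<epsilon>])
  then obtain \<delta> c where c: "\<delta> > 0" "c > 0" "\<forall>\<delta>'\<in>{0<..\<delta>}. \<forall>n\<in>I. \<exists>T0. \<forall>T\<ge>T0. c * (1 + \<bar>of_int n\<bar>) powr (- (1 + 2 * \<epsilon>))
      \<le> integral {\<delta>'..T} (\<lambda>t. (cmod (rad n t))\<^sup>2 * exp (- 2 * \<epsilon> * t))"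
    unfolding rad_low_def by blast
  show ?thesis
  proof (rule that[of "c / 2"])
    fix F :: "int set" assume F: "finite F" "F \<subseteq> I"
    from c have "\<forall>n\<in>F. \<exists>T0. \<forall>T\<ge>T0. c * (1 + \<bar>of_int n\<bar>) powr (- (1 + 2 * \<epsilon>))
      \<le> integral {\<delta>..T} (\<lambda>t. (cmod (rad n t))\<^sup>2 * exp (- 2 * \<epsilon> * t))" using F by auto
    from bchoice[OF this] obtain T0 where T0: "\<And>n T. n \<in> F \<Longrightarrow> T \<ge> T0 n \<Longrightarrow> c * (1 + \<bar>of_int n\<bar>) powr (- (1 + 2 * \<epsilon>))
      \<le> integral {\<delta>..T} (\<lambda>t. (cmod (rad n t))\<^sup>2 * exp (- 2 * \<epsilon> * t))"
      by blast
    define T where "T = Max (insert \<delta> (T0 ` F))"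
    have T: "\<delta> \<le> T" "n \<in> F \<Longrightarrow> T0 n \<le> T" for n unfolding T_def by (rule Max_ge; use F in auto)+
    let ?l = "\<lambda>n::int. c * (1 + \<bar>of_int n\<bar>) powr (- (1 + 2 * \<epsilon>))"
    \<comment> \<open>An error below half of each target costs the factor \<open>1 / 2\<close> in
      \<open>c\<close>; an error of at most \<open>1\<close> costs the summand \<open>1\<close> in
      the total mass.\<close>
    define \<eta> where "\<eta> = Min (insert 1 ((\<lambda>n. ?l n / 2) ` F))"
    have \<eta>: "\<eta> > 0" "\<eta> \<le> 1" using F c by (auto simp: \<eta>_def add_nonneg_eq_0_iff)
    have \<eta>l: "\<eta> \<le> ?l n / 2" if "n \<in> F" for n unfolding \<eta>_def by (rule Min_le) (use F that in auto)
    \<comment> \<open>The index \<open>None\<close> stands for the weight function itself, so that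
      its total mass is controlled by the same quadrature.\<close>
    let ?h = "\<lambda>k t. case k of None \<Rightarrow> exp (- 2 * \<epsilon> * t) | Some n \<Rightarrow> (cmod (rad n t))\<^sup>2 * exp (- 2 * \<epsilon> * t)"
    have "\<exists>(P :: (real \<times> real set) set) \<mu>. finite P \<and> (\<forall>i. 0 \<le> \<mu> i) \<and> (\<forall>k\<in>insert None (Some ` F). \<bar>(\<Sum>i\<in>P. \<mu> i * ?h k (fst i)) - integral {\<delta>..T} (?h k)\<bar> < \<eta>)"
    proof (rule quadrature_exists)
      show "continuous_on {\<delta>..T} (?h k)" for k
        by (cases k) (auto intro!: continuous_intros continuous_on_subset[OF rad_cont])
    qed (use F \<eta> in auto)
    then obtain P :: "(real \<times> real set) set" and \<mu> where P: "finite P" "\<forall>i. 0 \<le> \<mu> i"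
      "\<forall>k\<in>insert None (Some ` F). \<bar>(\<Sum>i\<in>P. \<mu> i * ?h k (fst i)) - integral {\<delta>..T} (?h k)\<bar> < \<eta>" by blast
    have I: "((\<lambda>t. exp (- 2 * \<epsilon> * t)) has_integral (- exp (- 2 * \<epsilon> * T) / (2 * \<epsilon>) - - exp (- 2 * \<epsilon> * \<delta>) / (2 * \<epsilon>))) {\<delta>..T}"
      by (rule fundamental_theorem_of_calculus) (use T \<epsilon> in \<open>auto intro!: derivative_eq_intros simp flip: has_real_derivative_iff_has_vector_derivative\<close>)
    have "- exp (- 2 * \<epsilon> * T) / (2 * \<epsilon>) - - exp (- 2 * \<epsilon> * \<delta>) / (2 * \<epsilon>) = (exp (- 2 * \<epsilon> * \<delta>) - exp (- 2 * \<epsilon> * T)) / (2 * \<epsilon>)" by (simp add: diff_divide_distrib)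
    also have "\<dots> \<le> 1 / (2 * \<epsilon>)"
    proof (rule divide_right_mono)
      have "exp (- 2 * \<epsilon> * \<delta>) \<le> 1" "exp (- 2 * \<epsilon> * T) \<ge> 0" using c(1) \<epsilon> by simp_all
      then show "exp (- 2 * \<epsilon> * \<delta>) - exp (- 2 * \<epsilon> * T) \<le> 1" by linarith
    qed (use \<epsilon> in simp)
    finally have J: "integral {\<delta>..T} (\<lambda>t. exp (- 2 * \<epsilon> * t)) \<le> 1 / (2 * \<epsilon>)" using integral_unique[OF I] by simp
    have 1: "(\<Sum>i\<in>P. \<mu> i * exp (- 2 * \<epsilon> * fst i)) \<le> 1 / (2 * \<epsilon>) + 1"
      using bspec[OF P(3), of None] J \<eta>(2) by (simp add: abs_less_iff)
    have 2: "c / 2 * (1 + \<bar>of_int n\<bar>) powr (- (1 + 2 * \<epsilon>)) \<le> (\<Sum>i\<in>P. \<mu> i * ((cmod (rad n (fst i)))\<^sup>2 * exp (- 2 * \<epsilon> * fst i)))" if n: "n \<in> F" for n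
      using bspec[OF P(3), of "Some n"] T0[OF n T(2)[OF n]] \<eta>l[OF n] n by (simp add: abs_less_iff)
    show "\<exists>(P :: (real \<times> real set) set) \<mu>. finite P \<and> (\<forall>i. 0 \<le> \<mu> i) \<and> (\<Sum>i\<in>P. \<mu> i * exp (- 2 * \<epsilon> * fst i)) \<le> 1 / (2 * \<epsilon>) + 1 \<and>
     (\<forall>n\<in>F. c / 2 * (1 + \<bar>of_int n\<bar>) powr (- (1 + 2 * \<epsilon>)) \<le> (\<Sum>i\<in>P. \<mu> i * ((cmod (rad n (fst i)))\<^sup>2 * exp (- 2 * \<epsilon> * fst i))))"
      using P(1,2) 1 2 by blast
  qed (use c in simp)
qed

lemma M_expand: assumes "g \<in> SL2" "finite F" "{n. co n v \<noteq> 0} \<subseteq> F" shows "M m g v = (\<Sum>n\<in>F. co n v * M m g (e n))"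
  by (subst co_exp'[OF assms(2,3)]) (simp add: functionalD[OF H.mc_lin[OF assms(1)]])

text \<open>Rotating \<open>v\<close> multiplies its coordinates by characters, and every
  coefficient at \<open>hyp t ** rot s\<close> is at most \<open>q0 o' v\<close>. Parseval over
  \<open>s\<close> gives the square sum.\<close>

lemma q0_f_sum:
  assumes F: "finite F" "{n. co n v \<noteq> 0} \<subseteq> F"
  shows "(\<Sum>n\<in>F. (cmod (co n v))\<^sup>2 * (cmod (rad n t))\<^sup>2) \<le> (q0 o' v)\<^sup>2"
proof -
  obtain L :: nat where L: "L > 0" "\<And>n. n \<in> (\<lambda>(m, n). n - m) ` (F \<times> F) \<Longrightarrow> int L > \<bar>n\<bar>"
    by (rule H.large_modulus[of "(\<lambda>(m, n). n - m) ` (F \<times> F)" 0]) (use F in auto)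
  have "M o' (hyp t ** rot s) v = (\<Sum>n\<in>F. (co n v * rad n t) * cis (of_int n * s))" for s
    using M_expand[of "hyp t ** rot s" F v o'] F by (simp add: H.mc_rot_right k_e functionalD[OF H.mc_lin] rad_def mult_ac)
  then have "(cmod (\<Sum>n\<in>F. (co n v * rad n t) * cis (of_int n * s)))\<^sup>2 \<le> (q0 o' v)\<^sup>2" for s
    using M_q0[of "hyp t ** rot s" o' v] by (intro power_mono) auto
  then have "(\<Sum>l<L. (cmod (\<Sum>n\<in>F. (co n v * rad n t) * cis (of_int n * ang L l)))\<^sup>2) \<le> (\<Sum>l<L. (q0 o' v)\<^sup>2)"
    by (rule sum_mono)
  also have "(\<Sum>l<L. (cmod (\<Sum>n\<in>F. (co n v * rad n t) * cis (of_int n * ang L l)))\<^sup>2) = real L * (\<Sum>n\<in>F. (cmod (co n v * rad n t))\<^sup>2)"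
    by (rule parseval_roots_of_unity[OF F(1) L(1)]) (use L(2) in force)
  finally show ?thesis using L(1) by (simp add: norm_mult power_mult_distrib)
qed

text \<open>The previous inequality is summed over the quadrature nodes: the left side collects the
  lower bounds for \<open>rad n\<close>, the right side only the bounded total mass.\<close>

lemma q0_sobolev_lower:
  assumes \<epsilon>: "0 < \<epsilon>" "\<epsilon> \<le> 1"
  obtains K where "K > 0" "\<And>v. (\<Sum>n | co n v \<noteq> 0. (cmod (co n v))\<^sup>2 * (1 + \<bar>of_int n\<bar>) powr (- (1 + 2 * \<epsilon>))) \<le> K * (q0 o' v)\<^sup>2"
proof -
  obtain c where c: "c > 0" "\<And>F. finite F \<Longrightarrow> F \<subseteq> I \<Longrightarrow> \<exists>(P :: (real \<times> real set) set) \<mu>. finite P \<and> (\<forall>i. 0 \<le> \<mu> i) \<and>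
     (\<Sum>i\<in>P. \<mu> i * exp (- 2 * \<epsilon> * fst i)) \<le> 1 / (2 * \<epsilon>) + 1 \<and>
     (\<forall>n\<in>F. c * (1 + \<bar>of_int n\<bar>) powr (- (1 + 2 * \<epsilon>)) \<le> (\<Sum>i\<in>P. \<mu> i * ((cmod (rad n (fst i)))\<^sup>2 * exp (- 2 * \<epsilon> * fst i))))"
    by (rule rad_quadrature[OF \<epsilon>]) blast
  show ?thesis
  proof (rule that[of "(1 / (2 * \<epsilon>) + 1) / c"])
    show "(1 / (2 * \<epsilon>) + 1) / c > 0" using c \<epsilon> by (simp add: add_pos_pos)
    fix v
    let ?F = "{n. co n v \<noteq> 0}"
    have F: "finite ?F" "?F \<subseteq> I" using co_fin co_out by auto
    from c(2)[OF F] obtain P :: "(real \<times> real set) set" and \<mu> where P: "finite P" "\<And>i. 0 \<le> \<mu> i"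
     "(\<Sum>i\<in>P. \<mu> i * exp (- 2 * \<epsilon> * fst i)) \<le> 1 / (2 * \<epsilon>) + 1"
     "\<And>n. n \<in> ?F \<Longrightarrow> c * (1 + \<bar>of_int n\<bar>) powr (- (1 + 2 * \<epsilon>)) \<le> (\<Sum>i\<in>P. \<mu> i * ((cmod (rad n (fst i)))\<^sup>2 * exp (- 2 * \<epsilon> * fst i)))"
      by blast
    have "(\<Sum>n\<in>?F. (cmod (co n v))\<^sup>2 * (c * (1 + \<bar>of_int n\<bar>) powr (- (1 + 2 * \<epsilon>))))
        \<le> (\<Sum>n\<in>?F. (cmod (co n v))\<^sup>2 * (\<Sum>i\<in>P. \<mu> i * ((cmod (rad n (fst i)))\<^sup>2 * exp (- 2 * \<epsilon> * fst i))))"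
      by (intro sum_mono mult_left_mono P(4)) auto
    also have "\<dots> = (\<Sum>i\<in>P. \<mu> i * exp (- 2 * \<epsilon> * fst i) * (\<Sum>n\<in>?F. (cmod (co n v))\<^sup>2 * (cmod (rad n (fst i)))\<^sup>2))"
      unfolding sum_distrib_left by (subst sum.swap) (simp add: mult_ac)
    also have "\<dots> \<le> (\<Sum>i\<in>P. \<mu> i * exp (- 2 * \<epsilon> * fst i) * (q0 o' v)\<^sup>2)"
      by (intro sum_mono mult_left_mono q0_f_sum F) (auto simp: P(2))
    also have "\<dots> \<le> (1 / (2 * \<epsilon>) + 1) * (q0 o' v)\<^sup>2"
      unfolding sum_distrib_right[symmetric] by (rule mult_right_mono[OF P(3)]) simp
    finally have "c * (\<Sum>n\<in>?F. (cmod (co n v))\<^sup>2 * (1 + \<bar>of_int n\<bar>) powr (- (1 + 2 * \<epsilon>))) \<le> (1 / (2 * \<epsilon>) + 1) * (q0 o' v)\<^sup>2"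
      by (simp add: sum_distrib_left mult_ac)
    then show "(\<Sum>n\<in>?F. (cmod (co n v))\<^sup>2 * (1 + \<bar>of_int n\<bar>) powr (- (1 + 2 * \<epsilon>))) \<le> (1 / (2 * \<epsilon>) + 1) / c * (q0 o' v)\<^sup>2"
      using c(1) by (simp add: field_simps)
  qed
qed
end

section \<open>Comparison of an arbitrary bounded norm with the extremal ones\<close>

locale bnorm = gnorm V e co b I \<mu> o' hp \<pi> p C \<rho>
  for V :: "('v::ab_group_add) gk" and e co b I \<mu> o' hp \<pi> p C \<rho> +
  assumes bdd: "g \<in> SL2 \<Longrightarrow> nrm (banach_completion V p) (\<rho> g (embed p v)) \<le> C * p v"
begin

lemma M_p: assumes g: "g \<in> SL2" shows "cmod (M n g v) * p (e n) \<le> C * (C * p v)"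
proof -
  obtain u where u: "\<And>n. (\<lambda>j. co n (u j)) \<longlonglongrightarrow> mc n g v" "(\<lambda>j. p (u j)) \<longlonglongrightarrow> nrm N.E (\<rho> g (embed p v))"
    by (rule mc_approx[OF g, of v]) blast
  have "cmod (mc n g v) * p (e n) \<le> C * nrm N.E (\<rho> g (embed p v))"
    by (rule LIMSEQ_le[of "\<lambda>j. cmod (co n (u j)) * p (e n)" _ "\<lambda>j. C * p (u j)"]) (auto intro!: tendsto_intros u co_p_bound)
  also have "\<dots> \<le> C * (C * p v)" using bdd[OF g] C_ge by (intro mult_left_mono) auto
  finally show ?thesis by (simp add: mc_unique g)
qed

lemma q0_le_p: "q0 o' v \<le> C * C / p (e o') * p v"
proof -
  have "q0 o' v \<le> C * (C * p v) / p (e o')"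
    by (rule q0_le) (use M_p p_e_pos[OF o_I] in \<open>simp add: field_simps\<close>)
  then show ?thesis by (simp add: field_simps)
qed

text \<open>A multiplier \<open>c\<close> is convolution on K with the trigonometric polynomial
  having these coefficients, so it costs the mean of its modulus, which by Cauchy-Schwarz and
  Parseval is at most the square root of the sum of the \<open>|c n|^2\<close>. One factor
  \<open>C\<close> comes from the K-average, the other from the orbit. The gain over the triangle
  inequality on types is what makes \<open>sobolev_upper\<close> sharp.\<close>

lemma orbit_bound:
  assumes g: "g \<in> SL2" and F: "finite F"
  shows "p (vec F (\<lambda>n. c n * M n g (e o'))) \<le> C * (C * p (e o')) * sqrt (\<Sum>n\<in>F. (cmod (c n))\<^sup>2)"
proof -
  let ?s = "sqrt (\<Sum>n\<in>F. (cmod (c n))\<^sup>2)"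
  obtain u where u: "\<And>n. (\<lambda>j. co n (u j)) \<longlonglongrightarrow> M n g (e o')" "(\<lambda>j. p (u j)) \<longlonglongrightarrow> nrm N.E (\<rho> g (embed p (e o')))"
    by (rule mc_approx[OF g, of "e o'"]) (unfold mc_unique[OF g], blast)
  have s0: "?s \<ge> 0" by (simp add: sum_nonneg)
  have b: "p (vec F (\<lambda>n. c n * co n x)) \<le> ?s * (C * p x)" for x
  proof -
    let ?S = "F \<union> {n. co n x \<noteq> 0}"
    have S: "finite ?S" using F co_fin by simp
    obtain L :: nat where L: "L > 0" "\<And>n. n \<in> (\<lambda>(m, n). n - m) ` (?S \<times> ?S) \<Longrightarrow> int L > \<bar>n\<bar>"
      by (rule large_modulus[of "(\<lambda>(m, n). n - m) ` (?S \<times> ?S)" 0]) (use S in auto)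
    have L2: "int L > \<bar>n - m\<bar>" if "m \<in> ?S" "n \<in> ?S" for m n using L(2) that by force
    \<comment> \<open>The modulus exceeds all differences of types in \<open>F\<close> and in the
      support of \<open>x\<close>, so the discrete convolution reproduces the multiplier
      exactly.\<close>
    define \<phi> where "\<phi> l = (\<Sum>m\<in>F. c m * cis (of_int (- m) * ang L l))" for l
    obtain A where A: "\<And>n. co n A = co n x * ((\<Sum>l<L. \<phi> l * cis (of_int n * ang L l)) / of_nat L)"
      "p A \<le> (\<Sum>l<L. cmod (\<phi> l)) / real L * (C * p x)" by (rule K_average[OF L(1), where f = \<phi> and v = x]) blast
    have "(\<Sum>l<L. \<phi> l * cis (of_int n * ang L l)) = (if n \<in> F then of_nat L * c n else 0)" if n: "n \<in> ?S" for n
    proof -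
      have "(\<Sum>l<L. \<phi> l * cis (of_int n * ang L l)) = (\<Sum>m\<in>F. c m * (\<Sum>l<L. cis (of_int (n - m) * ang L l)))"
        unfolding \<phi>_def sum_distrib_right sum_distrib_left by (subst sum.swap) (simp add: cis_mult algebra_simps)
      also have "\<dots> = (\<Sum>m\<in>F. if m = n then c m * of_nat L else 0)"
      proof (rule sum.cong[OF refl])
        fix m assume m: "m \<in> F"
        have "int L dvd n - m \<longleftrightarrow> m = n" using L2[of m n] n m zdvd_imp_le[of "int L" "\<bar>n - m\<bar>"] by (cases "m = n") auto
        then show "c m * (\<Sum>l<L. cis (of_int (n - m) * ang L l)) = (if m = n then c m * of_nat L else 0)"
          by (simp only: sum_roots_of_unity[OF L(1)]) simp
      qed
      also have "\<dots> = (if n \<in> F then of_nat L * c n else 0)" using F by (simp add: mult.commute)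
      finally show ?thesis .
    qed
    then have "co n A = (if n \<in> F then c n * co n x else 0)" for n
      using A(1)[of n] L(1) by (cases "co n x = 0") auto
    then have "A = vec F (\<lambda>n. c n * co n x)" by (intro v_eqI) (auto simp: co_vec F co_out)
    moreover have "(\<Sum>l<L. cmod (\<phi> l)) / real L \<le> ?s"
    proof (rule power2_le_imp_le[OF _ s0])
      have "((\<Sum>l<L. 1 * cmod (\<phi> l)))\<^sup>2 \<le> (\<Sum>l<L. 1\<^sup>2) * (\<Sum>l<L. (cmod (\<phi> l))\<^sup>2)" by (rule Cauchy_Schwarz_ineq_sum)
      also have "(\<Sum>l<L. (cmod (\<phi> l))\<^sup>2) = (\<Sum>l<L. (cmod (\<Sum>m\<in>uminus ` F. c (- m) * cis (of_int m * ang L l)))\<^sup>2)"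
        by (simp add: \<phi>_def sum.reindex)
      also have "\<dots> = real L * (\<Sum>m\<in>uminus ` F. (cmod (c (- m)))\<^sup>2)"
        by (rule parseval_roots_of_unity) (use F L(1) L2 in \<open>auto simp: abs_minus_commute\<close>)
      also have "(\<Sum>m\<in>uminus ` F. (cmod (c (- m)))\<^sup>2) = ?s\<^sup>2" by (simp add: sum.reindex sum_nonneg)
      finally have "(\<Sum>l<L. cmod (\<phi> l))\<^sup>2 \<le> (real L)\<^sup>2 * ?s\<^sup>2" by (simp add: power2_eq_square)
      then show "((\<Sum>l<L. cmod (\<phi> l)) / real L)\<^sup>2 \<le> ?s\<^sup>2" using L(1) by (simp add: power_divide field_simps)
    qed
    moreover have "0 \<le> C * p x" using C_ge by simp
    ultimately show ?thesis using A(2) order_trans mult_right_mono by blast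
  qed
  let ?v = "vec F (\<lambda>n. c n * M n g (e o'))"
  \<comment> \<open>The orbit vector is approximated by vectors \<open>u j\<close> of
    \<open>V\<close>, for which \<open>b\<close> holds; the error involves only the finitely many
    coordinates in \<open>F\<close>.\<close>
  have "p ?v \<le> 0 + ?s * (C * nrm N.E (\<rho> g (embed p (e o'))))"
  proof (rule LIMSEQ_le_const)
    have "(\<lambda>j. (\<Sum>n\<in>F. cmod (c n * M n g (e o') - c n * co n (u j)) * p (e n)) + ?s * (C * p (u j))) \<longlonglongrightarrow>
      (\<Sum>n\<in>F. cmod (c n * M n g (e o') - c n * M n g (e o')) * p (e n)) + ?s * (C * nrm N.E (\<rho> g (embed p (e o'))))"
      by (intro tendsto_intros u)
    then show "(\<lambda>j. (\<Sum>n\<in>F. cmod (c n * M n g (e o') - c n * co n (u j)) * p (e n)) + ?s * (C * p (u j))) \<longlonglongrightarrow>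
      0 + ?s * (C * nrm N.E (\<rho> g (embed p (e o'))))" by simp
    have "p ?v \<le> (\<Sum>n\<in>F. cmod (c n * M n g (e o') - c n * co n (u j)) * p (e n)) + ?s * (C * p (u j))" for j
    proof -
      have eq: "?v = vec F (\<lambda>n. c n * M n g (e o') - c n * co n (u j)) + vec F (\<lambda>n. c n * co n (u j))"
        by (simp add: vec_def vs.scale_left_diff_distrib sum_subtractf)
      show ?thesis by (subst eq, rule order_trans[OF N.p_triangle add_mono[OF p_vec b]])
    qed
    then show "\<exists>N. \<forall>j\<ge>N. p ?v \<le> (\<Sum>n\<in>F. cmod (c n * M n g (e o') - c n * co n (u j)) * p (e n)) + ?s * (C * p (u j))" by blast
  qed
  also have "\<dots> \<le> 0 + ?s * (C * (C * p (e o')))"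
    using bdd[OF g, of "e o'"] C_ge s0 by (intro add_left_mono mult_left_mono) auto
  finally show ?thesis by (simp add: mult_ac)
qed

abbreviation "B \<equiv> C * (C * p (e o'))"

lemma B_pos: "B > 0" using C_ge p_e_pos[OF o_I] by simp

text \<open>\<open>orbit_bound\<close> for the single type \<open>n\<close> bounds the coefficient
  of a translate of \<open>e o'\<close>; by adjointness this is a coefficient of \<open>e n\<close>
  at the inverse element, and the supremum over \<open>g\<close> produces
  \<open>q0 o' (e n)\<close>.\<close>

lemma p_e_w: "p (e n) \<le> B * w n"
proof (cases "n \<in> I")
  case True
  have "q0 o' (e n) \<le> B / p (e n)"
  proof (rule q0_le)
    fix g assume g: "g \<in> SL2"
    have "p (vec {n} (\<lambda>m. 1 * M m (adj2 g) (e o'))) \<le> B * sqrt (\<Sum>m\<in>{n}. (cmod 1)\<^sup>2)"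
      by (rule orbit_bound) (use g in auto)
    then have "cmod (M n (adj2 g) (e o')) * p (e n) \<le> B" by (simp add: vec_def)
    then show "cmod (M o' g (e n)) \<le> B / p (e n)"
      using M_adj'[OF g True o_I] p_e_pos[OF True] by (simp add: field_simps)
  qed
  then show ?thesis using True p_e_pos[OF True] q0_e_pos[OF True] by (simp add: w_def field_simps)
next
  case False
  then show ?thesis using B_pos w_ge1[of n] by (simp add: e_0)
qed

lemma nrm_lipschitz: assumes "A \<in> pts N.E" "D \<in> pts N.E" shows "\<bar>nrm N.E A - nrm N.E D\<bar> \<le> ndist N.E A D"
proof -
  obtain u x where u: "u \<in> N.CS" "A = N.cc u" "x \<in> N.CS" "D = N.cc x" using assms by (auto elim!: N.pts_cases)
  show ?thesis unfolding u(2,4)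
    by (rule LIMSEQ_le[of "\<lambda>j. \<bar>p (u j) - p (x j)\<bar>" _ "\<lambda>j. p (u j - x j)"])
      (auto intro!: tendsto_intros N.nrm_cc N.ndist_cc u N.p_rev)
qed

lemma orbit_norm:
  assumes g: "g \<in> SL2"
  shows "0 \<le> nrm N.E (\<rho> g (embed p v))" "nrm N.E (\<rho> g (embed p (u + v))) \<le> nrm N.E (\<rho> g (embed p u)) + nrm N.E (\<rho> g (embed p v))"
    "nrm N.E (\<rho> g (embed p (scl V c v))) = cmod c * nrm N.E (\<rho> g (embed p v))"
proof -
  obtain x where x: "x \<in> N.CS" "\<rho> g (embed p u) = N.cc x" using \<rho>_pts[OF g N.embed_pts] by (rule N.pts_cases)
  obtain y where y: "y \<in> N.CS" "\<rho> g (embed p v) = N.cc y" using \<rho>_pts[OF g N.embed_pts] by (rule N.pts_cases)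
  show "0 \<le> nrm N.E (\<rho> g (embed p v))" unfolding y(2) by (rule LIMSEQ_le_const[OF N.nrm_cc[OF y(1)]]) simp
  have a: "\<rho> g (embed p (u + v)) = N.cc (\<lambda>j. x j + y j)"
    using \<rho>_add[OF g N.embed_pts N.embed_pts, of u v] by (simp add: x y N.add_cc)
  show "nrm N.E (\<rho> g (embed p (u + v))) \<le> nrm N.E (\<rho> g (embed p u)) + nrm N.E (\<rho> g (embed p v))"
    unfolding a x(2) y(2)
    by (rule LIMSEQ_le[OF N.nrm_cc[OF N.CS_add[OF x(1) y(1)]] tendsto_add[OF N.nrm_cc[OF x(1)] N.nrm_cc[OF y(1)]]]) (auto intro: N.p_triangle)
  have s: "\<rho> g (embed p (scl V c v)) = N.cc (\<lambda>j. scl V c (y j))"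
    using \<rho>_smul[OF g N.embed_pts, of c v] by (simp add: y N.smul_cc)
  show "nrm N.E (\<rho> g (embed p (scl V c v))) = cmod c * nrm N.E (\<rho> g (embed p v))"
    unfolding s y(2)
    by (rule LIMSEQ_unique[OF N.nrm_cc[OF N.CS_scl[OF y(1)]]]) (use tendsto_mult_left[OF N.nrm_cc[OF y(1)], of "cmod c"] in simp)
qed

text \<open>The invariant hull of \<open>p\<close>, the supremum of its orbit norms, belongs to the
  family after division by \<open>C * B\<close>: the factor \<open>B\<close> normalizes the values
  at \<open>e n\<close>, and \<open>C\<close> bounds the passage to the orbit.\<close>

lemma p_le_pmax: "p v \<le> C * B * pmax v"
proof -
  have K: "C * B > 0" using B_pos C_ge by simp
  let ?q = "\<lambda>h v. nrm N.E (\<rho> h (embed p v)) / (C * B)"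
  have bd: "bdd_above ((\<lambda>h. ?q h v) ` SL2)" for v
    by (rule bdd_aboveI2[of _ _ "C * p v / (C * B)"], rule divide_right_mono[OF bdd]) (use K in auto)
  have "fam w W0 (\<lambda>v. SUP h\<in>SL2. ?q h v)"
  proof (rule famI)
    fix h assume h: "h \<in> SL2"
    show "0 \<le> ?q h v" for v using orbit_norm(1)[OF h] K by simp
    show "?q h (u + v) \<le> ?q h u + ?q h v" for u v
      using divide_right_mono[OF orbit_norm(2)[OF h, of u v], of "C * B"] K by (simp add: add_divide_distrib)
    show "?q h (scl V c v) = cmod c * ?q h v" for c v by (simp add: orbit_norm(3)[OF h])
    show "?q h (e n) \<le> w n" for n
    proof -
      have "nrm N.E (\<rho> h (embed p (e n))) \<le> C * (B * w n)"
        by (rule order_trans[OF bdd[OF h] mult_left_mono[OF p_e_w]]) (use C_ge in simp)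
      then show ?thesis using K by (simp add: field_simps)
    qed
    fix g v assume g: "g \<in> SL2"
    have "p (e n) \<le> B * W0 * (1 + \<bar>of_int n\<bar>)" for n
      using order_trans[OF p_e_w mult_left_mono[OF W0(2)]] B_pos by (simp add: mult.assoc)
    note conv = S_conv[OF g this, of v]
    have S: "(\<lambda>N. S N g v) \<in> N.CS" "\<rho> g (embed p v) = N.cc (\<lambda>N. S N g v)" using conv B_pos W0(1) by simp_all
    have "(\<lambda>N. ndist N.E (\<rho> h (embed p (S N g v))) (\<rho> h (\<rho> g (embed p v)))) \<longlonglongrightarrow> 0"
      by (rule \<rho>_tendsto[OF h]) (use N.embed_tendsto[OF S(1)] S g in auto)
    then have "(\<lambda>N. nrm N.E (\<rho> h (embed p (S N g v))) - nrm N.E (\<rho> h (\<rho> g (embed p v)))) \<longlonglongrightarrow> 0"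
      by (rule Lim_null_comparison[rotated]) (auto intro!: always_eventually nrm_lipschitz \<rho>_pts N.embed_pts h g)
    then have "(\<lambda>N. nrm N.E (\<rho> h (embed p (S N g v)))) \<longlonglongrightarrow> nrm N.E (\<rho> (h ** g) (embed p v))"
      by (simp add: LIM_zero_iff \<rho>_mult h g)
    then show "(\<lambda>N. ?q h (S N g v)) \<longlonglongrightarrow> ?q (h ** g) v" using K by (intro tendsto_intros) auto
  qed (rule bd)
  from pmax_upper[OF this, of v] have "?q (mat 1) v \<le> pmax v"
    using cSUP_upper[OF SL2_1 bd, of v] by linarith
  then show ?thesis using K by (simp add: \<rho>_one field_simps)
qed

text \<open>Dual to \<open>q0_sobolev_lower\<close>: \<open>v\<close> is written as a finite
  superposition of multipliers applied to translates of \<open>e o'\<close>.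
  \<open>orbit_bound\<close> estimates each summand and Cauchy-Schwarz over the nodes separates the
  total mass from the coordinates of \<open>v\<close>.\<close>

lemma sobolev_upper:
  assumes \<epsilon>: "0 < \<epsilon>" "\<epsilon> \<le> 1"
  obtains K where "K > 0" "\<And>v. (p v)\<^sup>2 \<le> K * (\<Sum>n | co n v \<noteq> 0. (cmod (co n v))\<^sup>2 * (1 + \<bar>of_int n\<bar>) powr (1 + 2 * \<epsilon>))"
proof -
  let ?A = "1 / (2 * \<epsilon>) + 1"
  obtain c where c: "c > 0" "\<And>F. finite F \<Longrightarrow> F \<subseteq> I \<Longrightarrow> \<exists>(P :: (real \<times> real set) set) \<mu>. finite P \<and> (\<forall>i. 0 \<le> \<mu> i) \<and>
     (\<Sum>i\<in>P. \<mu> i * exp (- 2 * \<epsilon> * fst i)) \<le> ?A \<and>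
     (\<forall>n\<in>F. c * (1 + \<bar>of_int n\<bar>) powr (- (1 + 2 * \<epsilon>)) \<le> (\<Sum>i\<in>P. \<mu> i * ((cmod (rad n (fst i)))\<^sup>2 * exp (- 2 * \<epsilon> * fst i))))"
    by (rule rad_quadrature[OF \<epsilon>]) blast
  have A: "?A > 0" using \<epsilon> by (simp add: add_pos_pos)
  show ?thesis
  proof (rule that[of "B\<^sup>2 * ?A / c"])
    show "B\<^sup>2 * ?A / c > 0" using A c(1) by (rule divide_pos_pos[OF mult_pos_pos[OF zero_less_power[OF B_pos]]])
    fix v
    let ?F = "{n. co n v \<noteq> 0}"
    have F: "finite ?F" "?F \<subseteq> I" using co_fin co_out by auto
    from c(2)[OF F] obtain P :: "(real \<times> real set) set" and \<mu> where P: "finite P" "\<And>i. 0 \<le> \<mu> i"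
     "(\<Sum>i\<in>P. \<mu> i * exp (- 2 * \<epsilon> * fst i)) \<le> ?A"
     "\<And>n. n \<in> ?F \<Longrightarrow> c * (1 + \<bar>of_int n\<bar>) powr (- (1 + 2 * \<epsilon>)) \<le> (\<Sum>i\<in>P. \<mu> i * ((cmod (rad n (fst i)))\<^sup>2 * exp (- 2 * \<epsilon> * fst i)))"
      by blast
    \<comment> \<open>\<open>R n\<close> is the quadrature value of the integral of
      \<open>|rad n|^2\<close> against the weight, the mass by which type \<open>n\<close> has to be
      divided.\<close>
    define R where "R n = (\<Sum>i\<in>P. \<mu> i * ((cmod (rad n (fst i)))\<^sup>2 * exp (- 2 * \<epsilon> * fst i)))" for n
    have R: "R n \<ge> c * (1 + \<bar>of_int n\<bar>) powr (- (1 + 2 * \<epsilon>))" "R n > 0" if "n \<in> ?F" for n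
    proof -
      show 1: "R n \<ge> c * (1 + \<bar>of_int n\<bar>) powr (- (1 + 2 * \<epsilon>))" using P(4)[OF that] by (simp only: R_def)
      have "c * (1 + \<bar>of_int n\<bar>) powr (- (1 + 2 * \<epsilon>)) > 0" using c(1) by (simp add: add_nonneg_eq_0_iff)
      then show "R n > 0" using 1 by linarith
    qed
    define \<gamma> where "\<gamma> i n = co n v * rad n (fst i) * of_real (exp (- 2 * \<epsilon> * fst i) / R n)" for i :: "real \<times> real set" and n
    let ?x = "\<lambda>i. vec ?F (\<lambda>n. \<gamma> i n * M n (hyp (- fst i)) (e o'))"
    define y where "y i = sqrt (\<Sum>n\<in>?F. (cmod (co n v))\<^sup>2 * ((cmod (rad n (fst i)))\<^sup>2 * exp (- 2 * \<epsilon> * fst i)) / (R n)\<^sup>2)" for i :: "real \<times> real set"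
    have y0: "y i \<ge> 0" for i by (simp add: y_def sum_nonneg)
    have \<gamma>y: "sqrt (\<Sum>n\<in>?F. (cmod (\<gamma> i n))\<^sup>2) = exp (- \<epsilon> * fst i) * y i" for i
    proof -
      have "(\<Sum>n\<in>?F. (cmod (\<gamma> i n))\<^sup>2) = (exp (- \<epsilon> * fst i))\<^sup>2 * (\<Sum>n\<in>?F. (cmod (co n v))\<^sup>2 * ((cmod (rad n (fst i)))\<^sup>2 * exp (- 2 * \<epsilon> * fst i)) / (R n)\<^sup>2)"
        unfolding sum_distrib_left
        by (rule sum.cong[OF refl]) (simp add: \<gamma>_def norm_mult norm_divide power_mult_distrib power_divide mult_ac flip: exp_add exp_double)
      then show ?thesis by (simp add: y_def real_sqrt_mult)
    qed
    \<comment> \<open>The coordinate of the translate by \<open>hyp (- t)\<close> is the conjugate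
      of \<open>rad n t\<close>, so each node contributes \<open>co n v\<close> times its share of
      \<open>R n\<close>.\<close>
    have "v = (\<Sum>i\<in>P. scl V (of_real (\<mu> i)) (?x i))"
    proof (rule v_eqI)
      fix n
      show "co n v = co n (\<Sum>i\<in>P. scl V (of_real (\<mu> i)) (?x i))"
      proof (cases "n \<in> ?F")
        case True
        then have nI: "n \<in> I" using F by blast
        have "co n (\<Sum>i\<in>P. scl V (of_real (\<mu> i)) (?x i)) = (\<Sum>i\<in>P. of_real (\<mu> i) * (\<gamma> i n * M n (hyp (- fst i)) (e o')))"
          using True nI by (simp add: co_simps co_vec F)
        also have "\<dots> = (\<Sum>i\<in>P. co n v / of_real (R n) * of_real (\<mu> i * ((cmod (rad n (fst i)))\<^sup>2 * exp (- 2 * \<epsilon> * fst i))))"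
        proof (rule sum.cong[OF refl])
          fix i :: "real \<times> real set"
          have "M n (hyp (- fst i)) (e o') = cnj (rad n (fst i))" using rad_adj[OF nI] by simp
          then show "of_real (\<mu> i) * (\<gamma> i n * M n (hyp (- fst i)) (e o')) = co n v / of_real (R n) * of_real (\<mu> i * ((cmod (rad n (fst i)))\<^sup>2 * exp (- 2 * \<epsilon> * fst i)))"
            by (simp add: \<gamma>_def complex_norm_square mult_ac del: exp_minus flip: of_real_power)
        qed
        also have "\<dots> = co n v / of_real (R n) * of_real (R n)" by (simp only: R_def of_real_sum sum_distrib_left)
        finally show ?thesis using R(2)[OF True] by simp
      next
        case False
        then show ?thesis by (simp add: co_simps co_vec F)
      qed
    qed
    then have "p v = p (\<Sum>i\<in>P. scl V (of_real (\<mu> i)) (?x i))" by (rule arg_cong)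
    also have "\<dots> \<le> (\<Sum>i\<in>P. p (scl V (of_real (\<mu> i)) (?x i)))" by (rule N.p_sum)
    also have "\<dots> \<le> (\<Sum>i\<in>P. \<mu> i * (B * (exp (- \<epsilon> * fst i) * y i)))"
    proof (rule sum_mono)
      fix i
      have "p (?x i) \<le> B * (exp (- \<epsilon> * fst i) * y i)" using orbit_bound[OF hyp_SL2 F(1), of "\<gamma> i" "- fst i"] unfolding \<gamma>y .
      then show "p (scl V (of_real (\<mu> i)) (?x i)) \<le> \<mu> i * (B * (exp (- \<epsilon> * fst i) * y i))" using P(2)[of i] by (simp add: mult_left_mono)
    qed
    \<comment> \<open>Splitting \<mu> and the weight evenly between the two factors prepares
      Cauchy-Schwarz: one factor becomes the total mass, the other sums to
      \<open>|co n v|^2 / R n\<close>.\<close>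
    also have "\<dots> = B * (\<Sum>i\<in>P. (sqrt (\<mu> i) * exp (- \<epsilon> * fst i)) * (sqrt (\<mu> i) * y i))"
      unfolding sum_distrib_left
    proof (rule sum.cong[OF refl])
      fix i
      have "sqrt (\<mu> i) * sqrt (\<mu> i) = \<mu> i" using P(2)[of i] by simp
      then have "B * ((sqrt (\<mu> i) * exp (- \<epsilon> * fst i)) * (sqrt (\<mu> i) * y i)) = B * (\<mu> i * (exp (- \<epsilon> * fst i) * y i))" by (metis mult.assoc mult.left_commute)
      then show "\<mu> i * (B * (exp (- \<epsilon> * fst i) * y i)) = B * ((sqrt (\<mu> i) * exp (- \<epsilon> * fst i)) * (sqrt (\<mu> i) * y i))" by (metis mult.left_commute)
    qed
    finally have "(p v)\<^sup>2 \<le> (B * (\<Sum>i\<in>P. (sqrt (\<mu> i) * exp (- \<epsilon> * fst i)) * (sqrt (\<mu> i) * y i)))\<^sup>2"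
      by (rule power_mono) simp
    also have "\<dots> \<le> B\<^sup>2 * ((\<Sum>i\<in>P. (sqrt (\<mu> i) * exp (- \<epsilon> * fst i))\<^sup>2) * (\<Sum>i\<in>P. (sqrt (\<mu> i) * y i)\<^sup>2))"
      unfolding power_mult_distrib[of B] by (rule mult_left_mono[OF Cauchy_Schwarz_ineq_sum]) simp
    also have "(\<Sum>i\<in>P. (sqrt (\<mu> i) * exp (- \<epsilon> * fst i))\<^sup>2) = (\<Sum>i\<in>P. \<mu> i * exp (- 2 * \<epsilon> * fst i))"
      using P(2) by (simp add: power_mult_distrib mult.assoc flip: exp_double)
    also have "(\<Sum>i\<in>P. (sqrt (\<mu> i) * y i)\<^sup>2) = (\<Sum>i\<in>P. \<mu> i * (\<Sum>n\<in>?F. (cmod (co n v))\<^sup>2 * ((cmod (rad n (fst i)))\<^sup>2 * exp (- 2 * \<epsilon> * fst i)) / (R n)\<^sup>2))"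
      using P(2) by (simp add: power_mult_distrib y_def sum_nonneg)
    also have "\<dots> = (\<Sum>n\<in>?F. (cmod (co n v))\<^sup>2 / (R n)\<^sup>2 * R n)"
      unfolding sum_distrib_left R_def by (subst sum.swap) (simp add: mult_ac)
    also have "\<dots> = (\<Sum>n\<in>?F. (cmod (co n v))\<^sup>2 / R n)"
      by (rule sum.cong[OF refl]) (use R(2) in \<open>simp add: power2_eq_square\<close>)
    also have "B\<^sup>2 * ((\<Sum>i\<in>P. \<mu> i * exp (- 2 * \<epsilon> * fst i)) * (\<Sum>n\<in>?F. (cmod (co n v))\<^sup>2 / R n)) \<le> B\<^sup>2 * (?A * (\<Sum>n\<in>?F. (cmod (co n v))\<^sup>2 * (1 + \<bar>of_int n\<bar>) powr (1 + 2 * \<epsilon>) / c))"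
    proof (intro mult_left_mono mult_mono P(3) sum_mono)
      fix n assume n: "n \<in> ?F"
      have "(cmod (co n v))\<^sup>2 / R n \<le> (cmod (co n v))\<^sup>2 / (c * (1 + \<bar>of_int n\<bar>) powr (- (1 + 2 * \<epsilon>)))"
        by (rule divide_left_mono[OF R(1)[OF n]]) (use R(2)[OF n] c(1) in \<open>auto simp: add_nonneg_eq_0_iff\<close>)
      also have "\<dots> = (cmod (co n v))\<^sup>2 * (1 + \<bar>of_int n\<bar>) powr (1 + 2 * \<epsilon>) / c"
        using c(1) unfolding powr_minus by (simp add: field_simps)
      finally show "(cmod (co n v))\<^sup>2 / R n \<le> (cmod (co n v))\<^sup>2 * (1 + \<bar>of_int n\<bar>) powr (1 + 2 * \<epsilon>) / c" .
    qed (use A R(2) in \<open>auto intro!: sum_nonneg divide_nonneg_pos\<close>)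
    finally show "(p v)\<^sup>2 \<le> B\<^sup>2 * ?A / c * (\<Sum>n\<in>?F. (cmod (co n v))\<^sup>2 * (1 + \<bar>of_int n\<bar>) powr (1 + 2 * \<epsilon>))"
      by (simp flip: sum_divide_distrib)
  qed
qed

end

section \<open>The Sobolev gap\<close>

lemma dominated_trans: assumes "dominated p q" "dominated q r" shows "dominated p r"
proof -
  obtain C where C: "C > 0" "\<And>v. p v \<le> C * q v" using assms(1) unfolding dominated_def by blast
  obtain D where D: "D > 0" "\<And>v. q v \<le> D * r v" using assms(2) unfolding dominated_def by blast
  have "p v \<le> C * D * r v" for v
    unfolding mult.assoc by (rule order_trans[OF C(2) mult_left_mono[OF D(2)]]) (use C(1) in simp)
  then show ?thesis unfolding dominated_def using C(1) D(1) by (intro exI[of _ "C * D"]) simp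
qed

lemma dominated_comp: "dominated p q \<Longrightarrow> dominated (\<lambda>v. p (T v)) (\<lambda>v. q (T v))"
  unfolding dominated_def by blast

context umod
begin

lemma Norms_bnorm: assumes "p \<in> Norms V" obtains C \<rho> where "bnorm V e co b I \<mu> o' hp \<pi> p C \<rho>"
  by (rule Norms_approx[OF assms]) (rule that, intro bnorm.intro bnorm_axioms.intro)

lemma dominated_min: assumes "p \<in> Norms V" shows "dominated (q0 o') p"
proof (rule Norms_bnorm[OF assms])
  fix C \<rho> assume "bnorm V e co b I \<mu> o' hp \<pi> p C \<rho>"
  then interpret bnorm V e co b I \<mu> o' hp \<pi> p C \<rho> .
  have "C * C / p (e o') > 0" using C_ge p_e_pos[OF o_I] by (intro divide_pos_pos) auto
  then show ?thesis unfolding dominated_def using q0_le_p by blast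
qed

lemma dominated_max: assumes "p \<in> Norms V" shows "dominated p pmax"
proof (rule Norms_bnorm[OF assms])
  fix C \<rho> assume "bnorm V e co b I \<mu> o' hp \<pi> p C \<rho>"
  then interpret bnorm V e co b I \<mu> o' hp \<pi> p C \<rho> .
  have "C * B > 0" using C_ge B_pos by simp
  then show ?thesis unfolding dominated_def using p_le_pmax by blast
qed

text \<open>\<open>p_min V\<close> is chosen merely as a minimal element; since \<open>q0 o'\<close>
  lies below every norm, minimality forces equivalence with it.\<close>

lemma p_min_equiv: "dominated (p_min V) (q0 o')" "dominated (q0 o') (p_min V)"
proof -
  have "\<exists>p. p \<in> Norms V \<and> (\<forall>q\<in>Norms V. dominated q p \<longrightarrow> dominated p q)"
    using q0_Norms dominated_min by blast
  from someI_ex[OF this] have p: "p_min V \<in> Norms V" "\<And>q. q \<in> Norms V \<Longrightarrow> dominated q (p_min V) \<Longrightarrow> dominated (p_min V) q"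
    unfolding p_min_def by blast+
  then show "dominated (p_min V) (q0 o')" "dominated (q0 o') (p_min V)" using dominated_min q0_Norms by blast+
qed

lemma p_max_equiv: "dominated (p_max V) pmax" "dominated pmax (p_max V)"
proof -
  have "\<exists>p. p \<in> Norms V \<and> (\<forall>q\<in>Norms V. dominated p q \<longrightarrow> dominated q p)"
    using pmax_Norms dominated_max by blast
  from someI_ex[OF this] have p: "p_max V \<in> Norms V" "\<And>q. q \<in> Norms V \<Longrightarrow> dominated (p_max V) q \<Longrightarrow> dominated q (p_max V)"
    unfolding p_max_def by blast+
  then show "dominated (p_max V) pmax" "dominated pmax (p_max V)" using dominated_max pmax_Norms by blast+
qed

section \<open>The Sobolev operator as a diagonal multiplier\<close>

lemma K_type_co: assumes "v \<in> K_type V n" "m \<noteq> n" shows "co m v = 0"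
proof -
  \<comment> \<open>The angle at which the characters of index \<open>m\<close> and \<open>n\<close>
    are opposite.\<close>
  let ?t = "pi / of_int (m - n)"
  have mn: "of_int m - of_int n \<noteq> (0::real)" using assms(2) by simp
  have "cis (of_int m * ?t) * co m v = cis (of_int n * ?t) * co m v"
    using assms(1) co_k[of m ?t v] by (auto simp: K_type_iff co_simps simp del: co_k)
  moreover have "of_int m * ?t = of_int n * ?t + pi" using mn by (simp add: field_simps)
  then have "cis (of_int m * ?t) = - cis (of_int n * ?t)" by (simp flip: cis_mult)
  ultimately show ?thesis by simp
qed

lemma mult_K_type: assumes "v \<in> K_type V n" shows "mult c v = scl V (c n) v"
proof (rule v_eqI)
  show "co m (mult c v) = co m (scl V (c n) v)" for m
    using K_type_co[OF assms, of m] by (cases "m = n") (simp_all add: co_simps)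
qed

lemma Delta_K_type: assumes "v \<in> K_type V n" shows "Delta_K V (y *\<^sub>R Y0) v = scl V (of_real (y\<^sup>2 * (of_int n)\<^sup>2)) v"
proof -
  have "Delta_K V (y *\<^sub>R Y0) v = - scl V (of_real y * (of_real y * (\<i> * of_int n * (\<i> * of_int n)))) v"
    using lie_Y0_K_type[OF assms] by (simp add: Delta_K_def lie_scale endoD[OF lie_endo])
  also have "of_real y * (of_real y * (\<i> * of_int n * (\<i> * of_int n))) = - complex_of_real (y\<^sup>2 * (of_int n)\<^sup>2)"
    by (simp add: power2_eq_square algebra_simps)
  finally show ?thesis by simp
qed

definition sw :: "real \<Rightarrow> real \<Rightarrow> int \<Rightarrow> real" where "sw y s n = (1 + y\<^sup>2 * (of_int n)\<^sup>2) powr (s / 2)"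

lemma sw_pos: "sw y s n > 0"
proof -
  have "1 + y\<^sup>2 * (of_int n)\<^sup>2 \<noteq> 0" by (smt (verit) mult_nonneg_nonneg zero_le_power2)
  then show ?thesis by (simp add: sw_def)
qed

text \<open>On a nonzero vector of type \<open>n\<close> the only possible scalar is
  \<open>y^2 n^2\<close>, and on the zero vector any scalar gives a true equation. The values on the
  basis then determine the operator.\<close>

lemma D_op_eq: "D_op V (y *\<^sub>R Y0) s = mult (\<lambda>n. of_real (sw y s n))"
  unfolding D_op_def
proof (rule the_equality)
  show "endo V (mult (\<lambda>n. of_real (sw y s n))) \<and> (\<forall>n. \<forall>v\<in>K_type V n. \<forall>\<nu>::real. Delta_K V (y *\<^sub>R Y0) v = scl V (of_real \<nu>) v \<longrightarrow>
      mult (\<lambda>n. of_real (sw y s n)) v = scl V (of_real ((1 + \<nu>) powr (s / 2))) v)"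
  proof (intro conjI allI ballI impI mult_endo)
    fix n v \<nu> assume v: "v \<in> K_type V n" and "Delta_K V (y *\<^sub>R Y0) v = scl V (of_real \<nu>) v"
    then have "scl V (of_real (y\<^sup>2 * (of_int n)\<^sup>2)) v = scl V (of_real \<nu>) v" by (simp only: Delta_K_type)
    then have "v = 0 \<or> \<nu> = y\<^sup>2 * (of_int n)\<^sup>2" by (simp only: vs.scale_cancel_right of_real_eq_iff) auto
    then show "mult (\<lambda>n. of_real (sw y s n)) v = scl V (of_real ((1 + \<nu>) powr (s / 2))) v"
      by (auto simp: mult_K_type[OF v] sw_def)
  qed
next
  fix T assume T: "endo V T \<and> (\<forall>n. \<forall>v\<in>K_type V n. \<forall>\<nu>::real. Delta_K V (y *\<^sub>R Y0) v = scl V (of_real \<nu>) v \<longrightarrow>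
      T v = scl V (of_real ((1 + \<nu>) powr (s / 2))) v)"
  then have Te: "T (e n) = scl V (of_real (sw y s n)) (e n)" for n
    using Delta_K_type[OF e_K, of y n] e_K[of n] unfolding sw_def by blast
  show "T = mult (\<lambda>n. of_real (sw y s n))"
  proof (rule ext, rule v_eqI)
    fix v m show "co m (T v) = co m (mult (\<lambda>n. of_real (sw y s n)) v)"
    proof (rule functional_e_eqI[of "\<lambda>v. co m (T v)" "\<lambda>v. co m (mult (\<lambda>n. of_real (sw y s n)) v)"])
      show "functional V (\<lambda>v. co m (T v))" by (rule functionalI[OF V]) (use T in \<open>auto simp: endoD co_simps\<close>)
      show "functional V (\<lambda>v. co m (mult (\<lambda>n. of_real (sw y s n)) v))" by (rule functionalI[OF V]) (simp_all add: co_simps algebra_simps)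
    qed (simp only: Te mult_e)
  qed
qed

lemma sobolev_dominated_iff:
  "dominated (p_max V) (sobolev_norm V (y *\<^sub>R Y0) (p_min V) s) \<longleftrightarrow> dominated pmax (\<lambda>v. q0 o' (mult (\<lambda>n. of_real (sw y s n)) v))"
  (is "?L \<longleftrightarrow> dominated pmax ?q")
proof -
  have "sobolev_norm V (y *\<^sub>R Y0) (p_min V) s = (\<lambda>v. p_min V (mult (\<lambda>n. of_real (sw y s n)) v))"
    by (simp add: sobolev_norm_def D_op_eq fun_eq_iff)
  then have d: "dominated (sobolev_norm V (y *\<^sub>R Y0) (p_min V) s) ?q" "dominated ?q (sobolev_norm V (y *\<^sub>R Y0) (p_min V) s)"
    using p_min_equiv by (simp_all add: dominated_comp)
  show ?thesis
  proof
    assume ?L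
    then show "dominated pmax ?q" by (rule dominated_trans[OF p_max_equiv(2) dominated_trans[OF _ d(1)]])
  next
    assume "dominated pmax ?q"
    then show ?L by (rule dominated_trans[OF p_max_equiv(1) dominated_trans[OF _ d(2)]])
  qed
qed

lemma sw_sq: "(sw y s n)\<^sup>2 = (1 + y\<^sup>2 * (of_int n)\<^sup>2) powr s"
proof -
  have "1 + y\<^sup>2 * (of_int n)\<^sup>2 \<noteq> 0" by (smt (verit) mult_nonneg_nonneg zero_le_power2)
  then show ?thesis by (simp add: sw_def power2_eq_square flip: powr_add)
qed

text \<open>The constant combines \<open>(1 + x)^2 <= 2 (1 + x^2)\<close> with
  \<open>1 + x^2 <= (1 + 1 / y^2) (1 + y^2 x^2)\<close>.\<close>

lemma sw_lower:
  assumes "y \<noteq> 0" "s \<ge> 0"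
  shows "(1 + \<bar>of_int n\<bar>) powr (2 * s) \<le> (2 * (1 + 1 / y\<^sup>2)) powr s * (sw y s n)\<^sup>2"
proof -
  let ?n = "\<bar>of_int n\<bar> :: real"
  have "0 \<le> (1 - ?n)\<^sup>2" by simp
  then have "(1 + ?n)\<^sup>2 \<le> 2 * (1 + ?n\<^sup>2)" by (simp add: power2_eq_square algebra_simps)
  also have "\<dots> \<le> 2 * ((1 + 1 / y\<^sup>2) * (1 + y\<^sup>2 * ?n\<^sup>2))"
    using assms(1) by (simp add: field_simps)
  finally have "(1 + ?n)\<^sup>2 \<le> 2 * (1 + 1 / y\<^sup>2) * (1 + y\<^sup>2 * (of_int n)\<^sup>2)" by (simp only: mult.assoc power2_abs)
  then have "((1 + ?n)\<^sup>2) powr s \<le> (2 * (1 + 1 / y\<^sup>2) * (1 + y\<^sup>2 * (of_int n)\<^sup>2)) powr s"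
    using assms(2) by (intro powr_mono2) auto
  also have "\<dots> = (2 * (1 + 1 / y\<^sup>2)) powr s * (sw y s n)\<^sup>2" by (subst powr_mult) (auto simp: sw_sq)
  also have "(1 + ?n)\<^sup>2 = (1 + ?n) powr 2" by simp
  also have "((1 + ?n) powr 2) powr s = (1 + ?n) powr (2 * s)" by (rule powr_powr)
  finally show ?thesis .
qed

text \<open>The Sobolev operator contributes the exponent \<open>2 s\<close> to the squared
  coordinates, and the two Sobolev bounds together require
  \<open>2 (1 + 2 \<epsilon>)\<close>.\<close>

lemma gap_above:
  assumes y: "y \<noteq> 0" and s: "s > 1"
  shows "dominated pmax (\<lambda>v. q0 o' (mult (\<lambda>n. of_real (sw y s n)) v))"
proof (rule Norms_bnorm[OF pmax_Norms])
  fix C \<rho> assume "bnorm V e co b I \<mu> o' hp \<pi> pmax C \<rho>"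
  then interpret bnorm V e co b I \<mu> o' hp \<pi> pmax C \<rho> .
  \<comment> \<open>Small enough for \<open>1 + 2 \<epsilon> <= s\<close>, and at most
    \<open>1\<close> as the integral estimates demand.\<close>
  define \<epsilon> where "\<epsilon> = min ((s - 1) / 2) 1"
  have \<epsilon>: "0 < \<epsilon>" "\<epsilon> \<le> 1" "1 + 2 * \<epsilon> \<le> s" using s by (auto simp: \<epsilon>_def min_def field_simps)
  obtain K where K: "K > 0" "\<And>v. (pmax v)\<^sup>2 \<le> K * (\<Sum>n | co n v \<noteq> 0. (cmod (co n v))\<^sup>2 * (1 + \<bar>of_int n\<bar>) powr (1 + 2 * \<epsilon>))"
    using sobolev_upper[OF \<epsilon>(1,2)] by blast
  obtain L where L: "L > 0" "\<And>v. (\<Sum>n | co n v \<noteq> 0. (cmod (co n v))\<^sup>2 * (1 + \<bar>of_int n\<bar>) powr (- (1 + 2 * \<epsilon>))) \<le> L * (q0 o' v)\<^sup>2"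
    using q0_sobolev_lower[OF \<epsilon>(1,2)] by blast
  let ?A = "(2 * (1 + 1 / y\<^sup>2)) powr s"
  have A: "?A > 0" using y by (simp add: add_nonneg_eq_0_iff)
  have KAL: "K * ?A * L > 0" using K(1) A L(1) by (intro mult_pos_pos)
  have "pmax v \<le> sqrt (K * ?A * L) * q0 o' (mult (\<lambda>n. of_real (sw y s n)) v)" for v
  proof -
    let ?D = "mult (\<lambda>n. of_real (sw y s n)) v"
    have supp: "{n. co n ?D \<noteq> 0} = {n. co n v \<noteq> 0}" using sw_pos[of y s] by (auto simp: less_le)
    have t: "(cmod (co n v))\<^sup>2 * (1 + \<bar>of_int n\<bar>) powr (1 + 2 * \<epsilon>) \<le> ?A * ((cmod (co n ?D))\<^sup>2 * (1 + \<bar>of_int n\<bar>) powr (- (1 + 2 * \<epsilon>)))" for n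
    proof -
      let ?x = "1 + \<bar>of_int n\<bar> :: real"
      have "?x powr (1 + 2 * \<epsilon>) = ?x powr (2 * (1 + 2 * \<epsilon>)) * ?x powr (- (1 + 2 * \<epsilon>))" by (simp flip: powr_add)
      also have "\<dots> \<le> ?x powr (2 * s) * ?x powr (- (1 + 2 * \<epsilon>))" using \<epsilon>(3) by (intro mult_right_mono powr_mono) auto
      also have "\<dots> \<le> ?A * (sw y s n)\<^sup>2 * ?x powr (- (1 + 2 * \<epsilon>))" using s by (intro mult_right_mono sw_lower y) auto
      finally have "(cmod (co n v))\<^sup>2 * ?x powr (1 + 2 * \<epsilon>) \<le> (cmod (co n v))\<^sup>2 * (?A * (sw y s n)\<^sup>2 * ?x powr (- (1 + 2 * \<epsilon>)))" by (rule mult_left_mono) simp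
      also have "\<dots> = ?A * ((cmod (co n ?D))\<^sup>2 * ?x powr (- (1 + 2 * \<epsilon>)))" by (simp add: norm_mult power_mult_distrib mult_ac)
      finally show ?thesis .
    qed
    have "(pmax v)\<^sup>2 \<le> K * (\<Sum>n | co n v \<noteq> 0. (cmod (co n v))\<^sup>2 * (1 + \<bar>of_int n\<bar>) powr (1 + 2 * \<epsilon>))" by (rule K(2))
    also have "\<dots> \<le> K * (\<Sum>n | co n v \<noteq> 0. ?A * ((cmod (co n ?D))\<^sup>2 * (1 + \<bar>of_int n\<bar>) powr (- (1 + 2 * \<epsilon>))))"
      using K(1) by (intro mult_left_mono sum_mono t) auto
    also have "\<dots> = K * ?A * (\<Sum>n | co n ?D \<noteq> 0. (cmod (co n ?D))\<^sup>2 * (1 + \<bar>of_int n\<bar>) powr (- (1 + 2 * \<epsilon>)))"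
      unfolding supp by (simp only: sum_distrib_left mult.assoc)
    also have "\<dots> \<le> K * ?A * (L * (q0 o' ?D)\<^sup>2)" using K(1) A by (intro mult_left_mono L(2)) auto
    finally have "(pmax v)\<^sup>2 \<le> (sqrt (K * ?A * L) * q0 o' ?D)\<^sup>2" using KAL by (simp add: power_mult_distrib mult.assoc)
    then show ?thesis by (rule power2_le_imp_le) (use KAL q0_nonneg in simp)
  qed
  then show ?thesis unfolding dominated_def using KAL by (intro exI[of _ "sqrt (K * ?A * L)"]) simp
qed

text \<open>Tested on \<open>e n\<close> the hypothesis reads \<open>1 / q0 <= C sw q0\<close>, with
  \<open>q0^2\<close> of order at most \<open>1 / (1 + |n|)\<close> and \<open>sw\<close> of order
  at most \<open>(1 + |n|)^s\<close>. For \<open>s < 1\<close> this bounds \<open>|n|\<close> on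
  \<open>I\<close>, which is infinite.\<close>

lemma gap_below:
  assumes s: "0 \<le> s" and dom: "dominated pmax (\<lambda>v. q0 o' (mult (\<lambda>n. of_real (sw y s n)) v))"
  shows "1 \<le> s"
proof (rule ccontr)
  assume "\<not> 1 \<le> s"
  then have s1: "s < 1" by simp
  obtain C where C: "C > 0" "\<And>v. pmax v \<le> C * q0 o' (mult (\<lambda>n. of_real (sw y s n)) v)" using dom unfolding dominated_def by blast
  obtain D where D: "D > 0" "\<And>n t. n \<in> I \<Longrightarrow> (1 + \<bar>of_int n\<bar>) * (cmod (rad n t))\<^sup>2 \<le> D" by (rule rad_upper_bound) blast
  let ?K = "C * D * (1 + \<bar>y\<bar>) powr s"
  have bound: "1 + \<bar>of_int n\<bar> \<le> ?K powr (1 / (1 - s))" if n: "n \<in> I" for n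
  proof -
    let ?x = "1 + \<bar>of_int n\<bar> :: real"
    have q: "(q0 o' (e n))\<^sup>2 \<le> D / ?x"
    proof -
      have "q0 o' (e n) \<le> sqrt (D / ?x)"
        by (rule q0_e_le_f) (use D(2)[OF n] in \<open>auto intro!: real_le_rsqrt simp: field_simps\<close>)
      then have "(q0 o' (e n))\<^sup>2 \<le> (sqrt (D / ?x))\<^sup>2" by (rule power_mono) (rule q0_nonneg)
      then show ?thesis using D(1) by simp
    qed
    have "1 + y\<^sup>2 * (of_int n)\<^sup>2 \<le> ((1 + \<bar>y\<bar>) * ?x)\<^sup>2"
    proof -
      have "1 \<le> (1 + \<bar>y\<bar>) * ?x - \<bar>y\<bar> * \<bar>of_int n\<bar>" by (simp add: algebra_simps)
      then have "1 + \<bar>y\<bar> * \<bar>of_int n\<bar> \<le> (1 + \<bar>y\<bar>) * ?x" by simp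
      then have "(1 + \<bar>y\<bar> * \<bar>of_int n\<bar>)\<^sup>2 \<le> ((1 + \<bar>y\<bar>) * ?x)\<^sup>2" by (rule power_mono) simp
      moreover have "1 + y\<^sup>2 * (of_int n)\<^sup>2 \<le> (1 + \<bar>y\<bar> * \<bar>of_int n\<bar>)\<^sup>2" by (simp add: power2_sum power_mult_distrib)
      ultimately show ?thesis by linarith
    qed
    then have "sw y s n \<le> (((1 + \<bar>y\<bar>) * ?x)\<^sup>2) powr (s / 2)" unfolding sw_def using s by (intro powr_mono2) auto
    also have "((1 + \<bar>y\<bar>) * ?x)\<^sup>2 = ((1 + \<bar>y\<bar>) * ?x) powr 2" by simp
    also have "(((1 + \<bar>y\<bar>) * ?x) powr 2) powr (s / 2) = ((1 + \<bar>y\<bar>) * ?x) powr s" unfolding powr_powr by simp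
    also have "\<dots> = (1 + \<bar>y\<bar>) powr s * ?x powr s" by (rule powr_mult)
    finally have sw: "sw y s n \<le> (1 + \<bar>y\<bar>) powr s * ?x powr s" .
    have "1 / q0 o' (e n) \<le> C * (sw y s n * q0 o' (e n))"
      using w_le_pmax[OF n] C(2)[of "e n"] n sw_pos[of y s n] by (simp add: w_def mult_e q0_scl)
    then have "1 \<le> C * (sw y s n * (q0 o' (e n))\<^sup>2)" using q0_e_pos[OF n] by (simp add: field_simps power2_eq_square)
    also have "\<dots> \<le> C * ((1 + \<bar>y\<bar>) powr s * ?x powr s * (D / ?x))"
      using C(1) D(1) by (intro mult_left_mono mult_mono sw q) auto
    also have "\<dots> = ?K * ?x powr (s - 1)" by (simp add: powr_diff field_simps)
    finally have "?x powr (1 - s) * 1 \<le> ?x powr (1 - s) * (?K * ?x powr (s - 1))" by (rule mult_left_mono) simp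
    also have "\<dots> = ?K * (?x powr (1 - s) * ?x powr (s - 1))" by (simp only: mult.left_commute)
    also have "?x powr (1 - s) * ?x powr (s - 1) = 1" by (simp add: add_nonneg_eq_0_iff flip: powr_add)
    finally have "?x powr (1 - s) \<le> ?K" by simp
    then have "(?x powr (1 - s)) powr (1 / (1 - s)) \<le> ?K powr (1 / (1 - s))" using s1 by (intro powr_mono2) auto
    then show ?thesis using s1 by (simp add: powr_powr)
  qed
  have "I \<subseteq> {- \<lceil>?K powr (1 / (1 - s))\<rceil>..\<lceil>?K powr (1 / (1 - s))\<rceil>}"
  proof
    fix n assume "n \<in> I"
    then have "\<bar>of_int n\<bar> \<le> ?K powr (1 / (1 - s))" using bound[of n] by linarith
    then have "of_int \<bar>n\<bar> \<le> ?K powr (1 / (1 - s))" by simp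
    then have "\<bar>n\<bar> \<le> \<lceil>?K powr (1 / (1 - s))\<rceil>" by (meson le_ceiling_iff ceiling_mono ceiling_of_int order_trans le_of_int_ceiling of_int_le_iff)
    then show "n \<in> {- \<lceil>?K powr (1 / (1 - s))\<rceil>..\<lceil>?K powr (1 / (1 - s))\<rceil>}" by auto
  qed
  then show False using I_inf finite_subset by blast
qed

lemma sobolev_gap_eq_1: assumes "y \<noteq> 0" shows "sobolev_gap V (y *\<^sub>R Y0) = 1"
proof (rule antisym)
  let ?S = "{s. 0 \<le> s \<and> dominated pmax (\<lambda>v. q0 o' (mult (\<lambda>n. of_real (sw y s n)) v))}"
  have gap: "sobolev_gap V (y *\<^sub>R Y0) = Inf (ereal ` ?S)" by (simp only: sobolev_gap_def sobolev_dominated_iff)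
  show "sobolev_gap V (y *\<^sub>R Y0) \<le> 1"
    unfolding gap
  proof (rule ereal_le_epsilon2)
    fix \<epsilon> :: real assume "\<epsilon> > 0"
    then have "1 + \<epsilon> \<in> ?S" using gap_above[OF assms, of "1 + \<epsilon>"] by simp
    then have "Inf (ereal ` ?S) \<le> ereal (1 + \<epsilon>)" by (intro Inf_lower imageI)
    then show "Inf (ereal ` ?S) \<le> 1 + ereal \<epsilon>" by (simp add: one_ereal_def)
  qed
  show "1 \<le> sobolev_gap V (y *\<^sub>R Y0)"
    unfolding gap by (rule Inf_greatest) (auto dest: gap_below)
qed

end

theorem theorem3:
  fixes V :: "('v::ab_group_add) gk" and Y :: "real^2^2" and c :: real
  assumes "harish_chandra_module V"
    and "irreducible_gk V"
    and "unitarizable V"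
    and "\<not> trivial_gk V"
    and "Y \<in> so2" and "c > 0" and "- c * killing Y Y = 1"
  shows "sobolev_gap V Y = 1"
proof -
  obtain y where y: "Y = y *\<^sub>R Y0" using assms(5) by (rule so2_cases)
  \<comment> \<open>The Killing form takes the value \<open>- 8 y^2\<close> on \<open>Y\<close>, so
    the normalization rules out \<open>y = 0\<close>.\<close>
  have y0: "y \<noteq> 0" using assms(7) killing_Y0[of y] by (auto simp: y)
  obtain ip \<rho> where ip: "inner_product V ip" "G_continuous V (ip_norm ip)" "globalization V (ip_norm ip) \<rho>"
    "\<forall>g\<in>SL2. \<forall>A\<in>pts (banach_completion V (ip_norm ip)). \<forall>D\<in>pts (banach_completion V (ip_norm ip)).
       ip_completion ip (\<rho> g A) (\<rho> g D) = ip_completion ip A D"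
    using assms(3) unfolding unitarizable_def by blast
  interpret unitary_hc V ip \<rho>
    by unfold_locales (use assms ip in \<open>auto simp: harish_chandra_module_def\<close>)
  obtain e co b I \<mu> o' where "umod V e co b I \<mu> o' (ip_norm ip) \<rho>" using model by blast
  then show ?thesis unfolding y using umod.sobolev_gap_eq_1[OF _ y0] by blast
qed

end
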